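(* Suppose that $Z$ is a quasi-normed lattice of measurable functions on $\mathbb T\times\Omega$ such that the real interpolation space $(L_\infty,Z)_{\theta,\infty}$ is $\mathrm{BMO}$-regular with some $0<\theta<1$. Then the couple $(L_\infty,Z^\alpha)$ is boundedly $\mathrm{AK}$-stable for all $0<\alpha<\theta$. Here $L_\infty=L_\infty(\mathbb T\times\Omega)$.
   Context: $\mathbb T$ is the unit circle with Lebesgue measure; $\Omega$ is a $\sigma$-finite measure space. A quasi-normed lattice $X$ of measurable functions on a $\sigma$-finite measure space $\mathcal M$ is a quasi-normed space of measurable functions (modulo equality a.e.) such that $|f|\le g$, $g\in X$ imply $f\in X$, $\|f\|_X\le\|g\|_X$; all lattices are assumed to satisfy $\operatorname{supp}X=\mathcal M$ up to a null set. The power $X^\delta$, $\delta>0$, has quasi-norm $\|f\|_{X^\delta}=\||f|^{1/\delta}\|_X^\delta$. A lattice $X$ on $\mathbb T\times\Omega$ is $\mathrm{BMO}$-regular if there are constants $C,m$ such that for any nonzero $f\in X$ there is $u\ge|f|$ with $\|u\|_X\le m\|f\|_X$ and $\|\log u(\cdot,\omega)\|_{\mathrm{BMO}}\le C$ for almost all $\omega\in\Omega$. $H_\infty(\mathbb T\times\Omega)$ is the space of $U\in L_\infty(\mathbb T\times\Omega)$ such that $U(\cdot,\omega)$ is the boundary value of a bounded analytic function on the disc for almost all $\omega$, with the $L_\infty$ norm. A couple $(X,Y)$ of quasi-normed lattices on $\mathbb T\times\Omega$ is boundedly $\mathrm{AK}$-stable if there is a constant $C$ such that for any $f\in X$ and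 $g\in Y$ there exists $U\in H_\infty(\mathbb T\times\Omega)$ with $\|U\|_{H_\infty}\le C$, $\|Ug\|_X\le C\|f\|_X$ and $\|(1-U)f\|_Y\le C\|g\|_Y$.
   Formalization: The quasi-normed lattice Z is additionally assumed to be complete; without completeness the claim fails, e.g. for bounded functions on T×ℕ with support of finite measure, under the L_1 norm. *)

theory Defs
  imports "HOL-Probability.Essential_Supremum" "HOL-Analysis.Complex_Analysis_Basics"
begin

section \<open>The unit circle with arc length\<close>

definition circle :: "complex measure" where
  "circle = distr (restrict_space lborel {0..<2 * pi}) (restrict_space borel (sphere 0 1)) cis"

lemma cis_measurable_circle:
  "cis \<in> restrict_space lborel {0..<2 * pi} \<rightarrow>\<^sub>M restrict_space borel (sphere 0 1)"
proof -
  have "cis \<in> borel_measurable borel"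
    by (rule borel_measurable_continuous_onI) (rule continuous_on_cis, rule continuous_on_id)
  then have "cis \<in> borel_measurable lborel"
    by simp
  then have "cis \<in> borel_measurable (restrict_space lborel {0..<2 * pi})"
    by (rule measurable_restrict_space1)
  then show ?thesis
    by (rule measurable_restrict_space2[rotated]) simp
qed

lemma space_circle: "space circle = sphere 0 1"
  by (simp add: circle_def space_restrict_space)

lemma emeasure_circle: "emeasure circle (sphere 0 1) = ennreal (2 * pi)"
proof -
  have "sphere 0 1 \<in> sets (restrict_space borel (sphere 0 1 :: complex set))"
    by (simp add: sets_restrict_space_iff)
  moreover have "cis -` sphere 0 1 \<inter> space (restrict_space lborel {0..<2 * pi}) = {0..<2 * pi}"
    by (auto simp: space_restrict_space)
  ultimately have "emeasure circle (sphere 0 1) =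
      emeasure (restrict_space lborel {0..<2 * pi}) {0..<2 * pi}"
    unfolding circle_def by (simp add: emeasure_distr[OF cis_measurable_circle])
  then show ?thesis
    by (simp add: emeasure_restrict_space)
qed

abbreviation circle_prod :: "'w measure \<Rightarrow> (complex \<times> 'w) measure" where
  "circle_prod \<Omega> \<equiv> circle \<Otimes>\<^sub>M \<Omega>"

section \<open>Quasi-normed spaces and lattices of measurable functions\<close>

text \<open>
  A space of functions modulo equality almost everywhere is represented by the set of all
  its representatives together with a real-valued functional on representatives; the
  functional is meaningful only on that set.
\<close>

record 'a fun_space =
  elems :: "('a \<Rightarrow> complex) set"
  qnorm :: "('a \<Rightarrow> complex) \<Rightarrow> real"

definition quasi_normed_space :: "'a measure \<Rightarrow> 'a fun_space \<Rightarrow> bool" where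
  "quasi_normed_space M X \<longleftrightarrow>
     elems X \<subseteq> borel_measurable M \<and>
     (\<lambda>x. 0) \<in> elems X \<and>
     (\<forall>f \<in> elems X. \<forall>g \<in> elems X. (\<lambda>x. f x + g x) \<in> elems X) \<and>
     (\<forall>c. \<forall>f \<in> elems X. (\<lambda>x. c * f x) \<in> elems X) \<and>
     (\<forall>f \<in> elems X. \<forall>g \<in> borel_measurable M.
        (AE x in M. f x = g x) \<longrightarrow> g \<in> elems X \<and> qnorm X g = qnorm X f) \<and>
     (\<forall>f \<in> elems X. 0 \<le> qnorm X f) \<and>
     (\<forall>f \<in> elems X. qnorm X f = 0 \<longleftrightarrow> (AE x in M. f x = 0)) \<and>
     (\<forall>c. \<forall>f \<in> elems X. qnorm X (\<lambda>x. c * f x) = cmod c * qnorm X f) \<and>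
     (\<exists>K. \<forall>f \<in> elems X. \<forall>g \<in> elems X.
        qnorm X (\<lambda>x. f x + g x) \<le> K * (qnorm X f + qnorm X g))"

text \<open>The last conjunct says that the support of the lattice is the whole measure space,
  up to a null set.\<close>

definition quasi_normed_lattice :: "'a measure \<Rightarrow> 'a fun_space \<Rightarrow> bool" where
  "quasi_normed_lattice M X \<longleftrightarrow>
     quasi_normed_space M X \<and>
     (\<forall>f \<in> borel_measurable M. \<forall>g \<in> elems X.
        (AE x in M. cmod (f x) \<le> cmod (g x)) \<longrightarrow> f \<in> elems X \<and> qnorm X f \<le> qnorm X g) \<and>
     (\<forall>A \<in> sets M. (\<forall>f \<in> elems X. AE x in M. x \<in> A \<longrightarrow> f x = 0) \<longrightarrow> A \<in> null_sets M)"

definition qnorm_complete :: "'a fun_space \<Rightarrow> bool" where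
  "qnorm_complete X \<longleftrightarrow>
     (\<forall>F :: nat \<Rightarrow> 'a \<Rightarrow> complex.
        (\<forall>n. F n \<in> elems X) \<and>
        (\<forall>e > 0. \<exists>N. \<forall>m \<ge> N. \<forall>n \<ge> N. qnorm X (\<lambda>x. F m x - F n x) < e) \<longrightarrow>
        (\<exists>f \<in> elems X. (\<lambda>n. qnorm X (\<lambda>x. F n x - f x)) \<longlonglongrightarrow> 0))"

definition Linf :: "'a measure \<Rightarrow> 'a fun_space" where
  "Linf M = \<lparr>
     elems = {f \<in> borel_measurable M. esssup M (\<lambda>x. ennreal (cmod (f x))) < \<infinity>},
     qnorm = (\<lambda>f. enn2real (esssup M (\<lambda>x. ennreal (cmod (f x))))) \<rparr>"

definition power_space :: "'a measure \<Rightarrow> 'a fun_space \<Rightarrow> real \<Rightarrow> 'a fun_space" where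
  "power_space M X \<delta> = \<lparr>
     elems = {f \<in> borel_measurable M.
                (\<lambda>x. complex_of_real (cmod (f x) powr (1 / \<delta>))) \<in> elems X},
     qnorm = (\<lambda>f. qnorm X (\<lambda>x. complex_of_real (cmod (f x) powr (1 / \<delta>))) powr \<delta>) \<rparr>"

section \<open>Real interpolation with second parameter infinity\<close>

definition decompositions ::
    "'a measure \<Rightarrow> 'a fun_space \<Rightarrow> 'a fun_space \<Rightarrow> ('a \<Rightarrow> complex) \<Rightarrow>
     (('a \<Rightarrow> complex) \<times> ('a \<Rightarrow> complex)) set" where
  "decompositions M X Y f =
     {(g, h). g \<in> elems X \<and> h \<in> elems Y \<and> (AE x in M. f x = g x + h x)}"

definition K_functional ::
    "'a measure \<Rightarrow> 'a fun_space \<Rightarrow> 'a fun_space \<Rightarrow> real \<Rightarrow> ('a \<Rightarrow> complex) \<Rightarrow> real" where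
  "K_functional M X Y t f = (INF (g, h) \<in> decompositions M X Y f. qnorm X g + t * qnorm Y h)"

definition real_interp_inf ::
    "'a measure \<Rightarrow> 'a fun_space \<Rightarrow> 'a fun_space \<Rightarrow> real \<Rightarrow> 'a fun_space" where
  "real_interp_inf M X Y \<theta> = \<lparr>
     elems = {f \<in> borel_measurable M. decompositions M X Y f \<noteq> {} \<and>
                bdd_above ((\<lambda>t. t powr (- \<theta>) * K_functional M X Y t f) ` {0<..})},
     qnorm = (\<lambda>f. SUP t \<in> {0<..}. t powr (- \<theta>) * K_functional M X Y t f) \<rparr>"

section \<open>BMO-regularity\<close>

definition circle_arc :: "real \<Rightarrow> real \<Rightarrow> complex set" where
  "circle_arc a b = cis ` {a..b}"

definition mean_on :: "complex set \<Rightarrow> (complex \<Rightarrow> real) \<Rightarrow> real" where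
  "mean_on I \<phi> = (LINT z:I|circle. \<phi> z) / measure circle I"

text \<open>The mean oscillation seminorm, which vanishes on constants.  It is infinite for
  functions that are not integrable.\<close>

definition BMO_norm :: "(complex \<Rightarrow> real) \<Rightarrow> ennreal" where
  "BMO_norm \<phi> =
     (if integrable circle \<phi> then
        (SUP (a, b) \<in> {(a, b). a < b \<and> b \<le> a + 2 * pi}.
           ennreal (mean_on (circle_arc a b) (\<lambda>z. \<bar>\<phi> z - mean_on (circle_arc a b) \<phi>\<bar>)))
      else \<infinity>)"

text \<open>The majorant is required to be positive almost everywhere because its logarithm
  is \<open>-\<infinity>\<close> at zeros, whereas \<open>ln\<close> is total and \<open>ln 0 = 0\<close>.\<close>

definition BMO_regular :: "'w measure \<Rightarrow> (complex \<times> 'w) fun_space \<Rightarrow> bool" where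
  "BMO_regular \<Omega> X \<longleftrightarrow>
     (\<exists>C m :: real. \<forall>f \<in> elems X. \<not> (AE x in circle_prod \<Omega>. f x = 0) \<longrightarrow>
        (\<exists>u :: complex \<times> 'w \<Rightarrow> real.
           (AE x in circle_prod \<Omega>. 0 < u x \<and> cmod (f x) \<le> u x) \<and>
           (\<lambda>x. complex_of_real (u x)) \<in> elems X \<and>
           qnorm X (\<lambda>x. complex_of_real (u x)) \<le> m * qnorm X f \<and>
           (AE \<omega> in \<Omega>. BMO_norm (\<lambda>z. ln (u (z, \<omega>))) \<le> ennreal C)))"

section \<open>Bounded AK-stability\<close>

text \<open>The boundary value of a bounded analytic function is its radial limit, which exists
  at almost every point of the circle by Fatou's theorem.\<close>

definition bounded_analytic_boundary_value :: "(complex \<Rightarrow> complex) \<Rightarrow> bool" where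
  "bounded_analytic_boundary_value \<phi> \<longleftrightarrow>
     (\<exists>F. F holomorphic_on ball 0 1 \<and> bounded (F ` ball 0 1) \<and>
        (AE z in circle. ((\<lambda>r. F (complex_of_real r * z)) \<longlongrightarrow> \<phi> z) (at_left 1)))"

definition Hinf :: "'w measure \<Rightarrow> (complex \<times> 'w) fun_space" where
  "Hinf \<Omega> = \<lparr>
     elems = {U \<in> elems (Linf (circle_prod \<Omega>)).
                AE \<omega> in \<Omega>. bounded_analytic_boundary_value (\<lambda>z. U (z, \<omega>))},
     qnorm = qnorm (Linf (circle_prod \<Omega>)) \<rparr>"

definition boundedly_AK_stable ::
    "'w measure \<Rightarrow> (complex \<times> 'w) fun_space \<Rightarrow> (complex \<times> 'w) fun_space \<Rightarrow> bool" where
  "boundedly_AK_stable \<Omega> X Y \<longleftrightarrow>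
     (\<exists>C :: real. \<forall>f \<in> elems X. \<forall>g \<in> elems Y. \<exists>U \<in> elems (Hinf \<Omega>).
        qnorm (Hinf \<Omega>) U \<le> C \<and>
        (\<lambda>x. U x * g x) \<in> elems X \<and> qnorm X (\<lambda>x. U x * g x) \<le> C * qnorm X f \<and>
        (\<lambda>x. (1 - U x) * f x) \<in> elems Y \<and>
        qnorm Y (\<lambda>x. (1 - U x) * f x) \<le> C * qnorm Y g)"

end

theory Submission
  imports Defs "HOL-Complex_Analysis.Cauchy_Integral_Formula"
begin

text \<open>
  Write \<open>G = \<bar>g\<bar> powr (1 / \<alpha>)\<close>, an element of \<open>Z\<close>. Cutting \<open>G\<close> at its level sets shows that \<open>G powr \<theta>\<close> lies in
  the interpolation space (\<open>interp_inf_power\<close>), and regularity provides a majorant \<open>u\<close> of \<open>G powr \<theta>\<close> whose norm is under control and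
  whose logarithm has bounded mean oscillation on almost every fibre. Two properties of \<open>u\<close> matter. First, the characteristic functions of its level
  sets satisfy \<open>\<parallel>1\<^bsub>{u > l}\<^esub>\<parallel>\<^sub>Z \<le> const * l powr (- 1 / \<theta>)\<close> (\<open>interp_inf_level_set\<close>). Second, a function whose logarithm has
  bounded mean oscillation can be separated analytically from a constant.

  The second point is \<open>bounded_separating_function\<close>: for a function \<open>\<phi>\<close> of bounded mean oscillation on the fibres and any exponent \<open>p\<close>
  there is a bounded analytic \<open>U\<close> with \<open>\<bar>U\<bar> \<le> K min 1 (exp (- p \<phi>))\<close> and \<open>\<bar>1 - U\<bar> \<le> K min 1 (exp (p \<phi>))\<close>. It is applied to
  \<open>\<phi> = ln (u / s powr (\<theta> / \<alpha>))\<close>, where \<open>s\<close> is the norm of \<open>f\<close>. The first bound gives \<open>\<bar>U g\<bar> \<le> K s\<close>. By the second one,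
  \<open>\<bar>(1 - U) f\<bar> powr (1 / \<alpha>)\<close> is at most a multiple of \<open>min 1 (exp \<phi>) powr (p / \<alpha>)\<close>, hence of a series of characteristic functions of
  dyadic level sets of \<open>u\<close> with geometrically decreasing coefficients. For large \<open>p\<close> this series converges in the complete space \<open>Z\<close>
  (\<open>geometric_series_majorant\<close>), with the bound that is required.

  To construct \<open>U\<close> on one fibre, let \<open>v = exp (\<delta> \<phi> / 2)\<close> with a small \<open>\<delta>\<close>. Bounded mean oscillation makes the variance of \<open>\<phi>\<close> with respect to all
  Poisson kernels bounded (\<open>BMO_imp_garsia_bounded\<close>), and a Bellman function shows that conjugation is then bounded on square integrable
  functions with the weights \<open>v\<^sup>2\<close> and \<open>v\<^sup>-\<^sup>2\<close> (\<open>weighted_conjugate_disc\<close>, \<open>weighted_conj_fun\<close>). An iteration produces a function \<open>F\<close>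
  for which both \<open>F v\<close> and \<open>F / v\<close> dominate their conjugate functions (\<open>jones_factorization\<close>). The quotient of the square roots of their
  Herglotz integrals is analytic, has positive real part, and its modulus is comparable to \<open>v\<close>; an explicit rational function of it
  is \<open>U\<close> (\<open>separator\<close>).

  Every object in this construction is given by integrals and by limits along fixed sequences, and so depends measurably on the fibre. In order that all
  integrals converge, \<open>\<phi>\<close> is first replaced by its Poisson integral on a smaller circle. The passage to the limit uses convex combinations that
  converge almost everywhere (\<open>Mazur_AE\<close>) and the description of boundary values by vanishing moments
  (\<open>boundary_value_of_hardy\<close>), which survives such limits.
\<close>

section \<open>Integration over the circle\<close>

lemma sets_circle: "sets circle = sets (restrict_space borel (sphere 0 1))"
  by (simp add: circle_def)

lemma borel_measurable_circle_ident: "(\<lambda>z. z) \<in> borel_measurable circle"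
proof -
  have "(\<lambda>z::complex. z) \<in> borel_measurable (restrict_space borel (sphere 0 1))"
    by (rule measurable_restrict_space1) simp
  then show ?thesis by (simp cong: measurable_cong_sets add: sets_circle)
qed

lemma borel_measurable_circle_borel:
  "f \<in> borel_measurable borel \<Longrightarrow> f \<in> borel_measurable circle"
  using measurable_compose[OF borel_measurable_circle_ident] by blast

lemma cis_measurable: "cis \<in> borel \<rightarrow>\<^sub>M circle"
proof -
  have "cis \<in> borel_measurable borel"
    by (rule borel_measurable_continuous_onI) (rule continuous_on_cis, rule continuous_on_id)
  then have "cis \<in> borel \<rightarrow>\<^sub>M restrict_space borel (sphere 0 1)"
    by (rule measurable_restrict_space2[rotated]) simp
  then show ?thesis by (simp cong: measurable_cong_sets add: sets_circle)
qed

lemma nn_integral_periodic: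
  fixes g :: "real \<Rightarrow> ennreal"
  assumes g [measurable]: "g \<in> borel_measurable borel" and per: "\<And>t. g (t + 2 * pi) = g t"
  shows "(\<integral>\<^sup>+t. g t * indicator {x..<x + 2 * pi} t \<partial>lborel) = (\<integral>\<^sup>+t. g t * indicator {0..<2 * pi} t \<partial>lborel)"
proof -
  have shift: "(\<integral>\<^sup>+t. g t * indicator {a + c..<b + c} t \<partial>lborel) = (\<integral>\<^sup>+t. g t * indicator {a..<b} t \<partial>lborel)"
    if "\<And>t. g (t + c) = g t" for a b c
  proof -
    have "(\<integral>\<^sup>+t. g t * indicator {a + c..<b + c} t \<partial>lborel)
        = (\<integral>\<^sup>+t. g (c + 1 * t) * indicator {a + c..<b + c} (c + 1 * t) \<partial>lborel)"
      by (subst nn_integral_real_affine[where c = 1 and t = c]) auto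
    also have "\<dots> = (\<integral>\<^sup>+t. g t * indicator {a..<b} t \<partial>lborel)"
      using that by (intro nn_integral_cong) (auto simp: indicator_def add.commute)
    finally show ?thesis .
  qed
  have pern: "g (t + 2 * pi * real n) = g t" for t n
  proof (induction n)
    case (Suc n)
    then show ?case using per[of "t + 2 * pi * real n"] by (simp add: algebra_simps)
  qed simp
  have peri: "g (t + 2 * pi * real_of_int k) = g t" for t k
  proof (cases "k \<ge> 0")
    case True
    then show ?thesis using pern[of t "nat k"] by simp
  next
    case False
    then show ?thesis using pern[of "t + 2 * pi * real_of_int k" "nat (- k)"] by simp
  qed
  define k where "k = \<lfloor>x / (2 * pi)\<rfloor>"
  define y where "y = x - 2 * pi * real_of_int k"
  have "real_of_int k \<le> x / (2 * pi)" "x / (2 * pi) < real_of_int k + 1"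
    unfolding k_def by linarith+
  then have y: "0 \<le> y" "y < 2 * pi"
    by (simp_all add: y_def field_simps)
  have "(\<integral>\<^sup>+t. g t * indicator {x..<x + 2 * pi} t \<partial>lborel) = (\<integral>\<^sup>+t. g t * indicator {y..<y + 2 * pi} t \<partial>lborel)"
    using shift[of "2 * pi * real_of_int k" y "y + 2 * pi"] peri by (simp add: y_def)
  also have "\<dots> = (\<integral>\<^sup>+t. g t * indicator {y..<2 * pi} t + g t * indicator {0 + 2 * pi..<y + 2 * pi} t \<partial>lborel)"
    using y by (intro nn_integral_cong) (auto simp: indicator_def)
  also have "\<dots> = (\<integral>\<^sup>+t. g t * indicator {y..<2 * pi} t \<partial>lborel) + (\<integral>\<^sup>+t. g t * indicator {0 + 2 * pi..<y + 2 * pi} t \<partial>lborel)"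
    by (rule nn_integral_add) auto
  also have "(\<integral>\<^sup>+t. g t * indicator {0 + 2 * pi..<y + 2 * pi} t \<partial>lborel) = (\<integral>\<^sup>+t. g t * indicator {0..<y} t \<partial>lborel)"
    by (rule shift) (rule per)
  also have "(\<integral>\<^sup>+t. g t * indicator {y..<2 * pi} t \<partial>lborel) + (\<integral>\<^sup>+t. g t * indicator {0..<y} t \<partial>lborel)
     = (\<integral>\<^sup>+t. g t * indicator {y..<2 * pi} t + g t * indicator {0..<y} t \<partial>lborel)"
    by (rule nn_integral_add[symmetric]) auto
  also have "\<dots> = (\<integral>\<^sup>+t. g t * indicator {0..<2 * pi} t \<partial>lborel)"
    using y by (intro nn_integral_cong) (auto simp: indicator_def)
  finally show ?thesis .
qed

text \<open>The circle measure is the image of arc length on every half-open interval of length \<open>2 * pi\<close>, so that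
  integrals near a given point can be written without wrapping around.\<close>

lemma circle_eq_distr:
  "circle = distr (restrict_space lborel {x..<x + 2 * pi}) circle cis"
proof (rule measure_eqI)
  fix A assume A: "A \<in> sets circle"
  have meas: "cis \<in> restrict_space lborel {y..<y + 2 * pi} \<rightarrow>\<^sub>M circle" for y
    by (rule measurable_restrict_space1) (simp add: cis_measurable)
  have *: "emeasure (distr (restrict_space lborel {y..<y + 2 * pi}) circle cis) A
      = (\<integral>\<^sup>+t. indicator A (cis t) * indicator {y..<y + 2 * pi} t \<partial>lborel)" for y
  proof -
    have "emeasure (distr (restrict_space lborel {y..<y + 2 * pi}) circle cis) A
      = (\<integral>\<^sup>+z. indicator A z \<partial>distr (restrict_space lborel {y..<y + 2 * pi}) circle cis)"
      using A by simp
    also have "\<dots> = (\<integral>\<^sup>+t. indicator A (cis t) \<partial>restrict_space lborel {y..<y + 2 * pi})"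
      using A by (intro nn_integral_distr meas) auto
    also have "\<dots> = (\<integral>\<^sup>+t. indicator A (cis t) * indicator {y..<y + 2 * pi} t \<partial>lborel)"
      by (rule nn_integral_restrict_space) simp
    finally show ?thesis .
  qed
  have "emeasure circle A = emeasure (distr (restrict_space lborel {0..<0 + 2 * pi}) circle cis) A"
    unfolding circle_def by (rule arg_cong2[where f = emeasure]) (auto intro!: distr_cong simp: sets_restrict_space)
  also have "\<dots> = emeasure (distr (restrict_space lborel {x..<x + 2 * pi}) circle cis) A"
    unfolding *
  proof -
    have [measurable]: "(\<lambda>t. indicator A (cis t) :: ennreal) \<in> borel_measurable borel"
      using A by (intro measurable_compose[OF cis_measurable]) simp
    have per: "cis (t + 2 * pi) = cis t" for t
      by (simp add: complex_eq_iff)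
    show "(\<integral>\<^sup>+t. indicator A (cis t) * indicator {0..<0 + 2 * pi} t \<partial>lborel) =
       (\<integral>\<^sup>+t. indicator A (cis t) * indicator {x..<x + 2 * pi} t \<partial>lborel)"
      using nn_integral_periodic[of "\<lambda>t. indicator A (cis t)" x] by (simp add: per)
  qed
  finally show "emeasure circle A = emeasure (distr (restrict_space lborel {x..<x + 2 * pi}) circle cis) A" .
qed simp

lemma cis_measurable_restrict: "cis \<in> restrict_space lborel S \<rightarrow>\<^sub>M circle"
  by (rule measurable_restrict_space1) (simp add: cis_measurable)

lemma integrable_circle_iff:
  fixes f :: "complex \<Rightarrow> 'b::{banach, second_countable_topology}"
  assumes "f \<in> borel_measurable circle"
  shows "integrable circle f \<longleftrightarrow> set_integrable lborel {x..<x + 2 * pi} (\<lambda>t. f (cis t))"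
  by (subst circle_eq_distr[of x])
    (simp add: integrable_distr_eq cis_measurable_restrict assms integrable_restrict_space set_integrable_def)

lemma integral_circle:
  fixes f :: "complex \<Rightarrow> 'b::{banach, second_countable_topology}"
  assumes "f \<in> borel_measurable circle"
  shows "integral\<^sup>L circle f = (LINT t:{x..<x + 2 * pi}|lborel. f (cis t))"
  by (subst circle_eq_distr[of x])
    (simp add: integral_distr cis_measurable_restrict assms integral_restrict_space set_lebesgue_integral_def)

lemma AE_circle_iff:
  assumes "Measurable.pred circle P"
  shows "(AE z in circle. P z) \<longleftrightarrow> (AE t in lborel. t \<in> {x..<x + 2 * pi} \<longrightarrow> P (cis t))"
proof -
  have "(AE z in circle. P z) \<longleftrightarrow> (AE z in distr (restrict_space lborel {x..<x + 2 * pi}) circle cis. P z)"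
    by (subst (1) circle_eq_distr[of x]) (rule refl)
  also have "\<dots> \<longleftrightarrow> (AE t in restrict_space lborel {x..<x + 2 * pi}. P (cis t))"
    using assms by (intro AE_distr_iff cis_measurable_restrict) (simp add: pred_def)
  also have "\<dots> \<longleftrightarrow> (AE t in lborel. t \<in> {x..<x + 2 * pi} \<longrightarrow> P (cis t))"
    by (rule AE_restrict_space_iff) simp
  finally show ?thesis .
qed

lemma finite_measure_circle: "finite_measure circle"
  by (rule finite_measureI) (simp add: space_circle emeasure_circle)

interpretation circle: finite_measure circle
  by (rule finite_measure_circle)

lemma measure_circle_space: "measure circle (space circle) = 2 * pi"
  by (simp add: measure_def space_circle emeasure_circle)

lemma norm_circle: "z \<in> space circle \<Longrightarrow> norm z = 1"
  by (simp add: space_circle)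

lemma set_integrable_cis:
  fixes f :: "complex \<Rightarrow> 'b::{banach, second_countable_topology}"
  assumes "integrable circle f"
  shows "set_integrable lborel {a..b} (\<lambda>t. f (cis t))"
proof -
  have [measurable]: "f \<in> borel_measurable circle" using assms by simp
  have 1: "set_integrable lborel {x..<x + 2 * pi} (\<lambda>t. f (cis t))" for x
    using assms by (simp flip: integrable_circle_iff)
  have 2: "set_integrable lborel {a..<a + 2 * pi * real n} (\<lambda>t. f (cis t))" for n
  proof (induction n)
    case 0
    then show ?case by (simp add: set_integrable_def)
  next
    case (Suc n)
    have "set_integrable lborel ({a..<a + 2 * pi * real n} \<union> {a + 2 * pi * real n..<a + 2 * pi * real n + 2 * pi}) (\<lambda>t. f (cis t))"
      by (intro set_integrable_Un Suc 1) auto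
    moreover have "{a..<a + 2 * pi * real n} \<union> {a + 2 * pi * real n..<a + 2 * pi * real n + 2 * pi} = {a..<a + 2 * pi * real (Suc n)}"
    proof -
      have nn: "0 \<le> 2 * pi * real n" by simp
      show ?thesis by (auto simp: distrib_left) (use pi_gt_zero nn in linarith)+
    qed
    ultimately show ?case by simp
  qed
  obtain n where "real n > (b - a) / (2 * pi)" using reals_Archimedean2 by blast
  then have "b < a + 2 * pi * real n" by (simp add: field_simps)
  then have "{a..b} \<subseteq> {a..<a + 2 * pi * real n}" by auto
  then show ?thesis by (intro set_integrable_subset[OF 2[of n]]) auto
qed

section \<open>Poisson and Herglotz kernels\<close>

definition poisson :: "complex \<Rightarrow> complex \<Rightarrow> real" where
  "poisson z \<xi> = (1 - (cmod z)\<^sup>2) / (cmod (\<xi> - z))\<^sup>2"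

lemma poisson_measurable [measurable (raw)]:
  assumes [measurable]: "f \<in> borel_measurable M" "g \<in> borel_measurable M"
  shows "(\<lambda>x. poisson (f x) (g x)) \<in> borel_measurable M"
  unfolding poisson_def by measurable

lemma poisson_eq_Re:
  assumes "cmod \<xi> = 1"
  shows "poisson z \<xi> = Re ((\<xi> + z) / (\<xi> - z))"
proof -
  have "Re ((\<xi> + z) * cnj (\<xi> - z)) = 1 - (cmod z)\<^sup>2"
    using assms by (simp add: cmod_def algebra_simps power2_eq_square)
  then show ?thesis
    unfolding poisson_def by (simp add: complex_div_cnj[of "\<xi> + z"] flip: of_real_power)
qed

lemma poisson_pos: "cmod z < 1 \<Longrightarrow> cmod \<xi> = 1 \<Longrightarrow> 0 < poisson z \<xi>"
  unfolding poisson_def by (rule divide_pos_pos) (auto simp: abs_square_less_1)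

lemma poisson_le:
  assumes "cmod z < 1" "cmod \<xi> = 1"
  shows "poisson z \<xi> \<le> 2 / (1 - cmod z)"
proof -
  have *: "1 - cmod z \<le> cmod (\<xi> - z)"
    using norm_triangle_ineq2[of \<xi> z] assms by simp
  have "poisson z \<xi> \<le> (1 - (cmod z)\<^sup>2) / (1 - cmod z)\<^sup>2"
    unfolding poisson_def using assms *
    by (intro divide_left_mono power_mono) (auto simp: abs_square_le_1 zero_less_mult_iff)
  also have "\<dots> = (1 + cmod z) / (1 - cmod z)"
    using assms by (simp add: power2_eq_square divide_simps) (simp add: algebra_simps)
  also have "\<dots> \<le> 2 / (1 - cmod z)"
    using assms by (intro divide_right_mono) auto
  finally show ?thesis .
qed

lemma poisson_rotate:
  "poisson (of_real r * cis x) (cis (x + t)) = poisson (of_real r) (cis t)"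
proof -
  have "cis (x + t) - of_real r * cis x = cis x * (cis t - of_real r)"
    by (simp add: cis_mult[symmetric] algebra_simps)
  then have "cmod (cis (x + t) - of_real r * cis x) = cmod (cis t - of_real r)"
    by (simp add: norm_mult)
  then show ?thesis by (simp add: poisson_def norm_mult)
qed

lemma poisson_swap:
  assumes "cmod \<xi> = 1" "cmod \<zeta> = 1"
  shows "poisson (of_real r * \<xi>) \<zeta> = poisson (of_real r * \<zeta>) \<xi>"
proof -
  have "cmod (\<zeta> - of_real r * \<xi>) = cmod (\<xi> - of_real r * \<zeta>)"
  proof -
    have "(cmod (\<zeta> - of_real r * \<xi>))\<^sup>2 = (cmod (\<xi> - of_real r * \<zeta>))\<^sup>2"
    proof -
      have 1: "(Re \<xi>)\<^sup>2 + (Im \<xi>)\<^sup>2 = 1" "(Re \<zeta>)\<^sup>2 + (Im \<zeta>)\<^sup>2 = 1"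
        using assms by (simp_all add: cmod_def)
      show ?thesis unfolding cmod_power2 using 1 by simp algebra
    qed
    then show ?thesis by simp
  qed
  then show ?thesis using assms by (simp add: poisson_def norm_mult)
qed

lemma one_minus_cos_ge:
  assumes "\<bar>t\<bar> \<le> pi"
  shows "t\<^sup>2 / 8 \<le> 1 - cos t"
proof -
  have half: "y / 2 \<le> sin y" if "0 \<le> y" "y \<le> pi / 2" for y :: real
  proof (cases "y \<le> pi / 3")
    case True
    have "sin 0 - 0 / 2 \<le> sin y - y / 2"
    proof (rule DERIV_nonneg_imp_nondecreasing[of 0 y "\<lambda>y. sin y - y / 2"])
      fix u assume u: "0 \<le> u" "u \<le> y"
      have "cos (pi / 3) \<le> cos u"
        using u True by (intro cos_monotone_0_pi_le) auto
      then show "\<exists>d. ((\<lambda>y. sin y - y / 2) has_real_derivative d) (at u) \<and> 0 \<le> d"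
        by (intro exI[of _ "cos u - 1 / 2"]) (auto intro!: derivative_eq_intros simp: cos_60)
    qed (use that in auto)
    then show ?thesis by simp
  next
    case False
    have "sin (pi / 3) \<le> sin y"
      using False that by (intro sin_monotone_2pi_le) auto
    moreover have "pi \<le> 3.2" using pi_approx by simp
    moreover have "1.6 \<le> sqrt 3" by (rule real_le_rsqrt) (simp add: power2_eq_square)
    ultimately show ?thesis using that by (simp add: sin_60)
  qed
  have "(\<bar>t\<bar> / 2 / 2)\<^sup>2 \<le> (sin (\<bar>t\<bar> / 2))\<^sup>2"
    using assms by (intro power_mono half) auto
  also have "(sin (\<bar>t\<bar> / 2))\<^sup>2 = (1 - cos t) / 2"
    using cos_double_sin[of "\<bar>t\<bar> / 2"] by simp
  finally show ?thesis by (simp add: power2_eq_square)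
qed

text \<open>The denominator of the kernel is \<open>(1 - r)\<^sup>2 + 2 r (1 - cos t)\<close>. For \<open>r \<ge> 1/2\<close> the second term is at least \<open>t\<^sup>2 / 8\<close>; for
  \<open>r < 1/2\<close> the first one is at least \<open>1/4\<close>, whereas \<open>t\<^sup>2 \<le> 10\<close>.\<close>

lemma poisson_decay:
  assumes r: "0 \<le> r" "r < 1" and t: "\<bar>t\<bar> \<le> pi" "t \<noteq> 0"
  shows "poisson (of_real r * cis x) (cis (x + t)) \<le> 80 * (1 - r) / t\<^sup>2"
proof -
  have P: "poisson (of_real r * cis x) (cis (x + t)) = (1 - r\<^sup>2) / (1 - 2 * r * cos t + r\<^sup>2)"
    unfolding poisson_rotate
  proof -
    have "(cmod (cis t - of_real r))\<^sup>2 = (cos t - r)\<^sup>2 + (sin t)\<^sup>2"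
      by (simp add: cmod_power2)
    also have "\<dots> = 1 - 2 * r * cos t + r\<^sup>2"
      by (simp add: power2_diff sin_squared_eq)
    finally show "poisson (of_real r) (cis t) = (1 - r\<^sup>2) / (1 - 2 * r * cos t + r\<^sup>2)"
      by (simp add: poisson_def)
  qed
  show ?thesis
  proof (cases "r < 1 / 2")
    case True
    have "t\<^sup>2 \<le> (3.15)\<^sup>2"
      using t pi_approx by (intro power2_le_iff_abs_le[THEN iffD2]) auto
    then have t10: "t\<^sup>2 \<le> 10" by (simp add: power2_eq_square)
    have "(1/2) * (1/2) \<le> (1 - r) * (1 - r)" using True by (intro mult_mono) auto
    then have "2 * t\<^sup>2 \<le> 80 * ((1 - r) * (1 - r))" using t10 by linarith
    then have "2 / (1 - r) \<le> 80 * (1 - r) / t\<^sup>2"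
      using True t by (simp add: divide_simps) (simp add: algebra_simps)
    then show ?thesis
      using poisson_le[of "of_real r * cis x" "cis (x + t)"] r by (simp add: norm_mult)
  next
    case False
    have "t\<^sup>2 / 8 \<le> 1 - cos t" by (rule one_minus_cos_ge) fact
    also have "\<dots> \<le> 2 * r * (1 - cos t)"
    proof -
      have "1 * (1 - cos t) \<le> 2 * r * (1 - cos t)" using False by (intro mult_right_mono) auto
      then show ?thesis by simp
    qed
    also have "\<dots> \<le> (1 - r)\<^sup>2 + 2 * r * (1 - cos t)" by simp
    also have "\<dots> = 1 - 2 * r * cos t + r\<^sup>2" by (simp add: power2_eq_square algebra_simps)
    finally have *: "t\<^sup>2 / 8 \<le> 1 - 2 * r * cos t + r\<^sup>2" .
    have "(1 - r\<^sup>2) / (1 - 2 * r * cos t + r\<^sup>2) \<le> (1 - r\<^sup>2) / (t\<^sup>2 / 8)"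
    proof (rule divide_left_mono)
      have "0 < t\<^sup>2 / 8" using t by simp
      then show "0 < (1 - 2 * r * cos t + r\<^sup>2) * (t\<^sup>2 / 8)"
        using * by (intro mult_pos_pos) linarith+
      show "0 \<le> 1 - r\<^sup>2" using r by (simp add: abs_square_le_1)
    qed (rule *)
    also have "\<dots> \<le> 80 * (1 - r) / t\<^sup>2"
    proof -
      have "1 - r\<^sup>2 = (1 - r) * (1 + r)" by (simp add: power2_eq_square algebra_simps)
      also have "\<dots> \<le> (1 - r) * 10" using r by (intro mult_left_mono) auto
      finally show ?thesis using t by (simp add: divide_simps)
    qed
    finally show ?thesis unfolding P .
  qed
qed

text \<open>The Poisson kernel is dominated by a superposition of normalised indicators of dyadic intervals. All estimates of
  Poisson integrals by means over intervals go through this bound.\<close>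

lemma poisson_layers:
  assumes r: "0 \<le> r" "r < 1" and t: "\<bar>t\<bar> \<le> pi" "\<bar>t\<bar> \<le> 2 ^ J * (1 - r)"
  shows "poisson (of_real r * cis x) (cis (x + t))
     \<le> 320 / (1 - r) * (\<Sum>j\<le>J. (1/4) ^ j * indicator {- (2 ^ j * (1 - r))..2 ^ j * (1 - r)} t)"
proof -
  \<comment> \<open>the first dyadic interval that contains \<open>t\<close>; for \<open>j > 0\<close> the previous one does not\<close>
  define j where "j = (LEAST j. \<bar>t\<bar> \<le> 2 ^ j * (1 - r))"
  have j: "\<bar>t\<bar> \<le> 2 ^ j * (1 - r)" unfolding j_def by (rule LeastI) (rule t)
  have jJ: "j \<le> J" unfolding j_def by (rule Least_le) (rule t)
  have "poisson (of_real r * cis x) (cis (x + t)) \<le> 320 / (1 - r) * (1/4) ^ j"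
  proof (cases j)
    case 0
    have "2 / (1 - r) \<le> 320 / (1 - r)" using r by (intro divide_right_mono) auto
    then show ?thesis
      using poisson_le[of "of_real r * cis x" "cis (x + t)"] r 0 by (simp add: norm_mult)
  next
    case (Suc i)
    have lt: "2 ^ i * (1 - r) < \<bar>t\<bar>"
      using not_less_Least[of i "\<lambda>j. \<bar>t\<bar> \<le> 2 ^ j * (1 - r)"] Suc unfolding j_def by simp
    have "(2 ^ i * (1 - r))\<^sup>2 \<le> \<bar>t\<bar>\<^sup>2"
      using lt r by (intro power_mono) auto
    then have sq: "4 ^ i * (1 - r)\<^sup>2 \<le> t\<^sup>2"
    proof -
      have "((2::real) ^ i)\<^sup>2 = 4 ^ i" by (simp add: power2_eq_square flip: power_mult_distrib)
      then show ?thesis using \<open>(2 ^ i * (1 - r))\<^sup>2 \<le> \<bar>t\<bar>\<^sup>2\<close> by (simp add: power_mult_distrib)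
    qed
    have t0: "t \<noteq> 0" using lt r by (auto simp: mult_less_0_iff)
    have "poisson (of_real r * cis x) (cis (x + t)) \<le> 80 * (1 - r) / t\<^sup>2"
      by (rule poisson_decay) (use r t t0 in auto)
    also have "\<dots> \<le> 80 * (1 - r) / (4 ^ i * (1 - r)\<^sup>2)"
      using sq r t0 by (intro divide_left_mono) auto
    also have "\<dots> = 320 / (1 - r) * (1/4) ^ j"
      using r by (simp add: Suc power2_eq_square power_one_over divide_simps)
    finally show ?thesis .
  qed
  also have "(1/4::real) ^ j \<le> (\<Sum>j\<le>J. (1/4) ^ j * indicator {- (2 ^ j * (1 - r))..2 ^ j * (1 - r)} t)"
  proof -
    have "(1/4::real) ^ j = (1/4) ^ j * indicator {- (2 ^ j * (1 - r))..2 ^ j * (1 - r)} t"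
      using j by (auto simp: indicator_def)
    also have "\<dots> \<le> (\<Sum>j\<le>J. (1/4) ^ j * indicator {- (2 ^ j * (1 - r))..2 ^ j * (1 - r)} t)"
      using jJ by (intro member_le_sum) auto
    finally show ?thesis .
  qed
  finally show ?thesis 
    using mult_left_mono[of _ _ "320 / (1 - r)"] r by (fastforce intro: order.trans)
qed

definition poisson_int :: "(complex \<Rightarrow> 'b::{banach, second_countable_topology}) \<Rightarrow> complex \<Rightarrow> 'b" where
  "poisson_int f z = (1 / (2 * pi)) *\<^sub>R (LINT \<xi>|circle. poisson z \<xi> *\<^sub>R f \<xi>)"

lemma integrable_poisson:
  fixes f :: "complex \<Rightarrow> 'b::{banach, second_countable_topology}"
  assumes f: "integrable circle f" and z: "cmod z < 1"
  shows "integrable circle (\<lambda>\<xi>. poisson z \<xi> *\<^sub>R f \<xi>)"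
proof (rule Bochner_Integration.integrable_bound)
  show "integrable circle (\<lambda>\<xi>. (2 / (1 - cmod z)) *\<^sub>R f \<xi>)" using f by simp
  show "(\<lambda>\<xi>. poisson z \<xi> *\<^sub>R f \<xi>) \<in> borel_measurable circle" using f borel_measurable_circle_ident by measurable
  show "AE \<xi> in circle. norm (poisson z \<xi> *\<^sub>R f \<xi>) \<le> norm ((2 / (1 - cmod z)) *\<^sub>R f \<xi>)"
  proof (rule AE_I2)
    fix \<xi> assume "\<xi> \<in> space circle"
    then have x: "cmod \<xi> = 1" by (simp add: norm_circle)
    show "norm (poisson z \<xi> *\<^sub>R f \<xi>) \<le> norm ((2 / (1 - cmod z)) *\<^sub>R f \<xi>)"
      using mult_right_mono[OF poisson_le[OF z x], of "norm (f \<xi>)"] poisson_pos[OF z x] z by simp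
  qed
qed

text \<open>A rotation leaves the integral unchanged and multiplies it by \<open>c\<close>.\<close>

lemma circle_monomial_aux:
  assumes c: "c \<noteq> 1" and f: "f \<in> borel_measurable circle"
    and rot: "\<And>t. f (cis (a + t)) = c * f (cis t)"
  shows "(LINT \<xi>|circle. f \<xi> :: complex) = 0"
proof -
  have "(LINT \<xi>|circle. f \<xi>) = (LINT t|lborel. indicator {0..<0 + 2 * pi} t *\<^sub>R f (cis t))"
    using integral_circle[OF f, of 0] by (simp add: set_lebesgue_integral_def)
  also have "\<dots> = \<bar>1\<bar> *\<^sub>R (LINT t|lborel. indicator {0..<0 + 2 * pi} (a + 1 * t) *\<^sub>R f (cis (a + 1 * t)))"
    by (rule lborel_integral_real_affine) simp
  also have "\<dots> = (LINT t|lborel. c * (indicator {- a..<- a + 2 * pi} t *\<^sub>R f (cis t)))"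
    using rot by (auto intro!: Bochner_Integration.integral_cong simp: indicator_def)
  also have "\<dots> = c * (LINT t|lborel. (indicator {- a..<- a + 2 * pi} t *\<^sub>R f (cis t)))"
    by (rule integral_mult_right_zero)
  also have "\<dots> = c * (LINT \<xi>|circle. f \<xi>)"
    using integral_circle[OF f, of "- a"] by (simp add: set_lebesgue_integral_def)
  finally show ?thesis using c by (simp add: algebra_simps)
qed

lemma integral_circle_power: "n > 0 \<Longrightarrow> (LINT \<xi>|circle. \<xi> ^ n) = 0"
proof (rule circle_monomial_aux[where a = "pi / n" and c = "-1"])
  fix t assume "n > 0"
  show "cis (pi / n + t) ^ n = - 1 * cis t ^ n"
  proof -
    have "cis (pi / n) ^ n = -1" using \<open>n > 0\<close> by (simp add: Complex.DeMoivre)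
    then show ?thesis by (simp add: power_mult_distrib flip: cis_mult)
  qed
qed (simp, rule borel_measurable_circle_borel, measurable)

lemma integral_circle_inverse_power: "n > 0 \<Longrightarrow> (LINT \<xi>|circle. inverse \<xi> ^ n) = 0"
proof (rule circle_monomial_aux[where a = "pi / n" and c = "-1"])
  fix t assume "n > 0"
  show "inverse (cis (pi / n + t)) ^ n = - 1 * inverse (cis t) ^ n"
  proof -
    have "inverse (cis (pi / n) ^ n) = -1" using \<open>n > 0\<close> by (simp add: Complex.DeMoivre)
    then show ?thesis by (simp add: power_mult_distrib power_inverse cis_mult[symmetric] del: cis_inverse)
  qed
qed (simp, rule borel_measurable_circle_borel, measurable)

text \<open>The analytic function whose real part is the Poisson integral when the boundary function is real.\<close>

definition herglotz :: "(complex \<Rightarrow> complex) \<Rightarrow> complex \<Rightarrow> complex" where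
  "herglotz f z = (LINT \<xi>|circle. f \<xi> * ((\<xi> + z) / (\<xi> - z))) / (2 * pi)"

lemma integrable_bounded_mult:
  fixes f :: "complex \<Rightarrow> complex"
  assumes f: "integrable circle f" and g [measurable]: "g \<in> borel_measurable circle"
    and b: "\<And>\<xi>. cmod \<xi> = 1 \<Longrightarrow> cmod (g \<xi>) \<le> B"
  shows "integrable circle (\<lambda>\<xi>. f \<xi> * g \<xi>)"
proof (rule Bochner_Integration.integrable_bound)
  show "integrable circle (\<lambda>\<xi>. of_real B * f \<xi>)" using f by simp
  show "(\<lambda>\<xi>. f \<xi> * g \<xi>) \<in> borel_measurable circle" using f by measurable
  show "AE \<xi> in circle. cmod (f \<xi> * g \<xi>) \<le> cmod (of_real B * f \<xi>)"
  proof (rule AE_I2)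
    fix \<xi> assume "\<xi> \<in> space circle"
    then have "cmod (g \<xi>) \<le> B" using b norm_circle by blast
    then have "cmod (f \<xi>) * cmod (g \<xi>) \<le> cmod (f \<xi>) * \<bar>B\<bar>" by (intro mult_left_mono) auto
    then show "cmod (f \<xi> * g \<xi>) \<le> cmod (of_real B * f \<xi>)" by (simp add: norm_mult mult.commute)
  qed
qed

lemma norm_circle_diff:
  assumes "cmod z < 1" "cmod \<xi> = 1"
  shows "1 - cmod z \<le> cmod (\<xi> - z)" "\<xi> \<noteq> z" "\<xi> \<noteq> 0"
  using norm_triangle_ineq2[of \<xi> z] assms by auto

lemma herglotz_kernel_sums:
  assumes "cmod z < 1" "cmod \<xi> = 1"
  shows "(\<lambda>n. (if n = 0 then 1 else 2) * inverse \<xi> ^ n * z ^ n) sums ((\<xi> + z) / (\<xi> - z))"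
proof -
  have n: "norm (z / \<xi>) < 1" using assms by (simp add: norm_divide)
  have "(\<lambda>n. 2 * (z / \<xi>) ^ n - (if n = 0 then 1 else 0)) sums (2 * (1 / (1 - z / \<xi>)) - 1)"
    by (intro sums_diff sums_mult geometric_sums[OF n] sums_single)
  moreover have "2 * (1 / (1 - z / \<xi>)) - 1 = (\<xi> + z) / (\<xi> - z)"
    using norm_circle_diff[OF assms] by (simp add: field_simps)
  moreover have "2 * (z / \<xi>) ^ n - (if n = 0 then 1 else 0) = (if n = 0 then 1 else 2) * inverse \<xi> ^ n * z ^ n" for n
    by (simp add: divide_inverse power_mult_distrib power_inverse mult_ac)
  ultimately show ?thesis by simp
qed

lemma integrable_herglotz:
  assumes f: "integrable circle f" and z: "cmod z < 1"
  shows "integrable circle (\<lambda>\<xi>. f \<xi> * ((\<xi> + z) / (\<xi> - z)))"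
proof (rule integrable_bounded_mult[OF f])
  fix \<xi> :: complex assume x: "cmod \<xi> = 1"
  have "cmod ((\<xi> + z) / (\<xi> - z)) \<le> 2 / (1 - cmod z)"
    unfolding norm_divide using norm_circle_diff[OF z x] norm_triangle_ineq[of \<xi> z] z x
    by (intro frac_le) auto
  then show "cmod ((\<xi> + z) / (\<xi> - z)) \<le> 2 / (1 - cmod z)" .
qed (rule borel_measurable_circle_borel, measurable)

lemma herglotz_sums:
  assumes f: "integrable circle f" and z: "cmod z < 1"
  shows "(\<lambda>n. ((if n = 0 then 1 else 2) * (LINT \<xi>|circle. f \<xi> * inverse \<xi> ^ n) / (2 * pi)) * z ^ n) sums herglotz f z"
proof -
  have [measurable]: "f \<in> borel_measurable circle" using f by simp
  let ?k = "\<lambda>n::nat. (if n = 0 then 1 else 2) :: complex"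
  let ?g = "\<lambda>n \<xi>. f \<xi> * (?k n * inverse \<xi> ^ n * z ^ n)"
  have i: "integrable circle (?g n)" for n
  proof (rule integrable_bounded_mult[OF f, where B = 2])
    fix \<xi> :: complex assume "cmod \<xi> = 1"
    moreover have "cmod z ^ n \<le> 1" using z by (intro power_le_one) auto
    ultimately show "cmod (?k n * inverse \<xi> ^ n * z ^ n) \<le> 2"
      by (simp add: norm_mult norm_power norm_inverse)
  qed (rule borel_measurable_circle_borel, measurable)
  have b: "norm (?g n \<xi>) \<le> cmod (f \<xi>) * (2 * cmod z ^ n)" if "\<xi> \<in> space circle" for n \<xi>
  proof -
    have "cmod (?k n * inverse \<xi> ^ n * z ^ n) \<le> 2 * cmod z ^ n"
      using norm_circle[OF that] by (simp add: norm_mult norm_power norm_inverse)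
    then show ?thesis by (simp only: norm_mult[of "f \<xi>"] mult_left_mono norm_ge_zero)
  qed
  have s: "summable (\<lambda>n. cmod (f \<xi>) * (2 * cmod z ^ n))" for \<xi>
    by (intro summable_mult summable_geometric) (use z in auto)
  have 1: "AE \<xi> in circle. summable (\<lambda>n. norm (?g n \<xi>))"
    proof (rule AE_I2)
    fix \<xi> assume "\<xi> \<in> space circle"
    then show "summable (\<lambda>n. norm (?g n \<xi>))"
      using b by (intro summable_comparison_test'[OF s[of \<xi>], of 0]) (simp del: norm_mult norm_power)
  qed
  have 2: "summable (\<lambda>n. LINT \<xi>|circle. norm (?g n \<xi>))"
  proof (rule summable_comparison_test')
    show "summable (\<lambda>n. (LINT \<xi>|circle. cmod (f \<xi>)) * (2 * cmod z ^ n))"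
      by (intro summable_mult summable_geometric) (use z in auto)
    fix n
    have "(LINT \<xi>|circle. norm (?g n \<xi>)) \<le> (LINT \<xi>|circle. cmod (f \<xi>) * (2 * cmod z ^ n))"
      using i b f by (intro integral_mono) auto
    then show "norm (LINT \<xi>|circle. norm (?g n \<xi>)) \<le> (LINT \<xi>|circle. cmod (f \<xi>)) * (2 * cmod z ^ n)"
      by simp
  qed
  have "(\<lambda>n. LINT \<xi>|circle. ?g n \<xi>) sums (LINT \<xi>|circle. (\<Sum>n. ?g n \<xi>))"
    by (rule sums_integral) (use i 1 2 in auto)
  moreover have "(LINT \<xi>|circle. (\<Sum>n. ?g n \<xi>)) = (LINT \<xi>|circle. f \<xi> * ((\<xi> + z) / (\<xi> - z)))"
  proof (rule Bochner_Integration.integral_cong[OF refl])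
    fix \<xi> assume "\<xi> \<in> space circle"
    then have "cmod \<xi> = 1" by (rule norm_circle)
    then show "(\<Sum>n. ?g n \<xi>) = f \<xi> * ((\<xi> + z) / (\<xi> - z))"
      using sums_mult[OF herglotz_kernel_sums[OF z], of \<xi> "f \<xi>"] by (simp add: sums_iff)
  qed
  ultimately have "(\<lambda>n. LINT \<xi>|circle. ?g n \<xi>) sums (herglotz f z * (2 * pi))"
    by (simp add: herglotz_def)
  then have "(\<lambda>n. (LINT \<xi>|circle. ?g n \<xi>) / (2 * pi)) sums herglotz f z"
    using sums_divide[of _ "herglotz f z * (2 * pi)" "2 * pi"] by fastforce
  moreover have "(LINT \<xi>|circle. ?g n \<xi>) = ?k n * (LINT \<xi>|circle. f \<xi> * inverse \<xi> ^ n) * z ^ n" for n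
  proof -
    have "(LINT \<xi>|circle. ?g n \<xi>) = (LINT \<xi>|circle. (?k n * z ^ n) * (f \<xi> * inverse \<xi> ^ n))"
      by (simp only: mult_ac)
    also have "\<dots> = (?k n * z ^ n) * (LINT \<xi>|circle. f \<xi> * inverse \<xi> ^ n)"
      by (rule integral_mult_right_zero)
    finally show ?thesis by (simp only: mult_ac)
  qed
  ultimately show ?thesis by (simp add: mult_ac)
qed

lemma herglotz_holomorphic:
  assumes f: "integrable circle f"
  shows "herglotz f holomorphic_on ball 0 1"
proof (rule power_series_holomorphic)
  fix w :: complex assume "w \<in> ball 0 1"
  then show "(\<lambda>n. ((if n = 0 then 1 else 2) * (LINT \<xi>|circle. f \<xi> * inverse \<xi> ^ n) / (2 * pi)) * (w - 0) ^ n) sums herglotz f w"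
    using herglotz_sums[OF f, of w] by simp
qed

lemma herglotz_0: "integrable circle f \<Longrightarrow> herglotz f 0 = (LINT \<xi>|circle. f \<xi>) / (2 * pi)"
  unfolding herglotz_def
  by (intro arg_cong2[where f = "(/)"] Bochner_Integration.integral_cong refl) (auto dest: norm_circle)

lemma herglotz_const: "cmod z < 1 \<Longrightarrow> herglotz (\<lambda>_. 1) z = 1"
proof -
  assume z: "cmod z < 1"
  have "(\<lambda>n. ((if n = 0 then 1 else 2) * (LINT \<xi>|circle. 1 * inverse \<xi> ^ n) / (2 * pi)) * z ^ n) sums herglotz (\<lambda>_. 1) z"
    by (rule herglotz_sums[OF _ z]) simp
  moreover have "(\<lambda>n. ((if n = 0 then 1 else 2) * (LINT \<xi>|circle. 1 * inverse \<xi> ^ n) / (2 * pi)) * z ^ n) = (\<lambda>n. if n = 0 then 1 else 0)"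
    by (auto simp: fun_eq_iff integral_circle_inverse_power measure_circle_space scaleR_conv_of_real)
  ultimately show ?thesis using sums_single[of 0 "\<lambda>_. 1::complex"] by (auto intro: sums_unique2)
qed

lemma Re_herglotz:
  assumes f: "integrable circle f" and z: "cmod z < 1"
  shows "Re (herglotz (\<lambda>\<xi>. complex_of_real (f \<xi>)) z) = poisson_int f z"
proof -
  have i: "integrable circle (\<lambda>\<xi>. complex_of_real (f \<xi>) * ((\<xi> + z) / (\<xi> - z)))"
    by (rule integrable_herglotz) (use f z in auto)
  have "Re (LINT \<xi>|circle. complex_of_real (f \<xi>) * ((\<xi> + z) / (\<xi> - z)))
      = (LINT \<xi>|circle. Re (complex_of_real (f \<xi>) * ((\<xi> + z) / (\<xi> - z))))"
    using i by (rule integral_Re[symmetric])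
  also have "\<dots> = (LINT \<xi>|circle. poisson z \<xi> *\<^sub>R f \<xi>)"
  proof (rule Bochner_Integration.integral_cong[OF refl])
    have *: "Re (complex_of_real a * w) = a * Re w" for a w by simp
    fix \<xi> assume "\<xi> \<in> space circle"
    then show "Re (complex_of_real (f \<xi>) * ((\<xi> + z) / (\<xi> - z))) = poisson z \<xi> *\<^sub>R f \<xi>"
      unfolding * by (simp add: poisson_eq_Re norm_circle)
  qed
  finally show ?thesis
    by (simp add: herglotz_def poisson_int_def)
qed

lemma integral_poisson: "cmod z < 1 \<Longrightarrow> (LINT \<xi>|circle. poisson z \<xi>) = 2 * pi"
  using Re_herglotz[of "\<lambda>_. 1" z] herglotz_const[of z] by (simp add: poisson_int_def)

lemma poisson_int_const: "cmod z < 1 \<Longrightarrow> poisson_int (\<lambda>_. c) z = c"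
  using integral_poisson[of z] integrable_poisson[of "\<lambda>_. 1::real" z] by (simp add: poisson_int_def)

section \<open>Radial limits of Poisson integrals\<close>

definition lebesgue_point :: "(real \<Rightarrow> 'b::real_normed_vector) \<Rightarrow> real \<Rightarrow> bool" where
  "lebesgue_point f x \<longleftrightarrow> (\<forall>e>0. \<exists>d>0. \<forall>h. 0 < h \<and> h < d \<longrightarrow>
      (LINT t:{x - h..x + h}|lborel. norm (f t - f x)) \<le> e * h)"

text \<open>Lebesgue's differentiation theorem for intervals with left end point \<open>x\<close>.\<close>

lemma AE_one_sided_average:
  fixes g :: "real \<Rightarrow> real"
  assumes "\<And>a b. set_integrable lborel {a..b} g"
  shows "AE x in lborel. \<forall>e>0. \<exists>d>0. \<forall>h. 0 < h \<and> h < d \<longrightarrow> \<bar>(LINT t:{x..x + h}|lborel. g t) / h - g x\<bar> < e"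
proof -
  have "g integrable_on cbox a b" for a b
    using set_borel_integral_eq_integral(1)[OF assms, of a b] by simp
  then obtain N where N: "negligible N"
    "\<And>x e. x \<notin> N \<Longrightarrow> 0 < e \<Longrightarrow> \<exists>d>0. \<forall>h. 0 < h \<and> h < d \<longrightarrow>
        norm (integral (cbox x (x + h *\<^sub>R One)) g /\<^sub>R h ^ DIM(real) - g x) < e"
    using integrable_ccontinuous_explicit[of g] by metis
  have eq: "integral (cbox x (x + h *\<^sub>R One)) g /\<^sub>R h ^ DIM(real) = (LINT t:{x..x + h}|lborel. g t) / h" for x h
    using set_borel_integral_eq_integral(2)[OF assms, of x "x + h"]
    by (simp add: divide_inverse mult.commute)
  have "AE x in lebesgue. x \<notin> N"
    using N(1) by (simp add: negligible_iff_null_sets AE_not_in)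
  then have "AE x in lborel. x \<notin> N" by (simp add: AE_completion_iff)
  then show ?thesis
  proof eventually_elim
    case (elim x)
    then show ?case using N(2)[OF elim] unfolding eq by simp
  qed
qed

lemma set_integrable_reflect:
  fixes g :: "real \<Rightarrow> real"
  assumes "set_integrable lborel {- b..- a} g"
  shows "set_integrable lborel {a..b} (\<lambda>t. g (- t))"
    and "(LINT t:{a..b}|lborel. g (- t)) = (LINT t:{- b..- a}|lborel. g t)"
proof -
  have ind: "indicator {a..b} t = (indicator {- b..- a} (0 + (-1) * t) :: real)" for t
    by (auto simp: indicator_def)
  show "set_integrable lborel {a..b} (\<lambda>t. g (- t))"
    using lborel_integrable_real_affine[OF assms[unfolded set_integrable_def], of "-1" 0]
    unfolding set_integrable_def ind by simp
  show "(LINT t:{a..b}|lborel. g (- t)) = (LINT t:{- b..- a}|lborel. g t)"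
    using lborel_integral_real_affine[of "-1" "\<lambda>t. indicator {- b..- a} t *\<^sub>R g t" 0]
    unfolding set_lebesgue_integral_def ind by simp
qed

lemma AE_lborel_reflect:
  assumes "AE x in lborel. P (x::real)"
  shows "AE x in lborel. P (- x)"
proof -
  obtain N where N: "N \<in> null_sets lborel" "{x. \<not> P x} \<subseteq> N"
    using assms unfolding eventually_ae_filter by auto
  have "uminus -` N \<in> null_sets lborel"
  proof -
    have 1: "N \<in> sets borel" using N(1) by auto
    have m: "uminus -` N \<in> sets borel" using measurable_sets[of uminus borel borel N] 1 by simp
    have "emeasure lborel (uminus -` N) = (\<integral>\<^sup>+x. indicator N (0 + (-1) * x) \<partial>lborel)"
    proof -
      have "(\<lambda>x. indicator N (0 + (-1) * x) :: ennreal) = indicator (uminus -` N)"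
        by (auto simp: fun_eq_iff indicator_def)
      then show ?thesis using m by simp
    qed
    also have "\<dots> = (\<integral>\<^sup>+x. indicator N x \<partial>lborel)"
      using nn_integral_real_affine[of "indicator N" "-1" 0] 1 by simp
    also have "\<dots> = 0" using N(1) 1 by auto
    finally show ?thesis using m by auto
  qed
  moreover have "{x. \<not> P (- x)} \<subseteq> uminus -` N" using N(2) by auto
  ultimately show ?thesis unfolding eventually_ae_filter by auto
qed

text \<open>The averages of \<open>\<bar>f - c\<bar>\<close> converge almost everywhere simultaneously for all \<open>c\<close> in a countable dense set;
  approximating the value \<open>f x\<close> by such a \<open>c\<close> gives the claim at \<open>x\<close>.\<close>

lemma AE_lebesgue_point:
  fixes f :: "real \<Rightarrow> 'b::{banach, second_countable_topology}"
  assumes f: "\<And>a b. set_integrable lborel {a..b} f"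
  shows "AE x in lborel. lebesgue_point f x"
proof -
  obtain D :: "'b set" where D: "countable D" "\<And>X. open X \<Longrightarrow> X \<noteq> {} \<Longrightarrow> \<exists>d\<in>D. d \<in> X"
    using countable_dense_setE by blast
  have cint: "set_integrable lborel {a..b} (\<lambda>t. c)" for a b :: real and c :: "'c::{banach, second_countable_topology}"
    unfolding set_integrable_def by (rule borel_integrable_compact) (auto intro: compact_Icc)
  have g: "set_integrable lborel {a..b} (\<lambda>t. norm (f t - c))" for a b c
    by (intro set_integrable_norm set_integral_diff(1) f cint)
  have "AE x in lborel. \<forall>c\<in>D. (\<forall>e>0. \<exists>d>0. \<forall>h. 0 < h \<and> h < d \<longrightarrow>
      \<bar>(LINT t:{x..x + h}|lborel. norm (f t - c)) / h - norm (f x - c)\<bar> < e)"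
    by (intro AE_ball_countable[OF D(1), THEN iffD2] ballI AE_one_sided_average g)
  moreover have "AE x in lborel. \<forall>c\<in>D. (\<forall>e>0. \<exists>d>0. \<forall>h. 0 < h \<and> h < d \<longrightarrow>
      \<bar>(LINT t:{- x..- x + h}|lborel. norm (f (- t) - c)) / h - norm (f (- (- x)) - c)\<bar> < e)"
    by (intro AE_ball_countable[OF D(1), THEN iffD2] ballI AE_lborel_reflect AE_one_sided_average set_integrable_reflect g)
  ultimately show ?thesis
  proof eventually_elim
    case (elim x)
    show ?case unfolding lebesgue_point_def
    proof (intro allI impI)
      fix e :: real assume e: "e > 0"
      obtain c where c: "c \<in> D" "norm (f x - c) < e / 8"
        using D(2)[of "ball (f x) (e / 8)"] e by (auto simp: dist_norm)
      obtain d1 where d1: "d1 > 0" "\<And>h. 0 < h \<Longrightarrow> h < d1 \<Longrightarrow>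
         \<bar>(LINT t:{x..x + h}|lborel. norm (f t - c)) / h - norm (f x - c)\<bar> < e / 8"
        using bspec[OF elim(1) c(1), rule_format, of "e / 8"] e by auto
      obtain d2 where d2: "d2 > 0" "\<And>h. 0 < h \<Longrightarrow> h < d2 \<Longrightarrow>
         \<bar>(LINT t:{- x..- x + h}|lborel. norm (f (- t) - c)) / h - norm (f x - c)\<bar> < e / 8"
        using bspec[OF elim(2) c(1), rule_format, of "e / 8"] e by auto
      show "\<exists>d>0. \<forall>h. 0 < h \<and> h < d \<longrightarrow> (LINT t:{x - h..x + h}|lborel. norm (f t - f x)) \<le> e * h"
      proof (intro exI[of _ "min d1 d2"] conjI allI impI)
        fix h assume h: "0 < h \<and> h < min d1 d2"
        have "(LINT t:{x - h..x + h}|lborel. norm (f t - f x)) \<le> (LINT t:{x - h..x + h}|lborel. norm (f t - c) + norm (f x - c))"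
          using norm_triangle_ineq4[of "f _ - c" "f x - c"]
          by (intro set_integral_mono set_integral_add(1) g cint) (auto simp: algebra_simps)
        also have "\<dots> = (LINT t:{x - h..x + h}|lborel. norm (f t - c)) + (LINT t:{x - h..x + h}|lborel. norm (f x - c))"
          by (intro set_integral_add(2) g cint)
        also have "(LINT t:{x - h..x + h}|lborel. norm (f x - c)) = 2 * h * norm (f x - c)"
          using h by (simp add: set_lebesgue_integral_def)
        also have "(LINT t:{x - h..x + h}|lborel. norm (f t - c))
           = (LINT t:{x - h..x}|lborel. norm (f t - c)) + (LINT t:{x..x + h}|lborel. norm (f t - c))"
        proof -
          have "{x - h..x + h} = {x - h..x} \<union> {x..x + h}" using h by auto
          moreover have "AE t in lborel. \<not> (t \<in> {x - h..x} \<and> t \<in> {x..x + h})"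
            using AE_lborel_singleton[of x] by eventually_elim auto
          ultimately show ?thesis using g by (simp, intro set_integral_Un_AE) auto
        qed
        also have "(LINT t:{x - h..x}|lborel. norm (f t - c)) = (LINT t:{- x..- x + h}|lborel. norm (f (- t) - c))"
          using set_integrable_reflect(2)[of "- x + h" "- x" "\<lambda>t. norm (f t - c)"] g by simp
        finally have "(LINT t:{x - h..x + h}|lborel. norm (f t - f x)) \<le>
            (LINT t:{- x..- x + h}|lborel. norm (f (- t) - c)) + (LINT t:{x..x + h}|lborel. norm (f t - c)) + 2 * h * norm (f x - c)" by simp
        moreover have "(LINT t:{- x..- x + h}|lborel. norm (f (- t) - c)) \<le> e / 4 * h"
          using d2(2)[of h] c(2) h by (subst pos_divide_le_eq[symmetric]) linarith+
        moreover have "(LINT t:{x..x + h}|lborel. norm (f t - c)) \<le> e / 4 * h"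
          using d1(2)[of h] c(2) h by (subst pos_divide_le_eq[symmetric]) linarith+
        moreover have "2 * h * norm (f x - c) \<le> 2 * h * (e / 8)"
          using c(2) h by (intro mult_left_mono) auto
        ultimately show "(LINT t:{x - h..x + h}|lborel. norm (f t - f x)) \<le> e * h"
          using mult_pos_pos[OF e conjunct1[OF h]] by (simp add: algebra_simps)
      qed (use d1 d2 in auto)
    qed
  qed
qed

text \<open>A Borel measurable inverse of \<open>cis\<close> on \<open>{0..<2 * pi}\<close>. It carries null sets of the line to null sets of the circle, so
  that almost everywhere statements can be transported for predicates that are not known to be measurable.\<close>

definition circle_arg :: "complex \<Rightarrow> real" where
  "circle_arg z = (let y = arccos (max (-1) (min 1 (Re z))) in if 0 \<le> Im z then y else 2 * pi - y)"

lemma circle_arg_measurable: "circle_arg \<in> borel_measurable borel"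
proof -
  have [measurable]: "(\<lambda>z. arccos (max (-1) (min 1 (Re z)))) \<in> borel_measurable borel"
    by (intro borel_measurable_continuous_onI continuous_on_arccos continuous_intros) auto
  show ?thesis unfolding circle_arg_def Let_def by measurable
qed

lemma circle_arg_cis:
  assumes "0 \<le> t" "t < 2 * pi"
  shows "circle_arg (cis t) = t"
proof (cases "t \<le> pi")
  case True
  then show ?thesis using assms
    by (simp add: circle_arg_def min_absorb2 max_absorb2 arccos_cos sin_ge_zero)
next
  case False
  have "arccos (cos (2 * pi - t)) = 2 * pi - t" using False assms by (intro arccos_cos) auto
  moreover have "cos (2 * pi - t) = cos t" by (simp add: cos_diff)
  ultimately have "arccos (cos t) = 2 * pi - t" by simp
  then show ?thesis using False assms sin_lt_zero[of t]
    by (simp add: circle_arg_def min_absorb2 max_absorb2)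
qed

lemma cis_circle_arg:
  assumes "cmod z = 1"
  shows "cis (circle_arg z) = z"
proof -
  have "z = cis (Arg2pi z)"
    using Arg2pi_eq[of z] assms by (simp add: cis_conv_exp)
  then show ?thesis using circle_arg_cis[of "Arg2pi z"] Arg2pi_ge_0[of z] Arg2pi_lt_2pi[of z] by metis
qed

lemma AE_circleI:
  assumes "AE t in lborel. P (cis t)"
  shows "AE z in circle. P z"
proof -
  obtain N where N: "N \<in> null_sets lborel" "{t. \<not> P (cis t)} \<subseteq> N"
    using assms unfolding eventually_ae_filter by auto
  have [measurable]: "circle_arg \<in> borel_measurable circle"
    by (rule borel_measurable_circle_borel[OF circle_arg_measurable])
  have [measurable]: "N \<in> sets borel" using N(1) by auto
  have "AE z in circle. circle_arg z \<notin> N"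
  proof (subst AE_circle_iff[of _ 0])
    show "Measurable.pred circle (\<lambda>z. circle_arg z \<notin> N)" by measurable
    show "AE t in lborel. t \<in> {0..<0 + 2 * pi} \<longrightarrow> circle_arg (cis t) \<notin> N"
      using AE_not_in[OF N(1)] by eventually_elim (auto simp: circle_arg_cis)
  qed
  moreover have "AE z in circle. cmod z = 1" by (rule AE_I2) (rule norm_circle)
  ultimately show ?thesis
  proof eventually_elim
    case (elim z)
    then have "P (cis (circle_arg z))" using N(2) by auto
    then show ?case using elim cis_circle_arg by simp
  qed
qed

lemma poisson_int_eq:
  fixes f :: "complex \<Rightarrow> 'b::{banach, second_countable_topology}"
  assumes f: "f \<in> borel_measurable circle"
  shows "poisson_int f z = (1 / (2 * pi)) *\<^sub>R (LINT t:{x - pi..x + pi}|lborel. poisson z (cis t) *\<^sub>R f (cis t))"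
proof -
  have [measurable]: "(\<lambda>\<xi>. poisson z \<xi> *\<^sub>R f \<xi>) \<in> borel_measurable circle"
    using f borel_measurable_circle_ident by measurable
  have m [measurable]: "(\<lambda>t. f (cis t)) \<in> borel_measurable borel" by (rule measurable_compose[OF cis_measurable f])
  have [measurable]: "cis \<in> borel_measurable borel" 
    by (rule borel_measurable_continuous_onI) (rule continuous_on_cis, rule continuous_on_id)
  have "(LINT \<xi>|circle. poisson z \<xi> *\<^sub>R f \<xi>) = (LINT t:{x - pi..<x - pi + 2 * pi}|lborel. poisson z (cis t) *\<^sub>R f (cis t))"
    by (rule integral_circle) simp
  also have "\<dots> = (LINT t:{x - pi..x + pi}|lborel. poisson z (cis t) *\<^sub>R f (cis t))"
  proof (rule set_integral_cong_set)
    show "AE t in lborel. (t \<in> {x - pi..x + pi}) = (t \<in> {x - pi..<x - pi + 2 * pi})"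
      using AE_lborel_singleton[of "x + pi"] by eventually_elim auto
  qed (auto simp: set_borel_measurable_def)
  finally show ?thesis by (simp add: poisson_int_def)
qed

lemma norm_poisson_int_le:
  fixes f :: "complex \<Rightarrow> 'b::{banach, second_countable_topology}"
  assumes f: "integrable circle f" and z: "cmod z < 1"
  shows "norm (poisson_int f z) \<le> poisson_int (\<lambda>\<xi>. norm (f \<xi>)) z"
proof -
  have "norm (LINT \<xi>|circle. poisson z \<xi> *\<^sub>R f \<xi>) \<le> (LINT \<xi>|circle. norm (poisson z \<xi> *\<^sub>R f \<xi>))"
    by (rule integral_norm_bound)
  also have "\<dots> = (LINT \<xi>|circle. poisson z \<xi> *\<^sub>R norm (f \<xi>))"
    using poisson_pos[OF z] by (intro Bochner_Integration.integral_cong refl) (auto dest!: norm_circle simp: less_imp_le)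
  finally show ?thesis by (simp add: poisson_int_def divide_right_mono)
qed

lemma poisson_int_diff:
  fixes f :: "complex \<Rightarrow> 'b::{banach, second_countable_topology}"
  assumes "integrable circle f" "integrable circle g" "cmod z < 1"
  shows "poisson_int (\<lambda>\<xi>. f \<xi> - g \<xi>) z = poisson_int f z - poisson_int g z"
  using integrable_poisson[OF assms(1,3)] integrable_poisson[OF assms(2,3)]
  by (simp add: poisson_int_def scaleR_diff_right)

text \<open>If the means of \<open>h\<close> over small symmetric intervals are at most \<open>B\<close>, so is, up to a constant,
  its Poisson integral, except for a contribution of the remote part that vanishes in the limit.\<close>

lemma poisson_int_le_local:
  fixes h :: "complex \<Rightarrow> real"
  assumes h: "integrable circle h" and h0: "\<And>\<xi>. 0 \<le> h \<xi>"
    and d: "0 < d" "d \<le> pi" and r: "0 \<le> r" "r < 1" "1 - r \<le> d"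
    and B: "0 \<le> B" "\<And>\<rho>. 0 < \<rho> \<Longrightarrow> \<rho> \<le> d \<Longrightarrow> (LINT t:{x - \<rho>..x + \<rho>}|lborel. h (cis t)) \<le> B * \<rho>"
  shows "poisson_int h (of_real r * cis x) \<le> 640 * B + 80 * (1 - r) / d\<^sup>2 * (LINT t:{x - pi..x + pi}|lborel. h (cis t))"
proof -
  have hm: "h \<in> borel_measurable circle" using h by simp
  note si = set_integrable_cis[OF h]
  define \<eta> where "\<eta> = 1 - r"
  have \<eta>: "0 < \<eta>" "\<eta> \<le> d" using r by (auto simp: \<eta>_def)
  obtain J where J: "d < 2 ^ J * \<eta>"
  proof -
    obtain n where "d / \<eta> < 2 ^ n" using real_arch_pow[of 2 "d / \<eta>"] by auto
    then show ?thesis using that[of n] \<eta> by (simp add: field_simps)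
  qed
  define m where "m j = min d (2 ^ j * \<eta>)" for j :: nat
  have m: "0 < m j" "m j \<le> d" "m j \<le> 2 ^ j * \<eta>" for j using d \<eta> by (auto simp: m_def)
  define G where "G t = (320 / \<eta>) * (\<Sum>j\<le>J. (1/4) ^ j * (indicator {x - m j..x + m j} t * h (cis t)))
       + 80 * \<eta> / d\<^sup>2 * (indicator {x - pi..x + pi} t * h (cis t))" for t
  have iG: "integrable lborel (\<lambda>t. indicator {x - a..x + a} t * h (cis t))" for a
    using si[of "x - a" "x + a"] by (simp add: set_integrable_def)
  have le: "indicator {x - pi..x + pi} t * (poisson (of_real r * cis x) (cis t) * h (cis t)) \<le> G t" for t
  proof (cases "t \<in> {x - pi..x + pi}")
    case True
    have P0: "0 \<le> poisson (of_real r * cis x) (cis t)"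
      using poisson_pos[of "of_real r * cis x" "cis t"] r by (simp add: norm_mult)
    have S0: "0 \<le> (\<Sum>j\<le>J. (1/4) ^ j * (indicator {x - m j..x + m j} t * h (cis t)))"
      using h0 by (intro sum_nonneg) auto
    show ?thesis
    proof (cases "\<bar>t - x\<bar> \<le> d")
      case near: True
      have "poisson (of_real r * cis x) (cis (x + (t - x)))
         \<le> 320 / (1 - r) * (\<Sum>j\<le>J. (1/4) ^ j * indicator {- (2 ^ j * (1 - r))..2 ^ j * (1 - r)} (t - x))"
        using near d J r by (intro poisson_layers) (auto simp: \<eta>_def)
      also have "(\<Sum>j\<le>J. (1/4) ^ j * indicator {- (2 ^ j * (1 - r))..2 ^ j * (1 - r)} (t - x))
         = (\<Sum>j\<le>J. (1/4) ^ j * indicator {x - m j..x + m j} t :: real)"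
        using near by (intro sum.cong refl) (auto simp: indicator_def m_def \<eta>_def)
      finally have "poisson (of_real r * cis x) (cis t) * h (cis t) \<le> 320 / \<eta> * (\<Sum>j\<le>J. (1/4) ^ j * indicator {x - m j..x + m j} t) * h (cis t)"
        using h0 by (intro mult_right_mono) (auto simp: \<eta>_def)
      also have "\<dots> = (320 / \<eta>) * (\<Sum>j\<le>J. (1/4) ^ j * (indicator {x - m j..x + m j} t * h (cis t)))"
        by (simp only: sum_distrib_right mult.assoc)
      also have "\<dots> \<le> G t" using True h0 \<eta> unfolding G_def by simp
      finally show ?thesis using True by simp
    next
      case far: False
      then have t0: "t - x \<noteq> 0" using d by auto
      have "poisson (of_real r * cis x) (cis (x + (t - x))) \<le> 80 * (1 - r) / (t - x)\<^sup>2"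
        using True r t0 by (intro poisson_decay) auto
      also have "\<dots> \<le> 80 * (1 - r) / d\<^sup>2"
      proof (rule divide_left_mono)
        have "d\<^sup>2 \<le> \<bar>t - x\<bar>\<^sup>2" using far d by (intro power_mono) auto
        then show "d\<^sup>2 \<le> (t - x)\<^sup>2" by simp
      qed (use r d t0 in auto)
      finally have "poisson (of_real r * cis x) (cis t) * h (cis t) \<le> 80 * \<eta> / d\<^sup>2 * h (cis t)"
        using h0 by (intro mult_right_mono) (auto simp: \<eta>_def)
      moreover have "0 \<le> (320 / \<eta>) * (\<Sum>j\<le>J. (1/4) ^ j * (indicator {x - m j..x + m j} t * h (cis t)))"
        using S0 \<eta> by simp
      ultimately show ?thesis using True unfolding G_def by simp
    qed
  next
    case False
    then show ?thesis using h0 \<eta> unfolding G_def by (auto intro!: add_nonneg_nonneg mult_nonneg_nonneg divide_nonneg_pos sum_nonneg)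
  qed
  have "(LINT t:{x - pi..x + pi}|lborel. poisson (of_real r * cis x) (cis t) *\<^sub>R h (cis t)) \<le> (LINT t|lborel. G t)"
    unfolding set_lebesgue_integral_def
  proof (rule integral_mono)
    have "integrable circle (\<lambda>\<xi>. poisson (of_real r * cis x) \<xi> *\<^sub>R h \<xi>)"
      using h r by (intro integrable_poisson) (auto simp: norm_mult)
    from set_integrable_cis[OF this, of "x - pi" "x + pi"]
    show "integrable lborel (\<lambda>t. indicator {x - pi..x + pi} t *\<^sub>R poisson (of_real r * cis x) (cis t) *\<^sub>R h (cis t))"
      by (simp add: set_integrable_def)
    show "integrable lborel G" unfolding G_def
      by (intro Bochner_Integration.integrable_add integrable_mult_right Bochner_Integration.integrable_sum iG)
  qed (use le in simp)
  also have "\<dots> = (320 / \<eta>) * (\<Sum>j\<le>J. (1/4) ^ j * (LINT t:{x - m j..x + m j}|lborel. h (cis t)))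
       + 80 * \<eta> / d\<^sup>2 * (LINT t:{x - pi..x + pi}|lborel. h (cis t))"
    unfolding G_def set_lebesgue_integral_def using iG by simp
  also have "(320 / \<eta>) * (\<Sum>j\<le>J. (1/4) ^ j * (LINT t:{x - m j..x + m j}|lborel. h (cis t)))
      \<le> (320 / \<eta>) * (\<Sum>j\<le>J. (1/4) ^ j * (B * (2 ^ j * \<eta>)))"
  proof (intro mult_left_mono sum_mono)
    fix j
    have "(LINT t:{x - m j..x + m j}|lborel. h (cis t)) \<le> B * m j" using m by (intro B)
    also have "\<dots> \<le> B * (2 ^ j * \<eta>)" using m B by (intro mult_left_mono)
    finally show "(LINT t:{x - m j..x + m j}|lborel. h (cis t)) \<le> B * (2 ^ j * \<eta>)" .
  qed (use \<eta> in auto)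
  also have "(320 / \<eta>) * (\<Sum>j\<le>J. (1/4) ^ j * (B * (2 ^ j * \<eta>))) = 320 * B * (\<Sum>j\<le>J. (1/2) ^ j)"
  proof -
    have "(1/4) ^ j * (B * (2 ^ j * \<eta>)) = B * \<eta> * (1/2) ^ j" for j
    proof -
      have "(1/4::real) ^ j * 2 ^ j = (1/2) ^ j" by (simp flip: power_mult_distrib)
      then show ?thesis by (metis mult.assoc mult.commute)
    qed
    then have "(\<Sum>j\<le>J. (1/4) ^ j * (B * (2 ^ j * \<eta>))) = B * \<eta> * (\<Sum>j\<le>J. (1/2) ^ j)"
      by (simp only: sum_distrib_left)
    then show ?thesis using \<eta> by simp
  qed
  also have "\<dots> \<le> 320 * B * 2"
  proof (intro mult_left_mono)
    have "(\<Sum>j\<le>J. (1/2::real) ^ j) \<le> (\<Sum>j. (1/2) ^ j)"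
      by (intro sum_le_suminf) auto
    then show "(\<Sum>j\<le>J. (1/2::real) ^ j) \<le> 2" by (simp add: suminf_geometric)
  qed (use B in auto)
  finally have main: "(LINT t:{x - pi..x + pi}|lborel. poisson (of_real r * cis x) (cis t) *\<^sub>R h (cis t))
      \<le> 640 * B + 80 * (1 - r) / d\<^sup>2 * (LINT t:{x - pi..x + pi}|lborel. h (cis t))" (is "?L \<le> ?R")
    by (simp add: \<eta>_def)
  have "0 \<le> ?R" using B h0 r by (intro add_nonneg_nonneg mult_nonneg_nonneg) (auto simp: set_lebesgue_integral_def)
  have "poisson_int h (of_real r * cis x) = 1 / (2 * pi) * ?L"
    unfolding poisson_int_eq[OF hm, of _ x] by simp
  also have "\<dots> \<le> 1 / (2 * pi) * ?R" using main by (intro mult_left_mono) auto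
  also have "\<dots> \<le> 1 * ?R" using \<open>0 \<le> ?R\<close> pi_ge_two by (intro mult_right_mono) auto
  finally show ?thesis by simp
qed

text \<open>At a Lebesgue point \<open>x\<close> the function \<open>\<bar>f - f x\<bar>\<close> has small means over all short intervals around \<open>x\<close>, and the
  preceding bound turns this into smallness of its Poisson integral near the boundary.\<close>

theorem Fatou_poisson_int:
  fixes f :: "complex \<Rightarrow> 'b::{banach, second_countable_topology}"
  assumes f: "integrable circle f"
  shows "AE z in circle. ((\<lambda>r. poisson_int f (of_real r * z)) \<longlongrightarrow> f z) (at_left 1)"
proof (rule AE_circleI)
  have "AE x in lborel. lebesgue_point (\<lambda>t. f (cis t)) x"
    by (intro AE_lebesgue_point set_integrable_cis f)
  then show "AE x in lborel. ((\<lambda>r. poisson_int f (of_real r * cis x)) \<longlongrightarrow> f (cis x)) (at_left 1)"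
  proof eventually_elim
    case (elim x)
    define h where "h \<xi> = norm (f \<xi> - f (cis x))" for \<xi>
    have h: "integrable circle h" unfolding h_def using f by (intro integrable_norm) simp
    define I where "I = (LINT t:{x - pi..x + pi}|lborel. h (cis t))"
    have I: "0 \<le> I" unfolding I_def h_def by (auto simp: set_lebesgue_integral_def)
    have est: "norm (poisson_int f z - f (cis x)) \<le> poisson_int h z" if "cmod z < 1" for z
    proof -
      have "poisson_int f z - f (cis x) = poisson_int (\<lambda>\<xi>. f \<xi> - f (cis x)) z"
        using f that by (simp add: poisson_int_diff poisson_int_const)
      then show ?thesis unfolding h_def using norm_poisson_int_le[of "\<lambda>\<xi>. f \<xi> - f (cis x)" z] f that by simp
    qed
    show ?case
    proof (rule tendstoI)
      fix e :: real assume e: "e > 0"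
      define B where "B = e / 2000"
      obtain d where d: "d > 0" "\<And>\<rho>. 0 < \<rho> \<Longrightarrow> \<rho> < d \<Longrightarrow> (LINT t:{x - \<rho>..x + \<rho>}|lborel. h (cis t)) \<le> B * \<rho>"
        using elim e unfolding lebesgue_point_def h_def B_def by (metis divide_pos_pos zero_less_numeral)
      define d' where "d' = min (d / 2) pi"
      have d': "0 < d'" "d' \<le> pi" "d' < d" using d by (auto simp: d'_def min_def)
      define s where "s = min (min d' (1/2)) (e * d'\<^sup>2 / (200 * (I + 1)))"
      have s: "0 < s" "s \<le> d'" "s \<le> 1 / 2" "s \<le> e * d'\<^sup>2 / (200 * (I + 1))"
        subgoal using e d' I by (simp add: s_def)
        unfolding s_def by linarith+
      have "eventually (\<lambda>r. r \<in> {1 - s<..<1}) (at_left 1)"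
        using eventually_at_left_real[of "1 - s" 1] s by simp
      then show "\<forall>\<^sub>F r in at_left 1. dist (poisson_int f (of_real r * cis x)) (f (cis x)) < e"
      proof eventually_elim
        case (elim r)
        then have r: "0 \<le> r" "r < 1" "1 - r \<le> s" using s by auto
        have "norm (poisson_int f (of_real r * cis x) - f (cis x)) \<le> poisson_int h (of_real r * cis x)"
          using r by (intro est) (simp add: norm_mult)
        also have "\<dots> \<le> 640 * B + 80 * (1 - r) / d'\<^sup>2 * I"
          unfolding I_def using r s d' d e
          by (intro poisson_int_le_local h) (auto simp: B_def h_def)
        also have "80 * (1 - r) / d'\<^sup>2 * I \<le> 80 * (e * d'\<^sup>2 / (200 * (I + 1))) / d'\<^sup>2 * I"
          using r s I by (intro mult_right_mono divide_right_mono mult_left_mono) auto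
        also have "\<dots> = 80 / 200 * e * (I / (I + 1))" using d' I by (simp add: divide_simps)
        also have "\<dots> \<le> 80 / 200 * e * 1" using e I by (intro mult_left_mono) auto
        also have "640 * B + 80 / 200 * e * 1 < e" using e by (simp add: B_def)
        finally show ?case by (simp add: dist_norm)
      qed
    qed
  qed
qed

section \<open>Almost everywhere convergent convex combinations\<close>

lemma AE_summable_of_summable_integrals:
  fixes h :: "nat \<Rightarrow> 'a \<Rightarrow> real"
  assumes int: "\<And>n. integrable M (h n)" and nn: "\<And>n x. 0 \<le> h n x"
    and sum: "summable (\<lambda>n. LINT x|M. h n x)"
  shows "AE x in M. summable (\<lambda>n. h n x)"
proof -
  have [measurable]: "h n \<in> borel_measurable M" for n using int by auto
  have "(\<integral>\<^sup>+x. (\<Sum>n. ennreal (h n x)) \<partial>M) = (\<Sum>n. \<integral>\<^sup>+x. ennreal (h n x) \<partial>M)"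
    by (rule nn_integral_suminf) simp
  also have "\<dots> = (\<Sum>n. ennreal (LINT x|M. h n x))"
    using int nn by (simp add: nn_integral_eq_integral)
  also have "\<dots> = ennreal (\<Sum>n. LINT x|M. h n x)"
    using sum nn by (intro suminf_ennreal2) auto
  finally have "(\<integral>\<^sup>+x. (\<Sum>n. ennreal (h n x)) \<partial>M) \<noteq> \<infinity>" by simp
  then have "AE x in M. (\<Sum>n. ennreal (h n x)) \<noteq> \<infinity>"
    by (intro nn_integral_noteq_infinite) auto
  then show ?thesis
    by eventually_elim (use nn in \<open>auto intro: summable_suminf_not_top\<close>)
qed

text \<open>The bound \<open>t \<le> 2\<^sup>-\<^sup>n + 2\<^sup>n t\<^sup>2\<close> replaces the increments by summable terms with a summable sum of integrals. The same sum
  supplies an integrable majorant.\<close>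

lemma AE_convergent_of_L2_increments:
  fixes g :: "nat \<Rightarrow> 'a \<Rightarrow> complex"
  assumes M: "finite_measure M" and g0: "integrable M (g 0)"
    and int: "\<And>n. integrable M (\<lambda>x. (cmod (g (Suc n) x - g n x))\<^sup>2)"
    and le: "\<And>n. (LINT x|M. (cmod (g (Suc n) x - g n x))\<^sup>2) \<le> C * (1/4) ^ n"
  shows "AE x in M. convergent (\<lambda>n. g n x)"
    and "\<exists>D. integrable M D \<and> (AE x in M. \<forall>n. cmod (g n x) \<le> D x)"
proof -
  interpret finite_measure M by (rule M)
  define h where "h n x = 2 ^ n * (cmod (g (Suc n) x - g n x))\<^sup>2" for n x
  have hi: "integrable M (h n)" and h0: "0 \<le> h n x" for n x
    unfolding h_def using int by simp_all
  have hs: "summable (\<lambda>n. LINT x|M. h n x)"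
  proof (rule summable_comparison_test')
    show "summable (\<lambda>n. C * (1/2) ^ n)" by (intro summable_mult summable_geometric) simp
    fix n
    have "(LINT x|M. h n x) = 2 ^ n * (LINT x|M. (cmod (g (Suc n) x - g n x))\<^sup>2)"
      by (simp add: h_def)
    also have "\<dots> \<le> 2 ^ n * (C * (1/4) ^ n)" using le by (intro mult_left_mono) auto
    also have "\<dots> = C * (1/2) ^ n"
    proof -
      have "(2::real) ^ n * (1/4) ^ n = (1/2) ^ n" by (simp flip: power_mult_distrib)
      then show ?thesis by (metis mult.assoc mult.commute)
    qed
    finally show "norm (LINT x|M. h n x) \<le> C * (1/2) ^ n"
      by (simp add: h_def)
  qed
  have sum: "AE x in M. summable (\<lambda>n. h n x)"
    by (rule AE_summable_of_summable_integrals[OF hi h0 hs])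
  have diff: "cmod (g (Suc n) x - g n x) \<le> (1/2) ^ n + h n x" for n x
  proof -
    let ?d = "cmod (g (Suc n) x - g n x)"
    have "0 \<le> (2 ^ n * ?d - 1)\<^sup>2" by simp
    then have "2 * (2 ^ n * ?d) \<le> 1 + 2 ^ n * (2 ^ n * ?d\<^sup>2)"
      by (simp add: power2_eq_square algebra_simps)
    then have "2 ^ n * (2 * ?d) \<le> 2 ^ n * ((1/2) ^ n + h n x)"
      by (simp add: h_def algebra_simps power_one_over)
    then have "2 * ?d \<le> (1/2) ^ n + h n x" by simp
    then show "?d \<le> (1/2) ^ n + h n x" by (smt (verit) norm_ge_zero)
  qed
  show "AE x in M. convergent (\<lambda>n. g n x)"
    using sum
  proof eventually_elim
    case (elim x)
    have "summable (\<lambda>n. g (Suc n) x - g n x)"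
    proof (rule summable_comparison_test')
      show "summable (\<lambda>n. (1/2) ^ n + h n x)"
        using elim by (intro summable_add summable_geometric) simp_all
    qed (rule diff)
    then have "convergent (\<lambda>n. \<Sum>k<n. g (Suc k) x - g k x)"
      by (simp add: summable_iff_convergent)
    then have "convergent (\<lambda>n. g n x - g 0 x)"
      by (simp add: sum_lessThan_telescope[of "\<lambda>n. g n x"])
    then have "convergent (\<lambda>n. (g n x - g 0 x) + g 0 x)"
      by (intro convergent_add) (auto simp: convergent_const)
    then show ?case by simp
  qed
  show "\<exists>D. integrable M D \<and> (AE x in M. \<forall>n. cmod (g n x) \<le> D x)"
  proof (intro exI conjI)
    have "integrable M (\<lambda>x. \<Sum>n. h n x)"
      by (rule integrable_suminf) (use hi sum hs h0 in \<open>auto simp: abs_of_nonneg\<close>)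
    then show "integrable M (\<lambda>x. cmod (g 0 x) + (2 + (\<Sum>n. h n x)))"
      using g0 by simp
    show "AE x in M. \<forall>n. cmod (g n x) \<le> cmod (g 0 x) + (2 + (\<Sum>n. h n x))"
      using sum
    proof (eventually_elim, intro allI)
      fix x n assume sx: "summable (\<lambda>n. h n x)"
      have "g n x = g 0 x + (\<Sum>k<n. g (Suc k) x - g k x)"
        by (simp add: sum_lessThan_telescope[of "\<lambda>n. g n x"])
      moreover have "cmod (\<Sum>k<n. g (Suc k) x - g k x) \<le> (\<Sum>k<n. (1/2) ^ k + h k x)"
        by (rule sum_norm_le) (rule diff)
      ultimately have "cmod (g n x) \<le> cmod (g 0 x) + (\<Sum>k<n. (1/2) ^ k + h k x)"
        using norm_triangle_ineq[of "g 0 x" "\<Sum>k<n. g (Suc k) x - g k x"] by simp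
      also have "(\<Sum>k<n. (1/2) ^ k + h k x) \<le> (\<Sum>k. (1/2) ^ k + h k x)"
        using sx h0 by (intro sum_le_suminf summable_add summable_geometric) auto
      also have "\<dots> = 2 + (\<Sum>k. h k x)"
        using sx by (subst suminf_add[symmetric]) (auto intro!: summable_geometric simp: suminf_geometric)
      finally show "cmod (g n x) \<le> cmod (g 0 x) + (2 + (\<Sum>k. h k x))" by simp
    qed
  qed
qed

text \<open>Convex weights on the indices from \<open>n\<close> to \<open>N\<close>: averages of the tails of a sequence, which keep its limits.\<close>

definition tail_weights :: "nat \<Rightarrow> nat \<Rightarrow> (nat \<Rightarrow> real) \<Rightarrow> bool" where
  "tail_weights n N c \<longleftrightarrow> (\<forall>k. 0 \<le> c k) \<and> (\<forall>k. k < n \<or> N < k \<longrightarrow> c k = 0) \<and> (\<Sum>k\<le>N. c k) = 1"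

lemma tail_weights_sum_extend:
  assumes "tail_weights n N c" "N \<le> N'"
  shows "(\<Sum>k\<le>N'. c k *\<^sub>R f k) = (\<Sum>k\<le>N. c k *\<^sub>R (f k :: 'b::real_vector))"
  using assms by (intro sum.mono_neutral_right) (auto simp: tail_weights_def)

lemma tail_weights_extend:
  assumes "tail_weights n N c" "N \<le> N'" "n' \<le> n"
  shows "tail_weights n' N' c"
  using assms tail_weights_sum_extend[OF assms(1,2), of "\<lambda>_. 1::real"] by (auto simp: tail_weights_def)

lemma tail_weights_average:
  assumes "tail_weights n N c" "tail_weights n N d"
  shows "tail_weights n N (\<lambda>k. (c k + d k) / 2)"
  using assms by (auto simp: tail_weights_def sum.distrib simp flip: sum_divide_distrib)

lemma tail_weights_tendsto:
  fixes a :: "nat \<Rightarrow> 'b::real_normed_vector"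
  assumes w: "\<And>n. tail_weights n (N n) (c n)" and a: "a \<longlonglongrightarrow> l"
  shows "(\<lambda>n. \<Sum>k\<le>N n. c n k *\<^sub>R a k) \<longlonglongrightarrow> l"
proof (rule LIMSEQ_I)
  fix e :: real assume "e > 0"
  then obtain m where m: "\<And>k. k \<ge> m \<Longrightarrow> norm (a k - l) < e / 2" 
    using LIMSEQ_D[OF a, of "e / 2"] by auto
  show "\<exists>m. \<forall>n\<ge>m. norm ((\<Sum>k\<le>N n. c n k *\<^sub>R a k) - l) < e"
  proof (intro exI[of _ m] allI impI)
    fix n assume n: "n \<ge> m"
    have c: "\<And>k. 0 \<le> c n k" "\<And>k. k < n \<Longrightarrow> c n k = 0" "(\<Sum>k\<le>N n. c n k) = 1"
      using w[of n] by (auto simp: tail_weights_def)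
    have "(\<Sum>k\<le>N n. c n k *\<^sub>R a k) - l = (\<Sum>k\<le>N n. c n k *\<^sub>R (a k - l))"
      using c(3) by (simp add: scaleR_diff_right sum_subtractf flip: scaleR_sum_left)
    also have "norm \<dots> \<le> (\<Sum>k\<le>N n. c n k * (e / 2))"
    proof (rule sum_norm_le)
      fix k
      show "norm (c n k *\<^sub>R (a k - l)) \<le> c n k * (e / 2)"
        using c(2)[of k] mult_left_mono[OF less_imp_le[OF m[of k]] c(1)[of k]] c(1)[of k] n by (cases "k < n") auto
    qed
    also have "\<dots> = e / 2" using c(3) by (simp flip: sum_distrib_right sum_divide_distrib)
    also have "\<dots> < e" using \<open>e > 0\<close> by simp
    finally show "norm ((\<Sum>k\<le>N n. c n k *\<^sub>R a k) - l) < e" .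
  qed
qed

lemma cmod_add_sq_le: "(cmod (a + b))\<^sup>2 \<le> 2 * (cmod a)\<^sup>2 + 2 * (cmod b)\<^sup>2"
proof -
  have "(cmod (a + b))\<^sup>2 \<le> (cmod a + cmod b)\<^sup>2" by (intro power_mono norm_triangle_ineq) auto
  also have "\<dots> \<le> 2 * (cmod a)\<^sup>2 + 2 * (cmod b)\<^sup>2"
    using sum_squares_bound[of "cmod a" "cmod b"] by (simp add: power2_eq_square algebra_simps)
  finally show ?thesis .
qed

lemma integrable_cmod_sq_add:
  fixes f g :: "'a \<Rightarrow> complex"
  assumes [measurable]: "f \<in> borel_measurable M" "g \<in> borel_measurable M"
    and f: "integrable M (\<lambda>x. (cmod (f x))\<^sup>2)" and g: "integrable M (\<lambda>x. (cmod (g x))\<^sup>2)"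
  shows "integrable M (\<lambda>x. (cmod (f x + g x))\<^sup>2)"
proof (rule Bochner_Integration.integrable_bound)
  show "integrable M (\<lambda>x. 2 * (cmod (f x))\<^sup>2 + 2 * (cmod (g x))\<^sup>2)" using f g by simp
  show "AE x in M. norm ((cmod (f x + g x))\<^sup>2) \<le> norm (2 * (cmod (f x))\<^sup>2 + 2 * (cmod (g x))\<^sup>2)"
    using cmod_add_sq_le by (intro AE_I2) simp
qed simp

lemma parallelogram: "(cmod (a + b))\<^sup>2 + (cmod (a - b))\<^sup>2 = 2 * (cmod a)\<^sup>2 + 2 * (cmod b)\<^sup>2"
  unfolding cmod_power2 by (simp add: power2_eq_square algebra_simps)

text \<open>This replaces weak compactness. Let \<open>S\<close> be the limit of the infimum of the squared norm over convex combinations of the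
  \<open>n\<close>-th tail. Two nearly minimal combinations have a midpoint which is again admissible and hence not much shorter, so
  by the parallelogram law they are close to each other. Quantitatively, a quickly minimising sequence has geometrically
  decreasing increments and converges almost everywhere.\<close>

lemma Mazur_AE:
  fixes f :: "nat \<Rightarrow> 'a \<Rightarrow> complex"
  assumes M: "finite_measure M" and f [measurable]: "\<And>n. f n \<in> borel_measurable M"
    and int: "\<And>n. integrable M (\<lambda>x. (cmod (f n x))\<^sup>2)"
    and bd: "\<And>n. (LINT x|M. (cmod (f n x))\<^sup>2) \<le> B"
  obtains c N where "\<And>n. tail_weights n (N n) (c n)"
    and "AE x in M. convergent (\<lambda>n. \<Sum>k\<le>N n. c n k *\<^sub>R f k x)"
    and "\<exists>D. integrable M D \<and> (AE x in M. \<forall>n. cmod (\<Sum>k\<le>N n. c n k *\<^sub>R f k x) \<le> D x)"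
proof -
  interpret finite_measure M by (rule M)
  define comb where "comb N c x = (\<Sum>k\<le>N. c k *\<^sub>R f k x)" for N and c :: "nat \<Rightarrow> real" and x
  define q where "q g = (LINT x|M. (cmod (g x))\<^sup>2)" for g :: "'a \<Rightarrow> complex"
  have comb_m [measurable]: "comb N c \<in> borel_measurable M" for N c
    unfolding comb_def by measurable
  have comb_int: "integrable M (\<lambda>x. (cmod (comb N c x))\<^sup>2)" for N c
  proof (induction N)
    case 0
    then show ?case using int[of 0] by (simp add: comb_def power_mult_distrib)
  next
    case (Suc N)
    have "integrable M (\<lambda>x. (cmod (c (Suc N) *\<^sub>R f (Suc N) x))\<^sup>2)"
      using int[of "Suc N"] by (simp add: power_mult_distrib)
    from integrable_cmod_sq_add[OF _ _ Suc this] show ?case by (simp add: comb_def)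
  qed
  \<comment> \<open>all squared norms of convex combinations of the tail from \<open>n\<close> on\<close>
  define V where "V n = {q (comb N c) | N c. tail_weights n N c}" for n
  have V0: "0 \<le> v" if "v \<in> V n" for v n using that by (auto simp: V_def q_def)
  have tw1: "tail_weights n n (\<lambda>k. if k = n then 1 else 0)" for n
    by (auto simp: tail_weights_def)
  have fV: "q (f n) \<in> V n" for n
  proof -
    have "comb n (\<lambda>k. if k = n then 1 else 0) = f n"
    proof
      fix x
      have "comb n (\<lambda>k. if k = n then 1 else 0) x = (\<Sum>k\<le>n. if k = n then f n x else 0)"
        unfolding comb_def by (intro sum.cong) auto
      then show "comb n (\<lambda>k. if k = n then 1 else 0) x = f n x" by simp
    qed
    then show ?thesis using tw1[of n] unfolding V_def by force
  qed
  have bb: "bdd_below (V n)" for n using V0 by (intro bdd_belowI) auto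
  define I where "I n = Inf (V n)" for n
  have I_le: "I n \<le> v" if "v \<in> V n" for v n unfolding I_def by (rule cInf_lower[OF that bb])
  have I_B: "I n \<le> B" for n using I_le[OF fV, of n] bd[of n] by (simp add: q_def)
  have I_mono: "I n \<le> I m" if "n \<le> m" for n m
    unfolding I_def
  proof (rule cInf_superset_mono)
    show "V m \<subseteq> V n" unfolding V_def using tail_weights_extend[OF _ order_refl that] by auto
  qed (use fV bb in auto)
  define S where "S = (SUP n. I n)"
  have bS: "bdd_above (range I)" using I_B by (intro bdd_aboveI) auto
  have IS: "I n \<le> S" for n unfolding S_def by (rule cSUP_upper) (use bS in auto)
  have "\<exists>m N c. n \<le> m \<and> S - (1/4) ^ n < I m \<and> tail_weights m N c \<and> q (comb N c) < I m + (1/4) ^ n" for n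
  proof -
    have "S - (1/4) ^ n < S" by simp
    then obtain m0 where m0: "S - (1/4) ^ n < I m0" unfolding S_def using less_cSUP_iff[of UNIV I] bS by auto
    define m where "m = max n m0"
    have *: "I m0 \<le> I m" by (rule I_mono) (simp add: m_def)
    obtain v where "v \<in> V m" "v < I m + (1/4) ^ n"
      using cInf_lessD[of "V m" "I m + (1/4) ^ n"] fV[of m] unfolding I_def by auto
    moreover note *
    moreover from \<open>v \<in> V m\<close> obtain N c where "v = q (comb N c)" "tail_weights m N c" by (auto simp: V_def)
    moreover have "n \<le> m" by (simp add: m_def)
    ultimately show ?thesis using m0 by (meson order.strict_trans2)
  qed
  then obtain m N c where mNc: "\<And>n. n \<le> m n" "\<And>n. S - (1/4) ^ n < I (m n)"
    "\<And>n. tail_weights (m n) (N n) (c n)" "\<And>n. q (comb (N n) (c n)) < I (m n) + (1/4) ^ n"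
    by metis
  define g where "g n = comb (N n) (c n)" for n
  have inc: "q (\<lambda>x. g (Suc n) x - g n x) \<le> 8 * (1/4) ^ n" and
    inc_int: "integrable M (\<lambda>x. (cmod (g (Suc n) x - g n x))\<^sup>2)" for n
  proof -
    \<comment> \<open>both combinations belong to the tail from the smaller index, so their midpoint competes in \<open>V p\<close>\<close>
    define p where "p = min (m n) (m (Suc n))"
    define L where "L = max (N n) (N (Suc n))"
    have w1: "tail_weights p L (c n)" and w2: "tail_weights p L (c (Suc n))"
      using mNc(3)[of n] mNc(3)[of "Suc n"] by (auto simp: p_def L_def intro: tail_weights_extend)
    have e1: "comb L (c n) = g n" and e2: "comb L (c (Suc n)) = g (Suc n)"
      using mNc(3)[of n] mNc(3)[of "Suc n"] unfolding g_def comb_def L_def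
      by (auto simp: fun_eq_iff intro!: tail_weights_sum_extend)
    have avg: "comb L (\<lambda>k. (c n k + c (Suc n) k) / 2) = (\<lambda>x. (g n x + g (Suc n) x) / 2)"
      unfolding e1[symmetric] e2[symmetric] comb_def
      by (auto simp: fun_eq_iff sum_divide_distrib sum.distrib[symmetric] scaleR_conv_of_real field_simps intro!: sum.cong)
    have "q (\<lambda>x. (g n x + g (Suc n) x) / 2) \<in> V p"
      unfolding V_def avg[symmetric] using tail_weights_average[OF w1 w2] by blast
    then have "I p \<le> q (\<lambda>x. (g n x + g (Suc n) x) / 2)" by (rule I_le)
    also have "\<dots> = q (\<lambda>x. g n x + g (Suc n) x) / 4"
      by (simp add: q_def norm_divide power_divide)
    finally have A: "I p \<le> q (\<lambda>x. g n x + g (Suc n) x) / 4" .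
    have gi: "integrable M (\<lambda>x. (cmod (g k x))\<^sup>2)" for k unfolding g_def by (rule comb_int)
    have gm [measurable]: "g k \<in> borel_measurable M" for k unfolding g_def by (rule comb_m)
    have i1: "integrable M (\<lambda>x. (cmod (g n x + g (Suc n) x))\<^sup>2)"
      by (intro integrable_cmod_sq_add gi gm)
    have i2: "integrable M (\<lambda>x. (cmod (g (Suc n) x - g n x))\<^sup>2)"
      using integrable_cmod_sq_add[of "g (Suc n)" M "\<lambda>x. - g n x"] gi gm by simp
    show "integrable M (\<lambda>x. (cmod (g (Suc n) x - g n x))\<^sup>2)" by (rule i2)
    have "q (\<lambda>x. g n x + g (Suc n) x) + q (\<lambda>x. g (Suc n) x - g n x) = 2 * q (g n) + 2 * q (g (Suc n))"
    proof -
      have "q (\<lambda>x. g n x + g (Suc n) x) + q (\<lambda>x. g (Suc n) x - g n x)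
         = (LINT x|M. (cmod (g (Suc n) x + g n x))\<^sup>2 + (cmod (g (Suc n) x - g n x))\<^sup>2)"
        unfolding q_def using i1 i2 by (simp add: add.commute)
      also have "\<dots> = (LINT x|M. 2 * (cmod (g n x))\<^sup>2 + 2 * (cmod (g (Suc n) x))\<^sup>2)"
        unfolding parallelogram by (simp add: add.commute)
      also have "\<dots> = 2 * q (g n) + 2 * q (g (Suc n))"
        unfolding q_def using gi by simp
      finally show ?thesis .
    qed
    moreover have "q (g n) \<le> S + (1/4) ^ n" using mNc(4)[of n] IS[of "m n"] by (simp add: g_def)
    moreover have "q (g (Suc n)) \<le> S + (1/4) ^ n"
    proof -
      have "(1/4::real) ^ Suc n \<le> (1/4) ^ n" by (rule power_decreasing) auto
      then show ?thesis using mNc(4)[of "Suc n"] IS[of "m (Suc n)"] unfolding g_def by linarith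
    qed
    moreover have "S - (1/4) ^ n \<le> I p"
    proof -
      have "(1/4::real) ^ Suc n \<le> (1/4) ^ n" by (rule power_decreasing) auto
      then have "S - (1/4) ^ n \<le> I (m n)" "S - (1/4) ^ n \<le> I (m (Suc n))" using mNc(2)[of n] mNc(2)[of "Suc n"] by linarith+
      then show ?thesis unfolding p_def min_def by simp
    qed
    ultimately show "q (\<lambda>x. g (Suc n) x - g n x) \<le> 8 * (1/4) ^ n" using A by simp
  qed
  have "integrable M (g 0)"
  proof (rule Bochner_Integration.integrable_bound)
    show "integrable M (\<lambda>x. 1 + (cmod (g 0 x))\<^sup>2)" unfolding g_def using comb_int by simp
    show "g 0 \<in> borel_measurable M" unfolding g_def by measurable
    have "t \<le> 1 + t\<^sup>2" for t :: real
      using sum_squares_bound[of t 1] by (simp add: power2_eq_square) (smt (verit) zero_le_square)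
    then show "AE x in M. norm (g 0 x) \<le> norm (1 + (cmod (g 0 x))\<^sup>2)"
      by (intro AE_I2) simp
  qed
  note conv = AE_convergent_of_L2_increments[OF M this inc_int, where C = 8]
  have "AE x in M. convergent (\<lambda>n. g n x)"
    by (rule conv(1)) (use inc in \<open>auto simp: q_def\<close>)
  moreover have "\<exists>D. integrable M D \<and> (AE x in M. \<forall>n. cmod (g n x) \<le> D x)"
    by (rule conv(2)) (use inc in \<open>auto simp: q_def\<close>)
  moreover have "tail_weights n (N n) (c n)" for n
    using tail_weights_extend[OF mNc(3) order_refl mNc(1)] .
  ultimately show ?thesis by (intro that[of N c]) (auto simp: g_def comb_def)
qed

section \<open>Boundary values of bounded analytic functions\<close>

text \<open>Boundary values of bounded analytic functions are characterised by their vanishing positive moments, that is, vanishing Fourier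
  coefficients of negative index. Unlike the existence of an analytic extension, this condition is visibly linear
  and stable under bounded almost everywhere limits.\<close>

definition hardy :: "(complex \<Rightarrow> complex) \<Rightarrow> bool" where
  "hardy \<phi> \<longleftrightarrow> \<phi> \<in> borel_measurable circle \<and> (\<exists>B. AE \<xi> in circle. cmod (\<phi> \<xi>) \<le> B) \<and>
     (\<forall>n>0. (LINT \<xi>|circle. \<phi> \<xi> * \<xi> ^ n) = 0)"

lemma borel_measurable_circle_power: "(\<lambda>\<xi>. \<xi> ^ n) \<in> borel_measurable circle"
  using borel_measurable_circle_ident by (rule borel_measurable_power)

lemma sums_integral_power_series_circle:
  assumes a: "summable (\<lambda>k. cmod (a k))" and g [measurable]: "g \<in> borel_measurable circle"
    and B: "\<And>\<xi>. cmod \<xi> = 1 \<Longrightarrow> cmod (g \<xi>) \<le> B"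
  shows "(\<lambda>k. a k * (LINT \<xi>|circle. \<xi> ^ k * g \<xi>)) sums (LINT \<xi>|circle. (\<Sum>k. a k * \<xi> ^ k) * g \<xi>)"
proof -
  note [measurable] = borel_measurable_circle_power
  have b: "cmod (\<xi> ^ k * g \<xi>) \<le> B" if "cmod \<xi> = 1" for \<xi> k
    using B[OF that] that by (simp add: norm_mult norm_power)
  have i: "integrable circle (\<lambda>\<xi>. \<xi> ^ k * g \<xi>)" for k
    using b norm_circle by (intro circle.integrable_const_bound[where B = B] AE_I2) auto
  have b2: "cmod (a k * (\<xi> ^ k * g \<xi>)) \<le> cmod (a k) * B" if "cmod \<xi> = 1" for \<xi> k
    using b[OF that] unfolding norm_mult[of "a k"] by (rule mult_left_mono) simp
  have "(\<lambda>k. LINT \<xi>|circle. a k * (\<xi> ^ k * g \<xi>)) sums (LINT \<xi>|circle. (\<Sum>k. a k * (\<xi> ^ k * g \<xi>)))"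
  proof (rule sums_integral)
    show "integrable circle (\<lambda>\<xi>. a k * (\<xi> ^ k * g \<xi>))" for k using i by simp
    show "AE \<xi> in circle. summable (\<lambda>k. norm (a k * (\<xi> ^ k * g \<xi>)))"
    proof (rule AE_I2)
      fix \<xi> assume "\<xi> \<in> space circle"
      then show "summable (\<lambda>k. norm (a k * (\<xi> ^ k * g \<xi>)))"
        using b2[of \<xi>] norm_circle[of \<xi>]
        by (intro summable_comparison_test'[OF summable_mult2[OF a, of B], of 0]) (simp del: norm_mult norm_power)
    qed
    show "summable (\<lambda>k. LINT \<xi>|circle. norm (a k * (\<xi> ^ k * g \<xi>)))"
    proof (rule summable_comparison_test')
      show "summable (\<lambda>k. cmod (a k) * (B * (2 * pi)))" by (rule summable_mult2[OF a])
      fix k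
      have "(LINT \<xi>|circle. norm (a k * (\<xi> ^ k * g \<xi>))) \<le> (LINT \<xi>|circle. cmod (a k) * B)"
        using i b2 norm_circle by (intro integral_mono integrable_norm integrable_mult_right) auto
      then show "norm (LINT \<xi>|circle. norm (a k * (\<xi> ^ k * g \<xi>))) \<le> cmod (a k) * (B * (2 * pi))"
        by (simp add: measure_circle_space mult_ac)
    qed
  qed
  moreover have "(LINT \<xi>|circle. a k * (\<xi> ^ k * g \<xi>)) = a k * (LINT \<xi>|circle. \<xi> ^ k * g \<xi>)" for k
    by (rule integral_mult_right_zero)
  moreover have "(LINT \<xi>|circle. (\<Sum>k. a k * (\<xi> ^ k * g \<xi>))) = (LINT \<xi>|circle. (\<Sum>k. a k * \<xi> ^ k) * g \<xi>)"
  proof (rule Bochner_Integration.integral_cong[OF refl])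
    fix \<xi> assume "\<xi> \<in> space circle"
    then have x: "cmod \<xi> = 1" by (rule norm_circle)
    have "summable (\<lambda>k. a k * \<xi> ^ k)"
      by (rule summable_norm_cancel) (use a x in \<open>simp add: norm_mult norm_power\<close>)
    from suminf_mult2[OF this, of "g \<xi>"]
    show "(\<Sum>k. a k * (\<xi> ^ k * g \<xi>)) = (\<Sum>k. a k * \<xi> ^ k) * g \<xi>"
      by (simp add: mult.assoc)
  qed
  ultimately show ?thesis by (simp only:)
qed

lemma integral_power_series_circle:
  assumes a: "summable (\<lambda>k. cmod (a k))" and n: "n > 0"
  shows "(LINT \<xi>|circle. (\<Sum>k. a k * \<xi> ^ k) * \<xi> ^ n) = 0"
proof -
  have "(\<lambda>k. a k * (LINT \<xi>|circle. \<xi> ^ k * \<xi> ^ n)) sums (LINT \<xi>|circle. (\<Sum>k. a k * \<xi> ^ k) * \<xi> ^ n)"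
    by (rule sums_integral_power_series_circle[OF a borel_measurable_circle_power, where B = 1])
      (simp add: norm_power)
  moreover have "(LINT \<xi>|circle. \<xi> ^ k * \<xi> ^ n) = 0" for k
    using integral_circle_power[of "k + n"] n by (simp add: power_add)
  ultimately show ?thesis using sums_unique2[OF _ sums_zero] by simp
qed

lemma integral_holomorphic_circle:
  assumes F: "F holomorphic_on ball 0 1" and r: "0 \<le> r" "r < 1" and n: "n > 0"
  shows "(LINT \<xi>|circle. F (of_real r * \<xi>) * \<xi> ^ n) = 0"
proof -
  define a where "a k = (deriv ^^ k) F 0 / fact k" for k
  have a: "(\<lambda>k. a k * w ^ k) sums F w" if "cmod w < 1" for w
    using holomorphic_power_series[OF F, of w] that by (simp add: a_def)
  obtain s where s: "r < s" "s < 1" using dense r by blast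
  have "summable (\<lambda>k. a k * of_real s ^ k)"
    using a[of "of_real s"] s r by (auto simp: sums_iff)
  then have sm: "summable (\<lambda>k. cmod (a k * of_real r ^ k))"
    by (rule powser_insidea) (use r s in simp)
  have "(LINT \<xi>|circle. F (of_real r * \<xi>) * \<xi> ^ n)
     = (LINT \<xi>|circle. (\<Sum>k. a k * of_real r ^ k * \<xi> ^ k) * \<xi> ^ n)"
  proof (rule Bochner_Integration.integral_cong[OF refl])
    fix \<xi> assume "\<xi> \<in> space circle"
    then have "cmod (of_real r * \<xi>) < 1" using norm_circle r by (simp add: norm_mult)
    from a[OF this] show "F (of_real r * \<xi>) * \<xi> ^ n = (\<Sum>k. a k * of_real r ^ k * \<xi> ^ k) * \<xi> ^ n"
      by (simp add: sums_iff power_mult_distrib mult.assoc)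
  qed
  also have "\<dots> = 0" by (rule integral_power_series_circle[OF sm n])
  finally show ?thesis .
qed

definition radius :: "nat \<Rightarrow> real" where
  "radius n = 1 - 1 / (real n + 2)"

lemma radius: "0 < radius n" "0 \<le> radius n" "radius n < 1"
  by (auto simp: radius_def divide_simps)

lemma radius_at_left: "filterlim radius (at_left 1) sequentially"
proof -
  have "(\<lambda>n. 1 - 1 / real (n + 2)) \<longlonglongrightarrow> 1 - 0"
    by (intro tendsto_diff tendsto_const LIMSEQ_ignore_initial_segment[OF lim_1_over_n])
  then have "radius \<longlonglongrightarrow> 1" by (simp add: radius_def[abs_def] add.commute)
  then show ?thesis
    using radius(3) by (auto simp: filterlim_at intro!: always_eventually less_imp_neq)
qed

lemma radial_measurable:
  assumes "continuous_on (ball 0 1) F" "0 \<le> r" "r < 1"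
  shows "(\<lambda>\<xi>. F (of_real r * \<xi>) :: complex) \<in> borel_measurable circle"
proof -
  have "continuous_on (sphere 0 1) (\<lambda>\<xi>. F (of_real r * \<xi>))"
    using assms by (intro continuous_on_compose2[OF assms(1)] continuous_intros) (auto simp: norm_mult)
  then have "(\<lambda>\<xi>. F (of_real r * \<xi>)) \<in> borel_measurable (restrict_space borel (sphere 0 1))"
    by (rule borel_measurable_continuous_on_restrict)
  then show ?thesis by (simp cong: measurable_cong_sets add: sets_circle)
qed

text \<open>The moments vanish on every smaller circle, and dominated convergence carries this to the boundary.\<close>

lemma hardy_of_boundary_value:
  assumes "bounded_analytic_boundary_value \<phi>" and m [measurable]: "\<phi> \<in> borel_measurable circle"
  shows "hardy \<phi>"
proof -
  obtain F where F: "F holomorphic_on ball 0 1" "bounded (F ` ball 0 1)"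
    "AE z in circle. ((\<lambda>r. F (complex_of_real r * z)) \<longlongrightarrow> \<phi> z) (at_left 1)"
    using assms unfolding bounded_analytic_boundary_value_def by blast
  obtain B where B: "\<And>z. cmod z < 1 \<Longrightarrow> cmod (F z) \<le> B"
  proof -
    obtain B where "\<forall>x\<in>F ` ball 0 1. norm x \<le> B" using F(2) unfolding bounded_iff by blast
    then show ?thesis by (intro that[of B]) auto
  qed
  have lim: "AE z in circle. (\<lambda>n. F (of_real (radius n) * z)) \<longlonglongrightarrow> \<phi> z"
    using F(3) by eventually_elim (rule filterlim_compose[OF _ radius_at_left])
  have FB: "cmod (F (of_real (radius n) * z)) \<le> B" if "cmod z = 1" for n z
    using radius[of n] that by (intro B) (simp add: norm_mult)
  have "AE z in circle. cmod (\<phi> z) \<le> B"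
    using lim AE_space
  proof eventually_elim
    case (elim z)
    then show ?case using FB norm_circle
      by (intro LIMSEQ_le_const2[OF tendsto_norm[OF elim(1)]]) blast
  qed
  moreover have "(LINT \<xi>|circle. \<phi> \<xi> * \<xi> ^ n) = 0" if n: "n > 0" for n
  proof -
    note [measurable] = radial_measurable[OF holomorphic_on_imp_continuous_on[OF F(1)] radius(2,3)]
       borel_measurable_circle_power
    have "(\<lambda>k. LINT \<xi>|circle. F (of_real (radius k) * \<xi>) * \<xi> ^ n) \<longlonglongrightarrow> (LINT \<xi>|circle. \<phi> \<xi> * \<xi> ^ n)"
    proof (rule integral_dominated_convergence[where w = "\<lambda>_. B"])
      show "AE x in circle. (\<lambda>i. F (of_real (radius i) * x) * x ^ n) \<longlonglongrightarrow> \<phi> x * x ^ n"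
        using lim by eventually_elim (intro tendsto_intros)
      show "AE x in circle. norm (F (of_real (radius k) * x) * x ^ n) \<le> B" for k
        using FB by (intro AE_I2) (auto dest!: norm_circle simp: norm_mult norm_power)
    qed auto
    moreover have "(LINT \<xi>|circle. F (of_real (radius k) * \<xi>) * \<xi> ^ n) = 0" for k
      by (rule integral_holomorphic_circle[OF F(1) radius(2,3) n])
    ultimately show ?thesis by (simp add: LIMSEQ_const_iff)
  qed
  ultimately show ?thesis using m by (auto simp: hardy_def)
qed

lemma poisson_int_herglotz:
  assumes f: "integrable circle f" and z: "cmod z < 1"
  shows "poisson_int f z = (herglotz f z + cnj (herglotz (\<lambda>\<xi>. cnj (f \<xi>)) z)) / 2"
proof -
  let ?k = "\<lambda>\<xi>. (\<xi> + z) / (\<xi> - z)"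
  have f': "integrable circle (\<lambda>\<xi>. cnj (f \<xi>))" using f by simp
  have 1: "integrable circle (\<lambda>\<xi>. f \<xi> * ?k \<xi>)" by (rule integrable_herglotz[OF f z])
  have 2: "integrable circle (\<lambda>\<xi>. cnj (cnj (f \<xi>) * ?k \<xi>))"
    by (rule integrable_cnj[OF integrable_herglotz[OF f' z]])
  have "(LINT \<xi>|circle. poisson z \<xi> *\<^sub>R f \<xi>) = (LINT \<xi>|circle. (f \<xi> * ?k \<xi> + cnj (cnj (f \<xi>) * ?k \<xi>)) / 2)"
  proof (rule Bochner_Integration.integral_cong[OF refl])
    fix \<xi> assume "\<xi> \<in> space circle"
    then have P: "poisson z \<xi> = Re (?k \<xi>)" by (intro poisson_eq_Re norm_circle)
    have "f \<xi> * ?k \<xi> + cnj (cnj (f \<xi>) * ?k \<xi>) = f \<xi> * (?k \<xi> + cnj (?k \<xi>))"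
      unfolding complex_cnj_mult complex_cnj_cnj by (simp only: distrib_left)
    also have "\<dots> = f \<xi> * (2 * of_real (Re (?k \<xi>)))" by (simp only: complex_add_cnj of_real_mult of_real_numeral)
    finally have fin: "f \<xi> * ?k \<xi> + cnj (cnj (f \<xi>) * ?k \<xi>) = f \<xi> * (2 * of_real (Re (?k \<xi>)))" .
    show "poisson z \<xi> *\<^sub>R f \<xi> = (f \<xi> * ?k \<xi> + cnj (cnj (f \<xi>) * ?k \<xi>)) / 2"
      unfolding P scaleR_conv_of_real fin by simp
  qed
  also have "\<dots> = ((LINT \<xi>|circle. f \<xi> * ?k \<xi>) + (LINT \<xi>|circle. cnj (cnj (f \<xi>) * ?k \<xi>))) / 2"
    by (subst integral_divide_zero) (simp only: Bochner_Integration.integral_add[OF 1 2])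
  also have "(LINT \<xi>|circle. cnj (cnj (f \<xi>) * ?k \<xi>)) = cnj (LINT \<xi>|circle. cnj (f \<xi>) * ?k \<xi>)"
    by (rule Bochner_Integration.integral_cnj)
  finally show ?thesis
    by (simp add: poisson_int_def herglotz_def scaleR_conv_of_real add_divide_distrib)
qed

lemma hardy_integrable: "hardy \<phi> \<Longrightarrow> integrable circle \<phi>"
  unfolding hardy_def by (auto intro: circle.integrable_const_bound)

text \<open>Splitting the Poisson kernel into its analytic and its conjugate analytic half, the second half contributes only a constant because the
  moments vanish. Hence the Poisson integral itself is analytic; it is bounded, and it has the right radial limits by
  Fatou's theorem.\<close>

lemma boundary_value_of_hardy:
  assumes \<phi>: "hardy \<phi>"
  shows "bounded_analytic_boundary_value \<phi>"
proof -
  note int = hardy_integrable[OF \<phi>]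
  obtain B where B: "AE \<xi> in circle. cmod (\<phi> \<xi>) \<le> B" using \<phi> by (auto simp: hardy_def)
  define c where "c = cnj (LINT \<xi>|circle. cnj (\<phi> \<xi>)) / (2 * pi)"
  have eq: "poisson_int \<phi> z = (herglotz \<phi> z + c) / 2" if z: "cmod z < 1" for z
  proof -
    have "(\<lambda>n. ((if n = 0 then 1 else 2) * (LINT \<xi>|circle. cnj (\<phi> \<xi>) * inverse \<xi> ^ n) / (2 * pi)) * z ^ n) sums herglotz (\<lambda>\<xi>. cnj (\<phi> \<xi>)) z"
      using int by (intro herglotz_sums z) simp
    moreover have "(LINT \<xi>|circle. cnj (\<phi> \<xi>) * inverse \<xi> ^ n) = 0" if "n > 0" for n
    proof -
      have "(LINT \<xi>|circle. cnj (\<phi> \<xi>) * inverse \<xi> ^ n) = (LINT \<xi>|circle. cnj (\<phi> \<xi> * \<xi> ^ n))"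
      proof (rule Bochner_Integration.integral_cong[OF refl])
        fix \<xi> assume "\<xi> \<in> space circle"
        then have "\<xi> * cnj \<xi> = 1" using norm_circle[of \<xi>] complex_norm_square[of \<xi>] by simp
        then have "inverse \<xi> = cnj \<xi>" by (rule inverse_unique)
        then show "cnj (\<phi> \<xi>) * inverse \<xi> ^ n = cnj (\<phi> \<xi> * \<xi> ^ n)" by simp
      qed
      also have "\<dots> = cnj (LINT \<xi>|circle. \<phi> \<xi> * \<xi> ^ n)" by (rule Bochner_Integration.integral_cnj)
      also have "\<dots> = 0" using \<phi> that by (simp add: hardy_def)
      finally show ?thesis .
    qed
    then have "(\<lambda>n. ((if n = 0 then 1 else 2) * (LINT \<xi>|circle. cnj (\<phi> \<xi>) * inverse \<xi> ^ n) / (2 * pi)) * z ^ n)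
        = (\<lambda>n. if n = 0 then cnj c else 0)"
      by (auto simp: fun_eq_iff c_def)
    ultimately have "herglotz (\<lambda>\<xi>. cnj (\<phi> \<xi>)) z = cnj c"
      using sums_single[of 0 "\<lambda>_. cnj c"] by (auto intro: sums_unique2)
    then show ?thesis using poisson_int_herglotz[OF int z] by simp
  qed
  show ?thesis unfolding bounded_analytic_boundary_value_def
  proof (intro exI conjI)
    show "(\<lambda>z. (herglotz \<phi> z + c) / 2) holomorphic_on ball 0 1"
      by (intro holomorphic_intros herglotz_holomorphic int) simp
    show "bounded ((\<lambda>z. (herglotz \<phi> z + c) / 2) ` ball 0 1)"
    proof (rule boundedI)
      fix w assume "w \<in> (\<lambda>z. (herglotz \<phi> z + c) / 2) ` ball 0 1"
      then obtain z where z: "cmod z < 1" "w = poisson_int \<phi> z" using eq by auto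
      have "cmod w \<le> poisson_int (\<lambda>\<xi>. cmod (\<phi> \<xi>)) z" using norm_poisson_int_le[OF int z(1)] z by simp
      also have "\<dots> \<le> poisson_int (\<lambda>\<xi>. B) z"
        unfolding poisson_int_def
      proof (intro scaleR_left_mono integral_mono_AE)
        show "integrable circle (\<lambda>\<xi>. poisson z \<xi> *\<^sub>R cmod (\<phi> \<xi>))" by (intro integrable_poisson integrable_norm int z)
        show "integrable circle (\<lambda>\<xi>. poisson z \<xi> *\<^sub>R B)" by (intro integrable_poisson z) simp
        show "AE \<xi> in circle. poisson z \<xi> *\<^sub>R cmod (\<phi> \<xi>) \<le> poisson z \<xi> *\<^sub>R B"
          using B AE_space
        proof eventually_elim
          case (elim \<xi>)
          then show ?case using poisson_pos[OF z(1) norm_circle, of \<xi>] by simp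
        qed
      qed simp
      also have "\<dots> = B" by (rule poisson_int_const[OF z(1)])
      finally show "cmod w \<le> B" .
    qed
    show "AE z in circle. ((\<lambda>r. (herglotz \<phi> (of_real r * z) + c) / 2) \<longlongrightarrow> \<phi> z) (at_left 1)"
      using Fatou_poisson_int[OF int] AE_space
    proof eventually_elim
      case (elim z)
      have ev: "eventually (\<lambda>r. r \<in> {0<..<1}) (at_left (1::real))" by (rule eventually_at_left_real) simp
      show ?case
      proof (rule Lim_transform_eventually[OF elim(1)])
        show "\<forall>\<^sub>F r in at_left 1. poisson_int \<phi> (of_real r * z) = (herglotz \<phi> (of_real r * z) + c) / 2"
          using ev by eventually_elim (use norm_circle[OF elim(2)] in \<open>simp add: eq norm_mult\<close>)
      qed
    qed
  qed
qed

lemma hardy_limit: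
  assumes h: "\<And>n. hardy (\<phi> n)" and B: "\<And>n. AE \<xi> in circle. cmod (\<phi> n \<xi>) \<le> B"
    and lim: "AE \<xi> in circle. (\<lambda>n. \<phi> n \<xi>) \<longlonglongrightarrow> \<psi> \<xi>" and m [measurable]: "\<psi> \<in> borel_measurable circle"
  shows "hardy \<psi>"
proof -
  have [measurable]: "\<phi> n \<in> borel_measurable circle" for n using h by (simp add: hardy_def)
  note [measurable] = borel_measurable_circle_power
  have "AE \<xi> in circle. \<forall>n. cmod (\<phi> n \<xi>) \<le> B" using B by (simp add: AE_all_countable)
  then have "AE \<xi> in circle. cmod (\<psi> \<xi>) \<le> B"
    using lim by eventually_elim (auto intro: LIMSEQ_le_const2[OF tendsto_norm])
  moreover have "(LINT \<xi>|circle. \<psi> \<xi> * \<xi> ^ n) = 0" if n: "n > 0" for n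
  proof -
    have "(\<lambda>k. LINT \<xi>|circle. \<phi> k \<xi> * \<xi> ^ n) \<longlonglongrightarrow> (LINT \<xi>|circle. \<psi> \<xi> * \<xi> ^ n)"
    proof (rule integral_dominated_convergence[where w = "\<lambda>_. B"])
      show "AE x in circle. (\<lambda>i. \<phi> i x * x ^ n) \<longlonglongrightarrow> \<psi> x * x ^ n"
        using lim by eventually_elim (intro tendsto_intros)
      show "AE x in circle. norm (\<phi> k x * x ^ n) \<le> B" for k
        using B[of k] AE_space by eventually_elim (auto dest!: norm_circle simp: norm_mult norm_power)
    qed auto
    then show ?thesis using h n by (simp add: hardy_def LIMSEQ_const_iff)
  qed
  ultimately show ?thesis using m by (auto simp: hardy_def)
qed

lemma hardy_sum:
  assumes "\<And>k. k \<in> K \<Longrightarrow> hardy (\<phi> k)" "finite K"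
  shows "hardy (\<lambda>\<xi>. \<Sum>k\<in>K. c k *\<^sub>R \<phi> k \<xi>)"
  using assms(2,1)
proof (induction K)
  case empty
  then show ?case by (auto simp: hardy_def)
next
  case (insert k K)
  have int: "integrable circle (\<lambda>\<xi>. \<psi> \<xi> * \<xi> ^ n)" if "hardy \<psi>" for \<psi> n
    by (rule integrable_bounded_mult[OF hardy_integrable[OF that] borel_measurable_circle_power, where B = 1]) (simp add: norm_power)
  have h: "hardy (\<phi> k)" "hardy (\<lambda>\<xi>. \<Sum>k\<in>K. c k *\<^sub>R \<phi> k \<xi>)" using insert by auto
  obtain B C where "AE \<xi> in circle. cmod (\<phi> k \<xi>) \<le> B" "AE \<xi> in circle. cmod (\<Sum>k\<in>K. c k *\<^sub>R \<phi> k \<xi>) \<le> C"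
    using h unfolding hardy_def by blast
  then have "AE \<xi> in circle. cmod (c k *\<^sub>R \<phi> k \<xi> + (\<Sum>k\<in>K. c k *\<^sub>R \<phi> k \<xi>)) \<le> \<bar>c k\<bar> * B + C"
    by eventually_elim (auto intro!: order.trans[OF norm_triangle_ineq] add_mono mult_left_mono)
  moreover have "(LINT \<xi>|circle. (c k *\<^sub>R \<phi> k \<xi> + (\<Sum>k\<in>K. c k *\<^sub>R \<phi> k \<xi>)) * \<xi> ^ n) = 0" if "n > 0" for n
    using int[OF h(1), of n] int[OF h(2), of n] h that by (simp add: distrib_right hardy_def)
  moreover have "(\<lambda>\<xi>. c k *\<^sub>R \<phi> k \<xi> + (\<Sum>k\<in>K. c k *\<^sub>R \<phi> k \<xi>)) \<in> borel_measurable circle"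
    using h unfolding hardy_def by (intro borel_measurable_add borel_measurable_scaleR) auto
  ultimately show ?case unfolding sum.insert[OF insert(1,2)] hardy_def by blast
qed

section \<open>Means of subharmonic functions in logarithmic coordinates\<close>

text \<open>Logarithmic polar coordinates \<open>z = exp (s + i t)\<close>, in which the Laplacian is \<open>d\<^sup>2/ds\<^sup>2 + d\<^sup>2/dt\<^sup>2\<close> up to a positive factor.\<close>

definition lpol :: "real \<Rightarrow> real \<Rightarrow> complex" where
  "lpol s t = exp (of_real s + \<i> * of_real t)"

lemma lpol_eq: "lpol s t = of_real (exp s) * cis t"
  by (simp add: lpol_def exp_add cis_conv_exp exp_of_real)

lemma norm_lpol: "cmod (lpol s t) = exp s"
  by (simp add: lpol_eq norm_mult)

lemma lpol_ball: "s < 0 \<Longrightarrow> lpol s t \<in> ball 0 1"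
  by (simp add: norm_lpol)

lemma lpol_derivs:
  "((\<lambda>s. lpol s t) has_vector_derivative lpol s t) (at s)"
  "((\<lambda>t. lpol s t) has_vector_derivative \<i> * lpol s t) (at t)"
proof -
  have "((\<lambda>s. of_real s + \<i> * of_real t) has_vector_derivative (1::complex)) (at s)"
    by (auto intro!: derivative_eq_intros simp: has_vector_derivative_def scaleR_conv_of_real)
  from field_vector_diff_chain_at[OF this DERIV_exp]
  show "((\<lambda>s. lpol s t) has_vector_derivative lpol s t) (at s)" by (simp add: lpol_def[abs_def] o_def)
  have "((\<lambda>t. of_real s + \<i> * of_real t) has_vector_derivative \<i>) (at t)"
    by (auto intro!: derivative_eq_intros simp: has_vector_derivative_def scaleR_conv_of_real)
  from field_vector_diff_chain_at[OF this DERIV_exp]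
  show "((\<lambda>t. lpol s t) has_vector_derivative \<i> * lpol s t) (at t)" by (simp add: lpol_def[abs_def] o_def)
qed

text \<open>The function \<open>F\<close> in logarithmic coordinates and its first two derivatives in the complex variable \<open>s + i t\<close>.\<close>

definition log0 :: "(complex \<Rightarrow> complex) \<Rightarrow> real \<Rightarrow> real \<Rightarrow> complex" where
  "log0 F s t = F (lpol s t)"
definition log1 :: "(complex \<Rightarrow> complex) \<Rightarrow> real \<Rightarrow> real \<Rightarrow> complex" where
  "log1 F s t = lpol s t * deriv F (lpol s t)"
definition log2 :: "(complex \<Rightarrow> complex) \<Rightarrow> real \<Rightarrow> real \<Rightarrow> complex" where
  "log2 F s t = lpol s t * (deriv F (lpol s t) + lpol s t * deriv (deriv F) (lpol s t))"

lemma log_derivs: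
  assumes F: "F holomorphic_on ball 0 1" and s: "s < 0"
  shows "((\<lambda>s. log0 F s t) has_vector_derivative log1 F s t) (at s)"
    and "((\<lambda>t. log0 F s t) has_vector_derivative \<i> * log1 F s t) (at t)"
    and "((\<lambda>s. log1 F s t) has_vector_derivative log2 F s t) (at s)"
    and "((\<lambda>t. log1 F s t) has_vector_derivative \<i> * log2 F s t) (at t)"
proof -
  note b = lpol_ball[OF s, of t]
  have d0: "(F has_field_derivative deriv F (lpol s t)) (at (lpol s t))"
    by (rule holomorphic_derivI[OF F _ b]) simp
  have "deriv F holomorphic_on ball 0 1" by (rule holomorphic_deriv[OF F]) simp
  then have d1: "(deriv F has_field_derivative deriv (deriv F) (lpol s t)) (at (lpol s t))"
    by (rule holomorphic_derivI[OF _ _ b]) simp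
  have d2: "((\<lambda>z. z * deriv F z) has_field_derivative deriv F (lpol s t) + lpol s t * deriv (deriv F) (lpol s t)) (at (lpol s t))"
    by (auto intro!: derivative_eq_intros d1)
  show "((\<lambda>s. log0 F s t) has_vector_derivative log1 F s t) (at s)"
    using field_vector_diff_chain_at[OF lpol_derivs(1) d0] by (simp add: log0_def[abs_def] log1_def o_def)
  show "((\<lambda>t. log0 F s t) has_vector_derivative \<i> * log1 F s t) (at t)"
    using field_vector_diff_chain_at[OF lpol_derivs(2) d0] by (simp add: log0_def[abs_def] log1_def o_def mult.assoc)
  show "((\<lambda>s. log1 F s t) has_vector_derivative log2 F s t) (at s)"
    using field_vector_diff_chain_at[OF lpol_derivs(1) d2] by (simp add: log1_def[abs_def] log2_def o_def)
  show "((\<lambda>t. log1 F s t) has_vector_derivative \<i> * log2 F s t) (at t)"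
    using field_vector_diff_chain_at[OF lpol_derivs(2) d2] by (simp add: log1_def[abs_def] log2_def o_def mult.assoc)
qed

lemma has_real_derivative_Re: "(f has_vector_derivative d) F \<Longrightarrow> ((\<lambda>x. Re (f x)) has_real_derivative Re d) F"
  using bounded_linear.has_vector_derivative[OF bounded_linear_Re]
  by (simp add: has_real_derivative_iff_has_vector_derivative)

lemma has_real_derivative_Im: "(f has_vector_derivative d) F \<Longrightarrow> ((\<lambda>x. Im (f x)) has_real_derivative Im d) F"
  using bounded_linear.has_vector_derivative[OF bounded_linear_Im]
  by (simp add: has_real_derivative_iff_has_vector_derivative)

lemma log_continuous:
  assumes F: "F holomorphic_on ball 0 1"
  shows "continuous_on ({..<0} \<times> UNIV) (\<lambda>x. log0 F (fst x) (snd x))"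
    and "continuous_on ({..<0} \<times> UNIV) (\<lambda>x. log1 F (fst x) (snd x))"
    and "continuous_on ({..<0} \<times> UNIV) (\<lambda>x. log2 F (fst x) (snd x))"
proof -
  have e: "continuous_on ({..<0} \<times> UNIV) (\<lambda>x. lpol (fst x) (snd x))"
    unfolding lpol_def by (intro continuous_intros)
  have c: "continuous_on ({..<0} \<times> UNIV) (\<lambda>x. G (lpol (fst x) (snd x)))" if "G holomorphic_on ball 0 1" for G
    by (rule continuous_on_compose2[OF holomorphic_on_imp_continuous_on[OF that] e]) (use lpol_ball in auto)
  have d1: "deriv F holomorphic_on ball 0 1" by (rule holomorphic_deriv[OF F]) simp
  have d2: "deriv (deriv F) holomorphic_on ball 0 1" by (rule holomorphic_deriv[OF d1]) simp
  show "continuous_on ({..<0} \<times> UNIV) (\<lambda>x. log0 F (fst x) (snd x))"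
    unfolding log0_def by (rule c[OF F])
  show "continuous_on ({..<0} \<times> UNIV) (\<lambda>x. log1 F (fst x) (snd x))"
    unfolding log1_def by (intro continuous_intros e c d1)
  show "continuous_on ({..<0} \<times> UNIV) (\<lambda>x. log2 F (fst x) (snd x))"
    unfolding log2_def by (intro continuous_intros e c d1 d2)
qed

text \<open>A convex function with a negative slope somewhere would be unbounded near \<open>-\<infinity>\<close>.\<close>

lemma convex_bounded_imp_mono:
  fixes M M1 M2 :: "real \<Rightarrow> real"
  assumes d1: "\<And>s. s < 0 \<Longrightarrow> (M has_real_derivative M1 s) (at s)"
    and d2: "\<And>s. s < 0 \<Longrightarrow> (M1 has_real_derivative M2 s) (at s)"
    and nn: "\<And>s. s < 0 \<Longrightarrow> 0 \<le> M2 s"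
    and bd: "\<And>s. s < b \<Longrightarrow> M s \<le> K" and st: "s \<le> t" "t < 0"
  shows "M s \<le> M t"
proof -
  have M1_mono: "M1 x \<le> M1 y" if "x \<le> y" "y < 0" for x y
  proof (rule DERIV_nonneg_imp_nondecreasing[OF that(1)])
    fix w assume "x \<le> w" "w \<le> y"
    then show "\<exists>d. (M1 has_real_derivative d) (at w) \<and> 0 \<le> d" using d2[of w] nn[of w] that by auto
  qed
  have pos: "0 \<le> M1 x" if x: "x < 0" for x
  proof (rule ccontr)
    assume "\<not> 0 \<le> M1 x"
    then have c: "M1 x < 0" by simp
    have lin: "M x - M1 x * x \<le> M y - M1 x * y" if "y \<le> x" for y
    proof (rule DERIV_nonpos_imp_nonincreasing[OF that])
      fix w assume w: "y \<le> w" "w \<le> x"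
      have "((\<lambda>s. M s - M1 x * s) has_real_derivative M1 w - M1 x) (at w)"
        using w x by (auto intro!: derivative_eq_intros d1)
      moreover have "M1 w - M1 x \<le> 0" using M1_mono[of w x] w x by simp
      ultimately show "\<exists>d. ((\<lambda>s. M s - M1 x * s) has_real_derivative d) (at w) \<and> d \<le> 0" by blast
    qed
    define y where "y = min (min x (b - 1)) (x + (K - M x + 1) / M1 x)"
    have "M x + M1 x * (y - x) \<le> M y" using lin[of y] by (simp add: y_def algebra_simps)
    moreover have "M y \<le> K" by (rule bd) (simp add: y_def min_less_iff_disj)
    moreover have "M1 x * ((K - M x + 1) / M1 x) \<le> M1 x * (y - x)"
      using c by (intro mult_left_mono_neg) (auto simp: y_def)
    ultimately show False using c by simp
  qed
  show ?thesis
  proof (rule DERIV_nonneg_imp_nondecreasing[OF st(1)])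
    fix w assume "s \<le> w" "w \<le> t"
    then show "\<exists>d. (M has_real_derivative d) (at w) \<and> 0 \<le> d" using d1[of w] pos[of w] st by auto
  qed
qed

text \<open>The mean value inequality for subharmonic functions. The mean over the circle of radius \<open>exp s\<close> is a convex function of
  \<open>s\<close>, since the second derivative in \<open>t\<close> integrates to zero over a period; it stays bounded as \<open>s\<close> tends to
  \<open>-\<infinity>\<close>, where it approaches the value at the centre. Hence it increases.\<close>

lemma polar_mean_ge_center:
  fixes \<Psi> :: "complex \<Rightarrow> real" and g1 g2 h1 h2 :: "real \<Rightarrow> real \<Rightarrow> real"
  assumes cont: "continuous_on (ball 0 1) \<Psi>"
    and gs: "\<And>s t. s < 0 \<Longrightarrow> ((\<lambda>s. \<Psi> (lpol s t)) has_real_derivative g1 s t) (at s)"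
    and gss: "\<And>s t. s < 0 \<Longrightarrow> ((\<lambda>s. g1 s t) has_real_derivative g2 s t) (at s)"
    and gtt: "\<And>s t. s < 0 \<Longrightarrow> ((\<lambda>t. h1 s t) has_real_derivative h2 s t) (at t)"
    and per: "\<And>s. h1 s (2 * pi) = h1 s 0"
    and cg1: "continuous_on ({..<0} \<times> UNIV) (\<lambda>x. g1 (fst x) (snd x))"
    and cg2: "continuous_on ({..<0} \<times> UNIV) (\<lambda>x. g2 (fst x) (snd x))"
    and sub: "\<And>s t. s < 0 \<Longrightarrow> 0 \<le> g2 s t + h2 s t"
    and s: "s < 0"
  shows "2 * pi * \<Psi> 0 \<le> integral {0..2 * pi} (\<lambda>t. \<Psi> (lpol s t))"
proof -
  define M where "M s = integral (cbox 0 (2 * pi)) (\<lambda>t. \<Psi> (lpol s t))" for s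
  define M1 where "M1 s = integral (cbox 0 (2 * pi)) (\<lambda>t. g1 s t)" for s
  define M2 where "M2 s = integral (cbox 0 (2 * pi)) (\<lambda>t. g2 s t)" for s
  have slice: "continuous_on S (\<lambda>t. k s t)" if "continuous_on ({..<0} \<times> UNIV) (\<lambda>x. k (fst x) (snd x))" "s < 0"
    for k :: "real \<Rightarrow> real \<Rightarrow> real" and s S
  proof -
    have "continuous_on S (\<lambda>t. k (fst (s, t)) (snd (s, t)))"
      by (rule continuous_on_compose2[OF that(1), of S "\<lambda>t. (s, t)"]) (use that in \<open>auto intro!: continuous_intros\<close>)
    then show ?thesis by simp
  qed
  have cl: "continuous_on S (\<lambda>t. lpol s t)" for s S unfolding lpol_def by (intro continuous_intros)
  have cP: "continuous_on S (\<lambda>t. \<Psi> (lpol s t))" if "s < 0" for s S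
    by (rule continuous_on_compose2[OF cont cl]) (use lpol_ball[OF that] in auto)
  have d1: "(M has_real_derivative M1 s) (at s)" if "s < 0" for s
  proof -
    have "((\<lambda>s. integral (cbox 0 (2 * pi)) (\<lambda>t. \<Psi> (lpol s t))) has_real_derivative integral (cbox 0 (2 * pi)) (g1 s)) (at s within {..<0})"
    proof (rule leibniz_rule_field_derivative)
      show "((\<lambda>x. \<Psi> (lpol x t)) has_real_derivative g1 x t) (at x within {..<0})" if "x \<in> {..<0}" for x t
        using gs[of x t] that by (auto intro: has_field_derivative_at_within)
      show "(\<lambda>t. \<Psi> (lpol x t)) integrable_on cbox 0 (2 * pi)" if "x \<in> {..<0}" for x
        using cP that by (intro integrable_continuous) auto
      show "continuous_on ({..<0} \<times> cbox 0 (2 * pi)) (\<lambda>(x, t). g1 x t)"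
        unfolding case_prod_unfold by (rule continuous_on_subset[OF cg1]) auto
    qed (use that in auto)
    then show ?thesis using that at_within_open[of s "{..<0}"] by (simp add: M_def[abs_def] M1_def)
  qed
  have d2: "(M1 has_real_derivative M2 s) (at s)" if "s < 0" for s
  proof -
    have "((\<lambda>s. integral (cbox 0 (2 * pi)) (g1 s)) has_real_derivative integral (cbox 0 (2 * pi)) (g2 s)) (at s within {..<0})"
    proof (rule leibniz_rule_field_derivative)
      show "((\<lambda>x. g1 x t) has_real_derivative g2 x t) (at x within {..<0})" if "x \<in> {..<0}" for x t
        using gss[of x t] that by (auto intro: has_field_derivative_at_within)
      show "(g1 x) integrable_on cbox 0 (2 * pi)" if "x \<in> {..<0}" for x
        using slice[OF cg1] that by (intro integrable_continuous) auto
      show "continuous_on ({..<0} \<times> cbox 0 (2 * pi)) (\<lambda>(x, t). g2 x t)"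
        unfolding case_prod_unfold by (rule continuous_on_subset[OF cg2]) auto
    qed (use that in auto)
    then show ?thesis using that at_within_open[of s "{..<0}"] by (simp add: M1_def[abs_def] M2_def)
  qed
  have nn: "0 \<le> M2 s" if "s < 0" for s
  proof -
    have "((\<lambda>t. h2 s t) has_integral (h1 s (2 * pi) - h1 s 0)) {0..2 * pi}"
      by (rule fundamental_theorem_of_calculus)
        (use gtt[OF that] in \<open>auto simp: has_real_derivative_iff_has_vector_derivative[symmetric] intro: has_field_derivative_at_within\<close>)
    then have h: "((\<lambda>t. h2 s t) has_integral 0) {0..2 * pi}" by (simp add: per)
    have g: "((\<lambda>t. g2 s t) has_integral M2 s) {0..2 * pi}"
      unfolding M2_def cbox_interval[symmetric]
      by (intro integrable_integral integrable_continuous slice[OF cg2 that])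
    have "((\<lambda>t. g2 s t + h2 s t) has_integral (M2 s + 0)) {0..2 * pi}"
      by (rule has_integral_add[OF g h])
    from has_integral_nonneg[OF this] sub[OF that] show ?thesis by simp
  qed
  have close: "\<exists>b. b < 0 \<and> (\<forall>s<b. \<bar>M s - 2 * pi * \<Psi> 0\<bar> \<le> 2 * pi * e)" if e: "e > 0" for e
  proof -
    have "isCont \<Psi> 0" using cont by (simp add: continuous_on_eq_continuous_at)
    then obtain d where d: "d > 0" "\<And>z. cmod z < d \<Longrightarrow> \<bar>\<Psi> z - \<Psi> 0\<bar> < e"
      using e unfolding continuous_at_eps_delta by (auto simp: dist_norm)
    define b where "b = min (-1) (ln d)"
    have "\<bar>M s - 2 * pi * \<Psi> 0\<bar> \<le> 2 * pi * e" if sb: "s < b" for s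
    proof -
      have s0: "s < 0" using sb by (simp add: b_def)
      have "s < ln d" using sb by (simp add: b_def)
      then have "exp s < exp (ln d)" by simp
      then have "exp s < d" using d(1) by simp
      then have dd: "\<bar>\<Psi> (lpol s t) - \<Psi> 0\<bar> \<le> e" for t using d(2)[of "lpol s t"] by (simp add: norm_lpol)
      have "M s - 2 * pi * \<Psi> 0 = integral (cbox 0 (2 * pi)) (\<lambda>t. \<Psi> (lpol s t) - \<Psi> 0)"
        unfolding M_def by (subst integral_diff) (auto intro!: integrable_continuous_real cP[OF s0])
      moreover have "norm (integral (cbox 0 (2 * pi)) (\<lambda>t. \<Psi> (lpol s t) - \<Psi> 0)) \<le> e * measure lborel (cbox 0 (2 * pi))"
        by (rule has_integral_bound[OF _ integrable_integral])
          (use e dd in \<open>auto intro!: integrable_continuous_real continuous_intros cP[OF s0]\<close>)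
      ultimately show ?thesis by (simp add: mult.commute)
    qed
    then show ?thesis by (intro exI[of _ b]) (auto simp: b_def)
  qed
  obtain b where b: "\<And>s. s < b \<Longrightarrow> \<bar>M s - 2 * pi * \<Psi> 0\<bar> \<le> 2 * pi * 1" using close[of 1] by auto
  have mono: "M x \<le> M y" if "x \<le> y" "y < 0" for x y
    by (rule convex_bounded_imp_mono[OF d1 d2 nn, where b = b and K = "2 * pi * \<Psi> 0 + 2 * pi"])
      (use that b in \<open>force simp: abs_le_iff\<close>)+
  have "2 * pi * \<Psi> 0 \<le> M s"
  proof (rule field_le_epsilon)
    fix e :: real assume e: "e > 0"
    obtain b where b: "b < 0" "\<And>s. s < b \<Longrightarrow> \<bar>M s - 2 * pi * \<Psi> 0\<bar> \<le> 2 * pi * (e / (2 * pi))"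
      using close[of "e / (2 * pi)"] e by auto
    have "\<bar>M (min s (b - 1)) - 2 * pi * \<Psi> 0\<bar> \<le> e" using b(2)[of "min s (b - 1)"] by simp
    moreover have "M (min s (b - 1)) \<le> M s" using s by (intro mono) auto
    ultimately show "2 * pi * \<Psi> 0 \<le> M s + e" by linarith
  qed
  then show ?thesis by (simp add: M_def)
qed

section \<open>The weighted inequality for conjugate functions on the disc\<close>

text \<open>A Bellman function for the weighted inequality. Here \<open>p\<close> and \<open>q\<close> stand for the real and the imaginary part of an analytic function
  \<open>F\<close>, and \<open>a\<close>, \<open>b\<close> for the real parts of two analytic functions with \<open>0 \<le> b - a\<^sup>2\<close> small; in the application \<open>a\<close> and \<open>b\<close> are the
  harmonic extensions of a function and of its square. The first summand carries the inequality but is not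
  subharmonic. The second one is comparable to the weight \<open>exp a\<close> times \<open>p\<^sup>2 + q\<^sup>2\<close>, and its exponent contains
  \<open>a\<^sup>2 - b\<close>, whose Laplacian \<open>2 \<bar>grad a\<bar>\<^sup>2\<close> pays for the defect of the first.\<close>

definition bell :: "real \<Rightarrow> real \<Rightarrow> real \<Rightarrow> real \<Rightarrow> real" where
  "bell p q a b = exp a * (9 * p\<^sup>2 - 7 * q\<^sup>2) + exp (a + 100 * (a\<^sup>2 - b)) * (p\<^sup>2 + q\<^sup>2)"

text \<open>The derivatives of \<open>bell\<close> along a curve, as functions of the first and second derivatives of its four arguments.\<close>

definition bell1 :: "real \<Rightarrow> real \<Rightarrow> real \<Rightarrow> real \<Rightarrow> real \<Rightarrow> real \<Rightarrow> real \<Rightarrow> real \<Rightarrow> real" where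
  "bell1 p q a b p1 q1 a1 b1 =
     exp a * (a1 * (9 * p\<^sup>2 - 7 * q\<^sup>2) + 2 * (9 * p * p1 - 7 * q * q1))
     + exp (a + 100 * (a\<^sup>2 - b)) * ((a1 + 100 * (2 * a * a1 - b1)) * (p\<^sup>2 + q\<^sup>2) + 2 * (p * p1 + q * q1))"

definition bell2 :: "real \<Rightarrow> real \<Rightarrow> real \<Rightarrow> real \<Rightarrow> real \<Rightarrow> real \<Rightarrow> real \<Rightarrow> real \<Rightarrow> real \<Rightarrow> real \<Rightarrow> real \<Rightarrow> real \<Rightarrow> real" where
  "bell2 p q a b p1 q1 a1 b1 p2 q2 a2 b2 =
     exp a * ((a2 + a1\<^sup>2) * (9 * p\<^sup>2 - 7 * q\<^sup>2) + 4 * a1 * (9 * p * p1 - 7 * q * q1)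
        + 2 * (9 * (p1\<^sup>2 + p * p2) - 7 * (q1\<^sup>2 + q * q2)))
     + exp (a + 100 * (a\<^sup>2 - b)) * (((a2 + 100 * (2 * a1\<^sup>2 + 2 * a * a2 - b2)) + (a1 + 100 * (2 * a * a1 - b1))\<^sup>2) * (p\<^sup>2 + q\<^sup>2)
        + 4 * (a1 + 100 * (2 * a * a1 - b1)) * (p * p1 + q * q1) + 2 * (p1\<^sup>2 + p * p2 + q1\<^sup>2 + q * q2))"

lemma bell_deriv:
  assumes "(p has_real_derivative p1) (at x)" "(q has_real_derivative q1) (at x)"
    "(a has_real_derivative a1) (at x)" "(b has_real_derivative b1) (at x)"
  shows "((\<lambda>x. bell (p x) (q x) (a x) (b x)) has_real_derivative bell1 (p x) (q x) (a x) (b x) p1 q1 a1 b1) (at x)"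
  unfolding bell_def
  by (auto intro!: derivative_eq_intros assms simp: bell1_def algebra_simps power2_eq_square)

lemma bell1_deriv:
  assumes "(p has_real_derivative p1 x) (at x)" "(q has_real_derivative q1 x) (at x)"
    "(a has_real_derivative a1 x) (at x)" "(b has_real_derivative b1 x) (at x)"
    "(p1 has_real_derivative p2) (at x)" "(q1 has_real_derivative q2) (at x)"
    "(a1 has_real_derivative a2) (at x)" "(b1 has_real_derivative b2) (at x)"
  shows "((\<lambda>x. bell1 (p x) (q x) (a x) (b x) (p1 x) (q1 x) (a1 x) (b1 x)) has_real_derivative
     bell2 (p x) (q x) (a x) (b x) (p1 x) (q1 x) (a1 x) (b1 x) p2 q2 a2 b2) (at x)"
  unfolding bell1_def
  by (auto intro!: derivative_eq_intros assms simp: bell2_def algebra_simps power2_eq_square)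

text \<open>The second derivatives cancel, because the arguments are harmonic. What remains is a sum of squares, except for negative
  multiples of \<open>\<bar>grad a\<bar>\<^sup>2 p\<^sup>2\<close> and \<open>\<bar>grad a\<bar>\<^sup>2 q\<^sup>2\<close>, which are absorbed by the term \<open>200 \<bar>grad a\<bar>\<^sup>2 (p\<^sup>2 + q\<^sup>2)\<close> coming from \<open>100 (a\<^sup>2 - b)\<close>. The
  Cauchy-Riemann equations appear as the pattern of arguments of the second \<open>bell2\<close>.\<close>

lemma bell_laplacian_nonneg:
  assumes ab: "0 \<le> b - a\<^sup>2" "b - a\<^sup>2 \<le> 1 / 200"
  shows "0 \<le> bell2 p q a b p1 q1 a1 b1 p2 q2 a2 b2
     + bell2 p q a b (- q1) p1 a1' b1' (- p2) (- q2) (- a2) (- b2)"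
proof -
  define E X where "E = exp a" and "X = exp (a + 100 * (a\<^sup>2 - b))"
  \<comment> \<open>the two partial derivatives of the exponent \<open>a + 100 (a\<^sup>2 - b)\<close>\<close>
  define v v' where "v = a1 + 100 * (2 * a * a1 - b1)" and "v' = a1' + 100 * (2 * a * a1' - b1')"
  define A where "A = a1\<^sup>2 + a1'\<^sup>2"
  define N where "N = p\<^sup>2 + q\<^sup>2"
  have "1 / 2 \<le> exp (100 * (a\<^sup>2 - b))"
  proof -
    have "1 / 2 \<le> 1 + 100 * (a\<^sup>2 - b)" using ab by simp
    then show ?thesis using exp_ge_add_one_self by (rule order.trans)
  qed
  then have "E * (1/2) \<le> E * exp (100 * (a\<^sup>2 - b))" by (intro mult_left_mono) (auto simp: E_def)
  then have XE: "E / 2 \<le> X" by (simp add: X_def E_def exp_add)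
  have pos: "0 < E" "0 < X" "0 \<le> A" "0 \<le> N" by (auto simp: E_def X_def A_def N_def)
  have "bell2 p q a b p1 q1 a1 b1 p2 q2 a2 b2 + bell2 p q a b (- q1) p1 a1' b1' (- p2) (- q2) (- a2) (- b2)
    = E * ((2 * p1 + 9 * p * a1 - 7 * q * a1')\<^sup>2 + (2 * q1 - 9 * p * a1' - 7 * q * a1)\<^sup>2
        + (- 81 * p\<^sup>2 * A - 49 * q\<^sup>2 * A + A * (9 * p\<^sup>2 - 7 * q\<^sup>2)))
     + X * (200 * A * N + ((p * v + q * v' + 2 * p1)\<^sup>2 + (q * v - p * v' + 2 * q1)\<^sup>2))"
    unfolding bell2_def E_def[symmetric] X_def[symmetric] v_def[symmetric] v'_def[symmetric] A_def N_def
    by (simp add: algebra_simps power2_eq_square)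
  \<comment> \<open>dropping the squares; the rest is decided by comparing coefficients of \<open>A * p\<^sup>2\<close> and \<open>A * q\<^sup>2\<close>\<close>
  moreover have "E * (- 81 * p\<^sup>2 * A - 49 * q\<^sup>2 * A + A * (9 * p\<^sup>2 - 7 * q\<^sup>2)) \<le>
    E * ((2 * p1 + 9 * p * a1 - 7 * q * a1')\<^sup>2 + (2 * q1 - 9 * p * a1' - 7 * q * a1)\<^sup>2
        + (- 81 * p\<^sup>2 * A - 49 * q\<^sup>2 * A + A * (9 * p\<^sup>2 - 7 * q\<^sup>2)))"
    using pos by (intro mult_left_mono) auto
  moreover have "X * (200 * A * N) \<le> X * (200 * A * N + ((p * v + q * v' + 2 * p1)\<^sup>2 + (q * v - p * v' + 2 * q1)\<^sup>2))"
    using pos by (intro mult_left_mono) auto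
  moreover have "E / 2 * (200 * A * N) \<le> X * (200 * A * N)" using XE pos by (intro mult_right_mono) auto
  moreover have "0 \<le> E * (- 81 * p\<^sup>2 * A - 49 * q\<^sup>2 * A + A * (9 * p\<^sup>2 - 7 * q\<^sup>2)) + E / 2 * (200 * A * N)"
  proof -
    have "E * (- 81 * p\<^sup>2 * A - 49 * q\<^sup>2 * A + A * (9 * p\<^sup>2 - 7 * q\<^sup>2)) + E / 2 * (200 * A * N)
       = E * A * (28 * p\<^sup>2 + 44 * q\<^sup>2)"
      by (simp add: N_def algebra_simps)
    then show ?thesis using pos by simp
  qed
  ultimately show ?thesis by linarith
qed

text \<open>The Bellman function composed with the analytic data is subharmonic and nonnegative at the centre, hence its circular means
  are nonnegative. Since \<open>exp (a + 100 (a\<^sup>2 - b)) \<le> exp a\<close>, it lies below \<open>exp a (10 p\<^sup>2 - 6 q\<^sup>2)\<close>, which gives the constant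
  \<open>10/6 = 5/3\<close>.\<close>

theorem weighted_conjugate_disc:
  assumes A: "A holomorphic_on ball 0 1" and B: "B holomorphic_on ball 0 1" and F: "F holomorphic_on ball 0 1"
    and osc: "\<And>z. cmod z < 1 \<Longrightarrow> 0 \<le> Re (B z) - (Re (A z))\<^sup>2" "\<And>z. cmod z < 1 \<Longrightarrow> Re (B z) - (Re (A z))\<^sup>2 \<le> 1 / 200"
    and F0: "Im (F 0) = 0" and r: "0 < r" "r < 1"
  shows "(LINT \<xi>|circle. exp (Re (A (of_real r * \<xi>))) * (Im (F (of_real r * \<xi>)))\<^sup>2)
     \<le> 5/3 * (LINT \<xi>|circle. exp (Re (A (of_real r * \<xi>))) * (Re (F (of_real r * \<xi>)))\<^sup>2)"
proof -
  define \<Psi> where "\<Psi> z = bell (Re (F z)) (Im (F z)) (Re (A z)) (Re (B z))" for z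
  \<comment> \<open>\<open>g1\<close>, \<open>g2\<close> are the derivatives in \<open>s\<close> and \<open>h1\<close>, \<open>h2\<close> those in \<open>t\<close>, the latter obtained by multiplication with \<open>i\<close>\<close>
  define g1 where "g1 s t = bell1 (Re (log0 F s t)) (Im (log0 F s t)) (Re (log0 A s t)) (Re (log0 B s t))
     (Re (log1 F s t)) (Im (log1 F s t)) (Re (log1 A s t)) (Re (log1 B s t))" for s t
  define g2 where "g2 s t = bell2 (Re (log0 F s t)) (Im (log0 F s t)) (Re (log0 A s t)) (Re (log0 B s t))
     (Re (log1 F s t)) (Im (log1 F s t)) (Re (log1 A s t)) (Re (log1 B s t))
     (Re (log2 F s t)) (Im (log2 F s t)) (Re (log2 A s t)) (Re (log2 B s t))" for s t
  define h1 where "h1 s t = bell1 (Re (log0 F s t)) (Im (log0 F s t)) (Re (log0 A s t)) (Re (log0 B s t))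
     (- Im (log1 F s t)) (Re (log1 F s t)) (- Im (log1 A s t)) (- Im (log1 B s t))" for s t
  define h2 where "h2 s t = bell2 (Re (log0 F s t)) (Im (log0 F s t)) (Re (log0 A s t)) (Re (log0 B s t))
     (- Im (log1 F s t)) (Re (log1 F s t)) (- Im (log1 A s t)) (- Im (log1 B s t))
     (- Re (log2 F s t)) (- Im (log2 F s t)) (- Re (log2 A s t)) (- Re (log2 B s t))" for s t
  have \<Psi>_log: "\<Psi> (lpol s t) = bell (Re (log0 F s t)) (Im (log0 F s t)) (Re (log0 A s t)) (Re (log0 B s t))" for s t
    by (simp add: \<Psi>_def log0_def)
  note cF = holomorphic_on_imp_continuous_on[OF F] and cA = holomorphic_on_imp_continuous_on[OF A]
    and cB = holomorphic_on_imp_continuous_on[OF B]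
  have c\<Psi>: "continuous_on (ball 0 1) \<Psi>" unfolding \<Psi>_def bell_def by (intro continuous_intros cF cA cB)
  define s where "s = ln r"
  have s: "s < 0" "exp s = r" using r by (auto simp: s_def)
  have "2 * pi * \<Psi> 0 \<le> integral {0..2 * pi} (\<lambda>t. \<Psi> (lpol s t))"
  proof (rule polar_mean_ge_center[where ?g1.0 = g1 and ?g2.0 = g2 and ?h1.0 = h1 and ?h2.0 = h2])
    fix s t :: real assume s: "s < 0"
    note D = log_derivs[OF F s, of t] log_derivs[OF A s, of t] log_derivs[OF B s, of t]
    note R = has_real_derivative_Re and I = has_real_derivative_Im
    show "((\<lambda>s. \<Psi> (lpol s t)) has_real_derivative g1 s t) (at s)"
      unfolding \<Psi>_log g1_def by (rule bell_deriv[OF R[OF D(1)] I[OF D(1)] R[OF D(5)] R[OF D(9)]])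
    show "((\<lambda>s. g1 s t) has_real_derivative g2 s t) (at s)"
      unfolding g1_def g2_def
      by (rule bell1_deriv[OF R[OF D(1)] I[OF D(1)] R[OF D(5)] R[OF D(9)] R[OF D(3)] I[OF D(3)] R[OF D(7)] R[OF D(11)]])
    have mi: "Re (\<i> * z) = - Im z" "Im (\<i> * z) = Re z" for z by auto
    have T1: "((\<lambda>t. Re (log0 F s t)) has_real_derivative - Im (log1 F s t)) (at t)"
      "((\<lambda>t. Im (log0 F s t)) has_real_derivative Re (log1 F s t)) (at t)"
      "((\<lambda>t. Re (log0 A s t)) has_real_derivative - Im (log1 A s t)) (at t)"
      "((\<lambda>t. Re (log0 B s t)) has_real_derivative - Im (log1 B s t)) (at t)"
      using R[OF D(2)] I[OF D(2)] R[OF D(6)] R[OF D(10)] by (simp_all add: mi)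
    have T2: "((\<lambda>t. - Im (log1 F s t)) has_real_derivative - Re (log2 F s t)) (at t)"
      "((\<lambda>t. Re (log1 F s t)) has_real_derivative - Im (log2 F s t)) (at t)"
      "((\<lambda>t. - Im (log1 A s t)) has_real_derivative - Re (log2 A s t)) (at t)"
      "((\<lambda>t. - Im (log1 B s t)) has_real_derivative - Re (log2 B s t)) (at t)"
      using DERIV_minus[OF I[OF D(4)]] R[OF D(4)] DERIV_minus[OF I[OF D(8)]] DERIV_minus[OF I[OF D(12)]] by (simp_all add: mi)
    show "((\<lambda>t. h1 s t) has_real_derivative h2 s t) (at t)"
      unfolding h1_def h2_def by (rule bell1_deriv[OF T1 T2])
    have "cmod (lpol s t) < 1" using lpol_ball[OF s] by simp
    then show "0 \<le> g2 s t + h2 s t"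
      unfolding g2_def h2_def using osc[of "lpol s t"] by (intro bell_laplacian_nonneg) (auto simp: log0_def)
  next
    fix s :: real
    have "lpol s (2 * pi) = lpol s 0" by (simp add: lpol_eq)
    then show "h1 s (2 * pi) = h1 s 0" by (simp add: h1_def log0_def log1_def)
  next
    show "continuous_on ({..<0} \<times> UNIV) (\<lambda>x. g1 (fst x) (snd x))"
      unfolding g1_def bell1_def by (intro continuous_intros log_continuous F A B)
    show "continuous_on ({..<0} \<times> UNIV) (\<lambda>x. g2 (fst x) (snd x))"
      unfolding g2_def bell2_def by (intro continuous_intros log_continuous F A B)
  qed (use c\<Psi> s in auto)
  moreover have "0 \<le> \<Psi> 0" unfolding \<Psi>_def bell_def using F0 by simp
  moreover from \<open>0 \<le> \<Psi> 0\<close> have "0 \<le> 2 * pi * \<Psi> 0" by simp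
  ultimately have int0: "0 \<le> integral {0..2 * pi} (\<lambda>t. \<Psi> (lpol s t))"
    by linarith
  have "integral {0..2 * pi} (\<lambda>t. \<Psi> (lpol s t)) = (LINT \<xi>|circle. \<Psi> (of_real r * \<xi>))"
  proof -
    have cr: "continuous_on {0..2*pi} (\<lambda>t. \<Psi> (of_real r * cis t))"
      by (rule continuous_on_compose2[OF c\<Psi>]) (use r in \<open>auto intro!: continuous_intros simp: norm_mult\<close>)
    have m: "(\<lambda>\<xi>. \<Psi> (of_real r * \<xi>)) \<in> borel_measurable circle"
    proof -
      have "continuous_on (sphere 0 1) (\<lambda>\<xi>. \<Psi> (of_real r * \<xi>))"
        using r by (intro continuous_on_compose2[OF c\<Psi>] continuous_intros) (auto simp: norm_mult)
      then have "(\<lambda>\<xi>. \<Psi> (of_real r * \<xi>)) \<in> borel_measurable (restrict_space borel (sphere 0 1))"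
        by (rule borel_measurable_continuous_on_restrict)
      then show ?thesis by (simp cong: measurable_cong_sets add: sets_circle)
    qed
    have "(LINT \<xi>|circle. \<Psi> (of_real r * \<xi>)) = (LINT t:{0..<0 + 2 * pi}|lborel. \<Psi> (of_real r * cis t))"
      by (rule integral_circle[OF m])
    also have "\<dots> = (LINT t:{0..2 * pi}|lborel. \<Psi> (of_real r * cis t))"
    proof (rule set_integral_cong_set)
      show "AE t in lborel. (t \<in> {0..2 * pi}) = (t \<in> {0..<0 + 2 * pi})"
        using AE_lborel_singleton[of "2 * pi"] by eventually_elim auto
      have "(\<lambda>t. \<Psi> (of_real r * cis t)) \<in> borel_measurable borel"
        by (rule measurable_compose[OF cis_measurable m])
      then show "set_borel_measurable lborel {0..2 * pi} (\<lambda>t. \<Psi> (of_real r * cis t))"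
        "set_borel_measurable lborel {0..<0 + 2 * pi} (\<lambda>t. \<Psi> (of_real r * cis t))"
        by (simp_all add: set_borel_measurable_def)
    qed
    also have "\<dots> = integral {0..2 * pi} (\<lambda>t. \<Psi> (of_real r * cis t))"
      by (intro set_borel_integral_eq_integral borel_integrable_compact[folded set_integrable_def] cr) auto
    finally show ?thesis by (simp add: lpol_eq s)
  qed
  with int0 have int1: "0 \<le> (LINT \<xi>|circle. \<Psi> (of_real r * \<xi>))" by simp
  have ci: "integrable circle (\<lambda>\<xi>. G (of_real r * \<xi>))" if G: "continuous_on (ball 0 1) G" for G :: "complex \<Rightarrow> real"
  proof -
    have c: "continuous_on (sphere 0 1) (\<lambda>\<xi>. G (of_real r * \<xi>))"
      using r by (intro continuous_on_compose2[OF G] continuous_intros) (auto simp: norm_mult)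
    then have "(\<lambda>\<xi>. G (of_real r * \<xi>)) \<in> borel_measurable (restrict_space borel (sphere 0 1))"
      by (rule borel_measurable_continuous_on_restrict)
    then have m: "(\<lambda>\<xi>. G (of_real r * \<xi>)) \<in> borel_measurable circle"
      by (simp cong: measurable_cong_sets add: sets_circle)
    have "bounded ((\<lambda>\<xi>. G (of_real r * \<xi>)) ` sphere 0 1)"
      by (intro compact_imp_bounded compact_continuous_image c) simp
    then obtain K where "\<forall>x\<in>(\<lambda>\<xi>. G (of_real r * \<xi>)) ` sphere 0 1. norm x \<le> K" unfolding bounded_iff by blast
    then show ?thesis
      by (intro circle.integrable_const_bound[where B = K] AE_I2 m) (auto simp: space_circle)
  qed
  define W where "W z = exp (Re (A z))" for z
  have W: "0 < W z" for z by (simp add: W_def)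
  have iI: "integrable circle (\<lambda>\<xi>. W (of_real r * \<xi>) * (Im (F (of_real r * \<xi>)))\<^sup>2)"
    unfolding W_def by (rule ci[of "\<lambda>z. exp (Re (A z)) * (Im (F z))\<^sup>2"]) (intro continuous_intros cF cA)
  have iR: "integrable circle (\<lambda>\<xi>. W (of_real r * \<xi>) * (Re (F (of_real r * \<xi>)))\<^sup>2)"
    unfolding W_def by (rule ci[of "\<lambda>z. exp (Re (A z)) * (Re (F z))\<^sup>2"]) (intro continuous_intros cF cA)
  have "0 \<le> (LINT \<xi>|circle. 10 * (W (of_real r * \<xi>) * (Re (F (of_real r * \<xi>)))\<^sup>2) - 6 * (W (of_real r * \<xi>) * (Im (F (of_real r * \<xi>)))\<^sup>2))"
    using int1
  proof (rule order.trans)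
    show "(LINT \<xi>|circle. \<Psi> (of_real r * \<xi>)) \<le> (LINT \<xi>|circle. 10 * (W (of_real r * \<xi>) * (Re (F (of_real r * \<xi>)))\<^sup>2) - 6 * (W (of_real r * \<xi>) * (Im (F (of_real r * \<xi>)))\<^sup>2))"
    proof (rule integral_mono)
      show "integrable circle (\<lambda>\<xi>. \<Psi> (of_real r * \<xi>))" by (rule ci[OF c\<Psi>])
      fix \<xi> assume "\<xi> \<in> space circle"
      then have z: "cmod (of_real r * \<xi>) < 1" using r norm_circle by (simp add: norm_mult)
      define z where "z = of_real r * \<xi>"
      have "exp (Re (A z) + 100 * ((Re (A z))\<^sup>2 - Re (B z))) \<le> W z"
        unfolding W_def using osc(1)[OF z] by (simp add: z_def)
      then have "exp (Re (A z) + 100 * ((Re (A z))\<^sup>2 - Re (B z))) * ((Re (F z))\<^sup>2 + (Im (F z))\<^sup>2) \<le> W z * ((Re (F z))\<^sup>2 + (Im (F z))\<^sup>2)"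
        by (intro mult_right_mono) auto
      then have "\<Psi> z \<le> 10 * (W z * (Re (F z))\<^sup>2) - 6 * (W z * (Im (F z))\<^sup>2)"
        unfolding \<Psi>_def bell_def W_def[symmetric] by (simp add: algebra_simps)
      then show "\<Psi> (of_real r * \<xi>) \<le> 10 * (W (of_real r * \<xi>) * (Re (F (of_real r * \<xi>)))\<^sup>2) - 6 * (W (of_real r * \<xi>) * (Im (F (of_real r * \<xi>)))\<^sup>2)"
        by (simp add: z_def)
    qed (use iI iR in simp)
  qed
  then show ?thesis using iI iR by (simp add: W_def)
qed

section \<open>Poisson integrals of square integrable functions\<close>

definition sq_integrable :: "(complex \<Rightarrow> real) \<Rightarrow> bool" where
  "sq_integrable f \<longleftrightarrow> f \<in> borel_measurable circle \<and> integrable circle (\<lambda>\<xi>. (f \<xi>)\<^sup>2)"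

lemma sq_integrable_integrable:
  assumes "sq_integrable f"
  shows "integrable circle f"
proof (rule Bochner_Integration.integrable_bound)
  show "integrable circle (\<lambda>\<xi>. 1 + (f \<xi>)\<^sup>2)" "f \<in> borel_measurable circle"
    using assms by (auto simp: sq_integrable_def)
  have "\<bar>t\<bar> \<le> 1 + t\<^sup>2" for t :: real
    using sum_squares_bound[of "\<bar>t\<bar>" 1] by (simp add: power2_eq_square)
  then show "AE \<xi> in circle. norm (f \<xi>) \<le> norm (1 + (f \<xi>)\<^sup>2)" by (intro AE_I2) simp
qed

lemma poisson_int_nonneg:
  fixes h :: "complex \<Rightarrow> real"
  assumes "\<And>\<xi>. 0 \<le> h \<xi>" "cmod z < 1"
  shows "0 \<le> poisson_int h z"
proof -
  have "0 \<le> (LINT \<xi>|circle. poisson z \<xi> *\<^sub>R h \<xi>)"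
  proof (rule integral_nonneg_AE, rule AE_I2)
    fix \<xi> assume "\<xi> \<in> space circle"
    then show "0 \<le> poisson z \<xi> *\<^sub>R h \<xi>"
      using assms poisson_pos[OF assms(2) norm_circle, of \<xi>] by simp
  qed
  then show ?thesis by (simp add: poisson_int_def)
qed

lemma poisson_int_sq_shift:
  assumes f: "sq_integrable f" and z: "cmod z < 1"
  shows "poisson_int (\<lambda>\<xi>. (f \<xi> - c)\<^sup>2) z = poisson_int (\<lambda>\<xi>. (f \<xi>)\<^sup>2) z - 2 * c * poisson_int f z + c\<^sup>2"
proof -
  have i: "integrable circle (\<lambda>\<xi>. poisson z \<xi> * (f \<xi>)\<^sup>2)" "integrable circle (\<lambda>\<xi>. poisson z \<xi> * f \<xi>)"
     "integrable circle (\<lambda>\<xi>. poisson z \<xi>)"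
    using integrable_poisson[OF _ z, of "\<lambda>\<xi>. (f \<xi>)\<^sup>2"] integrable_poisson[OF sq_integrable_integrable[OF f] z]
      integrable_poisson[of "\<lambda>_. 1::real", OF _ z] f by (auto simp: sq_integrable_def)
  have "(LINT \<xi>|circle. poisson z \<xi> * (f \<xi> - c)\<^sup>2)
      = (LINT \<xi>|circle. poisson z \<xi> * (f \<xi>)\<^sup>2 - 2 * c * (poisson z \<xi> * f \<xi>) + c\<^sup>2 * poisson z \<xi>)"
    by (intro Bochner_Integration.integral_cong refl) (simp add: power2_eq_square algebra_simps)
  also have "\<dots> = (LINT \<xi>|circle. poisson z \<xi> * (f \<xi>)\<^sup>2) - 2 * c * (LINT \<xi>|circle. poisson z \<xi> * f \<xi>) + c\<^sup>2 * (2 * pi)"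
    using i integral_poisson[OF z] by simp
  finally show ?thesis by (simp add: poisson_int_def field_simps)
qed

text \<open>The difference is the variance of \<open>f\<close> under the probability with density given by the Poisson kernel, which may be
  computed about any point \<open>c\<close>.\<close>

lemma poisson_int_variance:
  assumes f: "sq_integrable f" and z: "cmod z < 1"
  shows "poisson_int (\<lambda>\<xi>. (f \<xi>)\<^sup>2) z - (poisson_int f z)\<^sup>2 = poisson_int (\<lambda>\<xi>. (f \<xi> - c)\<^sup>2) z - (poisson_int f z - c)\<^sup>2"
  unfolding poisson_int_sq_shift[OF f z] by (simp add: power2_eq_square algebra_simps)

lemma poisson_int_sq_le:
  assumes f: "sq_integrable f" and z: "cmod z < 1"
  shows "(poisson_int f z)\<^sup>2 \<le> poisson_int (\<lambda>\<xi>. (f \<xi>)\<^sup>2) z"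
  using poisson_int_variance[OF f z, of "poisson_int f z"] poisson_int_nonneg[of "\<lambda>\<xi>. (f \<xi> - poisson_int f z)\<^sup>2" z] z
  by simp

lemma continuous_poisson_int:
  fixes h :: "complex \<Rightarrow> real"
  assumes "integrable circle h"
  shows "continuous_on (ball 0 1) (poisson_int h)"
proof -
  have "continuous_on (ball 0 1) (\<lambda>z. Re (herglotz (\<lambda>\<xi>. complex_of_real (h \<xi>)) z))"
    using assms by (intro continuous_intros holomorphic_on_imp_continuous_on herglotz_holomorphic) simp
  then show ?thesis
    by (rule continuous_on_eq) (use Re_herglotz[OF assms] in auto)
qed

lemma radial_bounded:
  fixes F :: "complex \<Rightarrow> 'b::real_normed_vector"
  assumes F: "continuous_on (ball 0 1) F" and r: "0 \<le> r" "r < 1"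
  obtains K where "\<And>\<zeta>. cmod \<zeta> = 1 \<Longrightarrow> norm (F (of_real r * \<zeta>)) \<le> K"
proof -
  have c: "continuous_on (sphere 0 1) (\<lambda>\<xi>. F (of_real r * \<xi>))"
    using r by (intro continuous_on_compose2[OF F] continuous_intros) (auto simp: norm_mult)
  have "bounded ((\<lambda>\<xi>. F (of_real r * \<xi>)) ` sphere 0 1)"
    by (intro compact_imp_bounded compact_continuous_image c) simp
  then obtain K where "\<forall>x\<in>(\<lambda>\<xi>. F (of_real r * \<xi>)) ` sphere 0 1. norm x \<le> K" unfolding bounded_iff by blast
  then show ?thesis by (intro that[of K]) auto
qed

lemma radial_measurable_real:
  assumes "continuous_on (ball 0 1) F" "0 \<le> r" "r < 1"
  shows "(\<lambda>\<xi>. F (of_real r * \<xi>) :: real) \<in> borel_measurable circle"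
proof -
  have "continuous_on (ball 0 1) (\<lambda>z. complex_of_real (F z))" by (intro continuous_intros assms)
  from radial_measurable[OF this assms(2,3)] have "(\<lambda>\<xi>. Re (complex_of_real (F (of_real r * \<xi>)))) \<in> borel_measurable circle"
    by measurable
  then show ?thesis by simp
qed

lemma radial_integrable:
  fixes F :: "complex \<Rightarrow> real"
  assumes "continuous_on (ball 0 1) F" "0 \<le> r" "r < 1"
  shows "integrable circle (\<lambda>\<xi>. F (of_real r * \<xi>))"
proof -
  obtain K where "\<And>\<zeta>. cmod \<zeta> = 1 \<Longrightarrow> norm (F (of_real r * \<zeta>)) \<le> K" using radial_bounded[OF assms] by blast
  then show ?thesis using norm_circle
    by (intro circle.integrable_const_bound[where B = K] AE_I2 radial_measurable_real assms) auto
qed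

text \<open>Fubini's theorem and the symmetry \<open>poisson_swap\<close> of the kernel.\<close>

lemma integral_poisson_int_radial:
  fixes h :: "complex \<Rightarrow> real"
  assumes h: "integrable circle h" and h0: "\<And>\<xi>. 0 \<le> h \<xi>" and r: "0 \<le> r" "r < 1"
  shows "(LINT \<zeta>|circle. poisson_int h (of_real r * \<zeta>)) = (LINT \<xi>|circle. h \<xi>)"
proof -
  interpret pair_sigma_finite circle circle ..
  have [measurable]: "h \<in> borel_measurable circle" using h by simp
  have nr: "cmod (of_real r * \<zeta>) < 1" if "cmod \<zeta> = 1" for \<zeta> using r that by (simp add: norm_mult)
  have P0: "0 \<le> poisson (of_real r * \<zeta>) \<xi>" if "cmod \<zeta> = 1" "cmod \<xi> = 1" for \<zeta> \<xi>
    using poisson_pos[OF nr[OF that(1)] that(2)] by simp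
  have m1: "(\<lambda>x. fst x) \<in> borel_measurable (circle \<Otimes>\<^sub>M circle)"
    by (rule measurable_compose[OF measurable_fst borel_measurable_circle_ident])
  have m2: "(\<lambda>x. snd x) \<in> borel_measurable (circle \<Otimes>\<^sub>M circle)"
    by (rule measurable_compose[OF measurable_snd borel_measurable_circle_ident])
  have m3: "(\<lambda>x. h (snd x)) \<in> borel_measurable (circle \<Otimes>\<^sub>M circle)"
    by (rule measurable_compose[OF measurable_snd]) simp
  have m: "(\<lambda>(\<zeta>, \<xi>). ennreal (poisson (of_real r * \<zeta>) \<xi> * h \<xi>)) \<in> borel_measurable (circle \<Otimes>\<^sub>M circle)"
    unfolding case_prod_unfold poisson_def using m1 m2 m3 by measurable
  have "(\<integral>\<^sup>+\<zeta>. ennreal (poisson_int h (of_real r * \<zeta>)) \<partial>circle)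
      = (\<integral>\<^sup>+\<zeta>. ennreal (1 / (2 * pi)) * (\<integral>\<^sup>+\<xi>. ennreal (poisson (of_real r * \<zeta>) \<xi> * h \<xi>) \<partial>circle) \<partial>circle)"
  proof (rule nn_integral_cong)
    fix \<zeta> assume "\<zeta> \<in> space circle"
    then have z: "cmod \<zeta> = 1" by (rule norm_circle)
    have "(\<integral>\<^sup>+\<xi>. ennreal (poisson (of_real r * \<zeta>) \<xi> * h \<xi>) \<partial>circle) = ennreal (LINT \<xi>|circle. poisson (of_real r * \<zeta>) \<xi> * h \<xi>)"
      using integrable_poisson[OF h nr[OF z]] P0[OF z] h0
      by (intro nn_integral_eq_integral AE_I2) (auto dest!: norm_circle)
    then show "ennreal (poisson_int h (of_real r * \<zeta>)) = ennreal (1 / (2 * pi)) * (\<integral>\<^sup>+\<xi>. ennreal (poisson (of_real r * \<zeta>) \<xi> * h \<xi>) \<partial>circle)"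
      by (simp add: poisson_int_def flip: ennreal_mult')
  qed
  also have "\<dots> = ennreal (1 / (2 * pi)) * (\<integral>\<^sup>+\<zeta>. (\<integral>\<^sup>+\<xi>. ennreal (poisson (of_real r * \<zeta>) \<xi> * h \<xi>) \<partial>circle) \<partial>circle)"
    using circle.borel_measurable_nn_integral[OF m]
    by (intro nn_integral_cmult) simp
  also have "(\<integral>\<^sup>+\<zeta>. (\<integral>\<^sup>+\<xi>. ennreal (poisson (of_real r * \<zeta>) \<xi> * h \<xi>) \<partial>circle) \<partial>circle)
      = (\<integral>\<^sup>+\<xi>. (\<integral>\<^sup>+\<zeta>. ennreal (poisson (of_real r * \<zeta>) \<xi> * h \<xi>) \<partial>circle) \<partial>circle)"
    by (rule Fubini'[OF m, symmetric])
  also have "\<dots> = (\<integral>\<^sup>+\<xi>. ennreal (2 * pi) * ennreal (h \<xi>) \<partial>circle)"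
  proof (rule nn_integral_cong)
    fix \<xi> assume "\<xi> \<in> space circle"
    then have x: "cmod \<xi> = 1" by (rule norm_circle)
    have "(\<integral>\<^sup>+\<zeta>. ennreal (poisson (of_real r * \<zeta>) \<xi> * h \<xi>) \<partial>circle) = (\<integral>\<^sup>+\<zeta>. ennreal (h \<xi> * poisson (of_real r * \<xi>) \<zeta>) \<partial>circle)"
    proof (rule nn_integral_cong)
      fix \<zeta> assume "\<zeta> \<in> space circle"
      then show "ennreal (poisson (of_real r * \<zeta>) \<xi> * h \<xi>) = ennreal (h \<xi> * poisson (of_real r * \<xi>) \<zeta>)"
        using poisson_swap[OF x norm_circle, of \<zeta> r] by (simp only: mult.commute[of "h \<xi>"])
    qed
    also have "\<dots> = ennreal (LINT \<zeta>|circle. h \<xi> * poisson (of_real r * \<xi>) \<zeta>)"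
      using integrable_poisson[of "\<lambda>_. 1::real", OF _ nr[OF x]] P0[OF x] h0
      by (intro nn_integral_eq_integral AE_I2) (auto dest!: norm_circle)
    also have "\<dots> = ennreal (2 * pi) * ennreal (h \<xi>)"
      using integral_poisson[OF nr[OF x]] h0 by (simp add: mult.commute flip: ennreal_mult')
    finally show "(\<integral>\<^sup>+\<zeta>. ennreal (poisson (of_real r * \<zeta>) \<xi> * h \<xi>) \<partial>circle) = ennreal (2 * pi) * ennreal (h \<xi>)" .
  qed
  also have "\<dots> = ennreal (2 * pi) * (\<integral>\<^sup>+\<xi>. ennreal (h \<xi>) \<partial>circle)"
    by (rule nn_integral_cmult) simp
  also have "(\<integral>\<^sup>+\<xi>. ennreal (h \<xi>) \<partial>circle) = ennreal (LINT \<xi>|circle. h \<xi>)"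
    using h h0 by (intro nn_integral_eq_integral) auto
  also have "ennreal (1 / (2 * pi)) * (ennreal (2 * pi) * ennreal (LINT \<xi>|circle. h \<xi>)) = ennreal (LINT \<xi>|circle. h \<xi>)"
    by (simp add: mult.assoc[symmetric] flip: ennreal_mult')
  finally have eq: "(\<integral>\<^sup>+\<zeta>. ennreal (poisson_int h (of_real r * \<zeta>)) \<partial>circle) = ennreal (LINT \<xi>|circle. h \<xi>)" .
  have "(\<integral>\<^sup>+\<zeta>. ennreal (poisson_int h (of_real r * \<zeta>)) \<partial>circle) = ennreal (LINT \<zeta>|circle. poisson_int h (of_real r * \<zeta>))"
    using radial_integrable[OF continuous_poisson_int[OF h] r] poisson_int_nonneg[OF h0 nr]
    by (intro nn_integral_eq_integral AE_I2) (auto dest!: norm_circle)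
  with eq have "ennreal (LINT \<zeta>|circle. poisson_int h (of_real r * \<zeta>)) = ennreal (LINT \<xi>|circle. h \<xi>)" by simp
  moreover have "0 \<le> (LINT \<zeta>|circle. poisson_int h (of_real r * \<zeta>))"
    using poisson_int_nonneg[OF h0 nr] by (intro integral_nonneg_AE AE_I2) (auto dest!: norm_circle)
  moreover have "0 \<le> (LINT \<xi>|circle. h \<xi>)" using h0 by simp
  ultimately show ?thesis by (simp add: ennreal_inj)
qed

text \<open>By orthogonality of the powers, only one term of the Herglotz series of \<open>\<xi>\<^sup>k\<close> survives and, for \<open>k > 0\<close>, none of that of its conjugate.\<close>

lemma poisson_int_power:
  assumes z: "cmod z < 1"
  shows "poisson_int (\<lambda>\<xi>. \<xi> ^ k) z = z ^ k"
proof (cases "k = 0")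
  case True
  then show ?thesis using poisson_int_const[OF z, of "1::complex"] by simp
next
  case False
  have int: "integrable circle (\<lambda>\<xi>. \<xi> ^ k)"
    using norm_circle by (intro circle.integrable_const_bound[where B = 1] AE_I2 borel_measurable_circle_power) (auto simp: norm_power)
  have "(\<lambda>n. ((if n = 0 then 1 else 2) * (LINT \<xi>|circle. \<xi> ^ k * inverse \<xi> ^ n) / (2 * pi)) * z ^ n) sums herglotz (\<lambda>\<xi>. \<xi> ^ k) z"
    by (rule herglotz_sums[OF int z])
  moreover have "((if n = 0 then 1 else 2) * (LINT \<xi>|circle. \<xi> ^ k * inverse \<xi> ^ n) / (2 * pi)) * z ^ n = (if n = k then 2 * z ^ k else 0)" for n
  proof -
    consider "n < k" | "n = k" | "n > k" by linarith
    then show ?thesis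
    proof cases
      case 1
      have "(LINT \<xi>|circle. \<xi> ^ k * inverse \<xi> ^ n) = (LINT \<xi>|circle. \<xi> ^ (k - n))"
      proof (rule Bochner_Integration.integral_cong[OF refl])
        fix \<xi> assume "\<xi> \<in> space circle"
        then have "\<xi> \<noteq> 0" using norm_circle by force
        moreover have "\<xi> ^ k = \<xi> ^ (k - n) * \<xi> ^ n" using 1 by (simp flip: power_add)
        ultimately show "\<xi> ^ k * inverse \<xi> ^ n = \<xi> ^ (k - n)" by (simp add: mult.assoc flip: power_mult_distrib)
      qed
      then show ?thesis using 1 integral_circle_power[of "k - n"] by simp
    next
      case 2
      have "(LINT \<xi>|circle. \<xi> ^ k * inverse \<xi> ^ n) = (LINT \<xi>|circle. 1)"
      proof (rule Bochner_Integration.integral_cong[OF refl])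
        fix \<xi> assume "\<xi> \<in> space circle"
        then have "\<xi> \<noteq> 0" using norm_circle by force
        then show "\<xi> ^ k * inverse \<xi> ^ n = 1" using 2 by (simp flip: power_mult_distrib)
      qed
      then show ?thesis using 2 False by (simp add: measure_circle_space scaleR_conv_of_real)
    next
      case 3
      have "(LINT \<xi>|circle. \<xi> ^ k * inverse \<xi> ^ n) = (LINT \<xi>|circle. inverse \<xi> ^ (n - k))"
      proof (rule Bochner_Integration.integral_cong[OF refl])
        fix \<xi> assume "\<xi> \<in> space circle"
        then have "\<xi> \<noteq> 0" using norm_circle by force
        moreover have "inverse \<xi> ^ n = inverse \<xi> ^ k * inverse \<xi> ^ (n - k)" using 3 by (simp flip: power_add)
        ultimately show "\<xi> ^ k * inverse \<xi> ^ n = inverse \<xi> ^ (n - k)" by (simp flip: power_mult_distrib)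
      qed
      then show ?thesis using 3 integral_circle_inverse_power[of "n - k"] by simp
    qed
  qed
  ultimately have "(\<lambda>n. if n = k then 2 * z ^ k else 0) sums herglotz (\<lambda>\<xi>. \<xi> ^ k) z" by (simp only:)
  then have 1: "herglotz (\<lambda>\<xi>. \<xi> ^ k) z = 2 * z ^ k" using sums_single[of k "\<lambda>_. 2 * z ^ k"] by (auto intro: sums_unique2)
  have "(\<lambda>n. ((if n = 0 then 1 else 2) * (LINT \<xi>|circle. cnj (\<xi> ^ k) * inverse \<xi> ^ n) / (2 * pi)) * z ^ n) sums herglotz (\<lambda>\<xi>. cnj (\<xi> ^ k)) z"
    using int by (intro herglotz_sums z) (simp only: complex_integrable_cnj)
  moreover have "(LINT \<xi>|circle. cnj (\<xi> ^ k) * inverse \<xi> ^ n) = 0" for n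
  proof -
    have "(LINT \<xi>|circle. cnj (\<xi> ^ k) * inverse \<xi> ^ n) = (LINT \<xi>|circle. inverse \<xi> ^ (k + n))"
    proof (rule Bochner_Integration.integral_cong[OF refl])
      fix \<xi> assume "\<xi> \<in> space circle"
      then have "\<xi> * cnj \<xi> = 1" using norm_circle[of \<xi>] complex_norm_square[of \<xi>] by simp
      then have "inverse \<xi> = cnj \<xi>" by (rule inverse_unique)
      then show "cnj (\<xi> ^ k) * inverse \<xi> ^ n = inverse \<xi> ^ (k + n)" by (simp add: power_add)
    qed
    then show ?thesis using False integral_circle_inverse_power[of "k + n"] by simp
  qed
  ultimately have "herglotz (\<lambda>\<xi>. cnj (\<xi> ^ k)) z = 0"
    using sums_unique2[OF _ sums_zero] by simp
  then show ?thesis unfolding poisson_int_herglotz[OF int z] 1 by simp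
qed

lemma poisson_int_holomorphic_radial:
  assumes F: "F holomorphic_on ball 0 1" and r: "0 \<le> r" "r < 1" and z: "cmod z < 1"
  shows "poisson_int (\<lambda>\<xi>. F (of_real r * \<xi>)) z = F (of_real r * z)"
proof -
  define a where "a k = (deriv ^^ k) F 0 / fact k" for k
  have a: "(\<lambda>k. a k * w ^ k) sums F w" if "cmod w < 1" for w
    using holomorphic_power_series[OF F, of w] that by (simp add: a_def)
  obtain s where s: "r < s" "s < 1" using dense r by blast
  have "summable (\<lambda>k. a k * of_real s ^ k)"
    using a[of "of_real s"] s r by (auto simp: sums_iff)
  then have sm: "summable (\<lambda>k. cmod (a k * of_real r ^ k))"
    by (rule powser_insidea) (use r s in simp)
  have "(\<lambda>k. a k * of_real r ^ k * (LINT \<xi>|circle. \<xi> ^ k * of_real (poisson z \<xi>))) sums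
     (LINT \<xi>|circle. (\<Sum>k. a k * of_real r ^ k * \<xi> ^ k) * of_real (poisson z \<xi>))"
  proof (rule sums_integral_power_series_circle[OF sm])
    show "(\<lambda>x. complex_of_real (poisson z x)) \<in> borel_measurable circle"
      using borel_measurable_circle_ident unfolding poisson_def by measurable
    show "cmod (complex_of_real (poisson z \<xi>)) \<le> 2 / (1 - cmod z)" if "cmod \<xi> = 1" for \<xi>
      using poisson_le[OF z that] poisson_pos[OF z that] by simp
  qed
  moreover have "(LINT \<xi>|circle. \<xi> ^ k * of_real (poisson z \<xi>)) = of_real (2 * pi) * z ^ k" for k
    using poisson_int_power[OF z, of k] unfolding poisson_int_def
    by (simp add: scaleR_conv_of_real mult.commute field_simps)
  moreover have "(LINT \<xi>|circle. (\<Sum>k. a k * of_real r ^ k * \<xi> ^ k) * of_real (poisson z \<xi>)) = (LINT \<xi>|circle. poisson z \<xi> *\<^sub>R F (of_real r * \<xi>))"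
  proof (rule Bochner_Integration.integral_cong[OF refl])
    fix \<xi> assume "\<xi> \<in> space circle"
    then have "cmod (of_real r * \<xi>) < 1" using norm_circle r by (simp add: norm_mult)
    from a[OF this] show "(\<Sum>k. a k * of_real r ^ k * \<xi> ^ k) * of_real (poisson z \<xi>) = poisson z \<xi> *\<^sub>R F (of_real r * \<xi>)"
      by (simp add: sums_iff power_mult_distrib mult.assoc scaleR_conv_of_real mult.commute[of "of_real (poisson z \<xi>)"])
  qed
  ultimately have 1: "(\<lambda>k. of_real (2 * pi) * (a k * (of_real r * z) ^ k)) sums (LINT \<xi>|circle. poisson z \<xi> *\<^sub>R F (of_real r * \<xi>))"
    by (simp add: power_mult_distrib mult_ac)
  have "r * cmod z \<le> 1 * cmod z" using r by (intro mult_right_mono) auto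
  then have "cmod (of_real r * z) < 1" using r z by (simp add: norm_mult)
  from sums_mult[OF a[OF this], of "of_real (2 * pi)"] 1
  have "(LINT \<xi>|circle. poisson z \<xi> *\<^sub>R F (of_real r * \<xi>)) = of_real (2 * pi) * F (of_real r * z)"
    by (rule sums_unique2[rotated])
  then show ?thesis by (simp add: poisson_int_def scaleR_conv_of_real)
qed

section \<open>The conjugate function\<close>

abbreviation herglotz_real :: "(complex \<Rightarrow> real) \<Rightarrow> complex \<Rightarrow> complex" where
  "herglotz_real f \<equiv> herglotz (\<lambda>\<xi>. complex_of_real (f \<xi>))"

text \<open>The conjugate function. It is defined along a fixed sequence of radii so that measurability, also with respect to further
  parameters, is immediate from the definition.\<close>

definition conj_fun :: "(complex \<Rightarrow> real) \<Rightarrow> complex \<Rightarrow> real" where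
  "conj_fun f \<zeta> = lim (\<lambda>n. Im (herglotz_real f (of_real (radius n) * \<zeta>)))"

lemma herglotz_real_0:
  assumes "integrable circle f"
  shows "Im (herglotz_real f 0) = 0"
  using herglotz_0[of "\<lambda>\<xi>. complex_of_real (f \<xi>)"] assms by simp

lemma herglotz_real_holomorphic: "integrable circle f \<Longrightarrow> herglotz_real f holomorphic_on ball 0 1"
  by (rule herglotz_holomorphic) simp

lemma integrable_radial_sq:
  assumes F: "F holomorphic_on ball 0 1" and r: "0 \<le> r" "r < 1"
  shows "integrable circle (\<lambda>\<xi>. (cmod (F (of_real r * \<xi>)))\<^sup>2)"
    "integrable circle (\<lambda>\<xi>. (Re (F (of_real r * \<xi>)))\<^sup>2)" "integrable circle (\<lambda>\<xi>. (Im (F (of_real r * \<xi>)))\<^sup>2)"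
proof -
  note c = holomorphic_on_imp_continuous_on[OF F]
  show "integrable circle (\<lambda>\<xi>. (cmod (F (of_real r * \<xi>)))\<^sup>2)"
    by (rule radial_integrable[of "\<lambda>z. (cmod (F z))\<^sup>2", OF _ r]) (intro continuous_intros c)
  show "integrable circle (\<lambda>\<xi>. (Re (F (of_real r * \<xi>)))\<^sup>2)"
    by (rule radial_integrable[of "\<lambda>z. (Re (F z))\<^sup>2", OF _ r]) (intro continuous_intros c)
  show "integrable circle (\<lambda>\<xi>. (Im (F (of_real r * \<xi>)))\<^sup>2)"
    by (rule radial_integrable[of "\<lambda>z. (Im (F z))\<^sup>2", OF _ r]) (intro continuous_intros c)
qed

text \<open>The case of constant weight in the inequality on the disc.\<close>

lemma herglotz_real_sq_bound:
  assumes f: "sq_integrable f" and r: "0 < r" "r < 1"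
  shows "(LINT \<xi>|circle. (cmod (herglotz_real f (of_real r * \<xi>)))\<^sup>2) \<le> 8/3 * (LINT \<xi>|circle. (f \<xi>)\<^sup>2)"
proof -
  note fi = sq_integrable_integrable[OF f]
  note F = herglotz_real_holomorphic[OF fi]
  have f2: "integrable circle (\<lambda>\<xi>. (f \<xi>)\<^sup>2)" using f by (simp add: sq_integrable_def)
  note I = integrable_radial_sq[OF F less_imp_le[OF r(1)] r(2)]
  have "(LINT \<xi>|circle. (Im (herglotz_real f (of_real r * \<xi>)))\<^sup>2) \<le> 5/3 * (LINT \<xi>|circle. (Re (herglotz_real f (of_real r * \<xi>)))\<^sup>2)"
    using weighted_conjugate_disc[of "\<lambda>_. 0" "\<lambda>_. 0", OF _ _ F _ _ herglotz_real_0[OF fi] r] by simp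
  moreover have "(LINT \<xi>|circle. (Re (herglotz_real f (of_real r * \<xi>)))\<^sup>2) \<le> (LINT \<xi>|circle. poisson_int (\<lambda>\<xi>. (f \<xi>)\<^sup>2) (of_real r * \<xi>))"
  proof (rule integral_mono[OF I(2)])
    show "integrable circle (\<lambda>\<xi>. poisson_int (\<lambda>\<xi>. (f \<xi>)\<^sup>2) (of_real r * \<xi>))"
      using r by (intro radial_integrable continuous_poisson_int f2) auto
    fix \<xi> assume "\<xi> \<in> space circle"
    then have z: "cmod (of_real r * \<xi>) < 1" using norm_circle r by (simp add: norm_mult)
    show "(Re (herglotz_real f (of_real r * \<xi>)))\<^sup>2 \<le> poisson_int (\<lambda>\<xi>. (f \<xi>)\<^sup>2) (of_real r * \<xi>)"
      unfolding Re_herglotz[OF fi z] by (rule poisson_int_sq_le[OF f z])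
  qed
  moreover have "(LINT \<xi>|circle. poisson_int (\<lambda>\<xi>. (f \<xi>)\<^sup>2) (of_real r * \<xi>)) = (LINT \<xi>|circle. (f \<xi>)\<^sup>2)"
    using r by (intro integral_poisson_int_radial f2) auto
  moreover have "(LINT \<xi>|circle. (cmod (herglotz_real f (of_real r * \<xi>)))\<^sup>2)
      = (LINT \<xi>|circle. (Re (herglotz_real f (of_real r * \<xi>)))\<^sup>2) + (LINT \<xi>|circle. (Im (herglotz_real f (of_real r * \<xi>)))\<^sup>2)"
    unfolding cmod_power2 using I by simp
  ultimately show ?thesis by simp
qed

text \<open>Suitable convex combinations of the functions on the smaller circles converge almost everywhere with an integrable
  majorant. Their limit has the original function as its Poisson integral, and Fatou's theorem identifies it as the radial
  limit.\<close>

theorem herglotz_real_radial_limit: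
  assumes f: "sq_integrable f"
  shows "AE \<zeta> in circle. ((\<lambda>r. herglotz_real f (of_real r * \<zeta>)) \<longlongrightarrow> Complex (f \<zeta>) (conj_fun f \<zeta>)) (at_left 1)"
proof -
  note fi = sq_integrable_integrable[OF f]
  define F where "F = herglotz_real f"
  have F: "F holomorphic_on ball 0 1" unfolding F_def by (rule herglotz_real_holomorphic[OF fi])
  have Fm: "(\<lambda>\<zeta>. F (of_real (radius k) * \<zeta>)) \<in> borel_measurable circle" for k
    by (intro radial_measurable holomorphic_on_imp_continuous_on F radius)
  obtain c N where w: "\<And>n. tail_weights n (N n) (c n)"
    and conv: "AE \<zeta> in circle. convergent (\<lambda>n. \<Sum>k\<le>N n. c n k *\<^sub>R F (of_real (radius k) * \<zeta>))"
    and dom: "\<exists>D. integrable circle D \<and> (AE \<zeta> in circle. \<forall>n. cmod (\<Sum>k\<le>N n. c n k *\<^sub>R F (of_real (radius k) * \<zeta>)) \<le> D \<zeta>)"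
  proof (rule Mazur_AE[OF finite_measure_circle, of "\<lambda>k \<zeta>. F (of_real (radius k) * \<zeta>)"])
    show "integrable circle (\<lambda>x. (cmod (F (of_real (radius n) * x)))\<^sup>2)" for n
      by (intro integrable_radial_sq F radius)
    show "(LINT x|circle. (cmod (F (of_real (radius n) * x)))\<^sup>2) \<le> 8/3 * (LINT \<xi>|circle. (f \<xi>)\<^sup>2)" for n
      unfolding F_def by (intro herglotz_real_sq_bound f radius)
  qed (rule Fm, blast)
  define G where "G n \<zeta> = (\<Sum>k\<le>N n. c n k *\<^sub>R F (of_real (radius k) * \<zeta>))" for n \<zeta>
  have Gm [measurable]: "G n \<in> borel_measurable circle" for n
    unfolding G_def using Fm by measurable
  obtain D where D: "integrable circle D" "AE \<zeta> in circle. \<forall>n. cmod (G n \<zeta>) \<le> D \<zeta>"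
    using dom unfolding G_def by blast
  define \<gamma> where "\<gamma> \<zeta> = lim (\<lambda>n. G n \<zeta>)" for \<zeta>
  have lim: "AE \<zeta> in circle. (\<lambda>n. G n \<zeta>) \<longlonglongrightarrow> \<gamma> \<zeta>"
    using conv unfolding \<gamma>_def G_def by eventually_elim (simp add: convergent_LIMSEQ_iff)
  have \<gamma>m [measurable]: "\<gamma> \<in> borel_measurable circle"
    unfolding \<gamma>_def by (rule borel_measurable_lim_metric) simp
  have Di: "integrable circle (G n)" for n
    by (rule Bochner_Integration.integrable_bound[OF D(1)])
      (use D(2) in \<open>auto elim!: eventually_mono intro: order.trans[OF _ abs_ge_self]\<close>)
  have \<gamma>i: "integrable circle \<gamma>"
    by (rule integrable_dominated_convergence[OF _ _ D(1) lim]) (use D(2) in \<open>auto elim!: eventually_mono\<close>)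
  \<comment> \<open>the same convex combinations of the values at \<open>radius k * z\<close> tend to \<open>F z\<close>, because the radii tend to \<open>1\<close>\<close>
  have P: "poisson_int \<gamma> z = F z" if z: "cmod z < 1" for z
  proof -
    have "(\<lambda>n. LINT \<xi>|circle. poisson z \<xi> *\<^sub>R G n \<xi>) \<longlonglongrightarrow> (LINT \<xi>|circle. poisson z \<xi> *\<^sub>R \<gamma> \<xi>)"
    proof (rule integral_dominated_convergence)
      show "integrable circle (\<lambda>\<xi>. poisson z \<xi> *\<^sub>R D \<xi>)" by (rule integrable_poisson[OF D(1) z])
      show "AE \<xi> in circle. norm (poisson z \<xi> *\<^sub>R G n \<xi>) \<le> poisson z \<xi> *\<^sub>R D \<xi>" for n
        using D(2) AE_space
      proof eventually_elim
        case (elim \<xi>)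
        then show ?case using poisson_pos[OF z norm_circle[OF elim(2)]] by simp
      qed
      show "AE \<xi> in circle. (\<lambda>n. poisson z \<xi> *\<^sub>R G n \<xi>) \<longlonglongrightarrow> poisson z \<xi> *\<^sub>R \<gamma> \<xi>"
        using lim by eventually_elim (intro tendsto_intros)
      show "(\<lambda>\<xi>. poisson z \<xi> *\<^sub>R \<gamma> \<xi>) \<in> borel_measurable circle" using integrable_poisson[OF \<gamma>i z] by simp
      show "(\<lambda>\<xi>. poisson z \<xi> *\<^sub>R G n \<xi>) \<in> borel_measurable circle" for n using integrable_poisson[OF Di z] by simp
    qed
    then have "(\<lambda>n. poisson_int (G n) z) \<longlonglongrightarrow> poisson_int \<gamma> z"
      unfolding poisson_int_def by (intro tendsto_intros)
    moreover have "poisson_int (G n) z = (\<Sum>k\<le>N n. c n k *\<^sub>R F (of_real (radius k) * z))" for n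
    proof -
      have Fi: "integrable circle (\<lambda>\<xi>. F (of_real (radius k) * \<xi>))" for k
      proof -
        obtain K where "\<And>\<zeta>. cmod \<zeta> = 1 \<Longrightarrow> norm (F (of_real (radius k) * \<zeta>)) \<le> K"
          using radial_bounded[OF holomorphic_on_imp_continuous_on[OF F] radius(2,3)] by blast
        then show ?thesis using norm_circle by (intro circle.integrable_const_bound[where B = K] AE_I2 Fm) auto
      qed
      have "(LINT \<xi>|circle. poisson z \<xi> *\<^sub>R G n \<xi>) = (LINT \<xi>|circle. (\<Sum>k\<le>N n. c n k *\<^sub>R (poisson z \<xi> *\<^sub>R F (of_real (radius k) * \<xi>))))"
        unfolding G_def by (simp add: scaleR_sum_right mult.commute)
      also have "\<dots> = (\<Sum>k\<le>N n. c n k *\<^sub>R (LINT \<xi>|circle. poisson z \<xi> *\<^sub>R F (of_real (radius k) * \<xi>)))"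
        using integrable_poisson[OF Fi z] by (subst Bochner_Integration.integral_sum) (simp_all del: scaleR_scaleR)
      finally have "poisson_int (G n) z = (\<Sum>k\<le>N n. c n k *\<^sub>R poisson_int (\<lambda>\<xi>. F (of_real (radius k) * \<xi>)) z)"
        unfolding poisson_int_def by (simp add: scaleR_sum_right mult.commute)
      then show ?thesis using poisson_int_holomorphic_radial[OF F radius(2,3) z] by simp
    qed
    moreover have "(\<lambda>n. \<Sum>k\<le>N n. c n k *\<^sub>R F (of_real (radius k) * z)) \<longlonglongrightarrow> F z"
    proof (rule tail_weights_tendsto[OF w])
      have "isCont F z" using holomorphic_on_imp_continuous_on[OF F] z by (simp add: continuous_on_eq_continuous_at)
      moreover have "(\<lambda>k. of_real (radius k) * z) \<longlonglongrightarrow> of_real 1 * z"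
        using radius_at_left by (intro tendsto_intros) (auto simp: filterlim_at)
      ultimately show "(\<lambda>k. F (of_real (radius k) * z)) \<longlonglongrightarrow> F z"
        by (intro isCont_tendsto_compose[where g = F]) simp_all
    qed
    ultimately show ?thesis by (simp add: LIMSEQ_unique)
  qed
  have ev: "eventually (\<lambda>r. r \<in> {0<..<1}) (at_left (1::real))" by (rule eventually_at_left_real) simp
  show ?thesis
    using Fatou_poisson_int[OF \<gamma>i] Fatou_poisson_int[OF fi] AE_space
  proof eventually_elim
    case (elim \<zeta>)
    have z1: "cmod \<zeta> = 1" by (rule norm_circle[OF elim(3)])
    have lim1: "((\<lambda>r. F (of_real r * \<zeta>)) \<longlongrightarrow> \<gamma> \<zeta>) (at_left 1)"
    proof (rule Lim_transform_eventually[OF elim(1)])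
      show "\<forall>\<^sub>F r in at_left 1. poisson_int \<gamma> (of_real r * \<zeta>) = F (of_real r * \<zeta>)"
        using ev by eventually_elim (use z1 in \<open>simp add: P norm_mult\<close>)
    qed
    have "((\<lambda>r. Re (F (of_real r * \<zeta>))) \<longlongrightarrow> f \<zeta>) (at_left 1)"
    proof (rule Lim_transform_eventually[OF elim(2)])
      show "\<forall>\<^sub>F r in at_left 1. poisson_int f (of_real r * \<zeta>) = Re (F (of_real r * \<zeta>))"
        using ev by eventually_elim (use z1 in \<open>simp add: F_def Re_herglotz[OF fi] norm_mult\<close>)
    qed
    then have "Re (\<gamma> \<zeta>) = f \<zeta>"
      using tendsto_Re[OF lim1] tendsto_unique trivial_limit_at_left_real by blast
    moreover have "(\<lambda>n. F (of_real (radius n) * \<zeta>)) \<longlonglongrightarrow> \<gamma> \<zeta>"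
      by (rule filterlim_compose[OF lim1 radius_at_left])
    then have "conj_fun f \<zeta> = Im (\<gamma> \<zeta>)"
      unfolding conj_fun_def F_def by (intro limI tendsto_Im)
    ultimately have "\<gamma> \<zeta> = Complex (f \<zeta>) (conj_fun f \<zeta>)" by (simp add: complex_eq_iff)
    then show ?case using lim1 by (simp add: F_def)
  qed
qed

lemma conj_fun_measurable:
  assumes "integrable circle f"
  shows "conj_fun f \<in> borel_measurable circle"
proof -
  have "(\<lambda>\<zeta>. Im (herglotz_real f (of_real (radius n) * \<zeta>))) \<in> borel_measurable circle" for n
    using radial_measurable[OF holomorphic_on_imp_continuous_on[OF herglotz_real_holomorphic[OF assms]] radius(2,3), of n]
    by measurable
  then show ?thesis unfolding conj_fun_def[abs_def] by (rule borel_measurable_lim_metric)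
qed

text \<open>Fatou's lemma for Bochner integrals of nonnegative real functions.\<close>

lemma integral_limit_le:
  fixes k :: "nat \<Rightarrow> 'a \<Rightarrow> real"
  assumes k: "\<And>n. integrable M (k n)" and k0: "\<And>n. AE x in M. 0 \<le> k n x"
    and lim: "AE x in M. (\<lambda>n. k n x) \<longlonglongrightarrow> h x" and h [measurable]: "h \<in> borel_measurable M"
    and C: "\<And>n. (LINT x|M. k n x) \<le> C"
  shows "integrable M h" "(LINT x|M. h x) \<le> C"
proof -
  have k0': "AE x in M. \<forall>n. 0 \<le> k n x" using k0 by (simp add: AE_all_countable)
  have h0: "AE x in M. 0 \<le> h x" using k0' lim by eventually_elim (auto intro: LIMSEQ_le_const)
  have C0: "0 \<le> C" using integral_nonneg_AE[OF k0[of 0]] C[of 0] by linarith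
  have "(\<integral>\<^sup>+x. ennreal (h x) \<partial>M) = (\<integral>\<^sup>+x. liminf (\<lambda>n. ennreal (k n x)) \<partial>M)"
  proof (rule nn_integral_cong_AE)
    show "AE x in M. ennreal (h x) = liminf (\<lambda>n. ennreal (k n x))"
      using lim
    proof eventually_elim
      case (elim x)
      have "(\<lambda>n. ennreal (k n x)) \<longlonglongrightarrow> ennreal (h x)" using elim by (rule tendsto_ennrealI)
      then show ?case by (simp add: lim_imp_Liminf)
    qed
  qed
  also have "\<dots> \<le> liminf (\<lambda>n. \<integral>\<^sup>+x. ennreal (k n x) \<partial>M)"
    by (rule nn_integral_liminf) (use k in auto)
  also have "\<dots> \<le> liminf (\<lambda>n. ennreal C)"
  proof (rule Liminf_mono, rule always_eventually, rule allI)
    fix n show "(\<integral>\<^sup>+x. ennreal (k n x) \<partial>M) \<le> ennreal C"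
      using C[of n] by (simp add: nn_integral_eq_integral[OF k k0] ennreal_leI)
  qed
  also have "\<dots> = ennreal C" by (simp add: Liminf_const)
  finally have le: "(\<integral>\<^sup>+x. ennreal (h x) \<partial>M) \<le> ennreal C" .
  show i: "integrable M h"
    by (rule integrableI_nonneg) (use h0 le in \<open>auto simp: less_top[symmetric] top_unique\<close>)
  show "(LINT x|M. h x) \<le> C"
    using le C0 unfolding nn_integral_eq_integral[OF i h0] by simp
qed

section \<open>The weighted inequality on the circle\<close>

text \<open>Garsia's description of bounded mean oscillation: the variance with respect to every Poisson kernel is bounded. This form
  provides the two analytic functions with small gap that the Bellman function asks for.\<close>

definition garsia_bounded :: "real \<Rightarrow> (complex \<Rightarrow> real) \<Rightarrow> bool" where
  "garsia_bounded K \<phi> \<longleftrightarrow> sq_integrable \<phi> \<and>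
     (\<forall>z. cmod z < 1 \<longrightarrow> poisson_int (\<lambda>\<xi>. (\<phi> \<xi>)\<^sup>2) z - (poisson_int \<phi> z)\<^sup>2 \<le> K)"

text \<open>The weight \<open>exp (\<delta> \<phi>)\<close> with \<open>\<phi>\<close> replaced by its Poisson integral on a smaller circle. This keeps the weight bounded
  above and below, so that the weighted and the unweighted square integrable functions are the same, while all constants remain
  independent of \<open>r\<close>.\<close>

definition exp_weight :: "real \<Rightarrow> (complex \<Rightarrow> real) \<Rightarrow> real \<Rightarrow> complex \<Rightarrow> real" where
  "exp_weight \<delta> \<phi> r z = exp (\<delta> * poisson_int \<phi> (of_real r * z))"

lemma exp_weight_pos: "0 < exp_weight \<delta> \<phi> r z"
  by (simp add: exp_weight_def)

lemma exp_weight_neg: "exp_weight (- \<delta>) \<phi> r z = inverse (exp_weight \<delta> \<phi> r z)"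
  by (simp add: exp_weight_def exp_minus)

lemma exp_weight_continuous:
  assumes "integrable circle \<phi>" "0 \<le> r" "r < 1"
  shows "continuous_on (cball 0 1) (exp_weight \<delta> \<phi> r)"
proof -
  have "cmod (of_real r * z) < 1" if "cmod z \<le> 1" for z
    using mult_left_mono[OF that assms(2)] assms by (simp add: norm_mult)
  then show ?thesis unfolding exp_weight_def[abs_def]
    by (intro continuous_intros continuous_on_compose2[OF continuous_poisson_int[OF assms(1)]]) auto
qed

lemma exp_weight_bounds:
  assumes "integrable circle \<phi>" "0 \<le> r" "r < 1"
  obtains K where "\<And>z. cmod z \<le> 1 \<Longrightarrow> exp_weight \<delta> \<phi> r z \<le> K"
proof -
  have "bounded (exp_weight \<delta> \<phi> r ` cball 0 1)"
    by (intro compact_imp_bounded compact_continuous_image exp_weight_continuous assms) simp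
  then obtain K where "\<forall>x\<in>exp_weight \<delta> \<phi> r ` cball 0 1. norm x \<le> K" unfolding bounded_iff by blast
  then show ?thesis by (intro that[of K]) (auto simp: abs_le_iff)
qed

lemma exp_weight_measurable:
  assumes "integrable circle \<phi>" "0 \<le> r" "r < 1"
  shows "exp_weight \<delta> \<phi> r \<in> borel_measurable circle"
  unfolding exp_weight_def[abs_def]
  using radial_measurable_real[OF continuous_poisson_int[OF assms(1)] assms(2,3)] by measurable

text \<open>The inequality on the disc, applied on circles of radius \<open>\<rho>\<close> tending to \<open>1\<close>. On the left, Fatou's lemma suffices; the right hand side
  needs convergence of \<open>\<integral> w (Re F)\<^sup>2\<close>, which is obtained by applying Fatou's lemma to the difference from the
  larger function \<open>L P(f\<^sup>2)\<close>, whose integral does not depend on the radius.\<close>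

theorem weighted_conj_fun:
  assumes \<phi>: "garsia_bounded K \<phi>" and \<delta>: "\<delta>\<^sup>2 * K \<le> 1 / 200" and r: "0 \<le> r" "r < 1"
    and f: "sq_integrable f"
  shows "integrable circle (\<lambda>\<zeta>. exp_weight \<delta> \<phi> r \<zeta> * (conj_fun f \<zeta>)\<^sup>2)"
    and "(LINT \<zeta>|circle. exp_weight \<delta> \<phi> r \<zeta> * (conj_fun f \<zeta>)\<^sup>2) \<le> 5/3 * (LINT \<zeta>|circle. exp_weight \<delta> \<phi> r \<zeta> * (f \<zeta>)\<^sup>2)"
proof -
  have \<phi>s: "sq_integrable \<phi>" using \<phi> by (simp add: garsia_bounded_def)
  note \<phi>i = sq_integrable_integrable[OF \<phi>s] and fi = sq_integrable_integrable[OF f]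
  have \<phi>2: "integrable circle (\<lambda>\<xi>. (\<phi> \<xi>)\<^sup>2)" using \<phi>s by (simp add: sq_integrable_def)
  have f2: "integrable circle (\<lambda>\<xi>. (f \<xi>)\<^sup>2)" using f by (simp add: sq_integrable_def)
  define W where "W = exp_weight \<delta> \<phi> r"
  define F where "F = herglotz_real f"
  have F: "F holomorphic_on ball 0 1" unfolding F_def by (rule herglotz_real_holomorphic[OF fi])
  have rz: "cmod (of_real r * z) < 1" if "cmod z \<le> 1" for z :: complex
    using mult_left_mono[OF that r(1)] r by (simp add: norm_mult)
  obtain L where L: "\<And>z. cmod z \<le> 1 \<Longrightarrow> W z \<le> L" using exp_weight_bounds[OF \<phi>i r] unfolding W_def by metis
  have W0: "0 < W z" for z by (simp add: W_def exp_weight_pos)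
  have Wc: "continuous_on (cball 0 1) W" unfolding W_def by (rule exp_weight_continuous[OF \<phi>i r])
  have Wm [measurable]: "W \<in> borel_measurable circle" unfolding W_def by (rule exp_weight_measurable[OF \<phi>i r])
  have L0: "0 \<le> L" using L[of 0] W0[of 0] by simp
  have hol: "(\<lambda>z. herglotz_real h (of_real r * z)) holomorphic_on ball 0 1" if "integrable circle h" for h
  proof -
    have "(herglotz_real h \<circ> (\<lambda>z. of_real r * z)) holomorphic_on ball 0 1"
      by (rule holomorphic_on_compose_gen[OF _ herglotz_real_holomorphic[OF that]])
        (use rz in \<open>auto intro!: holomorphic_intros\<close>)
    then show ?thesis by (simp add: o_def)
  qed
  define A where "A z = of_real \<delta> * herglotz_real \<phi> (of_real r * z)" for z
  define B where "B z = of_real (\<delta>\<^sup>2) * herglotz_real (\<lambda>\<xi>. (\<phi> \<xi>)\<^sup>2) (of_real r * z)" for z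
  have A: "A holomorphic_on ball 0 1" unfolding A_def[abs_def] by (intro holomorphic_intros hol \<phi>i)
  have B: "B holomorphic_on ball 0 1" unfolding B_def[abs_def] by (intro holomorphic_intros hol \<phi>2)
  have ReA: "Re (A z) = \<delta> * poisson_int \<phi> (of_real r * z)" if "cmod z \<le> 1" for z
    using Re_herglotz[OF \<phi>i rz[OF that]] by (simp add: A_def)
  have ReB: "Re (B z) = \<delta>\<^sup>2 * poisson_int (\<lambda>\<xi>. (\<phi> \<xi>)\<^sup>2) (of_real r * z)" if "cmod z \<le> 1" for z
    using Re_herglotz[OF \<phi>2 rz[OF that]] by (simp add: B_def)
  have osc: "Re (B z) - (Re (A z))\<^sup>2 = \<delta>\<^sup>2 * (poisson_int (\<lambda>\<xi>. (\<phi> \<xi>)\<^sup>2) (of_real r * z) - (poisson_int \<phi> (of_real r * z))\<^sup>2)"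
    if "cmod z \<le> 1" for z
    unfolding ReA[OF that] ReB[OF that] by (simp add: power_mult_distrib algebra_simps)
  have WA: "exp (Re (A z)) = W z" if "cmod z \<le> 1" for z
    unfolding ReA[OF that] W_def exp_weight_def ..
  define f' where "f' n \<zeta> = Re (F (of_real (radius n) * \<zeta>))" for n \<zeta>
  define g' where "g' n \<zeta> = Im (F (of_real (radius n) * \<zeta>))" for n \<zeta>
  define w where "w n \<zeta> = W (of_real (radius n) * \<zeta>)" for n \<zeta>
  define q where "q n \<zeta> = poisson_int (\<lambda>\<xi>. (f \<xi>)\<^sup>2) (of_real (radius n) * \<zeta>)" for n \<zeta>
  have nz: "cmod (of_real (radius n) * \<zeta>) < 1" if "cmod \<zeta> = 1" for n \<zeta> using that radius[of n] by (simp add: norm_mult)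
  have ineq: "(LINT \<zeta>|circle. w n \<zeta> * (g' n \<zeta>)\<^sup>2) \<le> 5/3 * (LINT \<zeta>|circle. w n \<zeta> * (f' n \<zeta>)\<^sup>2)" for n
  proof -
    have 1: "0 \<le> Re (B z) - (Re (A z))\<^sup>2" if "cmod z < 1" for z
      using osc[of z] poisson_int_sq_le[OF \<phi>s rz, of z] that by simp
    have 2: "Re (B z) - (Re (A z))\<^sup>2 \<le> 1 / 200" if z: "cmod z < 1" for z
    proof -
      have "poisson_int (\<lambda>\<xi>. (\<phi> \<xi>)\<^sup>2) (of_real r * z) - (poisson_int \<phi> (of_real r * z))\<^sup>2 \<le> K"
        using \<phi> rz[of z] z by (simp add: garsia_bounded_def)
      then have "\<delta>\<^sup>2 * (poisson_int (\<lambda>\<xi>. (\<phi> \<xi>)\<^sup>2) (of_real r * z) - (poisson_int \<phi> (of_real r * z))\<^sup>2) \<le> \<delta>\<^sup>2 * K"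
        by (rule mult_left_mono) simp
      then show ?thesis using osc[of z] z \<delta> by simp
    qed
    have "(LINT \<xi>|circle. exp (Re (A (of_real (radius n) * \<xi>))) * (Im (F (of_real (radius n) * \<xi>)))\<^sup>2)
      \<le> 5/3 * (LINT \<xi>|circle. exp (Re (A (of_real (radius n) * \<xi>))) * (Re (F (of_real (radius n) * \<xi>)))\<^sup>2)"
      by (rule weighted_conjugate_disc[OF A B F 1 2 _ radius(1,3)]) (use herglotz_real_0[OF fi] in \<open>simp_all add: F_def\<close>)
    moreover have "(LINT \<xi>|circle. exp (Re (A (of_real (radius n) * \<xi>))) * (Im (F (of_real (radius n) * \<xi>)))\<^sup>2) = (LINT \<zeta>|circle. w n \<zeta> * (g' n \<zeta>)\<^sup>2)"
      "(LINT \<xi>|circle. exp (Re (A (of_real (radius n) * \<xi>))) * (Re (F (of_real (radius n) * \<xi>)))\<^sup>2) = (LINT \<zeta>|circle. w n \<zeta> * (f' n \<zeta>)\<^sup>2)"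
      unfolding w_def g'_def f'_def
      using WA nz norm_circle by (auto intro!: Bochner_Integration.integral_cong simp: less_imp_le)
    ultimately show ?thesis by simp
  qed
  have cF: "continuous_on (ball 0 1) F" by (rule holomorphic_on_imp_continuous_on[OF F])
  have cW: "continuous_on (ball 0 1) W" using Wc by (rule continuous_on_subset) auto
  have i1: "integrable circle (\<lambda>\<zeta>. w n \<zeta> * (g' n \<zeta>)\<^sup>2)" for n
    unfolding w_def g'_def by (rule radial_integrable[of "\<lambda>z. W z * (Im (F z))\<^sup>2", OF _ radius(2,3)]) (intro continuous_intros cF cW)
  have i2: "integrable circle (\<lambda>\<zeta>. w n \<zeta> * (f' n \<zeta>)\<^sup>2)" for n
    unfolding w_def f'_def by (rule radial_integrable[of "\<lambda>z. W z * (Re (F z))\<^sup>2", OF _ radius(2,3)]) (intro continuous_intros cF cW)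
  have i3: "integrable circle (q n)" for n
    unfolding q_def by (intro radial_integrable continuous_poisson_int f2 radius)
  \<comment> \<open>adding \<open>5/3 (L q - w f'\<^sup>2) \<ge> 0\<close> turns the difference of the two sides into a nonnegative function\<close>
  define k where "k n \<zeta> = 5/3 * (L * q n \<zeta> - w n \<zeta> * (f' n \<zeta>)\<^sup>2) + w n \<zeta> * (g' n \<zeta>)\<^sup>2" for n \<zeta>
  define h where "h \<zeta> = 5/3 * (L * (f \<zeta>)\<^sup>2 - W \<zeta> * (f \<zeta>)\<^sup>2) + W \<zeta> * (conj_fun f \<zeta>)\<^sup>2" for \<zeta>
  have [measurable]: "conj_fun f \<in> borel_measurable circle" by (rule conj_fun_measurable[OF fi])
  have [measurable]: "f \<in> borel_measurable circle" using fi by simp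
  have k1: "integrable circle (k n)" for n
    unfolding k_def using i1 i2 i3 by simp
  have k2: "AE \<zeta> in circle. 0 \<le> k n \<zeta>" for n
    proof (rule AE_I2)
      fix \<zeta> assume "\<zeta> \<in> space circle"
      then have z: "cmod \<zeta> = 1" by (rule norm_circle)
      have "(f' n \<zeta>)\<^sup>2 \<le> q n \<zeta>"
        unfolding f'_def q_def F_def Re_herglotz[OF fi nz[OF z]] by (rule poisson_int_sq_le[OF f nz[OF z]])
      moreover have "w n \<zeta> \<le> L" unfolding w_def using nz[OF z, of n] by (intro L) simp
      moreover have "0 \<le> w n \<zeta>" unfolding w_def using W0 by (simp add: less_imp_le)
      ultimately have "w n \<zeta> * (f' n \<zeta>)\<^sup>2 \<le> L * q n \<zeta>" using L0 by (intro mult_mono) auto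
      then show "0 \<le> k n \<zeta>" unfolding k_def using \<open>0 \<le> w n \<zeta>\<close> by simp
    qed
  have k3: "AE \<zeta> in circle. (\<lambda>n. k n \<zeta>) \<longlonglongrightarrow> h \<zeta>"
      using herglotz_real_radial_limit[OF f] Fatou_poisson_int[OF f2] AE_space
    proof eventually_elim
      case (elim \<zeta>)
      have "(\<lambda>n. F (of_real (radius n) * \<zeta>)) \<longlonglongrightarrow> Complex (f \<zeta>) (conj_fun f \<zeta>)"
        unfolding F_def by (rule filterlim_compose[OF elim(1) radius_at_left])
      then have l1: "(\<lambda>n. f' n \<zeta>) \<longlonglongrightarrow> f \<zeta>" "(\<lambda>n. g' n \<zeta>) \<longlonglongrightarrow> conj_fun f \<zeta>"
        unfolding f'_def g'_def by (auto dest: tendsto_Re tendsto_Im)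
      have l2: "(\<lambda>n. q n \<zeta>) \<longlonglongrightarrow> (f \<zeta>)\<^sup>2"
        unfolding q_def by (rule filterlim_compose[OF elim(2) radius_at_left])
      have "(\<lambda>n. of_real (radius n) * \<zeta>) \<longlonglongrightarrow> of_real 1 * \<zeta>"
        using radius_at_left by (intro tendsto_intros) (auto simp: filterlim_at)
      then have l3: "(\<lambda>n. w n \<zeta>) \<longlonglongrightarrow> W \<zeta>"
        unfolding w_def using nz[OF norm_circle[OF elim(3)]] norm_circle[OF elim(3)]
        by (intro continuous_on_tendsto_compose[OF Wc]) (auto simp: less_imp_le)
      show ?case unfolding k_def h_def by (intro tendsto_intros l1 l2 l3)
    qed
  have k4: "h \<in> borel_measurable circle"
    unfolding h_def[abs_def] by measurable
  have k5: "(LINT \<zeta>|circle. k n \<zeta>) \<le> 5/3 * (L * (LINT \<zeta>|circle. (f \<zeta>)\<^sup>2))" for n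
  proof -
    have "(LINT \<zeta>|circle. k n \<zeta>) = 5/3 * (L * (LINT \<zeta>|circle. q n \<zeta>) - (LINT \<zeta>|circle. w n \<zeta> * (f' n \<zeta>)\<^sup>2)) + (LINT \<zeta>|circle. w n \<zeta> * (g' n \<zeta>)\<^sup>2)"
      unfolding k_def using i1[of n] i2[of n] i3[of n] by simp
    also have "\<dots> \<le> 5/3 * (L * (LINT \<zeta>|circle. q n \<zeta>))" unfolding right_diff_distrib using ineq[of n] by linarith
    also have "(LINT \<zeta>|circle. q n \<zeta>) = (LINT \<zeta>|circle. (f \<zeta>)\<^sup>2)"
      unfolding q_def by (rule integral_poisson_int_radial[OF f2 _ radius(2,3)]) simp
    finally show ?thesis .
  qed
  note hh = integral_limit_le[OF k1 k2 k3 k4 k5]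
  have iWf: "integrable circle (\<lambda>\<zeta>. W \<zeta> * (f \<zeta>)\<^sup>2)"
  proof (rule Bochner_Integration.integrable_bound)
    show "integrable circle (\<lambda>\<zeta>. L * (f \<zeta>)\<^sup>2)" using f2 by simp
    show "AE \<zeta> in circle. norm (W \<zeta> * (f \<zeta>)\<^sup>2) \<le> norm (L * (f \<zeta>)\<^sup>2)"
      using L W0 L0 by (intro AE_I2) (auto dest!: norm_circle simp: abs_mult abs_of_pos intro!: mult_right_mono)
  qed measurable
  have eq: "W \<zeta> * (conj_fun f \<zeta>)\<^sup>2 = h \<zeta> - 5/3 * (L * (f \<zeta>)\<^sup>2 - W \<zeta> * (f \<zeta>)\<^sup>2)" for \<zeta> by (simp add: h_def)
  show "integrable circle (\<lambda>\<zeta>. exp_weight \<delta> \<phi> r \<zeta> * (conj_fun f \<zeta>)\<^sup>2)"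
    unfolding W_def[symmetric] eq using hh(1) f2 iWf by simp
  show "(LINT \<zeta>|circle. exp_weight \<delta> \<phi> r \<zeta> * (conj_fun f \<zeta>)\<^sup>2) \<le> 5/3 * (LINT \<zeta>|circle. exp_weight \<delta> \<phi> r \<zeta> * (f \<zeta>)\<^sup>2)"
  proof -
    have "(LINT \<zeta>|circle. W \<zeta> * (conj_fun f \<zeta>)\<^sup>2)
        = (LINT \<zeta>|circle. h \<zeta>) - 5/3 * (L * (LINT \<zeta>|circle. (f \<zeta>)\<^sup>2) - (LINT \<zeta>|circle. W \<zeta> * (f \<zeta>)\<^sup>2))"
      unfolding eq using hh(1) f2 iWf by simp
    then show ?thesis unfolding W_def[symmetric] right_diff_distrib using hh(2) by linarith
  qed
qed

section \<open>Factorization of weights\<close>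

lemma sq_integrable_measurable: "sq_integrable f \<Longrightarrow> f \<in> borel_measurable circle"
  by (simp add: sq_integrable_def)

lemma sq_integrable_add:
  assumes f: "sq_integrable f" and g: "sq_integrable g"
  shows "sq_integrable (\<lambda>\<xi>. f \<xi> + g \<xi>)"
proof -
  have [measurable]: "f \<in> borel_measurable circle" "g \<in> borel_measurable circle"
    using f g by (auto simp: sq_integrable_def)
  have "integrable circle (\<lambda>\<xi>. (f \<xi> + g \<xi>)\<^sup>2)"
  proof (rule Bochner_Integration.integrable_bound)
    show "integrable circle (\<lambda>\<xi>. 2 * (f \<xi>)\<^sup>2 + 2 * (g \<xi>)\<^sup>2)" using f g by (simp add: sq_integrable_def)
    have "(x + y)\<^sup>2 \<le> 2 * x\<^sup>2 + 2 * y\<^sup>2" for x y :: real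
      using sum_squares_bound[of x y] by (simp add: power2_eq_square algebra_simps)
    then show "AE \<xi> in circle. norm ((f \<xi> + g \<xi>)\<^sup>2) \<le> norm (2 * (f \<xi>)\<^sup>2 + 2 * (g \<xi>)\<^sup>2)" by (intro AE_I2) simp
  qed measurable
  then show ?thesis by (simp add: sq_integrable_def)
qed

lemma sq_integrable_mult:
  assumes f: "sq_integrable f" and g [measurable]: "g \<in> borel_measurable circle" and K: "\<And>\<xi>. cmod \<xi> = 1 \<Longrightarrow> \<bar>g \<xi>\<bar> \<le> K"
  shows "sq_integrable (\<lambda>\<xi>. f \<xi> * g \<xi>)"
proof -
  have [measurable]: "f \<in> borel_measurable circle" using f by (simp add: sq_integrable_def)
  have "integrable circle (\<lambda>\<xi>. (f \<xi> * g \<xi>)\<^sup>2)"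
  proof (rule Bochner_Integration.integrable_bound)
    show "integrable circle (\<lambda>\<xi>. K\<^sup>2 * (f \<xi>)\<^sup>2)" using f by (simp add: sq_integrable_def)
    show "AE \<xi> in circle. norm ((f \<xi> * g \<xi>)\<^sup>2) \<le> norm (K\<^sup>2 * (f \<xi>)\<^sup>2)"
    proof (rule AE_I2)
      fix \<xi> assume "\<xi> \<in> space circle"
      then have "\<bar>g \<xi>\<bar>\<^sup>2 \<le> K\<^sup>2" using K norm_circle by (intro power_mono) auto
      then have "(f \<xi>)\<^sup>2 * (g \<xi>)\<^sup>2 \<le> (f \<xi>)\<^sup>2 * K\<^sup>2" by (intro mult_left_mono) auto
      then show "norm ((f \<xi> * g \<xi>)\<^sup>2) \<le> norm (K\<^sup>2 * (f \<xi>)\<^sup>2)" by (simp add: power_mult_distrib mult.commute)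
    qed
  qed measurable
  then show ?thesis by (simp add: sq_integrable_def)
qed

lemma conj_fun_tendsto:
  assumes f: "sq_integrable f"
  shows "AE \<zeta> in circle. (\<lambda>n. Im (herglotz_real f (of_real (radius n) * \<zeta>))) \<longlonglongrightarrow> conj_fun f \<zeta>"
  using herglotz_real_radial_limit[OF f]
proof eventually_elim
  case (elim \<zeta>)
  from tendsto_Im[OF filterlim_compose[OF elim radius_at_left]] show ?case by simp
qed

lemma conj_fun_cong_AE:
  assumes "AE \<xi> in circle. f \<xi> = g \<xi>" and m: "f \<in> borel_measurable circle" "g \<in> borel_measurable circle"
  shows "conj_fun f = conj_fun g"
proof -
  have "herglotz_real f z = herglotz_real g z" for z
    unfolding herglotz_def
    by (intro arg_cong2[where f = "(/)"] integral_cong_AE refl)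
      (use assms borel_measurable_circle_ident in \<open>auto elim!: eventually_mono intro!: borel_measurable_times borel_measurable_divide borel_measurable_add borel_measurable_diff\<close>)
  then show ?thesis by (simp add: conj_fun_def[abs_def])
qed

lemma conj_fun_add:
  assumes f: "sq_integrable f" and g: "sq_integrable g"
  shows "AE \<zeta> in circle. conj_fun (\<lambda>\<xi>. f \<xi> + g \<xi>) \<zeta> = conj_fun f \<zeta> + conj_fun g \<zeta>"
  using conj_fun_tendsto[OF f] conj_fun_tendsto[OF g] AE_space
proof eventually_elim
  case (elim \<zeta>)
  have "herglotz_real (\<lambda>\<xi>. f \<xi> + g \<xi>) z = herglotz_real f z + herglotz_real g z" if "cmod z < 1" for z
    using integrable_herglotz[OF integrable_of_real[OF sq_integrable_integrable[OF f]] that]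
      integrable_herglotz[OF integrable_of_real[OF sq_integrable_integrable[OF g]] that]
    by (simp add: herglotz_def distrib_right add_divide_distrib)
  then have "Im (herglotz_real (\<lambda>\<xi>. f \<xi> + g \<xi>) (of_real (radius n) * \<zeta>))
     = Im (herglotz_real f (of_real (radius n) * \<zeta>)) + Im (herglotz_real g (of_real (radius n) * \<zeta>))" for n
    using radius[of n] norm_circle[OF elim(3)] by (simp add: norm_mult)
  then have "(\<lambda>n. Im (herglotz_real (\<lambda>\<xi>. f \<xi> + g \<xi>) (of_real (radius n) * \<zeta>))) \<longlonglongrightarrow> conj_fun f \<zeta> + conj_fun g \<zeta>"
    using tendsto_add[OF elim(1,2)] by simp
  then show ?case unfolding conj_fun_def[of "\<lambda>\<xi>. f \<xi> + g \<xi>"] by (rule limI)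
qed

lemma conj_fun_sum:
  fixes h :: "nat \<Rightarrow> complex \<Rightarrow> real"
  assumes h: "\<And>n. sq_integrable (h n)"
  shows "sq_integrable (\<lambda>\<xi>. \<Sum>n<N. h n \<xi>)"
    and "AE \<zeta> in circle. conj_fun (\<lambda>\<xi>. \<Sum>n<N. h n \<xi>) \<zeta> = (\<Sum>n<N. conj_fun (h n) \<zeta>)"
proof (induction N)
  case 0
  { case 1 show ?case by (simp add: sq_integrable_def) }
  { case 2 show ?case by (simp add: conj_fun_def herglotz_def) }
next
  case (Suc N)
  { case 1 show ?case using sq_integrable_add[OF Suc(1) h[of N]] by simp }
  { case 2 show ?case using conj_fun_add[OF Suc(1) h[of N]] Suc(2) by eventually_elim simp }
qed

text \<open>The inequality of Cauchy and Schwarz with the weights \<open>2\<^sup>n\<close> and \<open>2\<^sup>-\<^sup>n\<close>.\<close>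

lemma weighted_series:
  fixes a :: "nat \<Rightarrow> real"
  assumes a: "\<And>n. 0 \<le> a n" and s: "summable (\<lambda>n. 2 ^ n * (a n)\<^sup>2)"
  shows "summable a" "(\<Sum>n. a n)\<^sup>2 \<le> 2 * (\<Sum>n. 2 ^ n * (a n)\<^sup>2)"
proof -
  show sa: "summable a"
  proof (rule summable_comparison_test')
    show "summable (\<lambda>n. (1/2) ^ n + 2 ^ n * (a n)\<^sup>2)"
      using s by (intro summable_add summable_geometric) simp_all
    fix n
    have "0 \<le> (2 ^ n * a n - 1)\<^sup>2" by simp
    then have "2 * (2 ^ n * a n) \<le> 1 + 2 ^ n * (2 ^ n * (a n)\<^sup>2)"
      by (simp add: power2_eq_square algebra_simps)
    then have "2 ^ n * (2 * a n) \<le> 2 ^ n * ((1/2) ^ n + 2 ^ n * (a n)\<^sup>2)"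
      by (simp add: algebra_simps power_one_over)
    then have "2 * a n \<le> (1/2) ^ n + 2 ^ n * (a n)\<^sup>2" by simp
    then show "norm (a n) \<le> (1/2) ^ n + 2 ^ n * (a n)\<^sup>2" using a[of n] by simp
  qed
  show "(\<Sum>n. a n)\<^sup>2 \<le> 2 * (\<Sum>n. 2 ^ n * (a n)\<^sup>2)"
  proof (rule LIMSEQ_le_const2)
    show "(\<lambda>N. (\<Sum>n<N. a n)\<^sup>2) \<longlonglongrightarrow> (\<Sum>n. a n)\<^sup>2"
      by (intro tendsto_power summable_LIMSEQ sa)
    show "\<exists>N. \<forall>n\<ge>N. (\<Sum>n<n. a n)\<^sup>2 \<le> 2 * (\<Sum>n. 2 ^ n * (a n)\<^sup>2)"
    proof (intro exI allI impI)
      fix N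
      have e: "sqrt ((1/2) ^ n) * (sqrt (2 ^ n) * a n) = a n" for n
        by (simp add: real_sqrt_mult[symmetric] power_one_over flip: mult.assoc)
      have "(\<Sum>n<N. a n)\<^sup>2 = (\<Sum>n<N. sqrt ((1/2) ^ n) * (sqrt (2 ^ n) * a n))\<^sup>2" by (simp only: e)
      also have "\<dots> \<le> (\<Sum>n<N. (sqrt ((1/2) ^ n))\<^sup>2) * (\<Sum>n<N. (sqrt (2 ^ n) * a n)\<^sup>2)"
        by (rule Cauchy_Schwarz_ineq_sum)
      also have "\<dots> = (\<Sum>n<N. (1/2) ^ n) * (\<Sum>n<N. 2 ^ n * (a n)\<^sup>2)"
        by (simp add: power_mult_distrib)
      also have "\<dots> \<le> 2 * (\<Sum>n. 2 ^ n * (a n)\<^sup>2)"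
      proof (rule mult_mono)
        have "(\<Sum>n<N. (1/2::real) ^ n) \<le> (\<Sum>n. (1/2) ^ n)" by (intro sum_le_suminf summable_geometric) auto
        then show "(\<Sum>n<N. (1/2::real) ^ n) \<le> 2" by (simp add: suminf_geometric)
        show "(\<Sum>n<N. 2 ^ n * (a n)\<^sup>2) \<le> (\<Sum>n. 2 ^ n * (a n)\<^sup>2)" by (intro sum_le_suminf s) auto
      qed (auto intro: sum_nonneg)
      finally show "(\<Sum>n<N. a n)\<^sup>2 \<le> 2 * (\<Sum>n. 2 ^ n * (a n)\<^sup>2)" .
    qed
  qed
qed

lemma sq_integrable_series:
  assumes a: "\<And>n. sq_integrable (a n)" and a0: "\<And>n \<xi>. 0 \<le> a n \<xi>"
    and le: "\<And>n. (LINT \<xi>|circle. (a n \<xi>)\<^sup>2) \<le> C * (1/4) ^ n"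
  shows "AE \<xi> in circle. summable (\<lambda>n. a n \<xi>)"
    and "sq_integrable (\<lambda>\<xi>. \<Sum>n. a n \<xi>)"
    and "(LINT \<xi>|circle. (\<Sum>n. a n \<xi>)\<^sup>2) \<le> 4 * C"
proof -
  have [measurable]: "a n \<in> borel_measurable circle" for n using a by (simp add: sq_integrable_def)
  define h where "h n \<xi> = 2 ^ n * (a n \<xi>)\<^sup>2" for n \<xi>
  have hi: "integrable circle (h n)" and h0: "0 \<le> h n \<xi>" for n \<xi>
    using a by (auto simp: h_def[abs_def] sq_integrable_def)
  have hle: "(LINT \<xi>|circle. h n \<xi>) \<le> C * (1/2) ^ n" for n
  proof -
    have "(LINT \<xi>|circle. h n \<xi>) = 2 ^ n * (LINT \<xi>|circle. (a n \<xi>)\<^sup>2)" by (simp add: h_def)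
    also have "\<dots> \<le> 2 ^ n * (C * (1/4) ^ n)" using le by (intro mult_left_mono) auto
    also have "\<dots> = C * (1/2) ^ n"
    proof -
      have "(2::real) ^ n * (1/4) ^ n = (1/2) ^ n" by (simp flip: power_mult_distrib)
      then show ?thesis by (metis mult.assoc mult.commute)
    qed
    finally show ?thesis .
  qed
  have sC: "summable (\<lambda>n. C * (1/2::real) ^ n)" by (intro summable_mult summable_geometric) simp
  have hs: "summable (\<lambda>n. LINT \<xi>|circle. h n \<xi>)"
    by (rule summable_comparison_test'[OF sC, of 0]) (use hle h0 in simp)
  have sum: "AE \<xi> in circle. summable (\<lambda>n. h n \<xi>)"
    by (rule AE_summable_of_summable_integrals[OF hi h0 hs])
  show "AE \<xi> in circle. summable (\<lambda>n. a n \<xi>)"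
    using sum by eventually_elim (use weighted_series(1)[OF a0] in \<open>simp add: h_def\<close>)
  have le2: "AE \<xi> in circle. (\<Sum>n. a n \<xi>)\<^sup>2 \<le> 2 * (\<Sum>n. h n \<xi>)"
    using sum by eventually_elim (use weighted_series(2)[OF a0] in \<open>simp add: h_def\<close>)
  have hS: "integrable circle (\<lambda>\<xi>. \<Sum>n. h n \<xi>)"
    by (rule integrable_suminf) (use hi sum hs h0 in \<open>auto simp: abs_of_nonneg\<close>)
  have hSi: "(LINT \<xi>|circle. (\<Sum>n. h n \<xi>)) = (\<Sum>n. LINT \<xi>|circle. h n \<xi>)"
    by (rule integral_suminf) (use hi sum hs h0 in \<open>auto simp: abs_of_nonneg\<close>)
  have int: "integrable circle (\<lambda>\<xi>. (\<Sum>n. a n \<xi>)\<^sup>2)"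
  proof (rule Bochner_Integration.integrable_bound)
    show "integrable circle (\<lambda>\<xi>. 2 * (\<Sum>n. h n \<xi>))" using hS by simp
    show "AE \<xi> in circle. norm ((\<Sum>n. a n \<xi>)\<^sup>2) \<le> norm (2 * (\<Sum>n. h n \<xi>))"
      using le2
    proof eventually_elim
      case (elim \<xi>)
      then have "(\<Sum>n. a n \<xi>)\<^sup>2 \<le> \<bar>2 * (\<Sum>n. h n \<xi>)\<bar>" by linarith
      then show ?case by (simp only: real_norm_def abs_power2)
    qed
  qed measurable
  then show "sq_integrable (\<lambda>\<xi>. \<Sum>n. a n \<xi>)" by (simp add: sq_integrable_def)
  have "(LINT \<xi>|circle. (\<Sum>n. a n \<xi>)\<^sup>2) \<le> (LINT \<xi>|circle. 2 * (\<Sum>n. h n \<xi>))"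
    by (rule integral_mono_AE[OF int _ le2]) (use hS in simp)
  also have "\<dots> = 2 * (\<Sum>n. LINT \<xi>|circle. h n \<xi>)" by (simp add: hSi)
  also have "\<dots> \<le> 2 * (\<Sum>n. C * (1/2) ^ n)"
    by (intro mult_left_mono suminf_le hle hs sC) simp
  also have "(\<Sum>n. C * (1/2::real) ^ n) = C * 2"
    by (subst suminf_mult) (auto simp: suminf_geometric intro!: summable_geometric)
  finally show "(LINT \<xi>|circle. (\<Sum>n. a n \<xi>)\<^sup>2) \<le> 4 * C" by simp
qed

text \<open>The operator \<open>f \<mapsto> v * conj_fun (f / v)\<close> is bounded on square integrable functions, with a fixed constant.\<close>

definition conj_weight :: "(complex \<Rightarrow> real) \<Rightarrow> bool" where
  "conj_weight v \<longleftrightarrow> v \<in> borel_measurable circle \<and> (\<exists>K. \<forall>\<zeta>. cmod \<zeta> = 1 \<longrightarrow> 0 < v \<zeta> \<and> v \<zeta> \<le> K) \<and>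
     (\<forall>f. sq_integrable f \<longrightarrow> integrable circle (\<lambda>\<zeta>. (v \<zeta> * conj_fun f \<zeta>)\<^sup>2) \<and>
        (LINT \<zeta>|circle. (v \<zeta> * conj_fun f \<zeta>)\<^sup>2) \<le> 5/3 * (LINT \<zeta>|circle. (v \<zeta> * f \<zeta>)\<^sup>2))"

lemma conj_weight_sq_integrable:
  assumes "conj_weight v" "sq_integrable f"
  shows "sq_integrable (\<lambda>\<xi>. f \<xi> * v \<xi>)"
proof -
  obtain K where "\<And>\<zeta>. cmod \<zeta> = 1 \<Longrightarrow> 0 < v \<zeta> \<and> v \<zeta> \<le> K" using assms(1) by (auto simp: conj_weight_def)
  then show ?thesis using assms by (intro sq_integrable_mult[where K = K]) (auto simp: conj_weight_def abs_of_pos)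
qed

text \<open>Conjugation is additive almost everywhere for finitely many summands. The tail of the series is
  handled in the mean: the weighted conjugates of the tails have geometrically decreasing square integrals and so tend to zero
  almost everywhere.\<close>

lemma conj_fun_series_bound:
  assumes v: "conj_weight v" "conj_weight (\<lambda>\<zeta>. 1 / v \<zeta>)"
    and a: "\<And>n. sq_integrable (a n)" and a0: "\<And>n \<xi>. 0 \<le> a n \<xi>"
    and le: "\<And>n. (LINT \<xi>|circle. (a n \<xi>)\<^sup>2) \<le> C * (1/4) ^ n"
    and step: "\<And>n \<zeta>. cmod \<zeta> = 1 \<Longrightarrow> v \<zeta> * \<bar>conj_fun (\<lambda>\<xi>. a n \<xi> * (1 / v \<xi>)) \<zeta>\<bar> \<le> 6 * a (Suc n) \<zeta>"
  shows "AE \<zeta> in circle. v \<zeta> * \<bar>conj_fun (\<lambda>\<xi>. (\<Sum>n. a n \<xi>) * (1 / v \<xi>)) \<zeta>\<bar> \<le> 6 * (\<Sum>n. a n \<zeta>)"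
proof -
  have vpos: "0 < v \<zeta>" if "cmod \<zeta> = 1" for \<zeta> using v(1) that by (auto simp: conj_weight_def)
  define h where "h n \<xi> = a n \<xi> * (1 / v \<xi>)" for n \<xi>
  define R where "R N \<xi> = (\<Sum>n. a (n + N) \<xi>)" for N \<xi>
  have h: "sq_integrable (h n)" for n unfolding h_def[abs_def] by (rule conj_weight_sq_integrable[OF v(2) a])
  have leN: "(LINT \<xi>|circle. (a (n + N) \<xi>)\<^sup>2) \<le> (C * (1/4) ^ N) * (1/4) ^ n" for n N
    using le[of "n + N"] by (simp add: power_add mult_ac)
  note RN = sq_integrable_series[of "\<lambda>n. a (n + N)" "C * (1/4) ^ N" for N, OF a a0 leN, folded R_def]
  have R0: "R 0 = (\<lambda>\<xi>. \<Sum>n. a n \<xi>)" by (simp add: R_def fun_eq_iff)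
  have Rv: "sq_integrable (\<lambda>\<xi>. R N \<xi> * (1 / v \<xi>))" for N by (rule conj_weight_sq_integrable[OF v(2) RN(2)])
  have sum: "AE \<xi> in circle. summable (\<lambda>n. a n \<xi>)" using RN(1)[of 0] by simp
  \<comment> \<open>the error left after \<open>N\<close> terms\<close>
  define E where "E N \<zeta> = v \<zeta> * conj_fun (\<lambda>\<xi>. R N \<xi> * (1 / v \<xi>)) \<zeta>" for N \<zeta>
  have Ei: "integrable circle (\<lambda>\<zeta>. (E N \<zeta>)\<^sup>2)" and Ele: "(LINT \<zeta>|circle. (E N \<zeta>)\<^sup>2) \<le> 20/3 * C * (1/4) ^ N" for N
  proof -
    have *: "integrable circle (\<lambda>\<zeta>. (E N \<zeta>)\<^sup>2) \<and> (LINT \<zeta>|circle. (E N \<zeta>)\<^sup>2) \<le> 5/3 * (LINT \<zeta>|circle. (v \<zeta> * (R N \<zeta> * (1 / v \<zeta>)))\<^sup>2)"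
      using v(1) Rv[of N] unfolding conj_weight_def E_def by blast
    then show "integrable circle (\<lambda>\<zeta>. (E N \<zeta>)\<^sup>2)" by simp
    have "(LINT \<zeta>|circle. (v \<zeta> * (R N \<zeta> * (1 / v \<zeta>)))\<^sup>2) = (LINT \<zeta>|circle. (R N \<zeta>)\<^sup>2)"
      by (intro Bochner_Integration.integral_cong refl) (auto dest!: norm_circle vpos)
    also have "\<dots> \<le> 4 * (C * (1/4) ^ N)" by (rule RN(3))
    finally show "(LINT \<zeta>|circle. (E N \<zeta>)\<^sup>2) \<le> 20/3 * C * (1/4) ^ N" using * by simp
  qed
  have "AE \<zeta> in circle. summable (\<lambda>N. (E N \<zeta>)\<^sup>2)"
  proof (rule AE_summable_of_summable_integrals[OF Ei])
    show "summable (\<lambda>N. LINT \<zeta>|circle. (E N \<zeta>)\<^sup>2)"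
    proof (rule summable_comparison_test'[of "\<lambda>N. 20/3 * C * (1/4) ^ N" 0])
      show "summable (\<lambda>N. 20/3 * C * (1/4) ^ N)" by (intro summable_mult summable_geometric) simp
    qed (use Ele in simp)
  qed simp
  moreover have "AE \<zeta> in circle. \<forall>N. conj_fun (\<lambda>\<xi>. R 0 \<xi> * (1 / v \<xi>)) \<zeta> = (\<Sum>n<N. conj_fun (h n) \<zeta>) + conj_fun (\<lambda>\<xi>. R N \<xi> * (1 / v \<xi>)) \<zeta>"
    unfolding AE_all_countable
  proof
    fix N
    have eq: "conj_fun (\<lambda>\<xi>. R 0 \<xi> * (1 / v \<xi>)) = conj_fun (\<lambda>\<xi>. (\<Sum>n<N. h n \<xi>) + R N \<xi> * (1 / v \<xi>))"
    proof (rule conj_fun_cong_AE)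
      show "AE \<xi> in circle. R 0 \<xi> * (1 / v \<xi>) = (\<Sum>n<N. h n \<xi>) + R N \<xi> * (1 / v \<xi>)"
        using sum
      proof eventually_elim
        case (elim \<xi>)
        have "R 0 \<xi> = R N \<xi> + (\<Sum>n<N. a n \<xi>)"
          unfolding R_def using suminf_split_initial_segment[OF elim, of N] by simp
        then show ?case by (simp only: h_def distrib_right sum_distrib_right add.commute)
      qed
      show "(\<lambda>\<xi>. R 0 \<xi> * (1 / v \<xi>)) \<in> borel_measurable circle" by (rule sq_integrable_measurable[OF Rv])
      show "(\<lambda>\<xi>. (\<Sum>n<N. h n \<xi>) + R N \<xi> * (1 / v \<xi>)) \<in> borel_measurable circle"
        by (rule sq_integrable_measurable[OF sq_integrable_add[OF conj_fun_sum(1)[OF h] Rv]])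
    qed
    show "AE \<zeta> in circle. conj_fun (\<lambda>\<xi>. R 0 \<xi> * (1 / v \<xi>)) \<zeta> = (\<Sum>n<N. conj_fun (h n) \<zeta>) + conj_fun (\<lambda>\<xi>. R N \<xi> * (1 / v \<xi>)) \<zeta>"
    proof -
      have "AE \<zeta> in circle. conj_fun (\<lambda>\<xi>. (\<Sum>n<N. h n \<xi>) + R N \<xi> * (1 / v \<xi>)) \<zeta>
          = conj_fun (\<lambda>\<xi>. \<Sum>n<N. h n \<xi>) \<zeta> + conj_fun (\<lambda>\<xi>. R N \<xi> * (1 / v \<xi>)) \<zeta>"
        by (rule conj_fun_add[OF conj_fun_sum(1)[OF h] Rv])
      moreover have "AE \<zeta> in circle. conj_fun (\<lambda>\<xi>. \<Sum>n<N. h n \<xi>) \<zeta> = (\<Sum>n<N. conj_fun (h n) \<zeta>)"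
        by (rule conj_fun_sum(2)[OF h])
      ultimately show ?thesis unfolding eq by eventually_elim simp
    qed
  qed
  ultimately show ?thesis
    using sum AE_space
  proof eventually_elim
    case (elim \<zeta>)
    have z: "cmod \<zeta> = 1" by (rule norm_circle[OF elim(4)])
    have "(\<lambda>N. (E N \<zeta>)\<^sup>2) \<longlonglongrightarrow> 0" by (rule summable_LIMSEQ_zero[OF elim(1)])
    then have "(\<lambda>N. sqrt ((E N \<zeta>)\<^sup>2)) \<longlonglongrightarrow> sqrt 0" by (rule tendsto_real_sqrt)
    then have E0: "(\<lambda>N. \<bar>E N \<zeta>\<bar>) \<longlonglongrightarrow> 0" by simp
    have "v \<zeta> * \<bar>conj_fun (\<lambda>\<xi>. R 0 \<xi> * (1 / v \<xi>)) \<zeta>\<bar> \<le> 6 * (\<Sum>n. a n \<zeta>) + 0"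
    proof (rule LIMSEQ_le_const)
      show "(\<lambda>N. 6 * (\<Sum>n. a n \<zeta>) + \<bar>E N \<zeta>\<bar>) \<longlonglongrightarrow> 6 * (\<Sum>n. a n \<zeta>) + 0"
        by (intro tendsto_add tendsto_const E0)
      show "\<exists>N. \<forall>n\<ge>N. v \<zeta> * \<bar>conj_fun (\<lambda>\<xi>. R 0 \<xi> * (1 / v \<xi>)) \<zeta>\<bar> \<le> 6 * (\<Sum>n. a n \<zeta>) + \<bar>E n \<zeta>\<bar>"
      proof (intro exI allI impI)
        fix N
        have "\<bar>conj_fun (\<lambda>\<xi>. R 0 \<xi> * (1 / v \<xi>)) \<zeta>\<bar> \<le> (\<Sum>n<N. \<bar>conj_fun (h n) \<zeta>\<bar>) + \<bar>conj_fun (\<lambda>\<xi>. R N \<xi> * (1 / v \<xi>)) \<zeta>\<bar>"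
          unfolding elim(2)[rule_format, of N]
          using sum_abs[of "\<lambda>n. conj_fun (h n) \<zeta>" "{..<N}"] by linarith
        then have "v \<zeta> * \<bar>conj_fun (\<lambda>\<xi>. R 0 \<xi> * (1 / v \<xi>)) \<zeta>\<bar> \<le> v \<zeta> * ((\<Sum>n<N. \<bar>conj_fun (h n) \<zeta>\<bar>) + \<bar>conj_fun (\<lambda>\<xi>. R N \<xi> * (1 / v \<xi>)) \<zeta>\<bar>)"
          using vpos[OF z] by (intro mult_left_mono) auto
        also have "\<dots> = (\<Sum>n<N. v \<zeta> * \<bar>conj_fun (h n) \<zeta>\<bar>) + \<bar>E N \<zeta>\<bar>"
          using vpos[OF z] by (simp add: E_def distrib_left sum_distrib_left abs_mult)
        also have "(\<Sum>n<N. v \<zeta> * \<bar>conj_fun (h n) \<zeta>\<bar>) \<le> (\<Sum>n<N. 6 * a (Suc n) \<zeta>)"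
          using step[OF z] unfolding h_def by (intro sum_mono)
        also have "\<dots> = 6 * (\<Sum>n<N. a (Suc n) \<zeta>)" by (simp add: sum_distrib_left)
        also have "(\<Sum>n<N. a (Suc n) \<zeta>) \<le> (\<Sum>n<Suc N. a n \<zeta>)"
          using a0[of 0 \<zeta>] by (simp add: sum.lessThan_Suc_shift del: sum.lessThan_Suc)
        also have "(\<Sum>n<Suc N. a n \<zeta>) \<le> (\<Sum>n. a n \<zeta>)" by (intro sum_le_suminf elim(3)) (auto simp: a0)
        finally show "v \<zeta> * \<bar>conj_fun (\<lambda>\<xi>. R 0 \<xi> * (1 / v \<xi>)) \<zeta>\<bar> \<le> 6 * (\<Sum>n. a n \<zeta>) + \<bar>E N \<zeta>\<bar>" by simp
      qed
    qed
    then show ?case by (simp add: R0)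
  qed
qed

text \<open>One step of the iteration of Rubio de Francia, applied simultaneously to the weight and its inverse. The factor \<open>1/6\<close> makes
  the step a contraction with ratio \<open>1/2\<close> in the square mean, since \<open>(x + y)\<^sup>2 \<le> 2 x\<^sup>2 + 2 y\<^sup>2\<close> and each summand has constant
  \<open>5/3\<close>.\<close>

definition jones_step :: "(complex \<Rightarrow> real) \<Rightarrow> (complex \<Rightarrow> real) \<Rightarrow> complex \<Rightarrow> real" where
  "jones_step v h \<zeta> = (\<bar>v \<zeta> * conj_fun (\<lambda>\<xi>. h \<xi> * (1 / v \<xi>)) \<zeta>\<bar> + \<bar>1 / v \<zeta> * conj_fun (\<lambda>\<xi>. h \<xi> * v \<xi>) \<zeta>\<bar>) / 6"

primrec jones_iter :: "(complex \<Rightarrow> real) \<Rightarrow> nat \<Rightarrow> complex \<Rightarrow> real" where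
  "jones_iter v 0 = (\<lambda>_. 1)"
| "jones_iter v (Suc n) = jones_step v (jones_iter v n)"

definition jones_fun :: "(complex \<Rightarrow> real) \<Rightarrow> complex \<Rightarrow> real" where
  "jones_fun v \<zeta> = (\<Sum>n. jones_iter v n \<zeta>)"

lemma jones_step_L2:
  assumes v: "conj_weight v" "conj_weight (\<lambda>\<zeta>. 1 / v \<zeta>)" and h: "sq_integrable h"
  shows "sq_integrable (jones_step v h)"
    and "(LINT \<zeta>|circle. (jones_step v h \<zeta>)\<^sup>2) \<le> 1/4 * (LINT \<zeta>|circle. (h \<zeta>)\<^sup>2)"
proof -
  have vpos: "0 < v \<zeta>" if "cmod \<zeta> = 1" for \<zeta> using v(1) that by (auto simp: conj_weight_def)
  have h1: "sq_integrable (\<lambda>\<xi>. h \<xi> * (1 / v \<xi>))" by (rule conj_weight_sq_integrable[OF v(2) h])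
  have h2: "sq_integrable (\<lambda>\<xi>. h \<xi> * v \<xi>)" by (rule conj_weight_sq_integrable[OF v(1) h])
  define p where "p \<zeta> = v \<zeta> * conj_fun (\<lambda>\<xi>. h \<xi> * (1 / v \<xi>)) \<zeta>" for \<zeta>
  define q where "q \<zeta> = 1 / v \<zeta> * conj_fun (\<lambda>\<xi>. h \<xi> * v \<xi>) \<zeta>" for \<zeta>
  have "integrable circle (\<lambda>\<zeta>. (p \<zeta>)\<^sup>2) \<and> (LINT \<zeta>|circle. (p \<zeta>)\<^sup>2) \<le> 5/3 * (LINT \<zeta>|circle. (v \<zeta> * (h \<zeta> * (1 / v \<zeta>)))\<^sup>2)"
    using v(1) h1 unfolding conj_weight_def p_def by blast
  moreover have "(LINT \<zeta>|circle. (v \<zeta> * (h \<zeta> * (1 / v \<zeta>)))\<^sup>2) = (LINT \<zeta>|circle. (h \<zeta>)\<^sup>2)"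
    by (intro Bochner_Integration.integral_cong refl) (auto dest!: norm_circle vpos)
  ultimately have p: "integrable circle (\<lambda>\<zeta>. (p \<zeta>)\<^sup>2)" "(LINT \<zeta>|circle. (p \<zeta>)\<^sup>2) \<le> 5/3 * (LINT \<zeta>|circle. (h \<zeta>)\<^sup>2)" by simp_all
  have "integrable circle (\<lambda>\<zeta>. (q \<zeta>)\<^sup>2) \<and> (LINT \<zeta>|circle. (q \<zeta>)\<^sup>2) \<le> 5/3 * (LINT \<zeta>|circle. (1 / v \<zeta> * (h \<zeta> * v \<zeta>))\<^sup>2)"
    using v(2) h2 unfolding conj_weight_def q_def by blast
  moreover have "(LINT \<zeta>|circle. (1 / v \<zeta> * (h \<zeta> * v \<zeta>))\<^sup>2) = (LINT \<zeta>|circle. (h \<zeta>)\<^sup>2)"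
    by (intro Bochner_Integration.integral_cong refl) (auto dest!: norm_circle vpos)
  ultimately have q: "integrable circle (\<lambda>\<zeta>. (q \<zeta>)\<^sup>2)" "(LINT \<zeta>|circle. (q \<zeta>)\<^sup>2) \<le> 5/3 * (LINT \<zeta>|circle. (h \<zeta>)\<^sup>2)" by simp_all
  have [measurable]: "v \<in> borel_measurable circle" using v by (simp add: conj_weight_def)
  have [measurable]: "conj_fun (\<lambda>\<xi>. h \<xi> * (1 / v \<xi>)) \<in> borel_measurable circle" "conj_fun (\<lambda>\<xi>. h \<xi> * v \<xi>) \<in> borel_measurable circle"
    using h1 h2 by (auto intro!: conj_fun_measurable sq_integrable_integrable)
  have m [measurable]: "jones_step v h \<in> borel_measurable circle"
    unfolding jones_step_def[abs_def] by measurable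
  have eq: "jones_step v h \<zeta> = (\<bar>p \<zeta>\<bar> + \<bar>q \<zeta>\<bar>) / 6" for \<zeta> by (simp add: jones_step_def p_def q_def)
  have le: "(jones_step v h \<zeta>)\<^sup>2 \<le> ((p \<zeta>)\<^sup>2 + (q \<zeta>)\<^sup>2) / 18" for \<zeta>
    using sum_squares_bound[of "\<bar>p \<zeta>\<bar>" "\<bar>q \<zeta>\<bar>"] unfolding eq by (simp add: power2_eq_square algebra_simps)
  have int: "integrable circle (\<lambda>\<zeta>. (jones_step v h \<zeta>)\<^sup>2)"
    by (rule Bochner_Integration.integrable_bound[of _ "\<lambda>\<zeta>. ((p \<zeta>)\<^sup>2 + (q \<zeta>)\<^sup>2) / 18"]) (use p q le in auto)
  then show "sq_integrable (jones_step v h)" using m by (simp add: sq_integrable_def)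
  have "(LINT \<zeta>|circle. (jones_step v h \<zeta>)\<^sup>2) \<le> (LINT \<zeta>|circle. ((p \<zeta>)\<^sup>2 + (q \<zeta>)\<^sup>2) / 18)"
    by (rule integral_mono[OF int _ le]) (use p q in simp)
  also have "\<dots> \<le> 1/4 * (LINT \<zeta>|circle. (h \<zeta>)\<^sup>2)"
  proof -
    have eq18: "(LINT \<zeta>|circle. ((p \<zeta>)\<^sup>2 + (q \<zeta>)\<^sup>2) / 18) = ((LINT \<zeta>|circle. (p \<zeta>)\<^sup>2) + (LINT \<zeta>|circle. (q \<zeta>)\<^sup>2)) / 18"
      using p q by simp
    have aux: "(P + Q) / 18 \<le> 1/4 * H" if "P \<le> 5/3 * H" "Q \<le> 5/3 * H" "0 \<le> H" for P Q H :: real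
      using that by (simp add: field_simps)
    show ?thesis unfolding eq18 by (rule aux[OF p(2) q(2)]) simp
  qed
  finally show "(LINT \<zeta>|circle. (jones_step v h \<zeta>)\<^sup>2) \<le> 1/4 * (LINT \<zeta>|circle. (h \<zeta>)\<^sup>2)" .
qed

lemma jones_iter_L2:
  assumes v: "conj_weight v" "conj_weight (\<lambda>\<zeta>. 1 / v \<zeta>)"
  shows "sq_integrable (jones_iter v n)" "(LINT \<zeta>|circle. (jones_iter v n \<zeta>)\<^sup>2) \<le> 2 * pi * (1/4) ^ n"
proof (induction n)
  case 0
  { case 1 show ?case by (simp add: sq_integrable_def) }
  { case 2 show ?case by (simp add: measure_circle_space) }
next
  case (Suc n)
  { case 1 show ?case using jones_step_L2(1)[OF v Suc(1)] by simp }
  { case 2 show ?case using jones_step_L2(2)[OF v Suc(1)] Suc(2) by simp }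
qed

lemma jones_iter_nonneg: "0 \<le> jones_iter v n \<zeta>"
  by (cases n) (auto simp: jones_step_def)

text \<open>For the sum \<open>f\<close> of all iterates of \<open>1\<close>, one step applied to \<open>f\<close> yields at most \<open>f\<close>, because it shifts the series. Thus both
  \<open>f * v\<close> and \<open>f / v\<close> dominate their own conjugate functions up to a factor, and \<open>v\<^sup>2\<close> is their quotient: the factorization of a weight in
  the manner of Jones.\<close>

theorem jones_factorization:
  assumes v: "conj_weight v" "conj_weight (\<lambda>\<zeta>. 1 / v \<zeta>)"
  shows "sq_integrable (\<lambda>\<xi>. jones_fun v \<xi> * (1 / v \<xi>))" "sq_integrable (\<lambda>\<xi>. jones_fun v \<xi> * v \<xi>)"
    and "AE \<zeta> in circle. 1 \<le> jones_fun v \<zeta>"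
    and "AE \<zeta> in circle. \<bar>conj_fun (\<lambda>\<xi>. jones_fun v \<xi> * (1 / v \<xi>)) \<zeta>\<bar> \<le> 6 * (jones_fun v \<zeta> * (1 / v \<zeta>))"
    and "AE \<zeta> in circle. \<bar>conj_fun (\<lambda>\<xi>. jones_fun v \<xi> * v \<xi>) \<zeta>\<bar> \<le> 6 * (jones_fun v \<zeta> * v \<zeta>)"
proof -
  have vpos: "0 < v \<zeta>" if "cmod \<zeta> = 1" for \<zeta> using v(1) that by (auto simp: conj_weight_def)
  note J = jones_iter_L2[OF v] and J0 = jones_iter_nonneg[of v]
  note S = sq_integrable_series[OF J(1) J0 J(2), folded jones_fun_def]
  show "sq_integrable (\<lambda>\<xi>. jones_fun v \<xi> * (1 / v \<xi>))" "sq_integrable (\<lambda>\<xi>. jones_fun v \<xi> * v \<xi>)"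
    by (rule conj_weight_sq_integrable[OF v(2) S(2)], rule conj_weight_sq_integrable[OF v(1) S(2)])
  show "AE \<zeta> in circle. 1 \<le> jones_fun v \<zeta>"
    using S(1)
  proof eventually_elim
    case (elim \<zeta>)
    have "(\<Sum>n<1. jones_iter v n \<zeta>) \<le> jones_fun v \<zeta>"
      unfolding jones_fun_def by (intro sum_le_suminf elim) (auto simp: J0)
    then show ?case by simp
  qed
  have b1: "v \<zeta> * \<bar>conj_fun (\<lambda>\<xi>. jones_iter v n \<xi> * (1 / v \<xi>)) \<zeta>\<bar> \<le> 6 * jones_iter v (Suc n) \<zeta>" if "cmod \<zeta> = 1" for n \<zeta>
  proof -
    have "6 * jones_iter v (Suc n) \<zeta> = v \<zeta> * \<bar>conj_fun (\<lambda>\<xi>. jones_iter v n \<xi> * (1 / v \<xi>)) \<zeta>\<bar> + \<bar>1 / v \<zeta> * conj_fun (\<lambda>\<xi>. jones_iter v n \<xi> * v \<xi>) \<zeta>\<bar>"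
      using vpos[OF that] by (simp add: jones_step_def abs_mult)
    then show ?thesis by linarith
  qed
  have b2: "1 / v \<zeta> * \<bar>conj_fun (\<lambda>\<xi>. jones_iter v n \<xi> * (1 / (1 / v \<xi>))) \<zeta>\<bar> \<le> 6 * jones_iter v (Suc n) \<zeta>" if "cmod \<zeta> = 1" for n \<zeta>
  proof -
    have "6 * jones_iter v (Suc n) \<zeta> = \<bar>v \<zeta> * conj_fun (\<lambda>\<xi>. jones_iter v n \<xi> * (1 / v \<xi>)) \<zeta>\<bar> + 1 / v \<zeta> * \<bar>conj_fun (\<lambda>\<xi>. jones_iter v n \<xi> * (1 / (1 / v \<xi>))) \<zeta>\<bar>"
      using vpos[OF that] by (simp add: jones_step_def abs_mult)
    then show ?thesis by linarith
  qed
  have v': "conj_weight (\<lambda>\<zeta>. 1 / (1 / v \<zeta>))" using v(1) by simp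
  have c1: "AE \<zeta> in circle. v \<zeta> * \<bar>conj_fun (\<lambda>\<xi>. jones_fun v \<xi> * (1 / v \<xi>)) \<zeta>\<bar> \<le> 6 * jones_fun v \<zeta>"
    unfolding jones_fun_def by (rule conj_fun_series_bound[OF v J(1) J0 J(2)]) (rule b1)
  have c2: "AE \<zeta> in circle. 1 / v \<zeta> * \<bar>conj_fun (\<lambda>\<xi>. jones_fun v \<xi> * (1 / (1 / v \<xi>))) \<zeta>\<bar> \<le> 6 * jones_fun v \<zeta>"
    unfolding jones_fun_def by (rule conj_fun_series_bound[OF v(2) v' J(1) J0 J(2)]) (rule b2)
  show "AE \<zeta> in circle. \<bar>conj_fun (\<lambda>\<xi>. jones_fun v \<xi> * (1 / v \<xi>)) \<zeta>\<bar> \<le> 6 * (jones_fun v \<zeta> * (1 / v \<zeta>))"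
    using c1 AE_space
  proof eventually_elim
    case (elim \<zeta>)
    then show ?case using vpos[OF norm_circle[OF elim(2)]] by (simp add: field_simps)
  qed
  show "AE \<zeta> in circle. \<bar>conj_fun (\<lambda>\<xi>. jones_fun v \<xi> * v \<xi>) \<zeta>\<bar> \<le> 6 * (jones_fun v \<zeta> * v \<zeta>)"
    using c2 AE_space
  proof eventually_elim
    case (elim \<zeta>)
    then show ?case using vpos[OF norm_circle[OF elim(2)]] by (simp add: field_simps)
  qed
qed

section \<open>Separating large and small values of a weight\<close>

text \<open>A polynomial in \<open>(1 + w)\<^sup>-\<^sup>1\<close> which on the right half plane is of size \<open>\<bar>w\<bar>\<^sup>-\<^sup>m\<close> at infinity and differs from \<open>1\<close>
  by a multiple of \<open>\<bar>w\<bar>\<^sup>m\<close> near the origin.\<close>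

definition cutoff :: "nat \<Rightarrow> complex \<Rightarrow> complex" where
  "cutoff m w = 1 - (1 - inverse (1 + w) ^ m) ^ m"

lemma one_plus_ge:
  assumes "0 \<le> Re w"
  shows "1 \<le> cmod (1 + w)" "cmod w \<le> cmod (1 + w)"
proof -
  have "(cmod (1 + w))\<^sup>2 = 1 + 2 * Re w + (cmod w)\<^sup>2"
    unfolding cmod_power2 by (simp add: power2_eq_square algebra_simps)
  then have "1\<^sup>2 \<le> (cmod (1 + w))\<^sup>2" "(cmod w)\<^sup>2 \<le> (cmod (1 + w))\<^sup>2" using assms by simp_all
  then show "1 \<le> cmod (1 + w)" "cmod w \<le> cmod (1 + w)" by (auto intro: power2_le_imp_le)
qed

text \<open>All three bounds come from \<open>\<bar>x\<^sup>m - y\<^sup>m\<bar> \<le> m \<bar>x - y\<bar>\<close> in the unit disc: with \<open>y = (1 + w)\<^sup>-\<^sup>1\<close>, applied to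
  \<open>1\<close> and \<open>1 - y\<^sup>m\<close> after division by \<open>2\<close> it gives the decay, applied to \<open>1\<close> and \<open>y\<close> it gives the approximation of \<open>1\<close>.\<close>

lemma cutoff_bounds:
  assumes w: "0 \<le> Re w"
  shows "cmod (cutoff m w) \<le> real m * 2 ^ m"
    and "cmod (cutoff m w) * cmod w ^ m \<le> real m * 2 ^ m"
    and "cmod (1 - cutoff m w) \<le> real m ^ m * min 1 (cmod w) ^ m"
proof -
  note g = one_plus_ge[OF w]
  have nz: "1 + w \<noteq> 0" using g by auto
  define y where "y = inverse (1 + w)"
  have y1: "cmod y \<le> 1" using g by (simp add: y_def norm_inverse inverse_le_1_iff)
  have "cmod y * cmod w = cmod w / cmod (1 + w)" by (simp only: y_def norm_inverse divide_inverse mult.commute)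
  then have yw: "cmod y * cmod w \<le> 1" using g nz by (simp add: divide_le_eq_1)
  define x where "x = y ^ m"
  have x1: "cmod x \<le> 1" using y1 by (simp add: x_def norm_power power_le_one)
  \<comment> \<open>both numbers lie in the unit disc only after division by \<open>2\<close>, which costs the factor \<open>2\<^sup>m\<close>\<close>
  have cx: "cmod (cutoff m w) \<le> real m * 2 ^ m * cmod x"
  proof -
    have "cmod ((1 / 2) ^ m - ((1 - x) / 2) ^ m) \<le> real m * cmod (1 / 2 - (1 - x) / 2)"
    proof (rule norm_power_diff)
      have "cmod (1 - x) \<le> 1 + cmod x" using norm_triangle_ineq4[of 1 x] by simp
      then show "cmod ((1 - x) / 2) \<le> 1" using x1 by (simp add: norm_divide)
    qed simp
    also have "1 / 2 - (1 - x) / 2 = x / 2" by (simp add: field_simps)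
    finally have "cmod ((1 / 2) ^ m - ((1 - x) / 2) ^ m) \<le> real m * cmod x" 
      by (simp add: norm_divide) (smt (verit) mult_nonneg_nonneg norm_ge_zero of_nat_0_le_iff)
    moreover have "(1 / 2) ^ m - ((1 - x) / 2) ^ m = cutoff m w / 2 ^ m"
      unfolding cutoff_def y_def[symmetric] x_def[symmetric] power_divide by (simp add: diff_divide_distrib)
    ultimately have "cmod (cutoff m w) / 2 ^ m \<le> real m * cmod x" by (simp add: norm_divide norm_power)
    then show ?thesis by (simp add: field_simps)
  qed
  also have "\<dots> \<le> real m * 2 ^ m * 1" by (intro mult_left_mono x1) simp
  finally show "cmod (cutoff m w) \<le> real m * 2 ^ m" by simp
  have "cmod (cutoff m w) * cmod w ^ m \<le> real m * 2 ^ m * cmod x * cmod w ^ m"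
    by (intro mult_right_mono cx) simp
  also have "\<dots> = real m * 2 ^ m * (cmod y * cmod w) ^ m"
    by (simp add: x_def norm_power power_mult_distrib)
  also have "\<dots> \<le> real m * 2 ^ m * 1"
    by (intro mult_left_mono power_le_one yw) auto
  finally show "cmod (cutoff m w) * cmod w ^ m \<le> real m * 2 ^ m" by simp
  have "cmod (1 - cutoff m w) = cmod (1 ^ m - y ^ m) ^ m"
    by (simp add: cutoff_def y_def norm_power)
  also have "\<dots> \<le> (real m * min 1 (cmod w)) ^ m"
  proof (rule power_mono)
    have "cmod (1 ^ m - y ^ m) \<le> real m * cmod (1 - y)" by (rule norm_power_diff) (use y1 in auto)
    also have "1 - y = w / (1 + w)" using nz by (simp add: y_def field_simps)
    also have "cmod (w / (1 + w)) \<le> min 1 (cmod w)"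
    proof -
      have "cmod w / cmod (1 + w) \<le> 1" using g nz by (simp add: divide_simps)
      moreover have "cmod w / cmod (1 + w) \<le> cmod w / 1" using g by (intro divide_left_mono) auto
      ultimately show ?thesis by (simp add: norm_divide)
    qed
    finally show "cmod (1 ^ m - y ^ m) \<le> real m * min 1 (cmod w)" by (simp add: mult_left_mono)
  qed simp
  finally show "cmod (1 - cutoff m w) \<le> real m ^ m * min 1 (cmod w) ^ m" by (simp add: power_mult_distrib)
qed

lemma csqrt_half_sector:
  assumes "0 < Re z"
  shows "\<bar>Im (csqrt z)\<bar> < Re (csqrt z)" "csqrt z \<noteq> 0"
proof -
  have "Re ((csqrt z)\<^sup>2) = (Re (csqrt z))\<^sup>2 - (Im (csqrt z))\<^sup>2" by (simp add: power2_eq_square del: csqrt.simps power2_csqrt)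
  then have "\<bar>Im (csqrt z)\<bar>\<^sup>2 < (Re (csqrt z))\<^sup>2" using assms by (simp del: csqrt.simps)
  then show *: "\<bar>Im (csqrt z)\<bar> < Re (csqrt z)" by (rule power2_less_imp_less) (rule Re_csqrt)
  show "csqrt z \<noteq> 0" using assms by auto
qed

lemma csqrt_quotient:
  assumes "0 < Re a" "0 < Re b"
  shows "0 < Re (csqrt a / csqrt b)" "(cmod (csqrt a / csqrt b))\<^sup>2 = cmod a / cmod b"
proof -
  define s t where "s = csqrt a" and "t = csqrt b"
  have s: "\<bar>Im s\<bar> < Re s" and t: "\<bar>Im t\<bar> < Re t" "t \<noteq> 0"
    using csqrt_half_sector assms by (auto simp: s_def t_def simp del: csqrt.simps)
  have "\<bar>Im s * Im t\<bar> < Re s * Re t"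
    unfolding abs_mult using s t by (intro mult_strict_mono') auto
  then have "0 < Re s * Re t + Im s * Im t" by linarith
  moreover have "0 < (Re t)\<^sup>2 + (Im t)\<^sup>2" using t by (simp add: sum_power2_gt_zero_iff)
  ultimately show "0 < Re (csqrt a / csqrt b)"
    unfolding s_def[symmetric] t_def[symmetric] by (simp add: Re_divide)
  have "(cmod (csqrt a / csqrt b))\<^sup>2 = cmod ((csqrt a)\<^sup>2) / cmod ((csqrt b)\<^sup>2)"
    unfolding norm_divide norm_power power_divide ..
  then show "(cmod (csqrt a / csqrt b))\<^sup>2 = cmod a / cmod b" by simp
qed

lemma poisson_int_ge:
  fixes h :: "complex \<Rightarrow> real"
  assumes h: "integrable circle h" and c: "AE \<xi> in circle. c \<le> h \<xi>" and z: "cmod z < 1"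
  shows "c \<le> poisson_int h z"
proof -
  have "(LINT \<xi>|circle. poisson z \<xi> *\<^sub>R c) \<le> (LINT \<xi>|circle. poisson z \<xi> *\<^sub>R h \<xi>)"
  proof (rule integral_mono_AE)
    show "AE \<xi> in circle. poisson z \<xi> *\<^sub>R c \<le> poisson z \<xi> *\<^sub>R h \<xi>"
      using c AE_space
    proof eventually_elim
      case (elim \<xi>)
      then show ?case using poisson_pos[OF z norm_circle[OF elim(2)]] by simp
    qed
  qed (use integrable_poisson[OF h z] integrable_poisson[of "\<lambda>_. c", OF _ z] in auto)
  then have "poisson_int (\<lambda>_. c) z \<le> poisson_int h z"
    unfolding poisson_int_def by (simp add: divide_right_mono)
  then show ?thesis by (simp add: poisson_int_const[OF z])
qed

text \<open>The boundary value of an analytic function with positive real part whose modulus is comparable to \<open>v\<close>: the Herglotz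
  integrals of \<open>f * v\<close> and \<open>f / v\<close> have moduli comparable to their real parts, and the square roots of functions with positive real part
  take values in a sector of half angle \<open>pi / 4\<close>, so that their quotient stays in the right half plane.\<close>

definition jones_outer :: "(complex \<Rightarrow> real) \<Rightarrow> complex \<Rightarrow> complex" where
  "jones_outer v \<zeta> =
     csqrt (Complex (jones_fun v \<zeta> * v \<zeta>) (conj_fun (\<lambda>\<xi>. jones_fun v \<xi> * v \<xi>) \<zeta>))
     / csqrt (Complex (jones_fun v \<zeta> * (1 / v \<zeta>)) (conj_fun (\<lambda>\<xi>. jones_fun v \<xi> * (1 / v \<xi>)) \<zeta>))"

definition separator :: "nat \<Rightarrow> (complex \<Rightarrow> real) \<Rightarrow> complex \<Rightarrow> complex" where
  "separator m v \<zeta> = cutoff m (jones_outer v \<zeta>)"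

lemma conj_weight_lower:
  assumes "conj_weight v" "conj_weight (\<lambda>\<zeta>. 1 / v \<zeta>)"
  obtains k where "0 < k" "\<And>\<zeta>. cmod \<zeta> = 1 \<Longrightarrow> k \<le> v \<zeta>"
proof -
  obtain K where K: "\<And>\<zeta>. cmod \<zeta> = 1 \<Longrightarrow> 0 < 1 / v \<zeta> \<and> 1 / v \<zeta> \<le> K" using assms(2) by (auto simp: conj_weight_def)
  have K0: "0 < K" using K[of 1] less_le_trans[of 0 "1 / v 1" K] by simp
  have "1 / K \<le> v \<zeta>" if "cmod \<zeta> = 1" for \<zeta>
  proof -
    have "0 < v \<zeta>" "1 / v \<zeta> \<le> K" using K[OF that] by (auto simp: zero_less_divide_iff)
    then show ?thesis using K0 by (simp add: field_simps)
  qed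
  then show ?thesis using K0 by (intro that[of "1 / K"]) auto
qed

lemma cmod_Complex_sector:
  assumes "0 < a" "\<bar>b\<bar> \<le> 6 * a"
  shows "a \<le> cmod (Complex a b)" "cmod (Complex a b) \<le> 7 * a"
  using complex_Re_le_cmod[of "Complex a b"] cmod_le[of "Complex a b"] assms by auto

text \<open>Composition of the half plane function comparable to \<open>v\<close> with \<open>cutoff\<close>.\<close>

theorem separator:
  assumes v: "conj_weight v" "conj_weight (\<lambda>\<zeta>. 1 / v \<zeta>)"
  shows "bounded_analytic_boundary_value (separator m v)"
    and "AE \<zeta> in circle. cmod (separator m v \<zeta>) \<le> real m * 6 ^ m"
    and "AE \<zeta> in circle. cmod (separator m v \<zeta>) * v \<zeta> ^ m \<le> real m * 6 ^ m"
    and "AE \<zeta> in circle. cmod (1 - separator m v \<zeta>) \<le> (3 * real m) ^ m * min 1 (v \<zeta>) ^ m"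
proof -
  have vpos: "0 < v \<zeta>" if "cmod \<zeta> = 1" for \<zeta> using v(1) that by (auto simp: conj_weight_def)
  have vpos': "0 < 1 / v \<zeta>" if "cmod \<zeta> = 1" for \<zeta> using vpos[OF that] by simp
  note J = jones_factorization[OF v]
  define V1 where "V1 \<xi> = jones_fun v \<xi> * v \<xi>" for \<xi>
  define V2 where "V2 \<xi> = jones_fun v \<xi> * (1 / v \<xi>)" for \<xi>
  have V: "sq_integrable V1" "sq_integrable V2" using J(1,2) by (simp_all add: V1_def[abs_def] V2_def[abs_def])
  note Vi = V[THEN sq_integrable_integrable]
  obtain k1 where k1: "0 < k1" "\<And>\<zeta>. cmod \<zeta> = 1 \<Longrightarrow> k1 \<le> v \<zeta>" using conj_weight_lower[OF v] by blast
  obtain k2 where k2: "0 < k2" "\<And>\<zeta>. cmod \<zeta> = 1 \<Longrightarrow> k2 \<le> 1 / v \<zeta>"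
    using conj_weight_lower[OF v(2)] v(1) by (auto simp: )
  have AE1: "AE \<zeta> in circle. k1 \<le> V1 \<zeta>" and AE2: "AE \<zeta> in circle. k2 \<le> V2 \<zeta>"
  proof -
    show "AE \<zeta> in circle. k1 \<le> V1 \<zeta>" using J(3) AE_space
    proof eventually_elim
      case (elim \<zeta>)
      have "1 * k1 \<le> jones_fun v \<zeta> * v \<zeta>" using elim k1(2)[OF norm_circle[OF elim(2)]] k1(1) by (intro mult_mono) auto
      then show ?case by (simp add: V1_def)
    qed
    show "AE \<zeta> in circle. k2 \<le> V2 \<zeta>" using J(3) AE_space
    proof eventually_elim
      case (elim \<zeta>)
      have "1 * k2 \<le> jones_fun v \<zeta> * (1 / v \<zeta>)" using elim k2(2)[OF norm_circle[OF elim(2)]] k2(1) by (intro mult_mono) auto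
      then show ?case by (simp add: V2_def)
    qed
  qed
  have R1: "0 < Re (herglotz_real V1 z)" if "cmod z < 1" for z
    using poisson_int_ge[OF Vi(1) AE1 that] k1 Re_herglotz[OF Vi(1) that] by simp
  have R2: "0 < Re (herglotz_real V2 z)" if "cmod z < 1" for z
    using poisson_int_ge[OF Vi(2) AE2 that] k2 Re_herglotz[OF Vi(2) that] by simp
  \<comment> \<open>the radial limits of the two Herglotz integrals\<close>
  define L1 where "L1 \<zeta> = Complex (V1 \<zeta>) (conj_fun V1 \<zeta>)" for \<zeta>
  define L2 where "L2 \<zeta> = Complex (V2 \<zeta>) (conj_fun V2 \<zeta>)" for \<zeta>
  have outer: "jones_outer v \<zeta> = csqrt (L1 \<zeta>) / csqrt (L2 \<zeta>)" for \<zeta>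
    by (simp add: jones_outer_def L1_def L2_def V1_def[abs_def] V2_def[abs_def] del: csqrt.simps)
  have Lpos: "AE \<zeta> in circle. 0 < Re (L1 \<zeta>) \<and> 0 < Re (L2 \<zeta>)"
    using AE1 AE2 by eventually_elim (use k1 k2 in \<open>auto simp: L1_def L2_def\<close>)
  have bnd: "AE \<zeta> in circle. 0 < Re (jones_outer v \<zeta>) \<and> v \<zeta> \<le> 3 * cmod (jones_outer v \<zeta>) \<and> cmod (jones_outer v \<zeta>) \<le> 3 * v \<zeta>"
    using Lpos J(4,5) AE_space
  proof eventually_elim
    case (elim \<zeta>)
    have vz: "0 < v \<zeta>" by (rule vpos[OF norm_circle[OF elim(4)]])
    have V0: "0 < V1 \<zeta>" "0 < V2 \<zeta>" using elim(1) by (auto simp: L1_def L2_def)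
    have b1: "V1 \<zeta> \<le> cmod (L1 \<zeta>)" "cmod (L1 \<zeta>) \<le> 7 * V1 \<zeta>"
      using cmod_Complex_sector[OF V0(1), of "conj_fun V1 \<zeta>"] elim(3) by (simp_all add: L1_def V1_def[abs_def])
    have b2: "V2 \<zeta> \<le> cmod (L2 \<zeta>)" "cmod (L2 \<zeta>) \<le> 7 * V2 \<zeta>"
      using cmod_Complex_sector[OF V0(2), of "conj_fun V2 \<zeta>"] elim(2) by (simp_all add: L2_def V2_def[abs_def])
    have q: "V1 \<zeta> / V2 \<zeta> = (v \<zeta>)\<^sup>2"
    proof -
      have "jones_fun v \<zeta> \<noteq> 0" using V0 by (auto simp: V1_def)
      then show ?thesis using vz by (simp add: V1_def V2_def power2_eq_square)
    qed
    have sq: "(cmod (jones_outer v \<zeta>))\<^sup>2 = cmod (L1 \<zeta>) / cmod (L2 \<zeta>)"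
      unfolding outer by (rule csqrt_quotient) (use elim(1) in auto)
    have "(v \<zeta>)\<^sup>2 = V1 \<zeta> / V2 \<zeta>" by (rule q[symmetric])
    also have "\<dots> \<le> cmod (L1 \<zeta>) / (cmod (L2 \<zeta>) / 7)"
      using b1 b2 V0 by (intro frac_le) auto
    \<comment> \<open>the constant \<open>3\<close> is an upper bound for \<open>sqrt 7\<close>\<close>
    also have "\<dots> \<le> (3 * cmod (jones_outer v \<zeta>))\<^sup>2"
    proof -
      have "cmod (L1 \<zeta>) / cmod (L2 \<zeta>) * 7 \<le> cmod (L1 \<zeta>) / cmod (L2 \<zeta>) * 9" by (intro mult_left_mono) auto
      then show ?thesis by (simp add: power_mult_distrib sq mult.commute)
    qed
    finally have up: "v \<zeta> \<le> 3 * cmod (jones_outer v \<zeta>)" by (rule power2_le_imp_le) simp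
    have "(cmod (jones_outer v \<zeta>))\<^sup>2 \<le> (7 * V1 \<zeta>) / V2 \<zeta>"
      unfolding sq using b1 b2 V0 by (intro frac_le) auto
    also have "\<dots> = 7 * (v \<zeta>)\<^sup>2" using q by simp
    also have "\<dots> \<le> (3 * v \<zeta>)\<^sup>2" by (simp add: power_mult_distrib)
    finally have lo: "cmod (jones_outer v \<zeta>) \<le> 3 * v \<zeta>" by (rule power2_le_imp_le) (use vz in simp)
    have "0 < Re (jones_outer v \<zeta>)" unfolding outer by (rule csqrt_quotient) (use elim(1) in auto)
    then show ?case using up lo by simp
  qed
  show "AE \<zeta> in circle. cmod (separator m v \<zeta>) \<le> real m * 6 ^ m"
    using bnd
  proof eventually_elim
    case (elim \<zeta>)
    have "cmod (separator m v \<zeta>) \<le> real m * 2 ^ m"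
      unfolding separator_def by (rule cutoff_bounds(1)) (use elim in auto)
    also have "\<dots> \<le> real m * 6 ^ m" by (intro mult_left_mono power_mono) auto
    finally show ?case .
  qed
  show "AE \<zeta> in circle. cmod (separator m v \<zeta>) * v \<zeta> ^ m \<le> real m * 6 ^ m"
    using bnd AE_space
  proof eventually_elim
    case (elim \<zeta>)
    have "cmod (separator m v \<zeta>) * v \<zeta> ^ m \<le> cmod (separator m v \<zeta>) * (3 * cmod (jones_outer v \<zeta>)) ^ m"
      using elim vpos[OF norm_circle[OF elim(2)]] by (intro mult_left_mono power_mono) auto
    also have "\<dots> = 3 ^ m * (cmod (separator m v \<zeta>) * cmod (jones_outer v \<zeta>) ^ m)" by (simp add: power_mult_distrib)
    also have "\<dots> \<le> 3 ^ m * (real m * 2 ^ m)"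
      unfolding separator_def by (intro mult_left_mono cutoff_bounds(2)) (use elim in auto)
    also have "\<dots> = real m * 6 ^ m" by (simp flip: power_mult_distrib)
    finally show ?case .
  qed
  show "AE \<zeta> in circle. cmod (1 - separator m v \<zeta>) \<le> (3 * real m) ^ m * min 1 (v \<zeta>) ^ m"
    using bnd AE_space
  proof eventually_elim
    case (elim \<zeta>)
    have "cmod (1 - separator m v \<zeta>) \<le> real m ^ m * min 1 (cmod (jones_outer v \<zeta>)) ^ m"
      unfolding separator_def by (rule cutoff_bounds(3)) (use elim in auto)
    also have "\<dots> \<le> real m ^ m * (3 * min 1 (v \<zeta>)) ^ m"
      using elim vpos[OF norm_circle[OF elim(2)]] by (intro mult_left_mono power_mono) (auto simp: min_def)
    also have "\<dots> = (3 * real m) ^ m * min 1 (v \<zeta>) ^ m" by (simp add: power_mult_distrib)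
    finally show ?case .
  qed
  define F where "F z = cutoff m (csqrt (herglotz_real V1 z) / csqrt (herglotz_real V2 z))" for z
  show "bounded_analytic_boundary_value (separator m v)"
    unfolding bounded_analytic_boundary_value_def
  proof (intro exI conjI)
    have nn: "z \<notin> \<real>\<^sub>\<le>\<^sub>0" if "0 < Re z" for z using that by (auto elim!: nonpos_Reals_cases)
    have h1: "(\<lambda>z. csqrt (herglotz_real V1 z)) holomorphic_on ball 0 1"
      by (intro holomorphic_on_csqrt' herglotz_real_holomorphic Vi) (use R1 nn in auto)
    have h2: "(\<lambda>z. csqrt (herglotz_real V2 z)) holomorphic_on ball 0 1"
      by (intro holomorphic_on_csqrt' herglotz_real_holomorphic Vi) (use R2 nn in auto)
    have pos: "0 < Re (csqrt (herglotz_real V1 z) / csqrt (herglotz_real V2 z))" if "z \<in> ball 0 1" for z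
      using R1[of z] R2[of z] that by (intro csqrt_quotient) auto
    have ne: "1 + csqrt (herglotz_real V1 z) / csqrt (herglotz_real V2 z) \<noteq> 0" if "z \<in> ball 0 1" for z
      using one_plus_ge(1)[OF less_imp_le[OF pos[OF that]]] by (auto simp del: csqrt.simps)
    show "F holomorphic_on ball 0 1"
      unfolding F_def[abs_def] cutoff_def
      by (intro holomorphic_intros h1 h2) (use ne R2 csqrt_half_sector(2) in \<open>auto simp del: csqrt.simps\<close>)
    show "bounded (F ` ball 0 1)"
      by (rule boundedI[where B = "real m * 2 ^ m"])
        (use less_imp_le[OF pos] in \<open>auto simp: F_def simp del: csqrt.simps intro!: cutoff_bounds(1)\<close>)
    show "AE z in circle. ((\<lambda>r. F (of_real r * z)) \<longlongrightarrow> separator m v z) (at_left 1)"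
      using herglotz_real_radial_limit[OF V(1)] herglotz_real_radial_limit[OF V(2)] Lpos
    proof eventually_elim
      case (elim \<zeta>)
      have c: "isCont csqrt (L1 \<zeta>)" "isCont csqrt (L2 \<zeta>)"
        using elim(3) nn by (auto intro!: continuous_at_csqrt)
      have t1: "((\<lambda>r. csqrt (herglotz_real V1 (of_real r * \<zeta>))) \<longlongrightarrow> csqrt (L1 \<zeta>)) (at_left 1)"
        by (rule isCont_tendsto_compose[OF c(1)]) (use elim(1) in \<open>simp add: L1_def\<close>)
      have t2: "((\<lambda>r. csqrt (herglotz_real V2 (of_real r * \<zeta>))) \<longlongrightarrow> csqrt (L2 \<zeta>)) (at_left 1)"
        by (rule isCont_tendsto_compose[OF c(2)]) (use elim(2) in \<open>simp add: L2_def\<close>)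
      have n2: "csqrt (L2 \<zeta>) \<noteq> 0" using elim(3) by (intro csqrt_half_sector(2)) auto
      have "0 < Re (jones_outer v \<zeta>)" unfolding outer by (rule csqrt_quotient) (use elim(3) in auto)
      then have n1: "1 + csqrt (L1 \<zeta>) / csqrt (L2 \<zeta>) \<noteq> 0"
        using one_plus_ge(1)[of "jones_outer v \<zeta>"] by (auto simp: outer simp del: csqrt.simps)
      show ?case unfolding F_def separator_def cutoff_def outer
        by (intro tendsto_intros t1 t2 n1 n2)
    qed
  qed
qed

text \<open>The weighted inequality applied to \<open>exp_weight \<delta> \<phi> r\<close>, the square of the present weight.\<close>

lemma conj_weight_exp:
  assumes \<phi>: "garsia_bounded K \<phi>" and \<delta>: "\<delta>\<^sup>2 * K \<le> 1 / 200" and r: "0 \<le> r" "r < 1"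
  shows "conj_weight (exp_weight (\<delta> / 2) \<phi> r)"
proof -
  have \<phi>s: "sq_integrable \<phi>" using \<phi> by (simp add: garsia_bounded_def)
  note \<phi>i = sq_integrable_integrable[OF \<phi>s]
  have sq: "(exp_weight (\<delta> / 2) \<phi> r \<zeta> * x)\<^sup>2 = exp_weight \<delta> \<phi> r \<zeta> * x\<^sup>2" for \<zeta> x
    by (simp add: exp_weight_def power_mult_distrib power2_eq_square flip: exp_add)
  obtain B where "\<And>z. cmod z \<le> 1 \<Longrightarrow> exp_weight (\<delta> / 2) \<phi> r z \<le> B" using exp_weight_bounds[OF \<phi>i r] by metis
  then show ?thesis
    unfolding conj_weight_def sq using weighted_conj_fun[OF \<phi> \<delta> r] exp_weight_measurable[OF \<phi>i r] exp_weight_pos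
    by (auto intro!: exI[of _ B])
qed

lemma conj_weight_exp_inverse:
  assumes \<phi>: "garsia_bounded K \<phi>" and \<delta>: "\<delta>\<^sup>2 * K \<le> 1 / 200" and r: "0 \<le> r" "r < 1"
  shows "conj_weight (\<lambda>\<zeta>. 1 / exp_weight (\<delta> / 2) \<phi> r \<zeta>)"
proof -
  have "conj_weight (exp_weight (- \<delta> / 2) \<phi> r)"
    using conj_weight_exp[OF \<phi>, of "- \<delta>"] \<delta> r by simp
  moreover have "exp_weight (- \<delta> / 2) \<phi> r = (\<lambda>\<zeta>. 1 / exp_weight (\<delta> / 2) \<phi> r \<zeta>)"
    by (simp add: exp_weight_neg[of "\<delta> / 2", simplified] fun_eq_iff inverse_eq_divide)
  ultimately show ?thesis by simp
qed

section \<open>Square means of functions of bounded mean oscillation\<close>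

lemma circle_arc_measurable: "circle_arc a b \<in> sets circle"
proof -
  have "compact (circle_arc a b)"
    unfolding circle_arc_def by (intro compact_continuous_image continuous_intros compact_Icc)
  then have "circle_arc a b \<in> sets borel" by (intro borel_closed compact_imp_closed)
  moreover have "circle_arc a b \<subseteq> sphere 0 1" by (auto simp: circle_arc_def)
  ultimately show ?thesis unfolding sets_circle by (simp add: sets_restrict_space_iff)
qed

text \<open>The only ambiguity of the angle is at \<open>b = a + 2 * pi\<close>, where the arc is the whole circle.\<close>

lemma cis_in_circle_arc:
  assumes "a < b" "b \<le> a + 2 * pi" "a \<le> t" "t < a + 2 * pi"
  shows "cis t \<in> circle_arc a b \<longleftrightarrow> t \<le> b"
proof
  assume "t \<le> b" then show "cis t \<in> circle_arc a b" using assms by (auto simp: circle_arc_def)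
next
  assume "cis t \<in> circle_arc a b"
  then obtain s where s: "a \<le> s" "s \<le> b" "cis t = cis s" by (auto simp: circle_arc_def)
  then have "sin t = sin s \<and> cos t = cos s" by (simp add: complex_eq_iff)
  then obtain n :: int where n: "t = s + 2 * pi * n" using sin_cos_eq_iff by blast
  show "t \<le> b"
  proof (cases "n \<le> 0")
    case True
    then have "2 * pi * n \<le> 0" by (simp add: mult_nonneg_nonpos)
    then show ?thesis using s n by linarith
  next
    case False
    then have "2 * pi * 1 \<le> 2 * pi * real_of_int n" by (intro mult_left_mono) auto
    then show ?thesis using s n assms by linarith
  qed
qed

lemma integral_circle_arc:
  fixes h :: "complex \<Rightarrow> real"
  assumes ab: "a < b" "b \<le> a + 2 * pi" and h [measurable]: "h \<in> borel_measurable circle"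
  shows "(LINT z:circle_arc a b|circle. h z) = (LINT t:{a..b}|lborel. h (cis t))"
proof -
  have [measurable]: "circle_arc a b \<in> sets circle" by (rule circle_arc_measurable)
  have hm [measurable]: "(\<lambda>t. h (cis t)) \<in> borel_measurable borel" by (rule measurable_compose[OF cis_measurable h])
  have "(LINT z:circle_arc a b|circle. h z) = (LINT t:{a..<a + 2 * pi}|lborel. indicator (circle_arc a b) (cis t) *\<^sub>R h (cis t))"
    unfolding set_lebesgue_integral_def
    by (subst integral_circle[of _ a]) (auto simp: set_lebesgue_integral_def)
  also have "\<dots> = (LINT t|lborel. indicator {a..b} t *\<^sub>R h (cis t))"
    unfolding set_lebesgue_integral_def
  proof (rule integral_cong_AE)
    have "(\<lambda>t. indicator (circle_arc a b) (cis t) :: real) \<in> borel_measurable borel"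
      by (rule measurable_compose[OF cis_measurable]) simp
    then show "(\<lambda>t. indicator {a..<a + 2 * pi} t *\<^sub>R indicator (circle_arc a b) (cis t) *\<^sub>R h (cis t)) \<in> borel_measurable lborel"
      by simp
    show "AE t in lborel. indicator {a..<a + 2 * pi} t *\<^sub>R indicator (circle_arc a b) (cis t) *\<^sub>R h (cis t) = indicator {a..b} t *\<^sub>R h (cis t)"
      using AE_lborel_singleton[of "a + 2 * pi"]
    proof eventually_elim
      case (elim t)
      then show ?case using cis_in_circle_arc[OF ab, of t] ab
        by (cases "t \<in> {a..<a + 2 * pi}") (auto simp: indicator_def)
    qed
  qed simp
  finally show ?thesis by (simp add: set_lebesgue_integral_def)
qed

lemma measure_circle_arc:
  assumes ab: "a < b" "b \<le> a + 2 * pi"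
  shows "measure circle (circle_arc a b) = b - a"
proof -
  have "(LINT z:circle_arc a b|circle. 1::real) = (LINT t:{a..b}|lborel. 1::real)"
    by (rule integral_circle_arc[OF ab]) simp
  moreover have "(LINT z:circle_arc a b|circle. 1::real) = measure circle (circle_arc a b)"
    using circle_arc_measurable by (simp add: set_lebesgue_integral_def)
  moreover have "(LINT t:{a..b}|lborel. 1::real) = b - a" using ab by (simp add: set_lebesgue_integral_def)
  ultimately show ?thesis by simp
qed

definition avg :: "(real \<Rightarrow> real) \<Rightarrow> real \<Rightarrow> real \<Rightarrow> real" where
  "avg g a b = (LINT t:{a..b}|lborel. g t) / (b - a)"

definition osc_bounded :: "real \<Rightarrow> (real \<Rightarrow> real) \<Rightarrow> bool" where
  "osc_bounded C g \<longleftrightarrow> (\<forall>a b. set_integrable lborel {a..b} g) \<and> 0 \<le> C \<and>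
    (\<forall>a b. a < b \<longrightarrow> b \<le> a + 2 * pi \<longrightarrow> (LINT t:{a..b}|lborel. \<bar>g t - avg g a b\<bar>) \<le> C * (b - a))"

lemma BMO_norm_osc_bounded:
  assumes "BMO_norm \<phi> \<le> ennreal C"
  shows "integrable circle \<phi>" "osc_bounded (max 0 C) (\<lambda>t. \<phi> (cis t))"
proof -
  show int: "integrable circle \<phi>"
    using assms unfolding BMO_norm_def by (auto split: if_splits simp: top_unique)
  have [measurable]: "\<phi> \<in> borel_measurable circle" using int by simp
  have le: "ennreal (mean_on (circle_arc a b) (\<lambda>z. \<bar>\<phi> z - mean_on (circle_arc a b) \<phi>\<bar>)) \<le> ennreal C" if "a < b" "b \<le> a + 2 * pi" for a b
  proof -
    have "ennreal (mean_on (circle_arc a b) (\<lambda>z. \<bar>\<phi> z - mean_on (circle_arc a b) \<phi>\<bar>)) \<le> BMO_norm \<phi>"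
      unfolding BMO_norm_def using int that by (auto intro!: SUP_upper2[of "(a, b)"])
    then show ?thesis using assms by (rule order.trans)
  qed
  show "osc_bounded (max 0 C) (\<lambda>t. \<phi> (cis t))"
    unfolding osc_bounded_def
  proof (intro conjI allI impI)
    fix a b show "set_integrable lborel {a..b} (\<lambda>t. \<phi> (cis t))" by (rule set_integrable_cis[OF int])
  next
    fix a b :: real assume ab: "a < b" "b \<le> a + 2 * pi"
    have m: "mean_on (circle_arc a b) \<phi> = avg (\<lambda>t. \<phi> (cis t)) a b"
      unfolding mean_on_def avg_def using ab by (simp add: integral_circle_arc measure_circle_arc)
    have "mean_on (circle_arc a b) (\<lambda>z. \<bar>\<phi> z - mean_on (circle_arc a b) \<phi>\<bar>)
       = (LINT t:{a..b}|lborel. \<bar>\<phi> (cis t) - avg (\<lambda>t. \<phi> (cis t)) a b\<bar>) / (b - a)"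
      unfolding m unfolding mean_on_def using ab by (subst integral_circle_arc) (auto simp: measure_circle_arc)
    then have "ennreal ((LINT t:{a..b}|lborel. \<bar>\<phi> (cis t) - avg (\<lambda>t. \<phi> (cis t)) a b\<bar>) / (b - a)) \<le> ennreal C"
      using le[OF ab] by simp
    then have "(LINT t:{a..b}|lborel. \<bar>\<phi> (cis t) - avg (\<lambda>t. \<phi> (cis t)) a b\<bar>) / (b - a) \<le> max 0 C"
      by (auto simp: ennreal_le_iff2)
    then show "(LINT t:{a..b}|lborel. \<bar>\<phi> (cis t) - avg (\<lambda>t. \<phi> (cis t)) a b\<bar>) \<le> max 0 C * (b - a)"
      using ab by (simp add: field_simps)
  qed simp
qed

lemma set_integrable_Icc_const: "set_integrable lborel {a..b::real} (\<lambda>_. c::real)"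
  unfolding set_integrable_def by (rule borel_integrable_compact) (auto intro: compact_Icc)

lemma set_integral_Icc_const: "a \<le> b \<Longrightarrow> (LINT t:{a..b}|lborel. c) = c * (b - a :: real)"
  by (simp add: set_lebesgue_integral_def)

lemma set_integral_Icc_split:
  fixes g :: "real \<Rightarrow> real"
  assumes g: "\<And>a b. set_integrable lborel {a..b} g" and ord: "a \<le> m" "m \<le> b"
  shows "(LINT t:{a..b}|lborel. g t) = (LINT t:{a..m}|lborel. g t) + (LINT t:{m..b}|lborel. g t)"
proof -
  have "{a..b} = {a..m} \<union> {m..b}" using ord by auto
  moreover have "AE t in lborel. \<not> (t \<in> {a..m} \<and> t \<in> {m..b})"
    using AE_lborel_singleton[of m] by eventually_elim auto
  ultimately show ?thesis using g by (simp, intro set_integral_Un_AE) auto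
qed

lemma set_integral_Icc_mono_set:
  fixes g :: "real \<Rightarrow> real"
  assumes g: "\<And>a b. set_integrable lborel {a..b} g" and nn: "\<And>t. 0 \<le> g t" and sub: "{a..b} \<subseteq> {c..d}"
  shows "(LINT t:{a..b}|lborel. g t) \<le> (LINT t:{c..d}|lborel. g t)"
  unfolding set_lebesgue_integral_def
  by (rule integral_mono) (use g[of a b] g[of c d] nn sub in \<open>auto simp: set_integrable_def indicator_def\<close>)

locale local_L1 =
  fixes g :: "real \<Rightarrow> real"
  assumes g: "\<And>a b. set_integrable lborel {a..b} g"
begin

lemma g_dev: "set_integrable lborel {a..b} (\<lambda>t. \<bar>g t - c\<bar>)"
  by (intro set_integrable_abs set_integral_diff(1) g set_integrable_Icc_const)

lemma avg_dev: "a < b \<Longrightarrow> (b - a) * \<bar>avg g a b - c\<bar> \<le> (LINT t:{a..b}|lborel. \<bar>g t - c\<bar>)"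
proof -
  assume ab: "a < b"
  have "(b - a) * (avg g a b - c) = (LINT t:{a..b}|lborel. g t - c)"
    using ab g by (simp add: set_integral_diff(2)[OF g set_integrable_Icc_const] set_integral_Icc_const avg_def field_simps)
  then have "(b - a) * \<bar>avg g a b - c\<bar> = \<bar>LINT t:{a..b}|lborel. g t - c\<bar>"
    using ab by (metis abs_mult abs_of_pos diff_gt_0_iff_gt)
  also have "\<dots> \<le> (LINT t:{a..b}|lborel. \<bar>g t - c\<bar>)"
    using set_integral_norm_bound[of lborel "{a..b}" "\<lambda>t. g t - c"] set_integral_diff(1)[OF g set_integrable_Icc_const] by simp
  finally show ?thesis .
qed

lemma avg_halves: "a < b \<Longrightarrow> avg g a b = (avg g a ((a + b) / 2) + avg g ((a + b) / 2) b) / 2"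
proof -
  assume ab: "a < b"
  have len: "(a + b) / 2 - a = (b - a) / 2" "b - (a + b) / 2 = (b - a) / 2" by (simp_all add: field_simps)
  have "(LINT t:{a..b}|lborel. g t) = (LINT t:{a..(a + b) / 2}|lborel. g t) + (LINT t:{(a + b) / 2..b}|lborel. g t)"
    by (rule set_integral_Icc_split[OF g]) (use ab in auto)
  moreover have "(x + y) / c = (x / (c / 2) + y / (c / 2)) / 2" for x y c :: real
    by (simp add: add_divide_distrib)
  ultimately show ?thesis unfolding avg_def len by (simp only:)
qed

text \<open>The integral of \<open>(E - c)\<^sup>2\<close> over \<open>{a..b}\<close>, where \<open>E\<close> is the average of \<open>g\<close> over the dyadic subintervals of generation
  \<open>n\<close>. It is finite for every locally integrable \<open>g\<close>, and the
  recursion allows a stopping time argument by induction on \<open>n\<close>.\<close>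

primrec dyadic_sq :: "nat \<Rightarrow> real \<Rightarrow> real \<Rightarrow> real \<Rightarrow> real" where
  "dyadic_sq 0 a b c = (b - a) * (avg g a b - c)\<^sup>2"
| "dyadic_sq (Suc n) a b c = dyadic_sq n a ((a + b) / 2) c + dyadic_sq n ((a + b) / 2) b c"

lemma dyadic_sq_shift:
  "a < b \<Longrightarrow> dyadic_sq n a b c = dyadic_sq n a b (avg g a b) + (b - a) * (avg g a b - c)\<^sup>2"
proof (induction n arbitrary: a b c)
  case (Suc n)
  define m where "m = (a + b) / 2"
  have m: "a < m" "m < b" using Suc.prems by (auto simp: m_def)
  have len: "m - a = (b - a) / 2" "b - m = (b - a) / 2" by (auto simp: m_def field_simps)
  have A: "avg g a b = (avg g a m + avg g m b) / 2" unfolding m_def by (rule avg_halves[OF Suc.prems])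
  have D: "dyadic_sq (Suc n) a b d = dyadic_sq n a m (avg g a m) + dyadic_sq n m b (avg g m b)
     + (b - a) / 2 * (avg g a m - d)\<^sup>2 + (b - a) / 2 * (avg g m b - d)\<^sup>2" for d
    using Suc.IH[OF m(1), of d] Suc.IH[OF m(2), of d] by (simp add: m_def[symmetric] len)
  show ?case unfolding D[of c] D[of "avg g a b"] unfolding A by (simp add: field_simps power2_eq_square)
qed simp

primrec dyadic_avg :: "nat \<Rightarrow> real \<Rightarrow> real \<Rightarrow> real \<Rightarrow> real" where
  "dyadic_avg 0 a b t = avg g a b"
| "dyadic_avg (Suc n) a b t = (if t < (a + b) / 2 then dyadic_avg n a ((a + b) / 2) t else dyadic_avg n ((a + b) / 2) b t)"

lemma dyadic_avg_measurable [measurable]: "(\<lambda>t. dyadic_avg n a b t) \<in> borel_measurable borel"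
proof (induction n arbitrary: a b)
  case 0
  have "(\<lambda>t. dyadic_avg 0 a b t) = (\<lambda>_. avg g a b)" by (simp add: fun_eq_iff)
  then show ?case by (simp only: borel_measurable_const)
next
  case (Suc n)
  have [measurable]: "(\<lambda>t. dyadic_avg n a b t) \<in> borel_measurable borel" for a b by (rule Suc)
  have "(\<lambda>t. if t < (a + b) / 2 then dyadic_avg n a ((a + b) / 2) t else dyadic_avg n ((a + b) / 2) b t) \<in> borel_measurable borel"
    by measurable
  moreover have "(\<lambda>t. dyadic_avg (Suc n) a b t) = (\<lambda>t. if t < (a + b) / 2 then dyadic_avg n a ((a + b) / 2) t else dyadic_avg n ((a + b) / 2) b t)"
    by (simp add: fun_eq_iff)
  ultimately show ?case by (simp only:)
qed

lemma dyadic_avg_sq_integral: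
  "a < b \<Longrightarrow> set_integrable lborel {a..<b} (\<lambda>t. (dyadic_avg n a b t - c)\<^sup>2) \<and>
     (LINT t:{a..<b}|lborel. (dyadic_avg n a b t - c)\<^sup>2) = dyadic_sq n a b c"
proof (induction n arbitrary: a b)
  case 0
  have "set_integrable lborel {a..<b} (\<lambda>t. (avg g a b - c)\<^sup>2)"
    by (rule set_integrable_subset[OF set_integrable_Icc_const[of a b]]) auto
  then show ?case using 0 by (simp add: set_lebesgue_integral_def)
next
  case (Suc n)
  define m where "m = (a + b) / 2"
  have m: "a < m" "m < b" using Suc.prems by (auto simp: m_def)
  let ?d = "\<lambda>t. (dyadic_avg (Suc n) a b t - c)\<^sup>2"
  have e1: "indicator {a..<m} t *\<^sub>R ?d t = indicator {a..<m} t *\<^sub>R (dyadic_avg n a m t - c)\<^sup>2" for t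
    by (auto simp: indicator_def m_def)
  have e2: "indicator {m..<b} t *\<^sub>R ?d t = indicator {m..<b} t *\<^sub>R (dyadic_avg n m b t - c)\<^sup>2" for t
    by (auto simp: indicator_def m_def)
  have i1: "set_integrable lborel {a..<m} ?d" "(LINT t:{a..<m}|lborel. ?d t) = dyadic_sq n a m c"
    using Suc.IH[OF m(1)] unfolding set_integrable_def set_lebesgue_integral_def e1 by auto
  have i2: "set_integrable lborel {m..<b} ?d" "(LINT t:{m..<b}|lborel. ?d t) = dyadic_sq n m b c"
    using Suc.IH[OF m(2)] unfolding set_integrable_def set_lebesgue_integral_def e2 by auto
  have U: "{a..<b} = {a..<m} \<union> {m..<b}" using m by auto
  have "set_integrable lborel {a..<b} ?d" unfolding U by (intro set_integrable_Un i1 i2) auto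
  moreover have "(LINT t:{a..<b}|lborel. ?d t) = dyadic_sq (Suc n) a b c"
    unfolding U by (subst set_integral_Un) (use i1 i2 in \<open>auto simp: m_def[symmetric]\<close>)
  ultimately show ?case by blast
qed

lemma dyadic_avg_interval:
  "a \<le> t \<Longrightarrow> t < b \<Longrightarrow> \<exists>p q. p \<le> t \<and> t < q \<and> q - p = (b - a) / 2 ^ n \<and> dyadic_avg n a b t = avg g p q"
proof (induction n arbitrary: a b)
  case 0
  then show ?case by auto
next
  case (Suc n)
  have h: "((a + b) / 2 - a) / 2 ^ n = (b - a) / 2 ^ Suc n" "(b - (a + b) / 2) / 2 ^ n = (b - a) / 2 ^ Suc n"
    by (simp_all add: field_simps)
  show ?case
  proof (cases "t < (a + b) / 2")
    case True
    then show ?thesis using Suc.IH[of a "(a + b) / 2"] Suc.prems h by auto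
  next
    case False
    then show ?thesis using Suc.IH[of "(a + b) / 2" b] Suc.prems h by auto
  qed
qed

lemma dyadic_avg_tendsto:
  assumes L: "lebesgue_point g t" and t: "a \<le> t" "t < b"
  shows "(\<lambda>n. dyadic_avg n a b t) \<longlonglongrightarrow> g t"
proof (rule LIMSEQ_I)
  fix e :: real assume e: "e > 0"
  obtain d where d: "d > 0" "\<And>h. 0 < h \<Longrightarrow> h < d \<Longrightarrow> (LINT s:{t - h..t + h}|lborel. norm (g s - g t)) \<le> e / 2 * h"
    using L e unfolding lebesgue_point_def by (meson half_gt_zero)
  obtain n0 where n0: "(b - a) / d < 2 ^ n0" using real_arch_pow[of 2 "(b - a) / d"] by auto
  show "\<exists>n0. \<forall>n\<ge>n0. norm (dyadic_avg n a b t - g t) < e"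
  proof (intro exI[of _ n0] allI impI)
    fix n assume n: "n0 \<le> n"
    define h where "h = (b - a) / 2 ^ n"
    have "(2::real) ^ n0 \<le> 2 ^ n" using n by (intro power_increasing) auto
    then have "(b - a) / d < 2 ^ n" using n0 by linarith
    then have h: "0 < h" "h < d" using t d(1) by (auto simp: h_def field_simps)
    obtain p q where pq: "p \<le> t" "t < q" "q - p = h" "dyadic_avg n a b t = avg g p q"
      using dyadic_avg_interval[OF t, of n] unfolding h_def by blast
    have "h * \<bar>avg g p q - g t\<bar> \<le> (LINT s:{p..q}|lborel. \<bar>g s - g t\<bar>)"
      using avg_dev[of p q "g t"] pq by simp
    also have "\<dots> \<le> (LINT s:{t - h..t + h}|lborel. \<bar>g s - g t\<bar>)"
      by (rule set_integral_Icc_mono_set[OF g_dev]) (use pq in auto)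
    also have "\<dots> \<le> e / 2 * h" using d(2)[OF h] by simp
    finally have "\<bar>avg g p q - g t\<bar> \<le> e / 2" using h by (simp add: mult.commute)
    then show "norm (dyadic_avg n a b t - g t) < e" using e pq by simp
  qed
qed

end

text \<open>A finite version of the Calderon-Zygmund stopping argument, by induction on the dyadic generation. As long as the mean of
  \<open>\<bar>g - c\<bar>\<close> stays below \<open>2 C\<close>, nothing is done. When it first exceeds this level on a half, it is still at most \<open>4 C\<close>
  there, and \<open>c\<close> is replaced by the average of \<open>g\<close>; the cost \<open>16 C\<^sup>2\<close> per length is paid by the integral of \<open>\<bar>g - c\<bar>\<close> over
  that half, which exceeds \<open>2 C\<close> times its length. This accounts for the term \<open>20 C \<integral> \<bar>g - c\<bar>\<close>. Letting the
  generation tend to infinity gives the square mean of \<open>g\<close> itself.\<close>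

theorem John_Nirenberg_L2:
  assumes C: "osc_bounded C g" and ab: "a < b" "b \<le> a + 2 * pi"
  shows "set_integrable lborel {a..b} (\<lambda>t. (g t - avg g a b)\<^sup>2)"
    and "(LINT t:{a..b}|lborel. (g t - avg g a b)\<^sup>2) \<le> 24 * C\<^sup>2 * (b - a)"
proof -
  interpret local_L1 g using C by unfold_locales (auto simp: osc_bounded_def)
  have C0: "0 \<le> C" using C by (simp add: osc_bounded_def)
  have osc: "(LINT t:{a..b}|lborel. \<bar>g t - avg g a b\<bar>) \<le> C * (b - a)" if "a < b" "b \<le> a + 2 * pi" for a b
    using C that by (simp add: osc_bounded_def)
  have Q: "(\<forall>a b c. a < b \<longrightarrow> b \<le> a + 2 * pi \<longrightarrow> (LINT t:{a..b}|lborel. \<bar>g t - c\<bar>) \<le> 2 * C * (b - a) \<longrightarrow>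
      dyadic_sq n a b c \<le> 4 * C\<^sup>2 * (b - a) + 20 * C * (LINT t:{a..b}|lborel. \<bar>g t - c\<bar>))" for n
  proof (induction n)
    case 0
    show ?case
    proof (intro allI impI)
      fix a b c :: real assume ab: "a < b" and L: "(LINT t:{a..b}|lborel. \<bar>g t - c\<bar>) \<le> 2 * C * (b - a)"
      have "(b - a) * \<bar>avg g a b - c\<bar> \<le> (b - a) * (2 * C)" using avg_dev[OF ab, of c] L by (simp add: mult_ac)
      then have "\<bar>avg g a b - c\<bar> \<le> 2 * C" using ab by simp
      then have "\<bar>avg g a b - c\<bar>\<^sup>2 \<le> (2 * C)\<^sup>2" by (intro power_mono) auto
      then have "(b - a) * (avg g a b - c)\<^sup>2 \<le> (b - a) * (4 * C\<^sup>2)"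
        using ab by (intro mult_left_mono) (auto simp: power_mult_distrib)
      moreover have "0 \<le> (LINT t:{a..b}|lborel. \<bar>g t - c\<bar>)" by (simp add: set_lebesgue_integral_def)
      then have "0 \<le> 20 * C * (LINT t:{a..b}|lborel. \<bar>g t - c\<bar>)" using C0 by simp
      ultimately show "dyadic_sq 0 a b c \<le> 4 * C\<^sup>2 * (b - a) + 20 * C * (LINT t:{a..b}|lborel. \<bar>g t - c\<bar>)"
        by (simp add: mult_ac)
    qed
  next
    case (Suc n)
    \<comment> \<open>the induction hypothesis for an interval whose mean may be up to twice as large: recentre if it exceeds \<open>2 C\<close>\<close>
    have half: "dyadic_sq n p q c \<le> 4 * C\<^sup>2 * (q - p) + 20 * C * (LINT t:{p..q}|lborel. \<bar>g t - c\<bar>)"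
      if pq: "p < q" "q \<le> p + 2 * pi" and L4: "(LINT t:{p..q}|lborel. \<bar>g t - c\<bar>) \<le> 4 * C * (q - p)" for p q c
    proof (cases "(LINT t:{p..q}|lborel. \<bar>g t - c\<bar>) \<le> 2 * C * (q - p)")
      case True
      then show ?thesis using Suc pq by blast
    next
      case False
      have "(q - p) * \<bar>avg g p q - c\<bar> \<le> (q - p) * (4 * C)" using avg_dev[OF pq(1), of c] L4 by (simp add: mult_ac)
      then have "\<bar>avg g p q - c\<bar> \<le> 4 * C" using pq by simp
      then have "\<bar>avg g p q - c\<bar>\<^sup>2 \<le> (4 * C)\<^sup>2" by (intro power_mono) auto
      then have 1: "(q - p) * (avg g p q - c)\<^sup>2 \<le> (q - p) * (16 * C\<^sup>2)"
        using pq by (intro mult_left_mono) (auto simp: power_mult_distrib)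
      have "dyadic_sq n p q (avg g p q) \<le> 4 * C\<^sup>2 * (q - p) + 20 * C * (LINT t:{p..q}|lborel. \<bar>g t - avg g p q\<bar>)"
        using Suc pq osc[OF pq] C0 by (auto intro!: Suc[rule_format] order.trans[OF osc[OF pq]] simp: mult_right_mono)
      also have "20 * C * (LINT t:{p..q}|lborel. \<bar>g t - avg g p q\<bar>) \<le> 20 * C * (C * (q - p))"
        using C0 by (intro mult_left_mono osc[OF pq]) auto
      finally have 2: "dyadic_sq n p q (avg g p q) \<le> 24 * C\<^sup>2 * (q - p)" by (simp add: power2_eq_square algebra_simps)
      have 3: "20 * C * (2 * C * (q - p)) \<le> 20 * C * (LINT t:{p..q}|lborel. \<bar>g t - c\<bar>)"
        using False C0 by (intro mult_left_mono) auto
      have 4: "0 \<le> 4 * C\<^sup>2 * (q - p)" using pq by simp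
      show ?thesis using dyadic_sq_shift[OF pq(1), of n c] 1 2 3 4 by (simp add: power2_eq_square algebra_simps)
    qed
    show ?case
    proof (intro allI impI)
      fix a b c :: real assume ab: "a < b" "b \<le> a + 2 * pi" and L: "(LINT t:{a..b}|lborel. \<bar>g t - c\<bar>) \<le> 2 * C * (b - a)"
      define m where "m = (a + b) / 2"
      have m: "a < m" "m < b" using ab by (auto simp: m_def)
      have S: "(LINT t:{a..b}|lborel. \<bar>g t - c\<bar>) = (LINT t:{a..m}|lborel. \<bar>g t - c\<bar>) + (LINT t:{m..b}|lborel. \<bar>g t - c\<bar>)"
        by (rule set_integral_Icc_split[OF g_dev]) (use m in auto)
      have L1: "(LINT t:{a..m}|lborel. \<bar>g t - c\<bar>) \<le> 4 * C * (m - a)"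
      proof -
        have "(LINT t:{a..m}|lborel. \<bar>g t - c\<bar>) \<le> (LINT t:{a..b}|lborel. \<bar>g t - c\<bar>)"
          by (rule set_integral_Icc_mono_set[OF g_dev]) (use m in auto)
        then show ?thesis using L by (simp add: m_def field_simps)
      qed
      have L2: "(LINT t:{m..b}|lborel. \<bar>g t - c\<bar>) \<le> 4 * C * (b - m)"
      proof -
        have "(LINT t:{m..b}|lborel. \<bar>g t - c\<bar>) \<le> (LINT t:{a..b}|lborel. \<bar>g t - c\<bar>)"
          by (rule set_integral_Icc_mono_set[OF g_dev]) (use m in auto)
        then show ?thesis using L by (simp add: m_def field_simps)
      qed
      have "dyadic_sq n a m c + dyadic_sq n m b c \<le>
        (4 * C\<^sup>2 * (m - a) + 20 * C * (LINT t:{a..m}|lborel. \<bar>g t - c\<bar>)) + (4 * C\<^sup>2 * (b - m) + 20 * C * (LINT t:{m..b}|lborel. \<bar>g t - c\<bar>))"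
        using m ab by (intro add_mono half L1 L2) auto
      then show "dyadic_sq (Suc n) a b c \<le> 4 * C\<^sup>2 * (b - a) + 20 * C * (LINT t:{a..b}|lborel. \<bar>g t - c\<bar>)"
        unfolding S by (simp add: m_def[symmetric] algebra_simps)
    qed
  qed
  define A where "A = avg g a b"
  have P: "dyadic_sq n a b A \<le> 24 * C\<^sup>2 * (b - a)" for n
  proof -
    have "dyadic_sq n a b A \<le> 4 * C\<^sup>2 * (b - a) + 20 * C * (LINT t:{a..b}|lborel. \<bar>g t - A\<bar>)"
      using ab osc[OF ab] C0 unfolding A_def by (auto intro!: Q[rule_format] order.trans[OF osc[OF ab]] simp: mult_right_mono)
    also have "20 * C * (LINT t:{a..b}|lborel. \<bar>g t - A\<bar>) \<le> 20 * C * (C * (b - a))"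
      using C0 unfolding A_def by (intro mult_left_mono osc[OF ab]) auto
    finally show ?thesis by (simp add: power2_eq_square algebra_simps)
  qed
  have gm: "(\<lambda>t. indicator {a..b} t * g t) \<in> borel_measurable lborel"
    using g[of a b] unfolding set_integrable_def by auto
  have k1: "integrable lborel (\<lambda>t. indicator {a..<b} t * (dyadic_avg n a b t - A)\<^sup>2)"
    and k5: "(LINT t|lborel. indicator {a..<b} t * (dyadic_avg n a b t - A)\<^sup>2) \<le> 24 * C\<^sup>2 * (b - a)" for n
    using dyadic_avg_sq_integral[OF ab(1), of n A] P[of n] by (auto simp: set_integrable_def set_lebesgue_integral_def)
  have k3: "AE t in lborel. (\<lambda>n. indicator {a..<b} t * (dyadic_avg n a b t - A)\<^sup>2) \<longlonglongrightarrow> indicator {a..b} t * (g t - A)\<^sup>2"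
    using AE_lebesgue_point[OF g] AE_lborel_singleton[of b]
  proof eventually_elim
    case (elim t)
    show ?case
    proof (cases "t \<in> {a..<b}")
      case True
      then show ?thesis using dyadic_avg_tendsto[OF elim(1), of a b] by (auto intro!: tendsto_intros)
    next
      case False
      then show ?thesis using elim(2) by auto
    qed
  qed
  have k4: "(\<lambda>t. indicator {a..b} t * (g t - A)\<^sup>2) \<in> borel_measurable lborel"
  proof -
    have "(\<lambda>t. indicator {a..b} t * (indicator {a..b} t * g t - A)\<^sup>2) \<in> borel_measurable lborel"
      using gm by measurable
    moreover have "(\<lambda>t. indicator {a..b} t * (indicator {a..b} t * g t - A)\<^sup>2) = (\<lambda>t. indicator {a..b} t * (g t - A)\<^sup>2 :: real)"
      by (auto simp: indicator_def fun_eq_iff)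
    ultimately show ?thesis by simp
  qed
  note F = integral_limit_le[OF k1 _ k3 k4 k5]
  show "set_integrable lborel {a..b} (\<lambda>t. (g t - avg g a b)\<^sup>2)"
    using F(1) by (simp add: set_integrable_def A_def)
  show "(LINT t:{a..b}|lborel. (g t - avg g a b)\<^sup>2) \<le> 24 * C\<^sup>2 * (b - a)"
    using F(2) by (simp add: set_lebesgue_integral_def A_def)
qed

lemma poisson_int_le_layers:
  fixes h :: "complex \<Rightarrow> real"
  assumes h: "integrable circle h" and h0: "\<And>\<xi>. 0 \<le> h \<xi>"
    and r: "0 \<le> r" "r < 1" and J: "pi \<le> 2 ^ J * (1 - r)"
    and m: "\<And>j. m j = min pi (2 ^ j * (1 - r))"
  shows "poisson_int h (of_real r * cis x)
     \<le> 160 / (pi * (1 - r)) * (\<Sum>j\<le>J. (1/4) ^ j * (LINT t:{x - m j..x + m j}|lborel. h (cis t)))"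
proof -
  have hm: "h \<in> borel_measurable circle" using h by simp
  note si = set_integrable_cis[OF h]
  define G where "G t = 320 / (1 - r) * (\<Sum>j\<le>J. (1/4) ^ j * (indicator {x - m j..x + m j} t * h (cis t)))" for t
  have iG: "integrable lborel (\<lambda>t. indicator {x - a..x + a} t * h (cis t))" for a
    using si[of "x - a" "x + a"] by (simp add: set_integrable_def)
  have le: "indicator {x - pi..x + pi} t * (poisson (of_real r * cis x) (cis t) * h (cis t)) \<le> G t" for t
  proof (cases "t \<in> {x - pi..x + pi}")
    case True
    have "poisson (of_real r * cis x) (cis (x + (t - x)))
       \<le> 320 / (1 - r) * (\<Sum>j\<le>J. (1/4) ^ j * indicator {- (2 ^ j * (1 - r))..2 ^ j * (1 - r)} (t - x))"
      using True J r by (intro poisson_layers) auto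
    also have "(\<Sum>j\<le>J. (1/4) ^ j * indicator {- (2 ^ j * (1 - r))..2 ^ j * (1 - r)} (t - x))
       = (\<Sum>j\<le>J. (1/4) ^ j * indicator {x - m j..x + m j} t :: real)"
      using True by (intro sum.cong refl) (auto simp: indicator_def m)
    finally have "poisson (of_real r * cis x) (cis t) * h (cis t) \<le> 320 / (1 - r) * (\<Sum>j\<le>J. (1/4) ^ j * indicator {x - m j..x + m j} t) * h (cis t)"
      using h0 by (intro mult_right_mono) auto
    also have "\<dots> = G t" unfolding G_def by (simp only: sum_distrib_right mult.assoc)
    finally show ?thesis using True by simp
  next
    case False
    then show ?thesis using h0 r unfolding G_def by (auto intro!: mult_nonneg_nonneg divide_nonneg_pos sum_nonneg)
  qed
  have "(LINT t:{x - pi..x + pi}|lborel. poisson (of_real r * cis x) (cis t) *\<^sub>R h (cis t)) \<le> (LINT t|lborel. G t)"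
    unfolding set_lebesgue_integral_def
  proof (rule integral_mono)
    have "integrable circle (\<lambda>\<xi>. poisson (of_real r * cis x) \<xi> *\<^sub>R h \<xi>)"
      using h r by (intro integrable_poisson) (auto simp: norm_mult)
    from set_integrable_cis[OF this, of "x - pi" "x + pi"]
    show "integrable lborel (\<lambda>t. indicator {x - pi..x + pi} t *\<^sub>R poisson (of_real r * cis x) (cis t) *\<^sub>R h (cis t))"
      by (simp add: set_integrable_def)
    show "integrable lborel G" unfolding G_def
      by (intro integrable_mult_right Bochner_Integration.integrable_sum iG)
  qed (use le in simp)
  also have "\<dots> = 320 / (1 - r) * (\<Sum>j\<le>J. (1/4) ^ j * (LINT t:{x - m j..x + m j}|lborel. h (cis t)))"
    unfolding G_def set_lebesgue_integral_def using iG by simp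
  finally have main: "(LINT t:{x - pi..x + pi}|lborel. poisson (of_real r * cis x) (cis t) *\<^sub>R h (cis t))
    \<le> 320 / (1 - r) * (\<Sum>j\<le>J. (1/4) ^ j * (LINT t:{x - m j..x + m j}|lborel. h (cis t)))" .
  have "poisson_int h (of_real r * cis x) = 1 / (2 * pi) * (LINT t:{x - pi..x + pi}|lborel. poisson (of_real r * cis x) (cis t) *\<^sub>R h (cis t))"
    unfolding poisson_int_eq[OF hm, of _ x] by simp
  also have "\<dots> \<le> 1 / (2 * pi) * (320 / (1 - r) * (\<Sum>j\<le>J. (1/4) ^ j * (LINT t:{x - m j..x + m j}|lborel. h (cis t))))"
    using main by (intro mult_left_mono) auto
  also have "\<dots> = 160 / (pi * (1 - r)) * (\<Sum>j\<le>J. (1/4) ^ j * (LINT t:{x - m j..x + m j}|lborel. h (cis t)))"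
    using r by (simp add: divide_simps)
  finally show ?thesis .
qed

text \<open>The averages over two consecutive dyadic intervals around the point differ by at most \<open>2 C\<close>, so the \<open>j\<close>-th one differs
  from the initial one by at most \<open>2 C j\<close>. With the square mean oscillation on each interval and the layer bound for the Poisson
  kernel this leads to the convergent series of \<open>2\<^sup>-\<^sup>j (1 + j\<^sup>2)\<close>.\<close>

theorem BMO_imp_garsia_bounded:
  assumes bmo: "BMO_norm \<phi> \<le> ennreal C"
  shows "garsia_bounded (50000 * C\<^sup>2) \<phi>"
proof -
  define g where "g t = \<phi> (cis t)" for t
  define D where "D = max 0 C"
  have int: "integrable circle \<phi>" by (rule BMO_norm_osc_bounded(1)[OF bmo])
  have osc: "osc_bounded D g" using BMO_norm_osc_bounded(2)[OF bmo] by (simp add: g_def[abs_def] D_def)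
  have D0: "0 \<le> D" and D2: "D\<^sup>2 \<le> C\<^sup>2" by (auto simp: D_def max_def)
  interpret local_L1 g using osc by unfold_locales (auto simp: osc_bounded_def)
  have [measurable]: "\<phi> \<in> borel_measurable circle" using int by simp
  note JN = John_Nirenberg_L2[OF osc]
  have sq: "sq_integrable \<phi>"
  proof -
    have JN0: "set_integrable lborel {0..0 + 2 * pi} (\<lambda>t. (g t - avg g 0 (0 + 2 * pi))\<^sup>2)"
      by (rule JN(1)) auto
    have "set_integrable lborel {0..<0 + 2 * pi} (\<lambda>t. (g t - avg g 0 (0 + 2 * pi))\<^sup>2)"
      by (rule set_integrable_subset[OF JN0]) auto
    then have "integrable circle (\<lambda>\<xi>. (\<phi> \<xi> - avg g 0 (0 + 2 * pi))\<^sup>2)"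
      by (subst integrable_circle_iff[of _ 0]) (auto simp: g_def)
    then have "sq_integrable (\<lambda>\<xi>. \<phi> \<xi> - avg g 0 (0 + 2 * pi))" by (simp add: sq_integrable_def)
    from sq_integrable_add[OF this, of "\<lambda>_. avg g 0 (0 + 2 * pi)"] show ?thesis by (simp add: sq_integrable_def)
  qed
  have main: "poisson_int (\<lambda>\<xi>. (\<phi> \<xi>)\<^sup>2) z - (poisson_int \<phi> z)\<^sup>2 \<le> 50000 * D\<^sup>2" if z: "cmod z < 1" for z
  proof -
    define r where "r = cmod z"
    define x where "x = Arg2pi z"
    have zr: "z = of_real r * cis x" using Arg2pi_eq[of z] by (simp add: r_def x_def cis_conv_exp)
    have r: "0 \<le> r" "r < 1" using z by (auto simp: r_def)
    define \<eta> where "\<eta> = 1 - r"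
    have \<eta>: "0 < \<eta>" using r by (simp add: \<eta>_def)
    obtain J where J: "pi \<le> 2 ^ J * \<eta>"
    proof -
      obtain n where "pi / \<eta> < 2 ^ n" using real_arch_pow[of 2 "pi / \<eta>"] by auto
      then show ?thesis using that[of n] \<eta> by (simp add: field_simps)
    qed
    \<comment> \<open>dyadic half lengths, capped so that the intervals do not overlap themselves on the circle\<close>
    define m where "m j = min pi (2 ^ j * \<eta>)" for j :: nat
    have m: "0 < m j" "m j \<le> pi" "m j \<le> 2 ^ j * \<eta>" for j using \<eta> by (auto simp: m_def)
    have m2: "m (Suc j) \<le> 2 * m j" "m j \<le> m (Suc j)" for j
    proof -
      have e: "2 ^ Suc j * \<eta> = 2 * (2 ^ j * \<eta>)" "0 < 2 ^ j * \<eta>" using \<eta> by auto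
      have "min pi (2 * y) \<le> 2 * min pi y \<and> min pi y \<le> min pi (2 * y)" if "0 < y" for y
        using that pi_gt_zero by (auto simp: min_def)
      from this[OF e(2)] show "m (Suc j) \<le> 2 * m j" "m j \<le> m (Suc j)" unfolding m_def e(1) by auto
    qed
    define A where "A j = avg g (x - m j) (x + m j)" for j
    have A1: "\<bar>A j - A (Suc j)\<bar> \<le> 2 * D" for j
    proof -
      have "2 * m j * \<bar>A j - A (Suc j)\<bar> \<le> (LINT t:{x - m j..x + m j}|lborel. \<bar>g t - A (Suc j)\<bar>)"
        using avg_dev[of "x - m j" "x + m j" "A (Suc j)"] m[of j] by (simp add: A_def)
      also have "\<dots> \<le> (LINT t:{x - m (Suc j)..x + m (Suc j)}|lborel. \<bar>g t - A (Suc j)\<bar>)"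
        by (rule set_integral_Icc_mono_set[OF g_dev]) (use m2[of j] in auto)
      also have "\<dots> \<le> D * (2 * m (Suc j))"
      proof -
        have "(LINT t:{x - m (Suc j)..x + m (Suc j)}|lborel. \<bar>g t - avg g (x - m (Suc j)) (x + m (Suc j))\<bar>)
            \<le> D * ((x + m (Suc j)) - (x - m (Suc j)))"
          by (rule osc[unfolded osc_bounded_def, THEN conjunct2, THEN conjunct2, rule_format]) (use m[of "Suc j"] in auto)
        then show ?thesis by (simp add: A_def)
      qed
      also have "\<dots> \<le> D * (2 * (2 * m j))" using D0 m2[of j] by (intro mult_left_mono) auto
      finally have "2 * m j * \<bar>A j - A (Suc j)\<bar> \<le> 2 * m j * (2 * D)" by (simp add: mult_ac)
      then show ?thesis using m[of j] by simp
    qed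
    have Aj: "\<bar>A j - A 0\<bar> \<le> 2 * D * real j" for j
    proof (induction j)
      case (Suc j)
      have "\<bar>A (Suc j) - A 0\<bar> \<le> \<bar>A j - A (Suc j)\<bar> + \<bar>A j - A 0\<bar>" by linarith
      then show ?case using A1[of j] Suc by (simp add: algebra_simps)
    qed simp
    define h where "h \<xi> = (\<phi> \<xi> - A 0)\<^sup>2" for \<xi>
    have hi: "integrable circle h"
      using sq_integrable_add[OF sq, of "\<lambda>_. - A 0"] by (simp add: h_def[abs_def] sq_integrable_def)
    have layer: "(LINT t:{x - m j..x + m j}|lborel. h (cis t)) \<le> (2 ^ j * \<eta>) * (D\<^sup>2 * (48 + 128 * (25/16) ^ j))" for j
    proof -
      have len: "x - m j < x + m j" "x + m j \<le> x - m j + 2 * pi" using m[of j] by auto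
      have i1: "set_integrable lborel {x - m j..x + m j} (\<lambda>t. (g t - A j)\<^sup>2)"
        unfolding A_def by (rule JN(1)[OF len])
      have i2: "set_integrable lborel {x - m j..x + m j} (\<lambda>t. g t - A j)"
        by (intro set_integral_diff(1) g set_integrable_Icc_const)
      have z0: "(LINT t:{x - m j..x + m j}|lborel. g t - A j) = 0"
        using m[of j] by (simp add: set_integral_diff(2)[OF g set_integrable_Icc_const] set_integral_Icc_const A_def avg_def)
      have "(LINT t:{x - m j..x + m j}|lborel. h (cis t))
         = (LINT t:{x - m j..x + m j}|lborel. (g t - A j)\<^sup>2 + (2 * (A j - A 0) * (g t - A j) + (A j - A 0)\<^sup>2))"
        by (simp add: h_def g_def power2_eq_square algebra_simps)
      also have "\<dots> = (LINT t:{x - m j..x + m j}|lborel. (g t - A j)\<^sup>2) + (2 * (A j - A 0) * (LINT t:{x - m j..x + m j}|lborel. g t - A j) + (A j - A 0)\<^sup>2 * (2 * m j))"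
        using i1 i2 m[of j] set_integrable_Icc_const set_integral_Icc_const[of "x - m j" "x + m j"]
        by (subst set_integral_add(2) | subst set_integral_mult_right | simp add: set_integrable_mult_right set_integral_add)+
      also have "\<dots> \<le> 24 * D\<^sup>2 * (2 * m j) + (2 * D * real j)\<^sup>2 * (2 * m j)"
      proof -
        have "(LINT t:{x - m j..x + m j}|lborel. (g t - A j)\<^sup>2) \<le> 24 * D\<^sup>2 * (2 * m j)"
          using JN(2)[OF len] by (simp add: A_def)
        moreover have "\<bar>A j - A 0\<bar>\<^sup>2 \<le> (2 * D * real j)\<^sup>2" by (intro power_mono Aj) auto
        then have "(A j - A 0)\<^sup>2 * (2 * m j) \<le> (2 * D * real j)\<^sup>2 * (2 * m j)"
          using m(1)[of j] by (intro mult_right_mono) auto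
        ultimately show ?thesis by (simp add: z0)
      qed
      also have "\<dots> = m j * (D\<^sup>2 * (48 + 8 * (real j)\<^sup>2))"
        by (simp add: power2_eq_square algebra_simps)
      also have "\<dots> \<le> (2 ^ j * \<eta>) * (D\<^sup>2 * (48 + 128 * (25/16) ^ j))"
      proof -
        \<comment> \<open>any base below \<open>sqrt 2\<close> would do, since the Poisson kernel leaves a factor \<open>2\<^sup>-\<^sup>j\<close>\<close>
        have "1 + real j * (1/4) \<le> (1 + 1/4) ^ j" by (rule Bernoulli_inequality) simp
        then have "real j \<le> 4 * (5/4) ^ j" by simp
        then have "(real j)\<^sup>2 \<le> (4 * (5/4) ^ j)\<^sup>2" by (intro power_mono) auto
        also have "\<dots> = 16 * (25/16) ^ j"
        proof -
          have "(5/4::real) ^ j * (5/4) ^ j = (25/16) ^ j" by (simp flip: power_mult_distrib)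
          then show ?thesis by (simp add: power2_eq_square)
        qed
        finally have F: "D\<^sup>2 * (48 + 8 * (real j)\<^sup>2) \<le> D\<^sup>2 * (48 + 128 * (25/16) ^ j)"
          by (intro mult_left_mono) auto
        show ?thesis by (rule mult_mono[OF m(3) F]) (use \<eta> in auto)
      qed
      finally show ?thesis .
    qed
    have "poisson_int h z \<le> 160 / (pi * (1 - r)) * (\<Sum>j\<le>J. (1/4) ^ j * (LINT t:{x - m j..x + m j}|lborel. h (cis t)))"
      unfolding zr by (rule poisson_int_le_layers[OF hi _ r]) (use J in \<open>auto simp: h_def m_def \<eta>_def\<close>)
    also have "\<dots> \<le> 160 / (pi * (1 - r)) * (\<Sum>j\<le>J. (1/4) ^ j * ((2 ^ j * \<eta>) * (D\<^sup>2 * (48 + 128 * (25/16) ^ j))))"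
      using r by (intro mult_left_mono sum_mono layer) auto
    also have "(\<Sum>j\<le>J. (1/4) ^ j * ((2 ^ j * \<eta>) * (D\<^sup>2 * (48 + 128 * (25/16) ^ j)))) = \<eta> * D\<^sup>2 * (\<Sum>j\<le>J. 48 * (1/2) ^ j + 128 * (25/32) ^ j)"
      unfolding sum_distrib_left
    proof (intro sum.cong refl)
      fix j
      have e1: "(1/4::real) ^ j * 2 ^ j = (1/2) ^ j" by (simp flip: power_mult_distrib)
      have e2: "(1/2::real) ^ j * (25/16) ^ j = (25/32) ^ j" by (simp flip: power_mult_distrib)
      have "(1/4) ^ j * ((2 ^ j * \<eta>) * (D\<^sup>2 * (48 + 128 * (25/16) ^ j))) = \<eta> * D\<^sup>2 * (((1/4) ^ j * 2 ^ j) * (48 + 128 * (25/16) ^ j))"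
        by (simp only: mult_ac)
      also have "\<dots> = \<eta> * D\<^sup>2 * (48 * (1/2) ^ j + 128 * ((1/2) ^ j * (25/16) ^ j))"
        unfolding e1 by (simp only: distrib_left mult_ac)
      finally show "(1/4) ^ j * ((2 ^ j * \<eta>) * (D\<^sup>2 * (48 + 128 * (25/16) ^ j))) = \<eta> * D\<^sup>2 * (48 * (1/2) ^ j + 128 * (25/32) ^ j)"
        unfolding e2 .
    qed
    also have "160 / (pi * (1 - r)) * (\<eta> * D\<^sup>2 * (\<Sum>j\<le>J. 48 * (1/2) ^ j + 128 * (25/32) ^ j)) = 160 / pi * D\<^sup>2 * (\<Sum>j\<le>J. 48 * (1/2) ^ j + 128 * (25/32) ^ j)"
      using \<eta> by (simp add: \<eta>_def)
    also have "\<dots> \<le> 160 / pi * D\<^sup>2 * 800"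
    proof (intro mult_left_mono)
      have s: "summable (\<lambda>j. 48 * (1/2::real) ^ j)" "summable (\<lambda>j. 128 * (25/32::real) ^ j)"
        by (intro summable_mult summable_geometric; simp)+
      have "(\<Sum>j\<le>J. 48 * (1/2::real) ^ j + 128 * (25/32) ^ j) \<le> (\<Sum>j. 48 * (1/2) ^ j + 128 * (25/32) ^ j)"
        by (intro sum_le_suminf summable_add s) auto
      also have "\<dots> = (\<Sum>j. 48 * (1/2) ^ j) + (\<Sum>j. 128 * (25/32) ^ j)" by (rule suminf_add[OF s, symmetric])
      also have "\<dots> = 48 * (\<Sum>j. (1/2) ^ j) + 128 * (\<Sum>j. (25/32) ^ j)"
        by (intro arg_cong2[where f = "(+)"] suminf_mult summable_geometric) auto
      also have "\<dots> \<le> 800" by (simp add: suminf_geometric)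
      finally show "(\<Sum>j\<le>J. 48 * (1/2::real) ^ j + 128 * (25/32) ^ j) \<le> 800" .
    qed auto
    also have "\<dots> \<le> 50000 * D\<^sup>2"
    proof -
      have "160 * 800 \<le> 50000 * pi" using pi_approx by simp
      then have "160 / pi * 800 \<le> 50000" by (simp add: divide_simps)
      then have "(160 / pi * 800) * D\<^sup>2 \<le> 50000 * D\<^sup>2" by (rule mult_right_mono) simp
      then show ?thesis by (simp only: mult_ac)
    qed
    finally have "poisson_int h z \<le> 50000 * D\<^sup>2" .
    then show ?thesis
      using poisson_int_variance[OF sq z, of "A 0"] unfolding h_def
      by (smt (verit) zero_le_power2)
  qed
  then show ?thesis unfolding garsia_bounded_def using sq D2 by (fastforce intro: order.trans)
qed

section \<open>Families of functions on the circle\<close>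

abbreviation fibrewise_measurable :: "'w measure \<Rightarrow> (complex \<Rightarrow> 'w \<Rightarrow> 'b::topological_space) \<Rightarrow> bool" where
  "fibrewise_measurable \<Omega> f \<equiv> (\<lambda>x. f (fst x) (snd x)) \<in> borel_measurable (circle \<Otimes>\<^sub>M \<Omega>)"

lemma fst_circle_measurable: "fst \<in> borel_measurable (circle \<Otimes>\<^sub>M \<Omega>)"
  by (rule measurable_compose[OF measurable_fst borel_measurable_circle_ident])

lemma fibre_measurable:
  assumes "fibrewise_measurable \<Omega> f" "\<omega> \<in> space \<Omega>"
  shows "(\<lambda>z. f z \<omega>) \<in> borel_measurable circle"
proof -
  have "(\<lambda>z. (z, \<omega>)) \<in> circle \<rightarrow>\<^sub>M circle \<Otimes>\<^sub>M \<Omega>" using assms(2) by simp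
  from measurable_compose[OF this assms(1)] show ?thesis by simp
qed

text \<open>All constructions on the circle used so far are integrals against kernels, limits along fixed sequences, and algebraic operations.
  Carried out on each fibre, they therefore depend measurably on the fibre variable.\<close>

lemma integral_param_measurable:
  fixes k :: "complex \<Rightarrow> complex \<Rightarrow> 'b::{banach, second_countable_topology, real_normed_algebra}" and f :: "complex \<Rightarrow> 'w \<Rightarrow> 'b"
  assumes f: "fibrewise_measurable \<Omega> f" and k: "(\<lambda>x. k (fst x) (snd x)) \<in> borel_measurable (borel \<Otimes>\<^sub>M borel)"
  shows "(\<lambda>x. LINT \<xi>|circle. f \<xi> (snd x) * k (fst x) \<xi>) \<in> borel_measurable (circle \<Otimes>\<^sub>M \<Omega>)"
proof -
  have 1: "(\<lambda>y. (snd y, snd (fst y))) \<in> (circle \<Otimes>\<^sub>M \<Omega>) \<Otimes>\<^sub>M circle \<rightarrow>\<^sub>M circle \<Otimes>\<^sub>M \<Omega>" by measurable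
  have a: "(\<lambda>y. fst (fst y)) \<in> borel_measurable ((circle \<Otimes>\<^sub>M \<Omega>) \<Otimes>\<^sub>M circle)"
    by (rule measurable_compose[OF measurable_fst fst_circle_measurable])
  have b: "(\<lambda>y. snd y) \<in> borel_measurable ((circle \<Otimes>\<^sub>M \<Omega>) \<Otimes>\<^sub>M circle)"
    by (rule measurable_compose[OF measurable_snd borel_measurable_circle_ident])
  have f1: "(\<lambda>y. f (snd y) (snd (fst y))) \<in> borel_measurable ((circle \<Otimes>\<^sub>M \<Omega>) \<Otimes>\<^sub>M circle)"
    using measurable_compose[OF 1 f] by simp
  have k1: "(\<lambda>y. k (fst (fst y)) (snd y)) \<in> borel_measurable ((circle \<Otimes>\<^sub>M \<Omega>) \<Otimes>\<^sub>M circle)"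
    using measurable_compose[OF measurable_Pair[OF a b] k] by simp
  have "(\<lambda>(x, \<xi>). f \<xi> (snd x) * k (fst x) \<xi>) \<in> borel_measurable ((circle \<Otimes>\<^sub>M \<Omega>) \<Otimes>\<^sub>M circle)"
    unfolding case_prod_unfold by (rule borel_measurable_times[OF f1 k1])
  then show ?thesis by (rule circle.borel_measurable_lebesgue_integral)
qed

lemma fibrewise_conj_fun:
  assumes f: "fibrewise_measurable \<Omega> f"
  shows "fibrewise_measurable \<Omega> (\<lambda>z \<omega>. conj_fun (\<lambda>\<xi>. f \<xi> \<omega>) z)"
proof -
  have f': "fibrewise_measurable \<Omega> (\<lambda>\<xi> \<omega>. complex_of_real (f \<xi> \<omega>))" using f by measurable
  have "(\<lambda>x. Im (herglotz_real (\<lambda>\<xi>. f \<xi> (snd x)) (of_real (radius n) * fst x))) \<in> borel_measurable (circle \<Otimes>\<^sub>M \<Omega>)" for n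
  proof -
    have "(\<lambda>x. LINT \<xi>|circle. complex_of_real (f \<xi> (snd x)) * ((\<xi> + of_real (radius n) * fst x) / (\<xi> - of_real (radius n) * fst x))) \<in> borel_measurable (circle \<Otimes>\<^sub>M \<Omega>)"
      by (rule integral_param_measurable[OF f', of "\<lambda>z \<xi>. (\<xi> + of_real (radius n) * z) / (\<xi> - of_real (radius n) * z)"]) measurable
    then show ?thesis unfolding herglotz_def by measurable
  qed
  then show ?thesis unfolding conj_fun_def by (rule borel_measurable_lim_metric)
qed

lemma fibrewise_poisson_int:
  assumes f: "fibrewise_measurable \<Omega> (f :: complex \<Rightarrow> 'w \<Rightarrow> real)"
  shows "fibrewise_measurable \<Omega> (\<lambda>z \<omega>. poisson_int (\<lambda>\<xi>. f \<xi> \<omega>) (of_real r * z))"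
proof -
  have "(\<lambda>x. LINT \<xi>|circle. f \<xi> (snd x) * poisson (of_real r * fst x) \<xi>) \<in> borel_measurable (circle \<Otimes>\<^sub>M \<Omega>)"
    by (rule integral_param_measurable[OF f, of "\<lambda>z \<xi>. poisson (of_real r * z) \<xi>"]) (unfold poisson_def, measurable)
  then show ?thesis unfolding poisson_int_def by (simp add: mult.commute)
qed

lemma fibrewise_jones_iter:
  assumes v: "fibrewise_measurable \<Omega> v"
  shows "fibrewise_measurable \<Omega> (\<lambda>z \<omega>. jones_iter (\<lambda>\<xi>. v \<xi> \<omega>) n z)"
proof (induction n)
  case (Suc n)
  have "fibrewise_measurable \<Omega> (\<lambda>z \<omega>. jones_iter (\<lambda>\<xi>. v \<xi> \<omega>) n z * (1 / v z \<omega>))"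
    "fibrewise_measurable \<Omega> (\<lambda>z \<omega>. jones_iter (\<lambda>\<xi>. v \<xi> \<omega>) n z * v z \<omega>)"
    using Suc v by measurable
  from this[THEN fibrewise_conj_fun] v show ?case unfolding jones_iter.simps jones_step_def by measurable
qed simp

lemma borel_measurable_Complex:
  assumes [measurable]: "f \<in> borel_measurable M" "g \<in> borel_measurable M"
  shows "(\<lambda>x. Complex (f x) (g x)) \<in> borel_measurable M"
proof -
  have "(\<lambda>x. complex_of_real (f x) + \<i> * complex_of_real (g x)) \<in> borel_measurable M" by measurable
  then show ?thesis by (simp add: Complex_eq)
qed

lemma borel_measurable_csqrt:
  assumes f [measurable]: "f \<in> borel_measurable M"
  shows "(\<lambda>x. csqrt (f x)) \<in> borel_measurable M"
proof -
  have "csqrt z = Complex (sqrt ((cmod z + Re z) / 2)) ((if Im z = 0 then 1 else sgn (Im z)) * sqrt ((cmod z - Re z) / 2))" for z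
    by (rule complex_eqI) simp_all
  then show ?thesis by (simp only:) (rule borel_measurable_Complex; measurable)
qed

lemma fibrewise_separator:
  assumes v: "fibrewise_measurable \<Omega> v"
  shows "fibrewise_measurable \<Omega> (\<lambda>z \<omega>. separator m (\<lambda>\<xi>. v \<xi> \<omega>) z)"
proof -
  have j: "fibrewise_measurable \<Omega> (\<lambda>z \<omega>. jones_fun (\<lambda>\<xi>. v \<xi> \<omega>) z)"
    unfolding jones_fun_def using fibrewise_jones_iter[OF v] by (rule borel_measurable_suminf)
  have a: "fibrewise_measurable \<Omega> (\<lambda>z \<omega>. jones_fun (\<lambda>\<xi>. v \<xi> \<omega>) z * v z \<omega>)"
    and b: "fibrewise_measurable \<Omega> (\<lambda>z \<omega>. jones_fun (\<lambda>\<xi>. v \<xi> \<omega>) z * (1 / v z \<omega>))"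
    using j v by measurable
  have "fibrewise_measurable \<Omega> (\<lambda>z \<omega>. jones_outer (\<lambda>\<xi>. v \<xi> \<omega>) z)"
    unfolding jones_outer_def
    by (intro borel_measurable_divide borel_measurable_csqrt borel_measurable_Complex a b fibrewise_conj_fun)
  then show ?thesis unfolding separator_def cutoff_def by measurable
qed

section \<open>Separating functions on the product\<close>

text \<open>The exceptional set is enclosed in a measurable null set before the order of the variables is exchanged.\<close>

lemma AE_product_fibre:
  assumes \<Omega>: "sigma_finite_measure \<Omega>" and Q: "AE x in circle \<Otimes>\<^sub>M \<Omega>. Q x"
  shows "AE \<omega> in \<Omega>. AE z in circle. Q (z, \<omega>)"
proof -
  interpret \<Omega>: sigma_finite_measure \<Omega> by (rule \<Omega>)
  interpret pair_sigma_finite circle \<Omega> ..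
  obtain N where N: "N \<in> null_sets (circle \<Otimes>\<^sub>M \<Omega>)" "{x \<in> space (circle \<Otimes>\<^sub>M \<Omega>). \<not> Q x} \<subseteq> N"
    using Q unfolding eventually_ae_filter by auto
  have [measurable]: "N \<in> sets (circle \<Otimes>\<^sub>M \<Omega>)" using N by auto
  have "AE z in circle. AE \<omega> in \<Omega>. (z, \<omega>) \<notin> N" by (rule AE_pair[OF AE_not_in[OF N(1)]])
  moreover have "{x \<in> space (circle \<Otimes>\<^sub>M \<Omega>). (fst x, snd x) \<notin> N} \<in> sets (circle \<Otimes>\<^sub>M \<Omega>)" by simp
  ultimately have "AE \<omega> in \<Omega>. AE z in circle. (z, \<omega>) \<notin> N"
    by (subst (asm) AE_commute)
  then show ?thesis using AE_space
  proof eventually_elim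
    case (elim \<omega>)
    from elim(1) AE_space show ?case
      by eventually_elim (use N(2) elim(2) in \<open>auto simp: space_pair_measure\<close>)
  qed
qed

lemma AE_product_of_fibres:
  assumes \<Omega>: "sigma_finite_measure \<Omega>" and P: "{x \<in> space (circle \<Otimes>\<^sub>M \<Omega>). P x} \<in> sets (circle \<Otimes>\<^sub>M \<Omega>)"
    and ae: "AE \<omega> in \<Omega>. AE z in circle. P (z, \<omega>)"
  shows "AE x in circle \<Otimes>\<^sub>M \<Omega>. P x"
proof -
  interpret \<Omega>: sigma_finite_measure \<Omega> by (rule \<Omega>)
  interpret pair_sigma_finite circle \<Omega> ..
  have "{x \<in> space (circle \<Otimes>\<^sub>M \<Omega>). P (fst x, snd x)} \<in> sets (circle \<Otimes>\<^sub>M \<Omega>)" using P by simp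
  from AE_commute[OF this] ae have "AE z in circle. AE \<omega> in \<Omega>. P (z, \<omega>)" by simp
  then show ?thesis by (rule AE_pair_measure[OF P])
qed

text \<open>The function \<open>U\<close> behaves like a regularised indicator of \<open>{\<phi> \<le> 0}\<close>: it decays like \<open>exp (- p \<phi>)\<close> where \<open>\<phi>\<close> is large, and
  \<open>1 - U\<close> decays like \<open>exp (p \<phi>)\<close> where \<open>- \<phi>\<close> is large. On each fibre the separator is built for the weight \<open>exp (\<delta> P\<phi> / 2)\<close> on a circle of radius \<open>r < 1\<close>, with
  \<open>\<delta>\<close> so small that the weighted inequality holds and with the power \<open>m\<close> making up for the smallness of \<open>\<delta>\<close>. The
  bounds do not depend on \<open>r\<close>. As \<open>r\<close> tends to \<open>1\<close>, convex combinations converge almost everywhere on the product; they preserve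
  the bounds, which are convex conditions, and the Hardy class on almost every fibre.\<close>

theorem bounded_separating_function:
  fixes \<Omega> :: "'w measure" and C p :: real
  assumes \<Omega>: "sigma_finite_measure \<Omega>" and p: "0 < p"
  shows "\<exists>K. \<forall>\<phi> \<in> borel_measurable (circle_prod \<Omega>). (AE \<omega> in \<Omega>. BMO_norm (\<lambda>z. \<phi> (z, \<omega>)) \<le> ennreal C) \<longrightarrow>
    (\<exists>U \<in> elems (Hinf \<Omega>). AE x in circle_prod \<Omega>. cmod (U x) \<le> K \<and> cmod (U x) * exp (p * \<phi> x) \<le> K \<and>
        cmod (1 - U x) \<le> K * exp (p * min 0 (\<phi> x)))"
proof -
  interpret \<Omega>: sigma_finite_measure \<Omega> by (rule \<Omega>)
  interpret PM: pair_sigma_finite circle \<Omega> ..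
  define \<delta> where "\<delta> = 1 / (4000 * (\<bar>C\<bar> + 1))"
  have \<delta>0: "0 < \<delta>" by (simp add: \<delta>_def)
  have \<delta>: "\<delta>\<^sup>2 * (50000 * C\<^sup>2) \<le> 1 / 200"
  proof -
    have "\<bar>C\<bar> / (\<bar>C\<bar> + 1) \<le> 1" by simp
    then have "(\<bar>C\<bar> / (\<bar>C\<bar> + 1))\<^sup>2 \<le> 1\<^sup>2" by (intro power_mono) auto
    moreover have "\<delta>\<^sup>2 * (50000 * C\<^sup>2) = 50000 / 16000000 * (\<bar>C\<bar> / (\<bar>C\<bar> + 1))\<^sup>2"
      unfolding \<delta>_def power_divide power_mult_distrib power2_abs by simp
    ultimately show ?thesis by simp
  qed
  define m where "m = nat \<lceil>2 * p / \<delta>\<rceil>"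
  have mp: "p \<le> real m * (\<delta> / 2)"
  proof -
    have "2 * p / \<delta> \<le> real m" unfolding m_def by linarith
    then show ?thesis using \<delta>0 by (simp add: field_simps)
  qed
  define K where "K = real m * 6 ^ m + (3 * real m) ^ m"
  have K: "real m * 6 ^ m \<le> K" "(3 * real m) ^ m \<le> K" "0 \<le> K" by (auto simp: K_def)
  show ?thesis
  proof (intro exI[of _ K] ballI impI)
    fix \<phi> :: "complex \<times> 'w \<Rightarrow> real"
    assume \<phi> [measurable]: "\<phi> \<in> borel_measurable (circle_prod \<Omega>)" and bmo: "AE \<omega> in \<Omega>. BMO_norm (\<lambda>z. \<phi> (z, \<omega>)) \<le> ennreal C"
    obtain N where N: "N \<in> null_sets \<Omega>" "{\<omega> \<in> space \<Omega>. \<not> BMO_norm (\<lambda>z. \<phi> (z, \<omega>)) \<le> ennreal C} \<subseteq> N"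
      using bmo unfolding eventually_ae_filter by auto
    have Nm [measurable]: "N \<in> sets \<Omega>" using N by auto
    define \<psi> where "\<psi> k z \<omega> = poisson_int (\<lambda>\<xi>. \<phi> (\<xi>, \<omega>)) (of_real (radius k) * z)" for k z \<omega>
    define v where "v k z \<omega> = exp_weight (\<delta> / 2) (\<lambda>\<xi>. \<phi> (\<xi>, \<omega>)) (radius k) z" for k z \<omega>
    \<comment> \<open>fibres without the oscillation bound form a null set, on which any value may be chosen\<close>
    define U where "U k x = (if snd x \<in> N then 0 else separator m (\<lambda>\<xi>. v k \<xi> (snd x)) (fst x))" for k x
    have \<phi>f: "fibrewise_measurable \<Omega> (\<lambda>\<xi> \<omega>. \<phi> (\<xi>, \<omega>))" using \<phi> by simp
    have \<psi>m: "fibrewise_measurable \<Omega> (\<psi> k)" for k unfolding \<psi>_def by (rule fibrewise_poisson_int[OF \<phi>f])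
    have v\<psi>: "v k z \<omega> = exp (\<delta> / 2 * \<psi> k z \<omega>)" for k z \<omega> by (simp add: v_def \<psi>_def exp_weight_def)
    have vm: "fibrewise_measurable \<Omega> (v k)" for k unfolding v\<psi> using \<psi>m[of k] by measurable
    have Um [measurable]: "U k \<in> borel_measurable (circle_prod \<Omega>)" for k
      unfolding U_def[abs_def] using fibrewise_separator[OF vm, of m k] by measurable
    have good: "garsia_bounded (50000 * C\<^sup>2) (\<lambda>\<xi>. \<phi> (\<xi>, \<omega>))" if "\<omega> \<in> space \<Omega>" "\<omega> \<notin> N" for \<omega>
      by (rule BMO_imp_garsia_bounded) (use that N in auto)
    have sep: "hardy (\<lambda>z. U k (z, \<omega>))"
      "AE z in circle. cmod (U k (z, \<omega>)) \<le> K \<and> cmod (U k (z, \<omega>)) * exp (p * \<psi> k z \<omega>) \<le> K \<and> cmod (1 - U k (z, \<omega>)) \<le> K * exp (p * min 0 (\<psi> k z \<omega>))"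
      if \<omega>: "\<omega> \<in> space \<Omega>" "\<omega> \<notin> N" for k \<omega>
    proof -
      note S = separator[OF conj_weight_exp[OF good[OF \<omega>] \<delta> radius(2,3)] conj_weight_exp_inverse[OF good[OF \<omega>] \<delta> radius(2,3)], of m k, folded v_def]
      have Ue: "(\<lambda>z. U k (z, \<omega>)) = separator m (\<lambda>\<xi>. v k \<xi> \<omega>)" using \<omega> by (simp add: U_def fun_eq_iff)
      have "(\<lambda>z. U k (z, \<omega>)) \<in> borel_measurable circle"
        using fibre_measurable[where \<Omega> = \<Omega> and f = "\<lambda>z \<omega>. U k (z, \<omega>)"] \<omega> by simp
      then show "hardy (\<lambda>z. U k (z, \<omega>))" using S(1) unfolding Ue by (rule hardy_of_boundary_value[rotated])
      show "AE z in circle. cmod (U k (z, \<omega>)) \<le> K \<and> cmod (U k (z, \<omega>)) * exp (p * \<psi> k z \<omega>) \<le> K \<and> cmod (1 - U k (z, \<omega>)) \<le> K * exp (p * min 0 (\<psi> k z \<omega>))"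
        using S(2,3,4)
      proof eventually_elim
        case (elim z)
        have Uz: "U k (z, \<omega>) = separator m (\<lambda>\<xi>. v k \<xi> \<omega>) z" using \<omega> by (simp add: U_def)
        define u where "u = cmod (U k (z, \<omega>))"
        define s where "s = \<psi> k z \<omega>"
        have vm: "v k z \<omega> ^ m = exp (real m * (\<delta> / 2) * s)"
          by (simp add: v\<psi> s_def exp_of_nat_mult[symmetric] mult.assoc)
        have "u * v k z \<omega> ^ m \<le> K" using elim(2) K(1) unfolding u_def Uz by linarith
        moreover have "u \<le> K" "0 \<le> u" using elim(1) K(1) unfolding u_def Uz by (linarith, simp)
        ultimately have u: "u \<le> K" "0 \<le> u" "u * exp (real m * (\<delta> / 2) * s) \<le> K" unfolding vm by simp_all
        have 2: "u * exp (p * s) \<le> K"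
        proof (cases "0 \<le> s")
          case True
          have "u * exp (p * s) \<le> u * exp (real m * (\<delta> / 2) * s)"
            using u True mult_right_mono[OF mp True] by (intro mult_left_mono) auto
          then show ?thesis using u by simp
        next
          case False
          then have "u * exp (p * s) \<le> u * 1" using u p by (intro mult_left_mono) (auto simp: mult_le_0_iff)
          then show ?thesis using u by simp
        qed
        have "min 1 (v k z \<omega>) ^ m \<le> exp (p * min 0 s)"
        proof (cases "0 \<le> s")
          case True
          then have "min 1 (v k z \<omega>) = 1" using \<delta>0 by (simp add: v\<psi> s_def)
          then show ?thesis using True by simp
        next
          case False
          have "min 1 (v k z \<omega>) ^ m \<le> v k z \<omega> ^ m" by (intro power_mono) (auto simp: v\<psi>)
          also have "\<dots> \<le> exp (p * s)" unfolding vm using mult_right_mono_neg[OF mp, of s] False by simp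
          finally show ?thesis using False by simp
        qed
        then have "(3 * real m) ^ m * min 1 (v k z \<omega>) ^ m \<le> K * exp (p * min 0 s)"
          using K by (intro mult_mono) (auto simp: v\<psi>)
        then have 3: "cmod (1 - U k (z, \<omega>)) \<le> K * exp (p * min 0 s)" using elim(3) by (simp add: Uz)
        show ?case using u(1) 2 3 by (simp add: u_def s_def)
      qed
    qed
    have aeN: "AE \<omega> in \<Omega>. \<omega> \<in> space \<Omega> \<and> \<omega> \<notin> N" using AE_not_in[OF N(1)] AE_space by eventually_elim auto
    have UB: "AE x in circle_prod \<Omega>. cmod (U k x) \<le> K" for k
    proof (rule AE_product_of_fibres[OF \<Omega>])
      show "{x \<in> space (circle_prod \<Omega>). cmod (U k x) \<le> K} \<in> sets (circle_prod \<Omega>)" by measurable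
      show "AE \<omega> in \<Omega>. AE z in circle. cmod (U k (z, \<omega>)) \<le> K"
        using aeN
      proof eventually_elim
        case (elim \<omega>)
        then show ?case using sep(2)[of \<omega> k] by (auto elim: eventually_mono)
      qed
    qed
    \<comment> \<open>a finite measure with the same null sets, as required by the convex combination argument\<close>
    obtain q :: "complex \<times> 'w \<Rightarrow> real" where q: "q \<in> borel_measurable (circle_prod \<Omega>)" "\<And>x. q x > 0" "\<And>x. q x \<le> 1" "integrable (circle_prod \<Omega>) q"
      using PM.P.obtain_positive_integrable_function by blast
    note [measurable] = q(1)
    define M where "M = density (circle_prod \<Omega>) (\<lambda>x. ennreal (q x))"
    have finM: "finite_measure M"
    proof (rule finite_measureI)
      have "emeasure M (space M) = (\<integral>\<^sup>+x. ennreal (q x) * indicator (space (circle_prod \<Omega>)) x \<partial>circle_prod \<Omega>)"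
        unfolding M_def by (simp add: emeasure_density)
      also have "\<dots> = (\<integral>\<^sup>+x. ennreal (q x) \<partial>circle_prod \<Omega>)" by (intro nn_integral_cong) simp
      also have "\<dots> = ennreal (LINT x|circle_prod \<Omega>. q x)" using q by (intro nn_integral_eq_integral) (auto simp: less_imp_le)
      finally show "emeasure M (space M) \<noteq> \<infinity>" by simp
    qed
    have AEM: "(AE x in M. P x) \<longleftrightarrow> (AE x in circle_prod \<Omega>. P x)" for P
      unfolding M_def by (subst AE_density) (auto simp: q(2))
    have measM: "f \<in> borel_measurable M \<longleftrightarrow> f \<in> borel_measurable (circle_prod \<Omega>)" for f :: "_ \<Rightarrow> complex"
      unfolding M_def by simp
    interpret M: finite_measure M by (rule finM)
    obtain c L where w: "\<And>n. tail_weights n (L n) (c n)" and conv: "AE x in M. convergent (\<lambda>n. \<Sum>k\<le>L n. c n k *\<^sub>R U k x)"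
    proof (rule Mazur_AE[OF finM, of U "K\<^sup>2 * measure M (space M)"])
      show "U n \<in> borel_measurable M" for n by (simp add: measM)
      have b: "AE x in M. (cmod (U n x))\<^sup>2 \<le> K\<^sup>2" for n
        unfolding AEM using UB[of n] by eventually_elim (auto intro: power_mono)
      show i: "integrable M (\<lambda>x. (cmod (U n x))\<^sup>2)" for n
        by (rule M.integrable_const_bound[where B = "K\<^sup>2"]) (use b[of n] in \<open>auto simp: M_def\<close>)
      have "(LINT x|M. (cmod (U n x))\<^sup>2) \<le> (LINT x|M. K\<^sup>2)" for n
        by (rule integral_mono_AE[OF i _ b]) simp
      then show "(LINT x|M. (cmod (U n x))\<^sup>2) \<le> K\<^sup>2 * measure M (space M)" for n by (simp add: mult.commute)
    qed blast
    define G where "G n x = (\<Sum>k\<le>L n. c n k *\<^sub>R U k x)" for n x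
    have Gm [measurable]: "G n \<in> borel_measurable (circle_prod \<Omega>)" for n unfolding G_def[abs_def] by measurable
    define V where "V x = lim (\<lambda>n. G n x)" for x
    have Vm [measurable]: "V \<in> borel_measurable (circle_prod \<Omega>)" unfolding V_def[abs_def] by (rule borel_measurable_lim_metric) simp
    have lim: "AE x in circle_prod \<Omega>. (\<lambda>n. G n x) \<longlonglongrightarrow> V x"
      using conv unfolding AEM V_def G_def by eventually_elim (simp add: convergent_LIMSEQ_iff)
    have c: "0 \<le> c n k" "(\<Sum>k\<le>L n. c n k) = 1" for n k using w[of n] by (auto simp: tail_weights_def)
    have tri: "cmod (\<Sum>k\<le>L n. c n k *\<^sub>R y k) \<le> (\<Sum>k\<le>L n. c n k *\<^sub>R b k)" if "\<And>k. cmod (y k) \<le> b k" for n y b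
      by (rule sum_norm_le) (use that c in \<open>auto intro: mult_left_mono\<close>)
    have fibre: "AE z in circle. cmod (V (z, \<omega>)) \<le> K \<and> cmod (V (z, \<omega>)) * exp (p * \<phi> (z, \<omega>)) \<le> K \<and>
         cmod (1 - V (z, \<omega>)) \<le> K * exp (p * min 0 (\<phi> (z, \<omega>)))"
      if \<omega>: "\<omega> \<in> space \<Omega>" "\<omega> \<notin> N" and lz: "AE z in circle. (\<lambda>n. G n (z, \<omega>)) \<longlonglongrightarrow> V (z, \<omega>)" for \<omega>
    proof -
      have \<phi>i: "integrable circle (\<lambda>\<xi>. \<phi> (\<xi>, \<omega>))"
        using good[OF \<omega>] by (auto simp: garsia_bounded_def sq_integrable_integrable)
      have bk: "AE z in circle. \<forall>k. cmod (U k (z, \<omega>)) \<le> K \<and> cmod (U k (z, \<omega>)) * exp (p * \<psi> k z \<omega>) \<le> K \<and> cmod (1 - U k (z, \<omega>)) \<le> K * exp (p * min 0 (\<psi> k z \<omega>))"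
        unfolding AE_all_countable using sep(2)[OF \<omega>] by blast
      show ?thesis
        using lz bk Fatou_poisson_int[OF \<phi>i]
      proof eventually_elim
        case (elim z)
        have \<psi>lim: "(\<lambda>k. \<psi> k z \<omega>) \<longlonglongrightarrow> \<phi> (z, \<omega>)"
          unfolding \<psi>_def by (rule filterlim_compose[OF elim(3) radius_at_left])
        have b1: "cmod (U k (z, \<omega>)) \<le> K" and b2: "cmod (U k (z, \<omega>)) \<le> K * exp (- (p * \<psi> k z \<omega>))"
          and b3: "cmod (1 - U k (z, \<omega>)) \<le> K * exp (p * min 0 (\<psi> k z \<omega>))" for k
          using elim(2) by (auto simp: exp_minus field_simps)
        have 1: "cmod (V (z, \<omega>)) \<le> K"
        proof (rule LIMSEQ_le[OF tendsto_norm[OF elim(1)] tail_weights_tendsto[OF w tendsto_const]])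
          show "\<exists>N. \<forall>n\<ge>N. cmod (G n (z, \<omega>)) \<le> (\<Sum>k\<le>L n. c n k *\<^sub>R K)" unfolding G_def using tri[of "\<lambda>k. U k (z, \<omega>)", OF b1] by blast
        qed
        have 2: "cmod (V (z, \<omega>)) \<le> K * exp (- (p * \<phi> (z, \<omega>)))"
        proof (rule LIMSEQ_le[OF tendsto_norm[OF elim(1)] tail_weights_tendsto[OF w]])
          show "(\<lambda>k. K * exp (- (p * \<psi> k z \<omega>))) \<longlonglongrightarrow> K * exp (- (p * \<phi> (z, \<omega>)))" by (intro tendsto_intros \<psi>lim)
          show "\<exists>N. \<forall>n\<ge>N. cmod (G n (z, \<omega>)) \<le> (\<Sum>k\<le>L n. c n k *\<^sub>R (K * exp (- (p * \<psi> k z \<omega>))))" unfolding G_def using tri[of "\<lambda>k. U k (z, \<omega>)", OF b2] by blast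
        qed
        have 3: "cmod (1 - V (z, \<omega>)) \<le> K * exp (p * min 0 (\<phi> (z, \<omega>)))"
        proof (rule LIMSEQ_le[OF tendsto_norm[OF tendsto_diff[OF tendsto_const elim(1)]] tail_weights_tendsto[OF w]])
          show "(\<lambda>k. K * exp (p * min 0 (\<psi> k z \<omega>))) \<longlonglongrightarrow> K * exp (p * min 0 (\<phi> (z, \<omega>)))" by (intro tendsto_intros \<psi>lim)
          have "1 - G n (z, \<omega>) = (\<Sum>k\<le>L n. c n k *\<^sub>R (1 - U k (z, \<omega>)))" for n
            using c(2)[of n] by (simp add: G_def scaleR_diff_right sum_subtractf flip: scaleR_sum_left)
          then show "\<exists>N. \<forall>n\<ge>N. cmod (1 - G n (z, \<omega>)) \<le> (\<Sum>k\<le>L n. c n k *\<^sub>R (K * exp (p * min 0 (\<psi> k z \<omega>))))"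
            using tri[of "\<lambda>k. 1 - U k (z, \<omega>)", OF b3] by simp
        qed
        show ?case using 1 2 3 by (simp add: exp_minus field_simps)
      qed
    qed
    have fae: "AE \<omega> in \<Omega>. AE z in circle. (\<lambda>n. G n (z, \<omega>)) \<longlonglongrightarrow> V (z, \<omega>)" by (rule AE_product_fibre[OF \<Omega> lim])
    have final: "AE x in circle_prod \<Omega>. cmod (V x) \<le> K \<and> cmod (V x) * exp (p * \<phi> x) \<le> K \<and> cmod (1 - V x) \<le> K * exp (p * min 0 (\<phi> x))"
    proof (rule AE_product_of_fibres[OF \<Omega>])
      show "AE \<omega> in \<Omega>. AE z in circle. cmod (V (z, \<omega>)) \<le> K \<and> cmod (V (z, \<omega>)) * exp (p * \<phi> (z, \<omega>)) \<le> K \<and>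
         cmod (1 - V (z, \<omega>)) \<le> K * exp (p * min 0 (\<phi> (z, \<omega>)))"
        using aeN fae by eventually_elim (blast intro: fibre)
    qed measurable
    have "V \<in> elems (Hinf \<Omega>)"
    proof -
      have "AE x in circle_prod \<Omega>. ennreal (cmod (V x)) \<le> ennreal K" using final by eventually_elim (auto intro: ennreal_leI)
      then have "esssup (circle_prod \<Omega>) (\<lambda>x. ennreal (cmod (V x))) \<le> ennreal K" by (intro esssup_I) auto
      then have "esssup (circle_prod \<Omega>) (\<lambda>x. ennreal (cmod (V x))) < \<infinity>" by (rule le_less_trans) simp
      moreover have "AE \<omega> in \<Omega>. bounded_analytic_boundary_value (\<lambda>z. V (z, \<omega>))"
        using aeN fae
      proof eventually_elim
        case (elim \<omega>)
        have "hardy (\<lambda>z. V (z, \<omega>))"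
        proof (rule hardy_limit[where \<phi> = "\<lambda>n z. G n (z, \<omega>)" and B = K])
          show "hardy (\<lambda>z. G n (z, \<omega>))" for n
            unfolding G_def using sep(1) elim(1) by (intro hardy_sum) auto
          show "AE z in circle. cmod (G n (z, \<omega>)) \<le> K" for n
          proof -
            have "AE z in circle. \<forall>k. cmod (U k (z, \<omega>)) \<le> K"
              unfolding AE_all_countable using sep(2)[of \<omega>] elim(1) by (auto elim: eventually_mono)
            then show ?thesis
            proof eventually_elim
              case (elim z)
              have "cmod (G n (z, \<omega>)) \<le> (\<Sum>k\<le>L n. c n k *\<^sub>R K)" unfolding G_def by (rule tri) (use elim in blast)
              also have "\<dots> = K" using c(2)[of n] by (simp flip: sum_distrib_right)
              finally show ?case .
            qed
          qed
          show "AE z in circle. (\<lambda>n. G n (z, \<omega>)) \<longlonglongrightarrow> V (z, \<omega>)" by (rule elim(2))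
          show "(\<lambda>z. V (z, \<omega>)) \<in> borel_measurable circle"
            using fibre_measurable[where \<Omega> = \<Omega> and f = "\<lambda>z \<omega>. V (z, \<omega>)"] elim(1) by simp
        qed
        then show ?case by (rule boundary_value_of_hardy)
      qed
      ultimately show ?thesis by (simp add: Hinf_def Linf_def)
    qed
    then show "\<exists>U\<in>elems (Hinf \<Omega>). AE x in circle_prod \<Omega>. cmod (U x) \<le> K \<and> cmod (U x) * exp (p * \<phi> x) \<le> K \<and> cmod (1 - U x) \<le> K * exp (p * min 0 (\<phi> x))"
      using final by blast
  qed
qed

section \<open>Quasi-normed lattices and real interpolation\<close>

lemma Linf_I:
  assumes "f \<in> borel_measurable M" "AE x in M. cmod (f x) \<le> B" "0 \<le> B"
  shows "f \<in> elems (Linf M)" and "qnorm (Linf M) f \<le> B"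
proof -
  have "AE x in M. ennreal (cmod (f x)) \<le> ennreal B" using assms(2) by eventually_elim (rule ennreal_leI)
  then have le: "esssup M (\<lambda>x. ennreal (cmod (f x))) \<le> ennreal B" using assms(1) by (intro esssup_I) auto
  from le_less_trans[OF le ennreal_less_top] show "f \<in> elems (Linf M)" using assms(1) by (simp add: Linf_def)
  show "qnorm (Linf M) f \<le> B" using enn2real_mono[OF le ennreal_less_top] assms(3) by (simp add: Linf_def)
qed

lemma Linf_measurable: "f \<in> elems (Linf M) \<Longrightarrow> f \<in> borel_measurable M"
  by (simp add: Linf_def)

lemma Linf_nonneg: "0 \<le> qnorm (Linf M) f"
  by (simp add: Linf_def)

lemma Linf_bound:
  assumes "f \<in> elems (Linf M)"
  shows "AE x in M. cmod (f x) \<le> qnorm (Linf M) f"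
  using esssup_AE[where f = "\<lambda>x. ennreal (cmod (f x))" and M = M]
proof eventually_elim
  case (elim x)
  have "esssup M (\<lambda>x. ennreal (cmod (f x))) < top" using assms by (simp add: Linf_def)
  from enn2real_mono[OF elim this] show ?case by (simp add: Linf_def)
qed

lemma Hinf_const: "(\<lambda>x. c) \<in> elems (Hinf \<Omega>)"
proof -
  have "bounded_analytic_boundary_value (\<lambda>z. c)"
    unfolding bounded_analytic_boundary_value_def by (intro exI[of _ "\<lambda>z. c"]) (auto intro: bounded_subset[of "{c}"])
  moreover have "(\<lambda>x. c) \<in> elems (Linf (circle_prod \<Omega>))" by (rule Linf_I[where B = "cmod c"]) auto
  ultimately show ?thesis by (simp add: Hinf_def)
qed

lemma borel_measurable_of_real_D:
  assumes "(\<lambda>x. complex_of_real (h x)) \<in> borel_measurable M"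
  shows "h \<in> borel_measurable M"
proof -
  have "(\<lambda>x. Re (complex_of_real (h x))) \<in> borel_measurable M" using assms by measurable
  then show ?thesis by simp
qed

locale function_lattice =
  fixes M :: "'a measure" and X :: "'a fun_space"
  assumes lattice: "quasi_normed_lattice M X"
begin

lemma measurable_elem: "f \<in> elems X \<Longrightarrow> f \<in> borel_measurable M"
  and zero_elem: "(\<lambda>x. 0) \<in> elems X"
  and add_elem: "f \<in> elems X \<Longrightarrow> g \<in> elems X \<Longrightarrow> (\<lambda>x. f x + g x) \<in> elems X"
  and scale_elem: "f \<in> elems X \<Longrightarrow> (\<lambda>x. c * f x) \<in> elems X"
  and norm_nonneg: "f \<in> elems X \<Longrightarrow> 0 \<le> qnorm X f"
  and norm_eq_0_iff: "f \<in> elems X \<Longrightarrow> qnorm X f = 0 \<longleftrightarrow> (AE x in M. f x = 0)"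
  and norm_scale: "f \<in> elems X \<Longrightarrow> qnorm X (\<lambda>x. c * f x) = cmod c * qnorm X f"
  and ex_quasi_triangle: "\<exists>K. \<forall>f \<in> elems X. \<forall>g \<in> elems X. qnorm X (\<lambda>x. f x + g x) \<le> K * (qnorm X f + qnorm X g)"
  and ideal: "f \<in> borel_measurable M \<Longrightarrow> g \<in> elems X \<Longrightarrow> AE x in M. cmod (f x) \<le> cmod (g x) \<Longrightarrow> f \<in> elems X"
    "f \<in> borel_measurable M \<Longrightarrow> g \<in> elems X \<Longrightarrow> AE x in M. cmod (f x) \<le> cmod (g x) \<Longrightarrow> qnorm X f \<le> qnorm X g"
proof -
  from lattice have space: "quasi_normed_space M X"
    and L: "\<forall>f \<in> borel_measurable M. \<forall>g \<in> elems X. (AE x in M. cmod (f x) \<le> cmod (g x)) \<longrightarrow> f \<in> elems X \<and> qnorm X f \<le> qnorm X g"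
    by (simp_all add: quasi_normed_lattice_def)
  note S = space[unfolded quasi_normed_space_def]
  show "f \<in> elems X \<Longrightarrow> f \<in> borel_measurable M" using S[THEN conjunct1] by (rule subsetD)
  note S = S[THEN conjunct2]
  show "(\<lambda>x. 0) \<in> elems X" by (rule S[THEN conjunct1])
  note S = S[THEN conjunct2]
  show "f \<in> elems X \<Longrightarrow> g \<in> elems X \<Longrightarrow> (\<lambda>x. f x + g x) \<in> elems X" using S[THEN conjunct1] by simp
  note S = S[THEN conjunct2]
  show "f \<in> elems X \<Longrightarrow> (\<lambda>x. c * f x) \<in> elems X" using S[THEN conjunct1] by simp
  note S = S[THEN conjunct2, THEN conjunct2]
  show "f \<in> elems X \<Longrightarrow> 0 \<le> qnorm X f" using S[THEN conjunct1] by simp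
  note S = S[THEN conjunct2]
  show "f \<in> elems X \<Longrightarrow> qnorm X f = 0 \<longleftrightarrow> (AE x in M. f x = 0)" using S[THEN conjunct1] by (rule bspec)
  note S = S[THEN conjunct2]
  show "f \<in> elems X \<Longrightarrow> qnorm X (\<lambda>x. c * f x) = cmod c * qnorm X f" using S[THEN conjunct1] by simp
  show "\<exists>K. \<forall>f \<in> elems X. \<forall>g \<in> elems X. qnorm X (\<lambda>x. f x + g x) \<le> K * (qnorm X f + qnorm X g)"
    by (rule S[THEN conjunct2])
  show "f \<in> borel_measurable M \<Longrightarrow> g \<in> elems X \<Longrightarrow> AE x in M. cmod (f x) \<le> cmod (g x) \<Longrightarrow> f \<in> elems X"
    "f \<in> borel_measurable M \<Longrightarrow> g \<in> elems X \<Longrightarrow> AE x in M. cmod (f x) \<le> cmod (g x) \<Longrightarrow> qnorm X f \<le> qnorm X g"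
    using L by blast+
qed

lemma diff_elem: "f \<in> elems X \<Longrightarrow> g \<in> elems X \<Longrightarrow> (\<lambda>x. f x - g x) \<in> elems X"
  using add_elem[of f "\<lambda>x. -1 * g x"] scale_elem[of g "-1"] by simp

lemma norm_diff_commute:
  assumes "f \<in> elems X" "g \<in> elems X"
  shows "qnorm X (\<lambda>x. f x - g x) = qnorm X (\<lambda>x. g x - f x)"
  using norm_scale[OF diff_elem[OF assms], of "-1"] by simp

lemma quasi_triangle:
  "\<exists>K\<ge>1. \<forall>f \<in> elems X. \<forall>g \<in> elems X. qnorm X (\<lambda>x. f x + g x) \<le> K * (qnorm X f + qnorm X g)"
proof -
  obtain K where K: "\<And>f g. f \<in> elems X \<Longrightarrow> g \<in> elems X \<Longrightarrow> qnorm X (\<lambda>x. f x + g x) \<le> K * (qnorm X f + qnorm X g)"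
    using ex_quasi_triangle by blast
  show ?thesis
  proof (intro exI[of _ "max 1 K"] conjI ballI)
    fix f g assume fg: "f \<in> elems X" "g \<in> elems X"
    have "K * (qnorm X f + qnorm X g) \<le> max 1 K * (qnorm X f + qnorm X g)"
      using norm_nonneg[OF fg(1)] norm_nonneg[OF fg(2)] by (intro mult_right_mono) auto
    then show "qnorm X (\<lambda>x. f x + g x) \<le> max 1 K * (qnorm X f + qnorm X g)" using K[OF fg] by linarith
  qed simp
qed

lemma interp_inf_norm_nonneg:
  assumes "f \<in> elems (real_interp_inf M (Linf M) X \<theta>)"
  shows "0 \<le> qnorm (real_interp_inf M (Linf M) X \<theta>) f"
proof -
  have f: "decompositions M (Linf M) X f \<noteq> {}"
     "bdd_above ((\<lambda>t. t powr (- \<theta>) * K_functional M (Linf M) X t f) ` {0<..})"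
    using assms unfolding real_interp_inf_def by auto
  have "0 \<le> K_functional M (Linf M) X 1 f"
    unfolding K_functional_def
    by (rule cINF_greatest[OF f(1)]) (auto simp: decompositions_def Linf_nonneg norm_nonneg)
  also have "\<dots> \<le> (SUP t\<in>{0<..}. t powr (- \<theta>) * K_functional M (Linf M) X t f)"
    by (rule cSUP_upper2[OF f(2), of 1]) auto
  finally show ?thesis by (simp add: real_interp_inf_def)
qed

text \<open>Cutting at the level \<open>h = t N\<close> gives a decomposition with \<open>h powr \<theta> \<le> (t N) powr \<theta>\<close> on one part and \<open>h powr \<theta> \<le> (t N) powr (\<theta> - 1) * h\<close>
  on the other.\<close>

lemma interp_inf_power:
  fixes h :: "'a \<Rightarrow> real" and \<theta> :: real
  assumes h: "(\<lambda>x. complex_of_real (h x)) \<in> elems X" "\<And>x. 0 \<le> h x"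
    and N: "qnorm X (\<lambda>x. complex_of_real (h x)) = N" "0 < N" and \<theta>: "0 < \<theta>" "\<theta> < 1"
  shows "(\<lambda>x. complex_of_real (h x powr \<theta>)) \<in> elems (real_interp_inf M (Linf M) X \<theta>)"
    and "qnorm (real_interp_inf M (Linf M) X \<theta>) (\<lambda>x. complex_of_real (h x powr \<theta>)) \<le> 2 * N powr \<theta>"
proof -
  define w where "w = (\<lambda>x. complex_of_real (h x powr \<theta>))"
  have hm [measurable]: "h \<in> borel_measurable M"
    using borel_measurable_of_real_D[OF measurable_elem[OF h(1)]] .
  have wm: "w \<in> borel_measurable M" unfolding w_def by measurable
  have split: "\<exists>(a, b) \<in> decompositions M (Linf M) X w. qnorm (Linf M) a + t * qnorm X b \<le> 2 * (t * N) powr \<theta>"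
    if t: "0 < t" for t
  proof -
    define l where "l = t * N"
    have l: "0 < l" using t N by (simp add: l_def)
    define a where "a = (\<lambda>x. complex_of_real (if h x \<le> l then h x powr \<theta> else 0))"
    define b where "b = (\<lambda>x. complex_of_real (if h x \<le> l then 0 else h x powr \<theta>))"
    have am: "a \<in> borel_measurable M" and bm: "b \<in> borel_measurable M" unfolding a_def b_def by measurable
    have "cmod (a x) \<le> l powr \<theta>" for x
      using h(2)[of x] \<theta> by (auto simp: a_def intro: powr_mono2)
    then have A: "a \<in> elems (Linf M)" "qnorm (Linf M) a \<le> l powr \<theta>"
      by (auto intro!: Linf_I am)
    have "cmod (b x) \<le> cmod (complex_of_real (l powr (\<theta> - 1)) * complex_of_real (h x))" for x
    proof (cases "h x \<le> l")
      case False
      then have hx: "l \<le> h x" "0 < h x" using l by auto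
      have "h x powr \<theta> = h x powr (\<theta> - 1) * h x" using hx powr_add[of "h x" "\<theta> - 1" 1] by simp
      also have "\<dots> \<le> l powr (\<theta> - 1) * h x"
        using powr_mono2'[of "\<theta> - 1" l "h x"] hx l \<theta> by (intro mult_right_mono) auto
      finally show ?thesis using False hx by (simp add: b_def norm_mult)
    qed (simp add: b_def)
    then have B: "b \<in> elems X" "qnorm X b \<le> l powr (\<theta> - 1) * N"
      using ideal[OF bm scale_elem[OF h(1)], of "complex_of_real (l powr (\<theta> - 1))"]
        norm_scale[OF h(1), of "complex_of_real (l powr (\<theta> - 1))"] N(1) by simp_all
    have "t * qnorm X b \<le> t * (l powr (\<theta> - 1) * N)" using B t by simp
    also have "\<dots> = l powr (\<theta> - 1) * l" by (simp add: l_def)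
    also have "\<dots> = l powr \<theta>" using l powr_add[of l "\<theta> - 1" 1] by simp
    finally have "qnorm (Linf M) a + t * qnorm X b \<le> 2 * (t * N) powr \<theta>" using A(2) by (simp add: l_def)
    moreover have "(a, b) \<in> decompositions M (Linf M) X w"
      using A B by (auto simp: decompositions_def w_def a_def b_def)
    ultimately show ?thesis by blast
  qed
  have K: "t powr (- \<theta>) * K_functional M (Linf M) X t w \<le> 2 * N powr \<theta>" if t: "0 < t" for t
  proof -
    obtain a b where ab: "(a, b) \<in> decompositions M (Linf M) X w" "qnorm (Linf M) a + t * qnorm X b \<le> 2 * (t * N) powr \<theta>"
      using split[OF t] by blast
    have "K_functional M (Linf M) X t w \<le> qnorm (Linf M) a + t * qnorm X b"
      unfolding K_functional_def
    proof (rule cINF_lower2[OF _ ab(1)])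
      show "bdd_below ((\<lambda>(g, h). qnorm (Linf M) g + t * qnorm X h) ` decompositions M (Linf M) X w)"
        using t by (intro bdd_belowI[where m = 0]) (auto simp: decompositions_def Linf_nonneg norm_nonneg)
    qed simp
    then have "t powr (- \<theta>) * K_functional M (Linf M) X t w \<le> t powr (- \<theta>) * (2 * (t * N) powr \<theta>)"
      using ab(2) by (intro mult_left_mono) auto
    also have "\<dots> = 2 * N powr \<theta>" using t N by (simp add: powr_mult powr_minus field_simps)
    finally show ?thesis .
  qed
  have "decompositions M (Linf M) X w \<noteq> {}" using split[of 1] by auto
  moreover have "bdd_above ((\<lambda>t. t powr (- \<theta>) * K_functional M (Linf M) X t w) ` {0<..})"
    using K by (intro bdd_aboveI[where M = "2 * N powr \<theta>"]) auto
  ultimately show "(\<lambda>x. complex_of_real (h x powr \<theta>)) \<in> elems (real_interp_inf M (Linf M) X \<theta>)"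
    using wm unfolding real_interp_inf_def w_def by simp
  have "(SUP t\<in>{0<..}. t powr (- \<theta>) * K_functional M (Linf M) X t w) \<le> 2 * N powr \<theta>"
    by (rule cSUP_least) (use K in auto)
  then show "qnorm (real_interp_inf M (Linf M) X \<theta>) (\<lambda>x. complex_of_real (h x powr \<theta>)) \<le> 2 * N powr \<theta>"
    unfolding real_interp_inf_def w_def by simp
qed

text \<open>A weak type estimate, converse to the preceding lemma. At a suitable \<open>t\<close> the bounded part of \<open>u\<close> is at most half the
  level, so that on the level set the other part is at least half the level.\<close>

lemma interp_inf_level_set:
  fixes u :: "'a \<Rightarrow> real" and \<theta> l B :: real
  assumes u: "(\<lambda>x. complex_of_real (u x)) \<in> elems (real_interp_inf M (Linf M) X \<theta>)"
    and B: "qnorm (real_interp_inf M (Linf M) X \<theta>) (\<lambda>x. complex_of_real (u x)) < B" "0 < B"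
    and \<theta>: "0 < \<theta>" and l: "0 < l"
  shows "(\<lambda>x. of_bool (l < u x)) \<in> elems X" and "qnorm X (\<lambda>x. of_bool (l < u x)) \<le> (2 * B / l) powr (1 / \<theta>)"
proof -
  define w where "w = (\<lambda>x. complex_of_real (u x))"
  have w: "w \<in> borel_measurable M" "decompositions M (Linf M) X w \<noteq> {}"
     "bdd_above ((\<lambda>t. t powr (- \<theta>) * K_functional M (Linf M) X t w) ` {0<..})"
    using u unfolding real_interp_inf_def w_def by auto
  have [measurable]: "u \<in> borel_measurable M" using borel_measurable_of_real_D[OF w(1)[unfolded w_def]] .
  define t where "t = (l / (2 * B)) powr (1 / \<theta>)"
  have t: "0 < t" using l B by (simp add: t_def)
  have t\<theta>: "t powr \<theta> * B = l / 2" using l B \<theta> by (simp add: t_def powr_powr)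
  have "t powr (- \<theta>) * K_functional M (Linf M) X t w \<le> (SUP t\<in>{0<..}. t powr (- \<theta>) * K_functional M (Linf M) X t w)"
    by (rule cSUP_upper[OF _ w(3)]) (use t in simp)
  also have "\<dots> < B" using B unfolding real_interp_inf_def w_def by simp
  finally have "K_functional M (Linf M) X t w < t powr \<theta> * B" using t by (simp add: powr_minus field_simps)
  then have "Inf ((\<lambda>(g, h). qnorm (Linf M) g + t * qnorm X h) ` decompositions M (Linf M) X w) < l / 2"
    unfolding K_functional_def t\<theta> .
  then have "\<exists>y\<in>(\<lambda>(g, h). qnorm (Linf M) g + t * qnorm X h) ` decompositions M (Linf M) X w. y < l / 2"
    by (rule cInf_lessD[rotated]) (use w(2) in auto)
  then obtain a b where ab: "a \<in> elems (Linf M)" "b \<in> elems X" "AE x in M. w x = a x + b x" "qnorm (Linf M) a + t * qnorm X b < l / 2"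
    by (auto simp: decompositions_def)
  have aN: "qnorm (Linf M) a \<le> l / 2" using ab(4) mult_nonneg_nonneg[OF less_imp_le[OF t] norm_nonneg[OF ab(2)]] by linarith
  have "AE x in M. cmod (of_bool (l < u x)) \<le> cmod (complex_of_real (2 / l) * b x)"
    using ab(3) Linf_bound[OF ab(1)]
  proof eventually_elim
    case (elim x)
    show ?case
    proof (cases "l < u x")
      case True
      have "u x \<le> cmod (w x)" by (simp add: w_def)
      also have "\<dots> \<le> cmod (a x) + cmod (b x)" unfolding elim(1) by (rule norm_triangle_ineq)
      finally have "l / 2 \<le> cmod (b x)" using True elim(2) aN by linarith
      then show ?thesis using True l by (simp add: norm_mult norm_divide field_simps)
    qed simp
  qed
  note I = ideal[OF _ scale_elem[OF ab(2)] this]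
  show "(\<lambda>x. of_bool (l < u x)) \<in> elems X" by (rule I(1)) measurable
  have "qnorm X (\<lambda>x. of_bool (l < u x)) \<le> qnorm X (\<lambda>x. complex_of_real (2 / l) * b x)" by (rule I(2)) measurable
  also have "\<dots> = 2 / l * qnorm X b" using norm_scale[OF ab(2), of "complex_of_real (2 / l)"] l by (simp add: norm_divide)
  also have "\<dots> \<le> 2 / l * (l / 2 / t)"
  proof (rule mult_left_mono)
    have "t * qnorm X b \<le> l / 2" using ab(4) Linf_nonneg[of M a] by linarith
    then show "qnorm X b \<le> l / 2 / t" using t by (simp add: field_simps)
  qed (use l in simp)
  also have "\<dots> = (2 * B / l) powr (1 / \<theta>)" using l B by (simp add: t_def powr_divide)
  finally show "qnorm X (\<lambda>x. of_bool (l < u x)) \<le> (2 * B / l) powr (1 / \<theta>)" .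
qed

text \<open>In a quasi-normed space a series converges when its terms decrease faster than the powers of the constant in the
  triangle inequality. The sum dominates all partial sums almost everywhere, since the positive part of \<open>S\<^sub>n - \<bar>f\<bar>\<close> is
  dominated by \<open>\<bar>S\<^sub>m - f\<bar>\<close> for every \<open>m \<ge> n\<close> and therefore has norm zero.\<close>

lemma geometric_series_majorant:
  fixes F :: "nat \<Rightarrow> 'a \<Rightarrow> real" and h :: "'a \<Rightarrow> real" and K B r :: real
  assumes complete: "qnorm_complete X"
    and K: "1 \<le> K" "\<And>f g. f \<in> elems X \<Longrightarrow> g \<in> elems X \<Longrightarrow> qnorm X (\<lambda>x. f x + g x) \<le> K * (qnorm X f + qnorm X g)"
    and F: "\<And>j. (\<lambda>x. complex_of_real (F j x)) \<in> elems X" "\<And>j x. 0 \<le> F j x"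
      "\<And>j. qnorm X (\<lambda>x. complex_of_real (F j x)) \<le> B * r ^ j"
    and r: "0 \<le> r" "K * r \<le> 1 / 2" and B: "0 \<le> B"
    and h: "h \<in> borel_measurable M" "AE x in M. 0 \<le> h x \<and> (\<exists>n. h x \<le> (\<Sum>j<n. F j x))"
  shows "(\<lambda>x. complex_of_real (h x)) \<in> elems X" and "qnorm X (\<lambda>x. complex_of_real (h x)) \<le> 2 * K\<^sup>2 * B"
proof -
  define S where "S n x = complex_of_real (\<Sum>j<n. F j x)" for n x
  have S_Suc: "S (Suc n) = (\<lambda>x. S n x + complex_of_real (F n x))" for n by (simp add: S_def fun_eq_iff)
  have S: "S n \<in> elems X" for n
  proof (induction n)
    case (Suc n) then show ?case unfolding S_Suc by (rule add_elem[OF _ F(1)])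
  qed (use zero_elem in \<open>simp add: S_def[abs_def]\<close>)
  \<comment> \<open>the generalised triangle inequality, applied from the first term on, weights the \<open>i\<close>-th term with \<open>K\<^sup>i\<^sup>+\<^sup>1\<close>\<close>
  have block: "(\<lambda>x. complex_of_real (\<Sum>i<k. F (m + i) x)) \<in> elems X \<and> qnorm X (\<lambda>x. complex_of_real (\<Sum>i<k. F (m + i) x)) \<le> 2 * K * (B * r ^ m)" for k m
  proof (induction k arbitrary: m)
    case 0
    have "qnorm X (\<lambda>x. 0) = 0" using norm_eq_0_iff[OF zero_elem] by simp
    then show ?case using zero_elem K(1) B r(1) by simp
  next
    case (Suc k)
    have e: "(\<lambda>x. complex_of_real (\<Sum>i<Suc k. F (m + i) x)) = (\<lambda>x. complex_of_real (F m x) + complex_of_real (\<Sum>i<k. F (Suc m + i) x))"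
      by (simp add: sum.lessThan_Suc_shift fun_eq_iff del: sum.lessThan_Suc)
    note IH = Suc[of "Suc m"]
    have "qnorm X (\<lambda>x. complex_of_real (\<Sum>i<Suc k. F (m + i) x)) \<le> K * (qnorm X (\<lambda>x. complex_of_real (F m x)) + qnorm X (\<lambda>x. complex_of_real (\<Sum>i<k. F (Suc m + i) x)))"
      unfolding e by (rule K(2)[OF F(1) conjunct1[OF IH]])
    also have "\<dots> \<le> K * (B * r ^ m + 2 * K * (B * r ^ Suc m))"
      using F(3)[of m] IH K(1) by (intro mult_left_mono add_mono) auto
    also have "\<dots> = (1 + 2 * (K * r)) * (K * (B * r ^ m))" by (simp add: algebra_simps)
    also have "\<dots> \<le> 2 * (K * (B * r ^ m))" using r B K(1) by (intro mult_right_mono) auto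
    finally show ?case using add_elem[OF F(1)[of m] conjunct1[OF IH]] unfolding e by (simp add: mult.assoc)
  qed
  have step: "qnorm X (\<lambda>x. S n x - S m x) \<le> 2 * K * (B * r ^ m)" if "m \<le> n" for m n
  proof -
    have "S n x - S m x = complex_of_real (\<Sum>i<n - m. F (m + i) x)" for x
    proof -
      have "(\<Sum>j<m + k. F j x) = (\<Sum>j<m. F j x) + (\<Sum>i<k. F (m + i) x)" for k
        by (induction k) auto
      from this[of "n - m"] have "(\<Sum>j<n. F j x) = (\<Sum>j<m. F j x) + (\<Sum>i<n - m. F (m + i) x)" using that by simp
      then show ?thesis by (simp add: S_def)
    qed
    then show ?thesis using block[of m "n - m"] by simp
  qed
  have "K * r < 1" "r \<le> K * r" using r K(1) mult_right_mono[OF K(1) r(1)] by simp_all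
  then have r1: "r < 1" by simp
  have tail0: "(\<lambda>m. 2 * K * (B * r ^ m)) \<longlonglongrightarrow> 2 * K * (B * 0)"
    by (intro tendsto_intros LIMSEQ_realpow_zero r(1) r1)
  have "\<exists>N. \<forall>m\<ge>N. \<forall>n\<ge>N. qnorm X (\<lambda>x. S m x - S n x) < e" if e: "0 < e" for e
  proof -
    have "eventually (\<lambda>m. 2 * K * (B * r ^ m) < e) sequentially" using order_tendstoD(2)[OF tail0] e by simp
    then obtain N where N: "\<And>m. N \<le> m \<Longrightarrow> 2 * K * (B * r ^ m) < e" unfolding eventually_sequentially by blast
    show ?thesis
    proof (intro exI[of _ N] allI impI)
      fix m n assume mn: "N \<le> m" "N \<le> n"
      show "qnorm X (\<lambda>x. S m x - S n x) < e"
      proof (cases "m \<le> n")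
        case True
        then show ?thesis using step[OF True] N[OF mn(1)] norm_diff_commute[OF S[of m] S[of n]] by linarith
      next
        case False
        then show ?thesis using step[of n m] N[OF mn(2)] by linarith
      qed
    qed
  qed
  then obtain f where f: "f \<in> elems X" "(\<lambda>n. qnorm X (\<lambda>x. S n x - f x)) \<longlonglongrightarrow> 0"
    using complete S unfolding qnorm_complete_def by blast
  have [measurable]: "f \<in> borel_measurable M" "S n \<in> borel_measurable M" for n
    using measurable_elem f(1) S by auto
  have below: "AE x in M. (\<Sum>j<n. F j x) \<le> cmod (f x)" for n
  proof -
    define d where "d = (\<lambda>x. complex_of_real (max 0 (cmod (S n x) - cmod (f x))))"
    have dm: "d \<in> borel_measurable M" unfolding d_def by measurable
    have le: "cmod (d x) \<le> cmod (S m x - f x)" if "n \<le> m" for m x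
    proof -
      have "(\<Sum>j<n. F j x) \<le> (\<Sum>j<m. F j x)" using that F(2) by (intro sum_mono2) auto
      then have "cmod (S n x) \<le> cmod (S m x)" 
        using sum_nonneg[of "{..<n}" "\<lambda>j. F j x"] F(2) unfolding S_def norm_of_real by simp
      also have "\<dots> \<le> cmod (S m x - f x) + cmod (f x)" using norm_triangle_sub[of "S m x" "f x"] by simp
      finally show ?thesis by (simp add: d_def)
    qed
    have d: "d \<in> elems X" by (rule ideal(1)[OF dm diff_elem[OF S f(1)]]) (use le[of n] in auto)
    have "qnorm X d \<le> qnorm X (\<lambda>x. S m x - f x)" if "n \<le> m" for m
      by (rule ideal(2)[OF dm diff_elem[OF S f(1)]]) (use le[OF that] in auto)
    then have "qnorm X d \<le> 0" by (intro LIMSEQ_le_const[OF f(2)]) auto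
    then have "AE x in M. d x = 0" using norm_eq_0_iff[OF d] norm_nonneg[OF d] by simp
    then show ?thesis
    proof eventually_elim
      case (elim x)
      have "(\<Sum>j<n. F j x) \<le> cmod (S n x)" unfolding S_def norm_of_real by simp
      with elim show ?case by (auto simp: d_def max_def split: if_splits)
    qed
  qed
  have hf: "AE x in M. cmod (complex_of_real (h x)) \<le> cmod (f x)"
  proof -
    have "AE x in M. \<forall>n. (\<Sum>j<n. F j x) \<le> cmod (f x)" unfolding AE_all_countable using below by blast
    with h(2) show ?thesis
    proof eventually_elim
      case (elim x)
      then obtain n where "h x \<le> (\<Sum>j<n. F j x)" by blast
      also have "\<dots> \<le> cmod (f x)" using elim by blast
      finally show ?case using elim by simp
    qed
  qed
  have hm: "(\<lambda>x. complex_of_real (h x)) \<in> borel_measurable M" using h(1) by measurable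
  show "(\<lambda>x. complex_of_real (h x)) \<in> elems X" by (rule ideal(1)[OF hm f(1) hf])
  have "qnorm X f \<le> K * (2 * K * B + qnorm X (\<lambda>x. S n x - f x))" for n
  proof -
    have "qnorm X f = qnorm X (\<lambda>x. S n x + (f x - S n x))" by simp
    also have "\<dots> \<le> K * (qnorm X (S n) + qnorm X (\<lambda>x. f x - S n x))" by (rule K(2)[OF S diff_elem[OF f(1) S]])
    also have "\<dots> \<le> K * (2 * K * B + qnorm X (\<lambda>x. S n x - f x))"
    proof (intro mult_left_mono add_mono)
      show "qnorm X (S n) \<le> 2 * K * B" using step[of 0 n] by (simp add: S_def[of 0])
      show "qnorm X (\<lambda>x. f x - S n x) \<le> qnorm X (\<lambda>x. S n x - f x)" using norm_diff_commute[OF f(1) S[of n]] by simp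
    qed (use K(1) in simp)
    finally show ?thesis .
  qed
  moreover have "(\<lambda>n. K * (2 * K * B + qnorm X (\<lambda>x. S n x - f x))) \<longlonglongrightarrow> K * (2 * K * B + 0)"
    by (intro tendsto_intros f(2))
  ultimately have "qnorm X f \<le> K * (2 * K * B + 0)" by (intro LIMSEQ_le_const) auto
  then show "qnorm X (\<lambda>x. complex_of_real (h x)) \<le> 2 * K\<^sup>2 * B"
    using ideal(2)[OF hm f(1) hf] by (simp add: power2_eq_square)
qed

end

section \<open>Bounded AK-stability\<close>

lemma BMO_norm_shift:
  "BMO_norm (\<lambda>z. \<phi> z - c) \<le> BMO_norm \<phi>"
proof (cases "integrable circle \<phi>")
  case True
  have "mean_on (circle_arc a b) (\<lambda>z. \<bar>\<phi> z - c - mean_on (circle_arc a b) (\<lambda>z. \<phi> z - c)\<bar>) =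
        mean_on (circle_arc a b) (\<lambda>z. \<bar>\<phi> z - mean_on (circle_arc a b) \<phi>\<bar>)" if ab: "a < b" "b \<le> a + 2 * pi" for a b
  proof -
    have [measurable]: "circle_arc a b \<in> sets circle" by (rule circle_arc_measurable)
    have i: "set_integrable circle (circle_arc a b) \<phi>" "set_integrable circle (circle_arc a b) (\<lambda>z. c)"
      unfolding set_integrable_def by (rule integrable_mult_indicator; simp add: True)+
    have "(LINT z:circle_arc a b|circle. \<phi> z - c) = (LINT z:circle_arc a b|circle. \<phi> z) - c * (b - a)"
      using set_integral_diff(2)[OF i] measure_circle_arc[OF ab] by (simp add: set_lebesgue_integral_def)
    then have "mean_on (circle_arc a b) (\<lambda>z. \<phi> z - c) = mean_on (circle_arc a b) \<phi> - c"
      using ab by (simp add: mean_on_def measure_circle_arc diff_divide_distrib)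
    then show ?thesis by simp
  qed
  note eq = this
  have i: "integrable circle (\<lambda>z. \<phi> z - c)" using True by simp
  show ?thesis unfolding BMO_norm_def if_P[OF True] if_P[OF i]
    by (rule SUP_subset_mono) (auto simp: eq)
qed (simp add: BMO_norm_def)

lemma dyadic_level:
  fixes y :: real
  assumes "0 < y"
  shows "\<exists>j. (1/2) ^ Suc j < y \<and> min 1 y \<le> (1/2) ^ j"
proof -
  obtain n where "(1/2) ^ n < y" using real_arch_pow_inv[OF assms, of "1/2"] by auto
  moreover have "(1/2::real) ^ Suc n \<le> (1/2) ^ n" by simp
  ultimately have ex: "\<exists>n. (1/2) ^ Suc n < y" by (intro exI[of _ n]) linarith
  define j where "j = (LEAST n. (1/2) ^ Suc n < y)"
  have 1: "(1/2) ^ Suc j < y" unfolding j_def by (rule LeastI_ex[OF ex])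
  have "min 1 y \<le> (1/2) ^ j"
  proof (cases j)
    case (Suc i)
    then have "\<not> (1/2) ^ Suc i < y" using not_less_Least[of i "\<lambda>n. (1/2) ^ Suc n < y"] unfolding j_def by simp
    then show ?thesis unfolding Suc by linarith
  qed simp
  with 1 show ?thesis by blast
qed

theorem proposition4p8:
  fixes \<Omega> :: "'w measure" and Z :: "(complex \<times> 'w) fun_space" and \<theta> :: real
  assumes "sigma_finite_measure \<Omega>"
    and "quasi_normed_lattice (circle_prod \<Omega>) Z"
    and "qnorm_complete Z"
    and "0 < \<theta>" and "\<theta> < 1"
    and "BMO_regular \<Omega> (real_interp_inf (circle_prod \<Omega>) (Linf (circle_prod \<Omega>)) Z \<theta>)"
  shows "\<forall>\<alpha>. 0 < \<alpha> \<and> \<alpha> < \<theta> \<longrightarrow>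
           boundedly_AK_stable \<Omega> (Linf (circle_prod \<Omega>)) (power_space (circle_prod \<Omega>) Z \<alpha>)"
proof (intro allI impI)
  fix \<alpha> :: real assume "0 < \<alpha> \<and> \<alpha> < \<theta>"
  then have \<alpha>: "0 < \<alpha>" by simp
  note \<theta> = assms(4,5)
  define M where "M = circle_prod \<Omega>"
  define W where "W = real_interp_inf M (Linf M) Z \<theta>"
  define Y where "Y = power_space M Z \<alpha>"
  interpret Z: function_lattice M Z by unfold_locales (use assms(2) in \<open>simp add: M_def\<close>)
  obtain Q where Q: "1 \<le> Q"
    "\<And>f g. f \<in> elems Z \<Longrightarrow> g \<in> elems Z \<Longrightarrow> qnorm Z (\<lambda>x. f x + g x) \<le> Q * (qnorm Z f + qnorm Z g)"
    using Z.quasi_triangle by blast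
  obtain C m where reg: "\<And>f. f \<in> elems W \<Longrightarrow> \<not> (AE x in M. f x = 0) \<Longrightarrow>
      \<exists>u :: complex \<times> 'w \<Rightarrow> real. (AE x in M. 0 < u x \<and> cmod (f x) \<le> u x) \<and>
         (\<lambda>x. complex_of_real (u x)) \<in> elems W \<and> qnorm W (\<lambda>x. complex_of_real (u x)) \<le> m * qnorm W f \<and>
         (AE \<omega> in \<Omega>. BMO_norm (\<lambda>z. ln (u (z, \<omega>))) \<le> ennreal C)"
    using assms(6) unfolding BMO_regular_def W_def M_def by blast
  \<comment> \<open>makes the ratio \<open>r\<close> of the series of level sets below satisfy \<open>Q * r \<le> 1/2\<close>\<close>
  define q where "q = log 2 Q + 1 / \<theta> + 1"
  define p where "p = \<alpha> * q"
  define r where "r = 2 powr (1 / \<theta> - q)"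
  have q: "0 < q" using Q(1) \<theta> by (simp add: q_def add_nonneg_pos)
  have p: "0 < p" "\<alpha> / \<theta> \<le> p"
  proof -
    show "0 < p" using q \<alpha> by (simp add: p_def)
    have "0 \<le> \<alpha> * log 2 Q" using \<alpha> Q(1) by simp
    then show "\<alpha> / \<theta> \<le> p" using \<alpha> by (simp add: p_def q_def distrib_left)
  qed
  have r: "0 \<le> r" "Q * r \<le> 1 / 2"
  proof -
    have "r = 2 powr (- log 2 Q) * 2 powr (- 1)" unfolding r_def q_def powr_add[symmetric] by simp
    also have "\<dots> = 1 / (2 * Q)" using Q(1) by (simp add: powr_minus powr_log_cancel field_simps)
    finally show "0 \<le> r" "Q * r \<le> 1 / 2" using Q(1) by simp_all
  qed
  obtain K' where K': "\<And>\<phi>. \<phi> \<in> borel_measurable M \<Longrightarrow> (AE \<omega> in \<Omega>. BMO_norm (\<lambda>z. \<phi> (z, \<omega>)) \<le> ennreal C) \<Longrightarrow>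
      \<exists>U \<in> elems (Hinf \<Omega>). AE x in M. cmod (U x) \<le> K' \<and> cmod (U x) * exp (p * \<phi> x) \<le> K' \<and>
        cmod (1 - U x) \<le> K' * exp (p * min 0 (\<phi> x))"
    using bounded_separating_function[OF assms(1) p(1), of C] unfolding M_def by blast
  define K where "K = \<bar>K'\<bar> + 1"
  have K: "K' \<le> K" "1 \<le> K" by (auto simp: K_def)
  define b where "b = 2 * \<bar>m\<bar> + 1"
  define D where "D = K powr (1 / \<alpha>) * (2 * Q\<^sup>2 * ((4 * b) powr (1 / \<theta>)))"
  have D: "0 \<le> D" by (simp add: D_def)
  define A where "A = K + D powr \<alpha>"
  have A: "K \<le> A" "D powr \<alpha> \<le> A" "1 \<le> A" using K add_mono[OF K(2) powr_ge_zero[of D \<alpha>]] by (simp_all add: A_def)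
  have Y_norm_nonneg: "0 \<le> qnorm Y f" for f by (simp add: Y_def power_space_def)
  have Y_zero: "f \<in> elems Y \<and> qnorm Y f = 0" if f: "f \<in> borel_measurable M" "AE x in M. f x = 0" for f
  proof -
    define k where "k = (\<lambda>x. complex_of_real (cmod (f x) powr (1 / \<alpha>)))"
    have k: "k \<in> borel_measurable M" using f(1) unfolding k_def by measurable
    have "AE x in M. k x = 0" using f(2) by eventually_elim (simp add: k_def)
    moreover from this have "k \<in> elems Z" by (intro Z.ideal(1)[OF k Z.zero_elem]) auto
    ultimately show ?thesis using Z.norm_eq_0_iff[of k] f(1) unfolding Y_def power_space_def k_def by simp
  qed
  have main: "\<exists>U \<in> elems (Hinf \<Omega>). qnorm (Hinf \<Omega>) U \<le> A \<and>
        (\<lambda>x. U x * g x) \<in> elems (Linf M) \<and> qnorm (Linf M) (\<lambda>x. U x * g x) \<le> A * qnorm (Linf M) f \<and>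
        (\<lambda>x. (1 - U x) * f x) \<in> elems Y \<and> qnorm Y (\<lambda>x. (1 - U x) * f x) \<le> A * qnorm Y g"
    if f: "f \<in> elems (Linf M)" and g: "g \<in> elems Y" for f g
  proof -
    have fm [measurable]: "f \<in> borel_measurable M" by (rule Linf_measurable[OF f])
    have gm [measurable]: "g \<in> borel_measurable M" using g by (simp add: Y_def power_space_def)
    define s where "s = qnorm (Linf M) f"
    have fs: "AE x in M. cmod (f x) \<le> s" unfolding s_def by (rule Linf_bound[OF f])
    define h where "h x = cmod (g x) powr (1 / \<alpha>)" for x
    have hZ: "(\<lambda>x. complex_of_real (h x)) \<in> elems Z" using g by (simp add: Y_def power_space_def h_def)
    define N where "N = qnorm Z (\<lambda>x. complex_of_real (h x))"
    have gN: "qnorm Y g = N powr \<alpha>" by (simp add: Y_def power_space_def h_def N_def)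
    \<comment> \<open>in the degenerate cases the constants \<open>0\<close> and \<open>1\<close> serve as \<open>U\<close>\<close>
    consider "s = 0" | "AE x in M. g x = 0" | "0 < s" "\<not> (AE x in M. g x = 0)"
      using Linf_nonneg[of M f] unfolding s_def by linarith
    then show ?thesis
    proof cases
      case 1
      have "AE x in M. f x = 0" using fs by eventually_elim (simp add: 1)
      then have "f \<in> elems Y \<and> qnorm Y f = 0" by (rule Y_zero[OF fm])
      moreover have "qnorm (Hinf \<Omega>) (\<lambda>x. 0) \<le> A" using Linf_I(2)[of "\<lambda>x. 0" "circle_prod \<Omega>" A] A by (simp add: Hinf_def)
      moreover have "(\<lambda>x. 0) \<in> elems (Linf M)" "qnorm (Linf M) (\<lambda>x. 0) \<le> 0" using Linf_I[of "\<lambda>x. 0" M 0] by auto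
      moreover have "0 \<le> A * qnorm Y g" "0 \<le> A * qnorm (Linf M) f" using A Y_norm_nonneg Linf_nonneg[of M f] by simp_all
      ultimately show ?thesis by (intro bexI[OF _ Hinf_const[of 0]]) auto
    next
      case 2
      have "AE x in M. cmod (g x) \<le> 0" using 2 by eventually_elim simp
      from Linf_I[OF gm this] have "g \<in> elems (Linf M)" "qnorm (Linf M) g \<le> 0" by auto
      moreover have "qnorm (Hinf \<Omega>) (\<lambda>x. 1) \<le> A" using Linf_I(2)[of "\<lambda>x. 1" "circle_prod \<Omega>" A] A by (simp add: Hinf_def)
      moreover have "(\<lambda>x. 0) \<in> elems Y \<and> qnorm Y (\<lambda>x. 0) = 0" by (rule Y_zero) auto
      moreover have "0 \<le> A * qnorm Y g" "0 \<le> A * qnorm (Linf M) f" using A Y_norm_nonneg Linf_nonneg[of M f] by simp_all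
      ultimately show ?thesis by (intro bexI[OF _ Hinf_const[of 1]]) auto
    next
      case 3
      have h0: "0 \<le> h x" for x by (simp add: h_def)
      have "\<not> (AE x in M. complex_of_real (h x) = 0)" using 3(2) by (simp add: h_def)
      then have N: "0 < N" using Z.norm_eq_0_iff[OF hZ] Z.norm_nonneg[OF hZ] unfolding N_def by linarith
      note P = Z.interp_inf_power[OF hZ h0 N_def[symmetric] N \<theta>, folded W_def]
      have "\<not> (AE x in M. complex_of_real (h x powr \<theta>) = 0)" using 3(2) by (simp add: h_def)
      from reg[OF P(1) this] obtain u :: "complex \<times> 'w \<Rightarrow> real" where
        u: "AE x in M. 0 < u x \<and> h x powr \<theta> \<le> u x" "(\<lambda>x. complex_of_real (u x)) \<in> elems W"
          "qnorm W (\<lambda>x. complex_of_real (u x)) \<le> m * qnorm W (\<lambda>x. complex_of_real (h x powr \<theta>))"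
          "AE \<omega> in \<Omega>. BMO_norm (\<lambda>z. ln (u (z, \<omega>))) \<le> ennreal C"
        by auto
      have um [measurable]: "u \<in> borel_measurable M"
        using u(2) by (intro borel_measurable_of_real_D) (simp add: W_def real_interp_inf_def)
      define B where "B = b * N powr \<theta>"
      have b: "1 \<le> b" by (simp add: b_def)
      have B: "0 < B" using b N by (simp add: B_def)
      have uB: "qnorm W (\<lambda>x. complex_of_real (u x)) < B"
      proof -
        have "m * qnorm W (\<lambda>x. complex_of_real (h x powr \<theta>)) \<le> \<bar>m\<bar> * (2 * N powr \<theta>)"
          using P(2) Z.interp_inf_norm_nonneg[OF P(1)[unfolded W_def], folded W_def] by (intro mult_mono) auto
        with u(3) have "qnorm W (\<lambda>x. complex_of_real (u x)) \<le> \<bar>m\<bar> * (2 * N powr \<theta>)" by linarith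
        also have "\<dots> < B" using N by (simp add: B_def b_def algebra_simps)
        finally show ?thesis .
      qed
      \<comment> \<open>\<open>B\<close> strictly exceeds the norm of \<open>u\<close>, also when the regularity constant is negative or zero\<close>
      note level = Z.interp_inf_level_set[OF u(2)[unfolded W_def] uB[unfolded W_def] B \<theta>(1)]
      \<comment> \<open>\<open>exp \<phi>\<close> is the quotient of \<open>u\<close> by \<open>s powr (\<theta> / \<alpha>)\<close>, so \<open>\<phi> \<le> 0\<close> describes where \<open>\<bar>g\<bar>\<close> is small compared with the norm of \<open>f\<close>\<close>
      define c where "c = \<theta> / \<alpha> * ln s"
      define \<phi> where "\<phi> x = ln (u x) - c" for x
      have \<phi>m [measurable]: "\<phi> \<in> borel_measurable M" unfolding \<phi>_def by measurable
      have "AE \<omega> in \<Omega>. BMO_norm (\<lambda>z. \<phi> (z, \<omega>)) \<le> ennreal C"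
        using u(4) unfolding \<phi>_def by eventually_elim (rule order_trans[OF BMO_norm_shift])
      from K'[OF \<phi>m this] obtain U where U: "U \<in> elems (Hinf \<Omega>)" and
        U': "AE x in M. cmod (U x) \<le> K' \<and> cmod (U x) * exp (p * \<phi> x) \<le> K' \<and> cmod (1 - U x) \<le> K' * exp (p * min 0 (\<phi> x))"
        by blast
      have UK: "AE x in M. cmod (U x) \<le> K \<and> cmod (U x) * exp (p * \<phi> x) \<le> K \<and> cmod (1 - U x) \<le> K * exp (p * min 0 (\<phi> x))"
        using U'
      proof eventually_elim
        case (elim x)
        have "K' * exp (p * min 0 (\<phi> x)) \<le> K * exp (p * min 0 (\<phi> x))" using K by (intro mult_right_mono) auto
        with elim K show ?case by linarith
      qed
      have Um [measurable]: "U \<in> borel_measurable M" using U by (simp add: Hinf_def Linf_def M_def)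
      have Unorm: "qnorm (Hinf \<Omega>) U \<le> A"
      proof -
        have "AE x in M. cmod (U x) \<le> A" using UK by eventually_elim (use A in linarith)
        from Linf_I(2)[OF Um this] show ?thesis using A by (simp add: Hinf_def M_def)
      qed
      have "AE x in M. cmod (U x * g x) \<le> K * s"
        using UK u(1)
      proof eventually_elim
        case (elim x)
        have gx: "cmod (g x) \<le> s * exp (\<alpha> / \<theta> * \<phi> x)"
        proof -
          have "cmod (g x) = (h x powr \<theta>) powr (\<alpha> / \<theta>)" using \<alpha> \<theta> by (simp add: h_def powr_powr)
          also have "\<dots> \<le> u x powr (\<alpha> / \<theta>)" using elim \<alpha> \<theta> by (intro powr_mono2) auto
          also have "\<dots> = exp (\<alpha> / \<theta> * \<phi> x + ln s)" using elim \<alpha> \<theta> by (simp add: powr_def \<phi>_def c_def algebra_simps)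
          also have "\<dots> = s * exp (\<alpha> / \<theta> * \<phi> x)" using 3(1) by (simp add: exp_add)
          finally show ?thesis .
        qed
        have "cmod (U x) * exp (\<alpha> / \<theta> * \<phi> x) \<le> K"
        proof (cases "0 \<le> \<phi> x")
          case True
          have "cmod (U x) * exp (\<alpha> / \<theta> * \<phi> x) \<le> cmod (U x) * exp (p * \<phi> x)"
            using mult_right_mono[OF p(2) True] by (intro mult_left_mono) auto
          then show ?thesis using elim by linarith
        next
          case False
          then have "exp (\<alpha> / \<theta> * \<phi> x) \<le> 1" using \<alpha> \<theta> by (simp add: mult_le_0_iff divide_le_0_iff)
          then have "cmod (U x) * exp (\<alpha> / \<theta> * \<phi> x) \<le> cmod (U x) * 1" by (intro mult_left_mono) auto
          then show ?thesis using elim by linarith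
        qed
        then have "s * (cmod (U x) * exp (\<alpha> / \<theta> * \<phi> x)) \<le> s * K" using 3(1) by (intro mult_left_mono) auto
        moreover have "cmod (U x) * cmod (g x) \<le> cmod (U x) * (s * exp (\<alpha> / \<theta> * \<phi> x))" by (intro mult_left_mono gx) simp
        ultimately show ?case by (simp add: norm_mult mult_ac)
      qed
      from Linf_I[OF _ this] have Ug: "(\<lambda>x. U x * g x) \<in> elems (Linf M)" "qnorm (Linf M) (\<lambda>x. U x * g x) \<le> K * s"
        using K 3(1) by auto
      \<comment> \<open>terms of the dyadic decomposition \<open>min 1 y powr q \<le> \<Sum>\<^sub>j 2\<^sup>-\<^sup>j\<^sup>q 1\<^bsub>{y > 2^(-j-1)}\<^esub>\<close> for \<open>y = exp \<phi>\<close>\<close>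
      define F where "F j x = 2 powr (- q * real j) * of_bool (exp c * (1/2) ^ Suc j < u x)" for j :: nat and x
      define E where "E = (4 * b) powr (1 / \<theta>) * N / s powr (1 / \<alpha>)"
      have E: "0 \<le> E" using N by (simp add: E_def)
      have F: "(\<lambda>x. complex_of_real (F j x)) \<in> elems Z" "qnorm Z (\<lambda>x. complex_of_real (F j x)) \<le> E * r ^ j" for j
      proof -
        have l: "0 < exp c * (1/2) ^ Suc j" by simp
        have e: "(\<lambda>x. complex_of_real (F j x)) = (\<lambda>x. complex_of_real (2 powr (- q * real j)) * of_bool (exp c * (1/2) ^ Suc j < u x))"
          by (simp add: F_def fun_eq_iff)
        show "(\<lambda>x. complex_of_real (F j x)) \<in> elems Z" unfolding e by (rule Z.scale_elem[OF level(1)[OF l]])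
        have "qnorm Z (\<lambda>x. complex_of_real (F j x)) \<le> 2 powr (- q * real j) * (2 * B / (exp c * (1/2) ^ Suc j)) powr (1 / \<theta>)"
          unfolding e Z.norm_scale[OF level(1)[OF l]] using level(2)[OF l] by (simp only: norm_of_real abs_of_nonneg powr_ge_zero) (intro mult_left_mono, auto)
        also have "2 * B / (exp c * (1/2) ^ Suc j) = (4 * b) * N powr \<theta> / exp c * 2 powr (real j)"
          by (simp add: B_def powr_realpow field_simps)
        also have "\<dots> powr (1 / \<theta>) = E * 2 powr (real j / \<theta>)"
        proof -
          have "exp c powr (1 / \<theta>) = s powr (1 / \<alpha>)" using \<theta> 3(1) by (simp add: c_def powr_def)
          then show ?thesis using b N \<theta> by (simp add: E_def powr_mult powr_divide powr_powr)
        qed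
        also have "2 powr (- q * real j) * (E * 2 powr (real j / \<theta>)) = E * r ^ j"
        proof -
          have "2 powr (- q * real j) * 2 powr (real j / \<theta>) = 2 powr (real j * (1 / \<theta> - q))"
            by (simp add: powr_add[symmetric] algebra_simps)
          also have "\<dots> = r ^ j" by (simp add: r_def powr_power mult.commute)
          finally show ?thesis by simp
        qed
        finally show "qnorm Z (\<lambda>x. complex_of_real (F j x)) \<le> E * r ^ j" .
      qed
      have cover: "AE x in M. 0 \<le> exp (q * min 0 (\<phi> x)) \<and> (\<exists>n. exp (q * min 0 (\<phi> x)) \<le> (\<Sum>j<n. F j x))"
        using u(1)
      proof eventually_elim
        case (elim x)
        obtain j where j: "(1/2) ^ Suc j < exp (\<phi> x)" "min 1 (exp (\<phi> x)) \<le> (1/2) ^ j"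
          using dyadic_level[of "exp (\<phi> x)"] by auto
        have "exp (min 0 (\<phi> x)) \<le> 2 powr (- real j)"
          using j(2) by (simp add: min_def powr_minus powr_realpow power_divide field_simps split: if_splits)
        then have "exp (min 0 (\<phi> x)) powr q \<le> (2 powr (- real j)) powr q" using q by (intro powr_mono2) auto
        then have "exp (q * min 0 (\<phi> x)) \<le> 2 powr (- q * real j)" by (simp add: powr_powr powr_def mult_ac)
        also have "\<dots> = F j x"
        proof -
          have "exp c * (1/2) ^ Suc j < exp c * exp (\<phi> x)" using j(1) by (intro mult_strict_left_mono) auto
          also have "\<dots> = u x" using elim by (simp add: \<phi>_def flip: exp_add)
          finally show ?thesis by (simp add: F_def)
        qed
        also have "F j x \<le> (\<Sum>i<Suc j. F i x)" by (rule member_le_sum) (auto simp: F_def)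
        finally have le: "exp (q * min 0 (\<phi> x)) \<le> (\<Sum>i<Suc j. F i x)" .
        show ?case by (intro conjI exI) (rule exp_ge_zero, rule le)
      qed
      have em: "(\<lambda>x. exp (q * min 0 (\<phi> x))) \<in> borel_measurable M" by measurable
      have F0: "0 \<le> F j x" for j x by (simp add: F_def)
      define G where "G x = complex_of_real (exp (q * min 0 (\<phi> x)))" for x
      have G: "G \<in> elems Z"
        unfolding G_def by (rule Z.geometric_series_majorant(1)[OF assms(3) Q F(1) F0 F(2) r E em cover])
      have G_norm: "qnorm Z G \<le> 2 * Q\<^sup>2 * E"
        unfolding G_def by (rule Z.geometric_series_majorant(2)[OF assms(3) Q F(1) F0 F(2) r E em cover])
      define k where "k x = complex_of_real (cmod ((1 - U x) * f x) powr (1 / \<alpha>))" for x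
      have km: "k \<in> borel_measurable M" unfolding k_def by measurable
      define S where "S = K powr (1 / \<alpha>) * s powr (1 / \<alpha>)"
      have "AE x in M. cmod (k x) \<le> cmod (complex_of_real S * G x)"
        using UK fs
      proof eventually_elim
        case (elim x)
        have "cmod ((1 - U x) * f x) \<le> (K * exp (p * min 0 (\<phi> x))) * s"
          unfolding norm_mult using elim K by (intro mult_mono) auto
        then have "cmod ((1 - U x) * f x) powr (1 / \<alpha>) \<le> ((K * exp (p * min 0 (\<phi> x))) * s) powr (1 / \<alpha>)"
          using \<alpha> by (intro powr_mono2) auto
        also have "\<dots> = S * exp (p * min 0 (\<phi> x)) powr (1 / \<alpha>)"
          using K 3(1) by (simp add: S_def powr_mult)
        also have "exp (p * min 0 (\<phi> x)) powr (1 / \<alpha>) = exp (q * min 0 (\<phi> x))"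
          using \<alpha> by (simp add: powr_def p_def)
        finally show ?case by (simp add: k_def S_def G_def norm_mult)
      qed
      note I = Z.ideal[OF km Z.scale_elem[OF G] this]
      have "0 \<le> S" by (simp add: S_def)
      then have Sn: "qnorm Z (\<lambda>x. complex_of_real S * G x) = S * qnorm Z G" using Z.norm_scale[OF G] by simp
      have "qnorm Z k \<le> qnorm Z (\<lambda>x. complex_of_real S * G x)" by (rule I(2))
      also have "\<dots> = S * qnorm Z G" by (rule Sn)
      also have "\<dots> \<le> S * (2 * Q\<^sup>2 * E)" by (intro mult_left_mono G_norm) (simp add: S_def)
      also have "\<dots> = D * N" using 3(1) by (simp add: S_def E_def D_def field_simps)
      finally have kN: "qnorm Z k \<le> D * N" .
      have Y1: "(\<lambda>x. (1 - U x) * f x) \<in> elems Y" using I(1) unfolding Y_def power_space_def k_def by simp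
      have "qnorm Y (\<lambda>x. (1 - U x) * f x) = qnorm Z k powr \<alpha>" unfolding Y_def power_space_def k_def[abs_def] by simp
      also have "\<dots> \<le> (D * N) powr \<alpha>" using \<alpha> Z.norm_nonneg[OF I(1)] kN by (intro powr_mono2) auto
      also have "\<dots> = D powr \<alpha> * qnorm Y g" using D N by (simp add: powr_mult gN)
      also have "\<dots> \<le> A * qnorm Y g" using A Y_norm_nonneg by (intro mult_right_mono) auto
      finally have Y2: "qnorm Y (\<lambda>x. (1 - U x) * f x) \<le> A * qnorm Y g" .
      have "K * s \<le> A * s" using A 3(1) by (intro mult_right_mono) auto
      then have "qnorm (Linf M) (\<lambda>x. U x * g x) \<le> A * qnorm (Linf M) f" using Ug(2) unfolding s_def by linarith
      with U Unorm Ug(1) Y1 Y2 show ?thesis by blast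
    qed
  qed
  show "boundedly_AK_stable \<Omega> (Linf (circle_prod \<Omega>)) (power_space (circle_prod \<Omega>) Z \<alpha>)"
    unfolding boundedly_AK_stable_def using main unfolding M_def Y_def by blast
qed

end
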